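(* Let $V\in\mathcal C^\infty(\mathbb R^d,\mathbb R)$ satisfy the confinement assumption and the degenerate Morse assumption described in the context, and let $\Delta_V$ be the semiclassical Witten Laplacian. Let $n_0$ be the number of points of $\mathcal U^{(0)}$ and $\overline\nu=\max_{x^*\in\mathcal U}\max_{1\le i\le d}\nu_i^{x^*}$. Then there exist $h_0,\varepsilon>0$ such that for all $h\in(0,h_0]$, the set $\sigma(\Delta_V)\cap\{z:\ \mathrm{Re}\,z<\varepsilon h^{2-\frac{2}{\overline\nu}}\}$ consists of exactly $n_0$ eigenvalues counted with multiplicity; denoting them $\{\lambda(\mathbf m,h):\ \mathbf m\in\mathcal U^{(0)}\}$, there moreover exists $c>0$ independent of $h$ such that $\lambda(\mathbf m,h)\le e^{-c/h}$ for all $\mathbf m\in\mathcal U^{(0)}$.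
   Context: For $h>0$, the Witten Laplacian is $\Delta_V=-h^2\Delta+|\nabla V|^2-h\Delta V$, defined on $\mathcal C_c^\infty(\mathbb R^d)$, where it is non-negative and essentially self-adjoint; $\Delta_V$ denotes its self-adjoint extension on $L^2(\mathbb R^d)$. Confinement assumption: there exist $C>0$ and a compact $K\subset\mathbb R^d$ such that for all $x\notin K$: $V(x)\ge -C$, $|\nabla V(x)|\ge 1/C$, $|\Delta V(x)|\le C|\nabla V(x)|^2$. Degenerate Morse assumption: for every critical point $x^*$ of $V$ there exist a neighborhood $\mathcal V$ of $x^*$, real numbers $t_i^{x^*}\neq0$ and integers $\nu_i^{x^*}\ge2$ ($1\le i\le d$), and a $\mathcal C^\infty$ change of variables $U^{x^*}$ defined on $\mathcal V$ with $U^{x^*}(x^* )=x^*$, $U^{x^*}$ and $d_{x^*}U^{x^*}$ invertible, such that $V(U^{x^*}(x))-V(x^* )=\sum_{i=1}^d t_i^{x^*}(x_i-x_i^* )^{\nu_i^{x^*}}$ for all $x\in\mathcal V$. $\mathcal U$ denotes the (finite) set of critical points of $V$, and $\mathcal U^{(0)}$ the set of $x^*\in\mathcal U$ such that all $\nu_i^{x^*}$ are even and all $t_i^{x^*}>0$ (the local minima). *)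

theory Defs
  imports "HOL-Analysis.Analysis"
begin

(* Functions on R^d are modelled on an arbitrary Euclidean space 'a (d = DIM('a));
   coordinates are taken w.r.t. the orthonormal basis Basis. *)

definition pd :: "'a::euclidean_space \<Rightarrow> ('a \<Rightarrow> 'b::real_normed_vector) \<Rightarrow> 'a \<Rightarrow> 'b" where
  "pd b f x = frechet_derivative f (at x) b"

fun Ck_on :: "'a::euclidean_space set \<Rightarrow> nat \<Rightarrow> ('a \<Rightarrow> 'b::real_normed_vector) \<Rightarrow> bool" where
  "Ck_on S 0 f = continuous_on S f"
| "Ck_on S (Suc k) f = ((\<forall>x\<in>S. f differentiable (at x)) \<and> (\<forall>b\<in>Basis. Ck_on S k (pd b f)))"

definition smooth_on :: "'a::euclidean_space set \<Rightarrow> ('a \<Rightarrow> 'b::real_normed_vector) \<Rightarrow> bool" where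
  "smooth_on S f \<longleftrightarrow> (\<forall>k. Ck_on S k f)"

definition grad_norm :: "('a::euclidean_space \<Rightarrow> real) \<Rightarrow> 'a \<Rightarrow> real" where
  "grad_norm V x = sqrt (\<Sum>b\<in>Basis. (pd b V x)\<^sup>2)"

definition lap :: "('a::euclidean_space \<Rightarrow> 'b::real_normed_vector) \<Rightarrow> 'a \<Rightarrow> 'b" where
  "lap f x = (\<Sum>b\<in>Basis. pd b (pd b f) x)"

definition crit :: "('a::euclidean_space \<Rightarrow> real) \<Rightarrow> 'a set" where
  "crit V = {x. \<forall>b\<in>Basis. pd b V x = 0}"

definition confinement :: "('a::euclidean_space \<Rightarrow> real) \<Rightarrow> bool" where
  "confinement V \<longleftrightarrow> (\<exists>C>0. \<exists>K. compact K \<and> (\<forall>x. x \<notin> K \<longrightarrow>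
      V x \<ge> - C \<and> grad_norm V x \<ge> 1 / C \<and> \<bar>lap V x\<bar> \<le> C * (grad_norm V x)\<^sup>2))"

definition degenerate_morse ::
  "('a::euclidean_space \<Rightarrow> real) \<Rightarrow> ('a \<Rightarrow> 'a \<Rightarrow> real) \<Rightarrow> ('a \<Rightarrow> 'a \<Rightarrow> nat) \<Rightarrow> bool" where
  "degenerate_morse V t \<nu> \<longleftrightarrow> (\<forall>x\<in>crit V.
      (\<forall>b\<in>Basis. t x b \<noteq> 0 \<and> \<nu> x b \<ge> 2) \<and>
      (\<exists>W U. open W \<and> x \<in> W \<and> smooth_on W U \<and> U x = x \<and> inj_on U W \<and>
         bij (frechet_derivative U (at x)) \<and>
         (\<forall>y\<in>W. V (U y) - V x = (\<Sum>b\<in>Basis. t x b * ((y - x) \<bullet> b) ^ \<nu> x b))))"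

definition local_minima :: "('a::euclidean_space \<Rightarrow> real) \<Rightarrow> ('a \<Rightarrow> 'a \<Rightarrow> real) \<Rightarrow> ('a \<Rightarrow> 'a \<Rightarrow> nat) \<Rightarrow> 'a set" where
  "local_minima V t \<nu> = {x\<in>crit V. \<forall>b\<in>Basis. even (\<nu> x b) \<and> t x b > 0}"

definition nu_bar :: "('a::euclidean_space \<Rightarrow> real) \<Rightarrow> ('a \<Rightarrow> 'a \<Rightarrow> nat) \<Rightarrow> nat" where
  "nu_bar V \<nu> = Max {\<nu> x b | x b. x \<in> crit V \<and> b \<in> Basis}"

(* L^2(R^d) (complex valued), elements represented by functions, identified a.e. *)
definition L2 :: "('a::euclidean_space \<Rightarrow> complex) \<Rightarrow> bool" where
  "L2 u \<longleftrightarrow> u \<in> borel_measurable lebesgue \<and> integrable lebesgue (\<lambda>x. (cmod (u x))\<^sup>2)"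

definition L2norm :: "('a::euclidean_space \<Rightarrow> complex) \<Rightarrow> real" where
  "L2norm u = sqrt (\<integral>x. (cmod (u x))\<^sup>2 \<partial>lebesgue)"

definition test_fun :: "('a::euclidean_space \<Rightarrow> complex) \<Rightarrow> bool" where
  "test_fun u \<longleftrightarrow> smooth_on UNIV u \<and> compact (closure {x. u x \<noteq> 0})"

definition witten :: "('a::euclidean_space \<Rightarrow> real) \<Rightarrow> real \<Rightarrow> ('a \<Rightarrow> complex) \<Rightarrow> 'a \<Rightarrow> complex" where
  "witten V h u x = - (complex_of_real (h\<^sup>2)) * lap u x
      + complex_of_real ((grad_norm V x)\<^sup>2 - h * lap V x) * u x"

(* graph of the closure of the Witten Laplacian on C_c^infinity, i.e. of its
   (unique) self-adjoint extension *)
definition witten_graph :: "('a::euclidean_space \<Rightarrow> real) \<Rightarrow> real \<Rightarrow> (('a \<Rightarrow> complex) \<times> ('a \<Rightarrow> complex)) set" where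
  "witten_graph V h = {(u, f). L2 u \<and> L2 f \<and> (\<exists>\<phi>. (\<forall>k. test_fun (\<phi> k)) \<and>
      (\<lambda>k. L2norm (\<lambda>x. \<phi> k x - u x)) \<longlonglongrightarrow> 0 \<and>
      (\<lambda>k. L2norm (\<lambda>x. witten V h (\<phi> k) x - f x)) \<longlonglongrightarrow> 0)}"

definition resolvent_set :: "(('a::euclidean_space \<Rightarrow> complex) \<times> ('a \<Rightarrow> complex)) set \<Rightarrow> complex set" where
  "resolvent_set G = {z. (\<forall>f. L2 f \<longrightarrow> (\<exists>(u, g)\<in>G. AE x in lebesgue. g x - z * u x = f x)) \<and>
      (\<exists>C. \<forall>(u, g)\<in>G. L2norm u \<le> C * L2norm (\<lambda>x. g x - z * u x))}"

definition op_spectrum :: "(('a::euclidean_space \<Rightarrow> complex) \<times> ('a \<Rightarrow> complex)) set \<Rightarrow> complex set" where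
  "op_spectrum G = - resolvent_set G"

definition eigenspace_of :: "(('a::euclidean_space \<Rightarrow> complex) \<times> ('a \<Rightarrow> complex)) set \<Rightarrow> complex \<Rightarrow> ('a \<Rightarrow> complex) set" where
  "eigenspace_of G \<mu> = {u. \<exists>g. (u, g) \<in> G \<and> (AE x in lebesgue. g x = \<mu> * u x)}"

definition has_multiplicity :: "(('a::euclidean_space \<Rightarrow> complex) \<times> ('a \<Rightarrow> complex)) set \<Rightarrow> complex \<Rightarrow> nat \<Rightarrow> bool" where
  "has_multiplicity G \<mu> k \<longleftrightarrow> (\<exists>e :: nat \<Rightarrow> 'a \<Rightarrow> complex.
      (\<forall>i<k. e i \<in> eigenspace_of G \<mu>) \<and>
      (\<forall>u\<in>eigenspace_of G \<mu>. \<exists>c. AE x in lebesgue. u x = (\<Sum>i<k. c i * e i x)) \<and>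
      (\<forall>c. (AE x in lebesgue. (\<Sum>i<k. c i * e i x) = 0) \<longrightarrow> (\<forall>i<k. c i = 0)))"

end

theory Submission
  imports Defs
begin

text \<open>
  Write \<open>d\<^sub>V = h \<nabla> + \<nabla>V\<close>, so that the quadratic form of the Witten Laplacian is \<open>Q u = \<parallel>d\<^sub>V u\<parallel>\<^sup>2\<close>. Since the
  operator is real, everything happens in the real Hilbert space \<open>L\<^sup>2\<close>. The range of \<open>\<Delta>\<^sub>V + s\<close> on test
  functions is dense: an orthogonal function is a weak solution, which mollification and a cutoff
  show to vanish. Near a critical point that is not a minimum, pairing \<open>X\<^sub>b\<close> (a coordinate field of the
  Morse chart) with a bounded multiplier \<open>\<alpha> (y\<^sub>b / h\<^bsup>1/\<nu>\<^esup>)\<close> gives \<open>Q u \<ge> c h\<^bsup>2-2/\<nu>\<^esup> \<parallel>u\<parallel>\<^sup>2\<close>. Near a minimum, the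
  multiplier \<open>arctan\<close> confines \<open>u\<close> to a box of side \<open>h\<^bsup>1/\<nu>\<^esup>\<close>, on which a Poincare inequality for
  \<open>exp (V/h) u\<close> gives the same bound up to one rank-one term. Away from critical points
  \<open>|\<nabla>V|\<^sup>2 - h \<Delta>V\<close> is bounded below. Gluing the local bounds yields
  \<open>Q u \<ge> \<epsilon> h\<^bsup>2-2/\<nu>\<^esup> \<parallel>u\<parallel>\<^sup>2 - C \<Sum>\<^sub>m \<langle>l\<^sub>m, u\<rangle>\<^sup>2\<close>, with one functional per minimum, while the cut-off Gibbs
  states \<open>exp (- (V - V m)/h)\<close> are orthogonal and have exponentially small energy. A min-max
  argument for the resolvent then counts the eigenvalues.
\<close>

text \<open>Confinement does not make the resolvent compact: the gradient is only bounded below at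
  infinity, so essential spectrum may begin at a finite positive level. Compactness is replaced by a
  form bound modulo finitely many functionals. It passes to the bounded inverse \<open>R\<close> as
  a norm bound modulo finitely many functionals, and this suffices for maximising sequences to
  converge. The count is a comparison of ranks: one functional per minimum allows at most
  \<open>n\<close> eigenvalues below the threshold, one quasimode per minimum forces at least
  \<open>n\<close>. Only the rank matters, so the factor in front of the functionals may depend on
  \<open>h\<close> arbitrarily. Gluing costs \<open>h^2\<close>, which is
  \<open>h powr (2/nb)\<close> times the threshold scale and hence negligible, even with a crude
  partition of unity. The Poincare inequality lives on images of boxes whose sides shrink at
  different rates, with constants uniform in \<open>h\<close>. Hence charts are taken bi-Lipschitz
  and the change of variables is a one-sided measure inequality without Jacobian.\<close>

section \<open>Hilbert space tools: projection, linear systems, coercive operators\<close>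

lemma hilbert_projection:
  fixes M :: "'v::{real_inner,complete_space} set"
  assumes sub: "subspace M" and cl: "closed M"
  obtains m where "m \<in> M" "\<And>y. y \<in> M ==> inner (x - m) y = 0"
proof -
  define d where "d = infdist x M"
  have ne: "M \<noteq> {}" using subspace_0[OF sub] by auto
  have d0: "d >= 0" by (simp add: d_def infdist_nonneg)
  have low: "d <= norm (x - m)" if "m \<in> M" for m
    using infdist_le[OF that, of x] by (simp add: d_def dist_norm)
  have "\<exists>m\<in>M. norm (x - m) < d + 1/real (Suc n)" for n
  proof -
    have "(INF a\<in>M. dist x a) < d + 1/real (Suc n)"
      using ne by (simp add: d_def infdist_notempty)
    then show ?thesis
      using ne by (subst (asm) cINF_less_iff) (auto simp: dist_norm intro!: bdd_belowI[where m=0])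
  qed
  then obtain m where m: "\<And>n. m n \<in> M" "\<And>n. norm (x - m n) < d + 1/real (Suc n)" by metis
  \<comment> \<open>Parallelogram identity: the midpoint of \<open>m i\<close> and
    \<open>m j\<close> lies in \<open>M\<close>, so its distance to \<open>x\<close> is at least
    \<open>d\<close>.\<close>
  have est: "(norm (m i - m j))^2 <= (8*d + 4)/real (Suc N)" if "i >= N" "j >= N" for i j N
  proof -
    define t where "t = 1/real (Suc N)"
    have t: "0 < t" "t <= 1" by (auto simp: t_def)
    have le: "norm (x - m k) <= d + t" if "k >= N" for k
    proof -
      have "1/real (Suc k) <= t" unfolding t_def using that by (intro divide_left_mono) auto
      then show ?thesis using m(2)[of k] by linarith
    qed
    have sq: "(norm (x - m k))^2 <= (d + t)^2" if "k >= N" for k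
      using le[OF that] by (intro power_mono) auto
    have mid: "(1/2) *\<^sub>R (m i + m j) \<in> M" using sub m(1) by (simp add: subspace_add subspace_scale)
    have "d^2 <= (norm (x - (1/2) *\<^sub>R (m i + m j)))^2" using low[OF mid] d0 by (intro power_mono) auto
    moreover have "(norm (m i - m j))^2 = 2*(norm (x - m i))^2 + 2*(norm (x - m j))^2
        - 4*(norm (x - (1/2) *\<^sub>R (m i + m j)))^2"
      by (simp add: power2_norm_eq_inner inner_diff_left inner_diff_right inner_add_left inner_add_right
           inner_commute algebra_simps)
    ultimately have "(norm (m i - m j))^2 <= 4*(d + t)^2 - 4*d^2"
      using sq[OF that(1)] sq[OF that(2)] by linarith
    also have "\<dots> = 8*d*t + 4*t*t" by (simp add: power2_eq_square algebra_simps)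
    also have "\<dots> <= 8*d*t + 4*t*1" using t by (intro add_left_mono mult_left_mono) auto
    also have "\<dots> = (8*d + 4)/real (Suc N)" by (simp add: t_def add_divide_distrib)
    finally show ?thesis .
  qed
  have "Cauchy m"
  proof (rule metric_CauchyI)
    fix e :: real assume e: "e > 0"
    obtain N where N: "(8*d + 4)/e^2 < real (Suc N)"
      using reals_Archimedean2 by (metis less_trans of_nat_less_iff lessI)
    have "(8*d + 4)/real (Suc N) < e^2" using N e by (simp add: field_simps)
    then have "(norm (m i - m j))^2 < e^2" if "i >= N" "j >= N" for i j using est[OF that] by linarith
    then have "dist (m i) (m j) < e" if "i >= N" "j >= N" for i j
      using that e by (metis dist_norm less_eq_real_def power2_less_imp_less)
    then show "\<exists>N. \<forall>i\<ge>N. \<forall>j\<ge>N. dist (m i) (m j) < e" by blast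
  qed
  then obtain p where p: "m \<longlonglongrightarrow> p" using Cauchy_convergent_iff convergent_def by blast
  have pM: "p \<in> M" using closed_sequentially[OF cl] m(1) p by blast
  have "norm (x - p) <= d"
  proof (rule LIMSEQ_le[where X="%n. norm (x - m n)" and Y="%n. d + 1/real (Suc n)"])
    show "(%n. norm (x - m n)) \<longlonglongrightarrow> norm (x - p)" by (intro tendsto_intros p)
    have "(%n. d + 1/real (Suc n)) \<longlonglongrightarrow> d + 0"
      by (intro tendsto_intros LIMSEQ_Suc lim_1_over_n)
    then show "(%n. d + 1/real (Suc n)) \<longlonglongrightarrow> d" by simp
  qed (use m(2) less_imp_le in blast)
  then have dp: "norm (x - p) = d" using low[OF pM] by simp
  have "inner (x - p) y = 0" if y: "y \<in> M" for y
  proof (cases "y = 0")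
    case False
    \<comment> \<open>The optimal step from \<open>p\<close> in direction \<open>y\<close>. It would
      lower the squared distance by \<open>(inner (x - p) y)^2/(norm y)^2\<close>, which minimality
      of \<open>d\<close> forbids unless this is zero.\<close>
    define c where "c = inner (x - p) y/(norm y)^2"
    have "p + c *\<^sub>R y \<in> M" using sub pM y by (simp add: subspace_add subspace_scale)
    from low[OF this] have "d^2 <= (norm (x - (p + c *\<^sub>R y)))^2" using d0 by (intro power_mono) auto
    also have "\<dots> = d^2 - 2*c*inner (x - p) y + c^2*(norm y)^2"
    proof -
      have "(norm (z - c *\<^sub>R y))^2 = (norm z)^2 - 2*c*inner z y + c^2*(norm y)^2" for z
        unfolding power2_norm_eq_inner
        by (simp add: inner_diff_left inner_diff_right inner_commute algebra_simps power2_eq_square)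
      from this[of "x - p"] show ?thesis unfolding dp by (metis diff_diff_eq)
    qed
    also have "\<dots> = d^2 - (inner (x - p) y)^2/(norm y)^2"
    proof -
      have "- 2*(a/n^2)*a + (a/n^2)^2*n^2 = - (a^2/n^2)" if "n \<noteq> 0" for a n :: real
        using that by (simp add: power2_eq_square divide_simps)
      from this[of "norm y" "inner (x - p) y"] False show ?thesis unfolding c_def by simp
    qed
    finally have "(inner (x - p) y)^2/(norm y)^2 <= 0" by simp
    then show ?thesis using False by (simp add: divide_le_0_iff)
  qed auto
  then show ?thesis using that pM by blast
qed

text \<open>Gaussian elimination, one equation at a time: an unknown with nonzero coefficient in the
  new equation is eliminated from the remaining ones and afterwards solved for.\<close>

lemma underdetermined_system:
  fixes A :: "'m => nat => real"
  assumes "finite M" "finite I" "card M < card I"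
  shows "\<exists>c. (\<exists>i\<in>I. c i \<noteq> 0) \<and> (\<forall>m\<in>M. (\<Sum>i\<in>I. c i*A m i) = 0)"
  using assms
proof (induction M arbitrary: I A rule: finite_induct)
  case empty
  then have "I \<noteq> {}" by auto
  then show ?case by (intro exI[of _ "%_. 1"]) auto
next
  case (insert m M)
  show ?case
  proof (cases "\<forall>i\<in>I. A m i = 0")
    case True
    have "card M < card I" using insert by auto
    from insert.IH[OF insert.prems(1) this, of A] show ?thesis using True by auto
  next
    case False
    then obtain k where k: "k \<in> I" "A m k \<noteq> 0" by blast
    let ?J = "I - {k}"
    have "card M < card ?J" using insert k by auto
    from insert.IH[OF _ this, of "%m' i. A m' i - A m i/A m k*A m' k"] insert.prems
    obtain c where c: "\<exists>i\<in>?J. c i \<noteq> 0"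
      "\<And>m'. m' \<in> M ==> (\<Sum>i\<in>?J. c i*(A m' i - A m i/A m k*A m' k)) = 0" by auto
    define d where "d = c(k := - (\<Sum>i\<in>?J. c i*A m i)/A m k)"
    have split: "(\<Sum>i\<in>I. d i*B i) = d k*B k + (\<Sum>i\<in>?J. c i*B i)" for B
    proof -
      have "(\<Sum>i\<in>I. d i*B i) = d k*B k + (\<Sum>i\<in>?J. d i*B i)"
        using k insert.prems by (simp add: sum.remove)
      then show ?thesis by (simp add: d_def)
    qed
    have "(\<Sum>i\<in>I. d i*A m i) = 0" unfolding split using k by (simp add: d_def)
    moreover have "(\<Sum>i\<in>I. d i*A m' i) = 0" if "m' \<in> M" for m'
    proof -
      have "0 = (\<Sum>i\<in>?J. c i*A m' i) - (\<Sum>i\<in>?J. c i*A m i)/A m k*A m' k"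
        using c(2)[OF that] by (simp add: algebra_simps sum_subtractf sum_distrib_left sum_distrib_right sum_divide_distrib)
      then show ?thesis unfolding split by (simp add: d_def)
    qed
    moreover have "\<exists>i\<in>I. d i \<noteq> 0" using c(1) by (auto simp: d_def)
    ultimately show ?thesis by blast
  qed
qed

text \<open>Lax-Milgram by Banach's fixed point theorem: coercivity makes the relaxation
  \<open>u - \<tau> *\<^sub>R (S u - f)\<close> a contraction, and its fixed point solves the
  equation.\<close>

lemma coercive_surj:
  fixes S :: "'w::{real_inner,complete_space} => 'w"
  assumes lin: "linear S" and bd: "\<And>u. norm (S u) <= K*norm u"
    and co: "\<And>u. inner (S u) u >= kp*(norm u)^2" and kp: "kp > 0"
  shows "\<exists>u. S u = f"
proof -
  \<comment> \<open>Exceeding \<open>kp\<close> keeps \<open>1 - kp^2/L^2\<close> positive. The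
    choice of \<open>\<tau>\<close> below minimises \<open>1 - 2*\<tau>*kp + \<tau>^2*L^2\<close>,
    whose minimum is exactly that number.\<close>
  define L where "L = max K kp + 1"
  have L: "L > kp" "L > 0" "L >= K" using kp by (auto simp: L_def)
  define \<tau> where "\<tau> = kp/L^2"
  define c where "c = sqrt (1 - kp^2/L^2)"
  have k: "kp^2/L^2 <= 1" "kp^2/L^2 > 0" using L kp by (auto simp: field_simps power_mono)
  have c: "0 <= c" "c < 1" using k by (auto simp: c_def)
  have contr: "norm (w - \<tau> *\<^sub>R S w) <= c*norm w" for w
  proof -
    have "(norm (S w))^2 <= (L*norm w)^2"
      using bd[of w] L by (intro power_mono) (auto intro!: order_trans[OF bd] mult_right_mono)
    then have a: "\<tau>^2*(norm (S w))^2 <= \<tau>^2*(L*norm w)^2" by (intro mult_left_mono) auto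
    have b: "\<tau>*inner (S w) w >= \<tau>*(kp*(norm w)^2)" using co[of w] kp by (intro mult_left_mono) (auto simp: \<tau>_def)
    have "(norm (w - \<tau> *\<^sub>R S w))^2 = (norm w)^2 - 2*(\<tau>*inner (S w) w) + \<tau>^2*(norm (S w))^2"
      unfolding power2_norm_eq_inner
      by (simp add: inner_diff_left inner_diff_right inner_commute power2_eq_square algebra_simps)
    also have "\<dots> <= (norm w)^2 - 2*(\<tau>*(kp*(norm w)^2)) + \<tau>^2*(L*norm w)^2" using a b by linarith
    also have "\<dots> = (1 - kp^2/L^2)*(norm w)^2"
    proof -
      have "x - 2*(kp/l*(kp*x)) + (kp/l)^2*(l*x) = (1 - kp^2/l)*x" if "l \<noteq> 0" for x l :: real
        using that by (simp add: power2_eq_square divide_simps) (simp add: algebra_simps)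
      from this[of "L^2" "(norm w)^2"] L show ?thesis by (simp add: \<tau>_def power_mult_distrib)
    qed
    also have "\<dots> = (c*norm w)^2" using k by (simp add: c_def power_mult_distrib)
    finally show ?thesis by (rule power2_le_imp_le) (use c in auto)
  qed
  have "\<exists>!u. u - \<tau> *\<^sub>R (S u - f) = u"
  proof (rule banach_fix_type[OF c], intro allI)
    fix x y
    have "x - \<tau> *\<^sub>R (S x - f) - (y - \<tau> *\<^sub>R (S y - f)) = (x - y) - \<tau> *\<^sub>R S (x - y)"
      by (simp add: linear_diff[OF lin] algebra_simps)
    then show "dist (x - \<tau> *\<^sub>R (S x - f)) (y - \<tau> *\<^sub>R (S y - f)) <= c*dist x y"
      using contr[of "x - y"] unfolding dist_norm by (simp only:)
  qed
  then obtain u where "u - \<tau> *\<^sub>R (S u - f) = u" by blast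
  then have "\<tau> *\<^sub>R (S u - f) = 0" by simp
  then show ?thesis using kp L by (auto simp: \<tau>_def)
qed

text \<open>Discriminant of a nonnegative quadratic polynomial. Nonnegativity is asked for only on
  the line through \<open>f\<close> in direction \<open>g\<close> and at \<open>g\<close>, because
  the lemma is later applied to a form that is nonnegative merely on an invariant subspace.\<close>

lemma nonneg_form_Cauchy_Schwarz:
  fixes R :: "'v::real_inner => 'v"
  assumes lin: "linear R" and sym: "inner (R f) g = inner f (R g)"
    and nn: "\<And>c. inner (R (f + c *\<^sub>R g)) (f + c *\<^sub>R g) >= 0" and nng: "inner (R g) g >= 0"
  shows "(inner (R f) g)^2 <= inner (R f) f*inner (R g) g"
proof -
  define a b p where "a = inner (R f) f" and "b = inner (R f) g" and "p = inner (R g) g"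
  have q: "0 <= a + 2*c*b + c^2*p" for c
    using nn[of c] sym
    by (simp add: a_def b_def p_def linear_add[OF lin] linear_scale[OF lin] inner_add_left inner_add_right
       power2_eq_square inner_commute algebra_simps)
  show ?thesis
  proof (cases "p = 0")
    case True
    have "b = 0"
    proof (rule ccontr)
      assume b: "b \<noteq> 0"
      \<comment> \<open>At this argument the polynomial, now affine, takes the value -1.\<close>
      from q[of "- (a + 1)/(2*b)"] True b show False by (simp add: field_simps)
    qed
    then show ?thesis using True by (simp add: a_def b_def p_def)
  next
    case False
    then have p: "p > 0" using nng by (simp add: p_def)
    from q[of "- b/p"] p have "0 <= a - b^2/p" by (simp add: power2_eq_square field_simps)
    then show ?thesis using p by (simp add: a_def[symmetric] b_def[symmetric] p_def[symmetric] field_simps)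
  qed
qed

text \<open>Only finitely many scalar sequences have to converge, so iterating Bolzano-Weierstrass
  suffices; nothing is said about convergence of the vectors themselves.\<close>

lemma bounded_functionals_convergent_subseq:
  fixes f :: "nat => 'v::real_inner"
  assumes "finite M" "\<And>k. norm (f k) <= B"
  shows "\<exists>sg::nat=>nat. strict_mono sg \<and> (\<forall>m\<in>M. convergent (%k. inner m (f (sg k))))"
  using assms(1)
proof (induction M rule: finite_induct)
  case empty
  then show ?case by (auto intro!: exI[of _ id] simp: strict_mono_def)
next
  case (insert m M)
  then obtain sg :: "nat => nat" where s: "strict_mono sg" "\<forall>m\<in>M. convergent (%k. inner m (f (sg k)))" by blast
  have "bounded (range (%k. inner m (f (sg k))))"
    unfolding bounded_iff
  proof (intro exI ballI)
    fix y assume "y \<in> range (%k. inner m (f (sg k)))"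
    then obtain k where "y = inner m (f (sg k))" by auto
    then have "\<bar>y\<bar> <= norm m*norm (f (sg k))" using Cauchy_Schwarz_ineq2 by simp
    also have "\<dots> <= norm m*B" using assms(2) by (intro mult_left_mono) auto
    finally show "norm y <= norm m*B" by simp
  qed
  then obtain \<tau> l where t: "strict_mono \<tau>" "((%k. inner m (f (sg k))) \<circ> \<tau>) \<longlonglongrightarrow> l"
    using bounded_imp_convergent_subsequence by blast
  have "convergent (%k. inner m' (f ((sg \<circ> \<tau>) k)))" if "m' \<in> insert m M" for m'
  proof (cases "m' = m")
    case True
    then show ?thesis using t(2) by (auto simp: convergent_def o_def)
  next
    case False
    then have "convergent (%k. inner m' (f (sg k)))" using s that by auto
    from convergent_subseq_convergent[OF this t(1)] show ?thesis by (simp add: o_def)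
  qed
  then show ?case using strict_mono_o[OF s(1) t(1)] by blast
qed

section \<open>Eigenvalues of a bounded nonnegative operator above a threshold\<close>

text \<open>The assumption \<open>small\<close> plays the role of compactness above the level
  \<open>r\<close>: on the common kernel of the functionals in \<open>M\<close> the operator has
  norm at most \<open>r\<close>, so it has no essential spectrum above \<open>r\<close>.\<close>

locale nonneg_operator =
  fixes R :: "'v::{real_inner,complete_space} => 'v" and M :: "'v set" and r B C :: real
  assumes lin: "linear R" and sym: "\<And>f g. inner (R f) g = inner f (R g)"
    and nonneg: "\<And>f. inner (R f) f >= 0" and bound: "\<And>f. norm (R f) <= B*norm f" and B0: "B >= 0"
    and finM: "finite M" and r0: "r >= 0" and C0: "C >= 0"
    and small: "\<And>f. norm (R f) <= r*norm f + C*(\<Sum>m\<in>M. \<bar>inner m f\<bar>)"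
begin

text \<open>The supremum \<open>\<mu>\<close> of the Rayleigh quotient on \<open>N\<close> is
  attained. Along a maximising sequence \<open>\<mu> w - R w\<close> tends to zero, finitely many
  functionals converge after passing to a subsequence, and since \<open>\<mu>\<close> exceeds
  \<open>r\<close>, \<open>small\<close> turns this into the Cauchy property. The invariant subspace
  \<open>N\<close> allows the lemma to be iterated on orthogonal complements.\<close>

lemma maximal_eigenvector:
  assumes inv: "\<And>f. f \<in> N ==> R f \<in> N" and subN: "subspace N" and clN: "closed N"
    and g: "g \<in> N" "g \<noteq> 0" "inner (R g) g >= q*(norm g)^2" and q: "q > r"
  shows "\<exists>f\<in>N. norm f = 1 \<and> (\<exists>\<mu>\<ge>q. R f = \<mu> *\<^sub>R f)"
proof -
  define X where "X = {inner (R f) f |f. f \<in> N \<and> norm f = 1}"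
  define \<mu> where "\<mu> = Sup X"
  have bddX: "bdd_above X"
  proof (rule bdd_aboveI)
    fix x assume "x \<in> X"
    then obtain f where "x = inner (R f) f" "norm f = 1" by (auto simp: X_def)
    then have "x <= norm (R f)*norm f" using norm_cauchy_schwarz by blast
    then show "x <= B" using bound[of f] \<open>norm f = 1\<close> by simp
  qed
  define g1 where "g1 = (1/norm g) *\<^sub>R g"
  have g1: "g1 \<in> N" "norm g1 = 1" using g subN by (auto simp: g1_def subspace_scale)
  have "inner (R g1) g1 = inner (R g) g/(norm g)^2"
    by (simp add: g1_def linear_scale[OF lin] power2_eq_square)
  then have gq: "inner (R g1) g1 >= q" using g by (simp add: pos_le_divide_eq)
  have Xne: "X \<noteq> {}" using g1 by (auto simp: X_def)
  have up: "inner (R f) f <= \<mu>" if "f \<in> N" "norm f = 1" for f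
    unfolding \<mu>_def by (rule cSup_upper[OF _ bddX]) (use that in \<open>auto simp: X_def\<close>)
  then have \<mu>q: "\<mu> >= q" using gq g1 by fastforce
  have \<mu>: "\<mu> > r" "\<mu> > 0" using \<mu>q q r0 by auto
  have up': "inner (R f) f <= \<mu>*(norm f)^2" if "f \<in> N" for f
  proof (cases "f = 0")
    case False
    have "inner (R ((1/norm f) *\<^sub>R f)) ((1/norm f) *\<^sub>R f) <= \<mu>"
      using that False subN by (intro up) (auto simp: subspace_scale)
    then have "inner (R f) f/(norm f)^2 <= \<mu>" by (simp add: linear_scale[OF lin] power2_eq_square)
    then show ?thesis using False by (simp add: field_simps)
  qed (simp add: linear_0[OF lin])
  have "\<exists>f. f \<in> N \<and> norm f = 1 \<and> inner (R f) f > \<mu> - 1/real (Suc k)" for k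
  proof -
    have "\<exists>x\<in>X. \<mu> - 1/real (Suc k) < x"
      using less_cSup_iff[OF Xne bddX, of "\<mu> - 1/real (Suc k)"] by (simp add: \<mu>_def)
    then show ?thesis by (auto simp: X_def)
  qed
  then obtain f where f: "\<And>k. f k \<in> N" "\<And>k. norm (f k) = 1" "\<And>k. inner (R (f k)) (f k) > \<mu> - 1/real (Suc k)"
    by metis
  define P where "P = (%x. \<mu> *\<^sub>R x - R x)"
  have linP: "linear P" unfolding P_def by (intro linear_compose_sub linear_compose_scale_right linear_id[unfolded id_def] lin)
  have symP: "inner (P x) y = inner x (P y)" for x y by (simp add: P_def inner_diff_left inner_diff_right sym)
  have nnP: "inner (P x) x >= 0" if "x \<in> N" for x
    using up'[OF that] by (simp add: P_def inner_diff_left power2_norm_eq_inner)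
  have PN: "P x \<in> N" if "x \<in> N" for x using that inv subN by (auto simp: P_def subspace_diff subspace_scale)
  \<comment> \<open>Cauchy-Schwarz for the form of \<open>P\<close> with second argument
    \<open>P (f k)\<close>: the fourth power of \<open>norm (P (f k))\<close> is at most
    \<open>inner (P (f k)) (f k)\<close> times \<open>\<mu>\<close> times its square.\<close>
  have small_P: "(norm (P (f k)))^2 <= \<mu>*(1/real (Suc k))" for k
  proof -
    define y where "y = P (f k)"
    have y: "y \<in> N" using PN f by (simp add: y_def)
    have "(inner (P (f k)) y)^2 <= inner (P (f k)) (f k)*inner (P y) y"
      using f y subN by (intro nonneg_form_Cauchy_Schwarz linP symP nnP) (auto simp: subspace_add subspace_scale)
    moreover have "inner (P (f k)) (f k) <= 1/real (Suc k)"
      using f(3)[of k] f(2)[of k] by (simp add: P_def inner_diff_left dot_square_norm)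
    moreover have "inner (P y) y <= \<mu>*(norm y)^2"
      using nonneg[of y] by (simp add: P_def inner_diff_left power2_norm_eq_inner)
    ultimately have "(inner (P (f k)) y)^2 <= (1/real (Suc k))*(\<mu>*(norm y)^2)"
      using nnP[OF y] by (meson order_trans mult_mono zero_le_divide_1_iff of_nat_0_le_iff)
    then have "((norm y)^2)^2 <= (1/real (Suc k))*(\<mu>*(norm y)^2)"
      by (simp add: y_def[symmetric] dot_square_norm)
    then have *: "(norm y)^2*(norm y)^2 <= (\<mu>*(1/real (Suc k)))*(norm y)^2"
      by (simp only: power2_eq_square[of "(norm y)^2"] mult.assoc mult.left_commute[of "1/real (Suc k)"])
    then show ?thesis unfolding y_def[symmetric]
      using \<mu> mult_right_le_imp_le[OF *] by (cases "norm y = 0") auto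
  qed
  have "(%k. (norm (P (f k)))^2) \<longlonglongrightarrow> 0"
  proof (rule tendsto_sandwich[OF _ _ tendsto_const])
    show "(%k. \<mu>*(1/real (Suc k))) \<longlonglongrightarrow> 0"
      using tendsto_mult_right_zero[OF LIMSEQ_Suc[OF lim_1_over_n], of \<mu>] by simp
  qed (use small_P in auto)
  then have Pf: "(%k. norm (P (f k))) \<longlonglongrightarrow> 0" using tendsto_real_sqrt by force
  obtain sg :: "nat => nat" where sg: "strict_mono sg" "\<forall>m\<in>M. convergent (%k. inner m (f (sg k)))"
    using bounded_functionals_convergent_subseq[OF finM, of f 1] f by auto
  define w where "w = (%k. f (sg k))"
  have Pw: "(%k. norm (P (w k))) \<longlonglongrightarrow> 0"
    using LIMSEQ_subseq_LIMSEQ[OF Pf sg(1)] by (simp add: w_def o_def)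
  have diffest: "(\<mu> - r)*norm (w i - w j) <= norm (P (w i)) + norm (P (w j)) + C*(\<Sum>m\<in>M. \<bar>inner m (w i) - inner m (w j)\<bar>)" for i j
  proof -
    have "\<mu>*norm (w i - w j) = norm (P (w i - w j) + R (w i - w j))"
      using \<mu> by (simp add: P_def)
    also have "\<dots> <= norm (P (w i - w j)) + norm (R (w i - w j))" by (rule norm_triangle_ineq)
    also have "norm (P (w i - w j)) <= norm (P (w i)) + norm (P (w j))"
      by (simp add: linear_diff[OF linP] norm_triangle_ineq4)
    finally show ?thesis using small[of "w i - w j"] by (simp add: inner_diff_right algebra_simps)
  qed
  have "Cauchy w"
  proof (rule metric_CauchyI)
    fix e :: real assume e: "e > 0"
    \<comment> \<open>Two residuals and \<open>card M\<close> functional differences, the latter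
      weighted by \<open>C\<close>, must together stay below \<open>(\<mu> - r)*e\<close>; the
      factor 3 leaves room to spare.\<close>
    define e' where "e' = (\<mu> - r)*e/(3*(1 + C*real (card M)))"
    have cM: "C*real (card M) >= 0" using C0 by simp
    have e': "e' > 0" using e \<mu> cM by (simp add: e'_def)
    have "\<forall>\<^sub>F k in sequentially. norm (P (w k)) < e'" using Pw e' by (simp add: order_tendstoD)
    then obtain N1 where N1: "\<And>k. k >= N1 ==> norm (P (w k)) < e'" by (auto simp: eventually_sequentially)
    have "\<forall>m\<in>M. \<exists>N2. \<forall>i\<ge>N2. \<forall>j\<ge>N2. \<bar>inner m (w i) - inner m (w j)\<bar> < e'"
    proof
      fix m assume "m \<in> M"
      then have "Cauchy (%k. inner m (w k))" using sg by (simp add: w_def convergent_Cauchy)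
      from CauchyD[OF this e'] show "\<exists>N2. \<forall>i\<ge>N2. \<forall>j\<ge>N2. \<bar>inner m (w i) - inner m (w j)\<bar> < e'" by auto
    qed
    then obtain N2 where N2: "\<And>m i j. m \<in> M ==> i >= N2 m ==> j >= N2 m ==> \<bar>inner m (w i) - inner m (w j)\<bar> < e'"
      by metis
    define N3 where "N3 = Max (insert N1 (N2 ` M))"
    have N3: "N1 <= N3" "\<And>m. m \<in> M ==> N2 m <= N3" using finM by (auto simp: N3_def)
    have "dist (w i) (w j) < e" if ij: "i >= N3" "j >= N3" for i j
    proof -
      have "(\<Sum>m\<in>M. \<bar>inner m (w i) - inner m (w j)\<bar>) <= (\<Sum>m\<in>M. e')"
        using N2 N3 ij by (intro sum_mono) (meson le_trans less_imp_le)
      then have "C*(\<Sum>m\<in>M. \<bar>inner m (w i) - inner m (w j)\<bar>) <= C*(real (card M)*e')"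
        using C0 by (intro mult_left_mono) auto
      moreover have "norm (P (w i)) < e'" "norm (P (w j)) < e'" using N1 N3 ij by auto
      ultimately have "(\<mu> - r)*norm (w i - w j) < e' + e' + C*(real (card M)*e')"
        using diffest[of i j] by linarith
      also have "\<dots> <= 3*(1 + C*real (card M))*e'" using mult_nonneg_nonneg[OF cM less_imp_le[OF e']] e' by (simp add: algebra_simps)
      also have "\<dots> = (\<mu> - r)*e" using cM by (simp add: e'_def field_simps)
      finally show ?thesis using \<mu> by (simp add: dist_norm)
    qed
    then show "\<exists>N. \<forall>i\<ge>N. \<forall>j\<ge>N. dist (w i) (w j) < e" by blast
  qed
  then obtain p where p: "w \<longlonglongrightarrow> p" using Cauchy_convergent_iff convergent_def by blast
  have pN: "p \<in> N" using closed_sequentially[OF clN _ p] f by (auto simp: w_def)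
  have "(%k. norm (w k)) \<longlonglongrightarrow> norm p" by (intro tendsto_intros p)
  moreover have "(%k. norm (w k)) = (%k. 1)" using f by (auto simp: w_def)
  ultimately have np: "norm p = 1" using LIMSEQ_unique tendsto_const by metis
  have blP: "bounded_linear P"
    unfolding P_def by (intro bounded_linear_sub bounded_linear_scaleR_right
        bounded_linear_intro[of R B] ) (auto simp: linear_add[OF lin] linear_scale[OF lin] bound mult.commute)
  have "(%k. P (w k)) \<longlonglongrightarrow> P p" by (rule bounded_linear.tendsto[OF blP p])
  moreover have "(%k. P (w k)) \<longlonglongrightarrow> 0" using Pw tendsto_norm_zero_iff by blast
  ultimately have "P p = 0" using LIMSEQ_unique by blast
  then have "R p = \<mu> *\<^sub>R p" by (simp add: P_def)
  then show ?thesis using pN np \<mu>q by blast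
qed

definition eigenfamily :: "nat => (nat => 'v) => (nat => real) => bool" where
  "eigenfamily n e \<mu> \<longleftrightarrow> (\<forall>i<n. \<forall>j<n. inner (e i) (e j) = (if i = j then 1 else 0)) \<and> (\<forall>i<n. R (e i) = \<mu> i *\<^sub>R e i)"

text \<open>By symmetry of \<open>R\<close> the orthogonal complement of eigenvectors is invariant,
  so the maximal quotient there is again an eigenvalue.\<close>

lemma eigenfamily_extend:
  assumes ef: "eigenfamily n e \<mu>"
    and g: "\<forall>i<n. inner (e i) g = 0" "g \<noteq> 0" "inner (R g) g >= q*(norm g)^2" and q: "q > r"
  shows "\<exists>f l. l >= q \<and> eigenfamily (Suc n) (e(n := f)) (\<mu>(n := l))"
proof -
  define N where "N = {f. \<forall>i<n. inner (e i) f = 0}"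
  have 1: "R f \<in> N" if "f \<in> N" for f
    using that ef by (auto simp: N_def sym[symmetric] eigenfamily_def)
  have 2: "subspace N" by (auto simp: N_def subspace_def inner_add_right)
  have "N = (\<Inter>i\<in>{..<n}. {f. inner (e i) f = 0})" by (auto simp: N_def)
  then have 3: "closed N" by (auto intro!: closed_INT closed_hyperplane)
  obtain f l where f: "f \<in> N" "norm f = 1" "l >= q" "R f = l *\<^sub>R f"
    using maximal_eigenvector[OF 1 2 3 _ g(2,3) q] g(1) by (auto simp: N_def)
  have "inner f f = 1" using f by (simp add: dot_square_norm)
  then have "eigenfamily (Suc n) (e(n := f)) (\<mu>(n := l))"
    using ef f(1,2,4) unfolding eigenfamily_def N_def by (simp add: less_Suc_eq inner_commute)
  then show ?thesis using f(3) by blast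
qed

lemma eigenfamily_sum:
  assumes ef: "eigenfamily n e \<mu>"
  shows "(norm (\<Sum>i<n. c i *\<^sub>R e i))^2 = (\<Sum>i<n. (c i)^2)"
proof -
  have "inner (\<Sum>i<n. c i *\<^sub>R e i) (\<Sum>j<n. c j *\<^sub>R e j) = (\<Sum>i<n. \<Sum>j<n. if i = j then c i*c j else 0)"
    unfolding inner_sum_left inner_sum_right
    by (intro sum.cong refl) (use ef in \<open>auto simp: eigenfamily_def\<close>)
  also have "\<dots> = (\<Sum>i<n. (c i)^2)" by (intro sum.cong) (auto simp: sum.delta power2_eq_square)
  finally show ?thesis by (simp add: power2_norm_eq_inner)
qed

text \<open>With more than \<open>card M\<close> eigenvectors some nontrivial combination is
  annihilated by every functional in \<open>M\<close>. There \<open>R\<close> expands by at most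
  \<open>r\<close>, while all eigenvalues involved exceed \<open>r\<close>.\<close>

lemma eigenfamily_card:
  assumes ef: "eigenfamily n e \<mu>" and \<mu>: "\<And>i. i < n ==> \<mu> i > r"
  shows "n <= card M"
proof (rule ccontr)
  assume "\<not> n <= card M"
  then obtain c where c: "\<exists>i\<in>{..<n}. c i \<noteq> 0" "\<forall>m\<in>M. (\<Sum>i<n. c i*inner m (e i)) = 0"
    using underdetermined_system[OF finM finite_lessThan[of n], of "%m i. inner m (e i)"] by auto
  define g where "g = (\<Sum>i<n. c i *\<^sub>R e i)"
  have "norm (R g) <= r*norm g"
    using small[of g] c(2) by (simp add: g_def inner_sum_right)
  then have "(norm (R g))^2 <= (r*norm g)^2" by (intro power_mono) auto
  also have "\<dots> = (\<Sum>i<n. (r*c i)^2)"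
    by (simp add: power_mult_distrib g_def eigenfamily_sum[OF ef] sum_distrib_left)
  finally have 1: "(norm (R g))^2 <= (\<Sum>i<n. (r*c i)^2)" .
  have "R g = (\<Sum>i<n. (c i*\<mu> i) *\<^sub>R e i)"
    unfolding g_def linear_sum[OF lin] using ef by (intro sum.cong) (auto simp: linear_scale[OF lin] eigenfamily_def)
  then have 2: "(norm (R g))^2 = (\<Sum>i<n. (c i*\<mu> i)^2)" by (simp add: eigenfamily_sum[OF ef])
  have "(\<Sum>i<n. (r*c i)^2) < (\<Sum>i<n. (c i*\<mu> i)^2)"
  proof (rule sum_strict_mono_ex1)
    show "\<forall>x\<in>{..<n}. (r*c x)^2 <= (c x*\<mu> x)^2"
    proof
      fix x assume "x \<in> {..<n}"
      then have "r^2 <= (\<mu> x)^2" using \<mu>[of x] r0 by (intro power_mono) auto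
      then show "(r*c x)^2 <= (c x*\<mu> x)^2" by (simp add: power_mult_distrib mult.commute mult_right_mono)
    qed
    obtain i where i: "i < n" "c i \<noteq> 0" using c by auto
    then have "r^2 < (\<mu> i)^2" using \<mu>[of i] r0 by (intro power_strict_mono) auto
    then have "(r*c i)^2 < (c i*\<mu> i)^2" using i by (simp add: power_mult_distrib mult.commute)
    then show "\<exists>a\<in>{..<n}. (r*c a)^2 < (c a*\<mu> a)^2" using i by auto
  qed simp
  then show False using 1 2 by simp
qed

text \<open>Both halves of the min-max count. As long as fewer than \<open>n\<close> eigenvectors
  are known, some combination of the \<open>n\<close> trial vectors \<open>F i\<close> is orthogonal
  to them and still has quotient at least \<open>q\<close>. Once there are \<open>n\<close>, a
  further vector with quotient above \<open>r\<close> would contradict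
  \<open>eigenfamily_card\<close>.\<close>

lemma eigenfamily_exists:
  assumes card: "card M <= n" and q: "q > r"
    and F: "\<And>c. (\<exists>i<n. c i \<noteq> 0) ==> (\<Sum>i<n. c i *\<^sub>R F i) \<noteq> 0"
    and Fq: "\<And>c. inner (R (\<Sum>i<n. c i *\<^sub>R F i)) (\<Sum>i<n. c i *\<^sub>R F i) >= q*(norm (\<Sum>i<n. c i *\<^sub>R F i))^2"
  shows "\<exists>e \<mu>. eigenfamily n e \<mu> \<and> (\<forall>i<n. \<mu> i >= q) \<and>
     (\<forall>g. (\<forall>i<n. inner (e i) g = 0) --> inner (R g) g <= r*(norm g)^2)"
proof -
  have "\<exists>e \<mu>. eigenfamily k e \<mu> \<and> (\<forall>i<k. \<mu> i >= q)" if "k <= n" for k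
    using that
  proof (induction k)
    case 0
    then show ?case by (simp add: eigenfamily_def)
  next
    case (Suc k)
    then obtain e \<mu> where e: "eigenfamily k e \<mu>" "\<forall>i<k. \<mu> i >= q" by auto
    obtain c where c: "\<exists>i\<in>{..<n}. c i \<noteq> 0" "\<forall>j\<in>{..<k}. (\<Sum>i<n. c i*inner (e j) (F i)) = 0"
      using underdetermined_system[of "{..<k}" "{..<n}" "%j i. inner (e j) (F i)"] Suc.prems by auto
    define g where "g = (\<Sum>i<n. c i *\<^sub>R F i)"
    have "\<forall>j<k. inner (e j) g = 0" using c by (simp add: g_def inner_sum_right)
    moreover have "g \<noteq> 0" using F c by (auto simp: g_def)
    moreover have "inner (R g) g >= q*(norm g)^2" using Fq by (simp add: g_def)
    ultimately obtain f l where f: "l >= q" "eigenfamily (Suc k) (e(k := f)) (\<mu>(k := l))"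
      using eigenfamily_extend[OF e(1) _ _ _ q] by blast
    moreover have "\<forall>i<Suc k. (\<mu>(k := l)) i >= q" using e(2) f(1) by (auto simp: less_Suc_eq)
    ultimately show ?case by blast
  qed
  then obtain e \<mu> where e: "eigenfamily n e \<mu>" "\<forall>i<n. \<mu> i >= q" by blast
  have "inner (R g) g <= r*(norm g)^2" if g: "\<forall>i<n. inner (e i) g = 0" for g
  proof (rule ccontr)
    assume *: "\<not> inner (R g) g <= r*(norm g)^2"
    then have g0: "g \<noteq> 0" by (auto simp: linear_0[OF lin])
    define p where "p = inner (R g) g/(norm g)^2"
    have p: "p > r" "inner (R g) g >= p*(norm g)^2" using*g0 by (auto simp: p_def field_simps)
    obtain f l where f: "l >= p" "eigenfamily (Suc n) (e(n := f)) (\<mu>(n := l))"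
      using eigenfamily_extend[OF e(1) g g0 p(2,1)] by blast
    have "(\<mu>(n := l)) i > r" if "i < Suc n" for i
    proof (cases "i = n")
      case False
      then have "\<mu> i >= q" using e(2) that by simp
      then show ?thesis using q False by simp
    qed (use f(1) p(1) in simp)
    then have "Suc n <= card M" by (rule eigenfamily_card[OF f(2)])
    then show False using card by simp
  qed
  then show ?thesis using e by blast
qed

end

section \<open>From a symmetric graph with dense shifted range to the spectrum below a level\<close>

text \<open>For a nonnegative symmetric operator, triviality of the orthogonal complement of the
  range of the operator plus \<open>s\<close> is essential self-adjointness. Working with graphs
  avoids speaking of domains.\<close>

locale dense_range_graph =
  fixes G0 :: "('v::{real_inner,complete_space} \<times> 'v) set" and s :: real
  assumes sub0: "subspace G0"
    and sym0: "\<And>u f w g. (u, f) \<in> G0 ==> (w, g) \<in> G0 ==> inner f w = inner u g"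
    and nonneg0: "\<And>u f. (u, f) \<in> G0 ==> inner f u >= 0"
    and s: "s > 0"
    and dense: "\<And>w. (\<And>u f. (u, f) \<in> G0 ==> inner w (f + s *\<^sub>R u) = 0) ==> w = 0"
begin

abbreviation G where "G \<equiv> closure G0"

lemma G_sequence:
  assumes "(u, f) \<in> G"
  obtains x y where "\<And>n. (x n, y n) \<in> G0" "x \<longlonglongrightarrow> u" "y \<longlonglongrightarrow> f"
proof -
  obtain p where p: "\<And>n. p n \<in> G0" "p \<longlonglongrightarrow> (u, f)" using assms closure_sequential by metis
  show ?thesis
    by (rule that[of "%n. fst (p n)" "%n. snd (p n)"]) (use p tendsto_fst[OF p(2)] tendsto_snd[OF p(2)] in auto)
qed

lemma G_subspace: "subspace G"
proof (rule subspaceI)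
  show "0 \<in> G" using subspace_0[OF sub0] closure_subset by blast
  fix p q :: "'v \<times> 'v" and c :: real assume p: "p \<in> G"
  obtain x where x: "\<And>n. x n \<in> G0" "x \<longlonglongrightarrow> p" using p closure_sequential by metis
  have "(%n. c *\<^sub>R x n) \<longlonglongrightarrow> c *\<^sub>R p" by (intro tendsto_intros x)
  then show "c *\<^sub>R p \<in> G" using subspace_scale[OF sub0 x(1)] unfolding closure_sequential
    by (intro exI[of _ "%n. c *\<^sub>R x n"]) auto
  assume q: "q \<in> G"
  obtain y where y: "\<And>n. y n \<in> G0" "y \<longlonglongrightarrow> q" using q closure_sequential by metis
  have "(%n. x n + y n) \<longlonglongrightarrow> p + q" by (intro tendsto_intros x y)
  then show "p + q \<in> G" using subspace_add[OF sub0 x(1) y(1)] unfolding closure_sequential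
    by (intro exI[of _ "%n. x n + y n"]) auto
qed

lemma G_add: "(u, f) \<in> G ==> (w, g) \<in> G ==> (u + w, f + g) \<in> G"
  using subspace_add[OF G_subspace, of "(u, f)" "(w, g)"] by simp

lemma G_diff: "(u, f) \<in> G ==> (w, g) \<in> G ==> (u - w, f - g) \<in> G"
  using subspace_diff[OF G_subspace, of "(u, f)" "(w, g)"] by simp

lemma G_scale: "(u, f) \<in> G ==> (c *\<^sub>R u, c *\<^sub>R f) \<in> G"
  using subspace_scale[OF G_subspace, of "(u, f)" c] by simp

lemma G_sum: "(\<And>i. i \<in> I ==> (u i, f i) \<in> G) ==> ((\<Sum>i\<in>I. u i), (\<Sum>i\<in>I. f i)) \<in> G"
proof (induction I rule: infinite_finite_induct)
  case (insert x F)
  then show ?case by (auto intro: G_add)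
qed (use subspace_0[OF G_subspace] in \<open>auto simp: zero_prod_def\<close>)

lemma G_sym:
  assumes "(u, f) \<in> G" "(w, g) \<in> G"
  shows "inner f w = inner u g"
proof -
  obtain x y where 1: "\<And>n. (x n, y n) \<in> G0" "x \<longlonglongrightarrow> u" "y \<longlonglongrightarrow> f" using G_sequence[OF assms(1)] by metis
  obtain x' y' where 2: "\<And>n. (x' n, y' n) \<in> G0" "x' \<longlonglongrightarrow> w" "y' \<longlonglongrightarrow> g" using G_sequence[OF assms(2)] by metis
  have "(%n. inner (y n) (x' n)) \<longlonglongrightarrow> inner f w" by (intro tendsto_intros 1 2)
  moreover have "(%n. inner (y n) (x' n)) \<longlonglongrightarrow> inner u g"
    using sym0[OF 1(1) 2(1)] tendsto_inner[OF 1(2) 2(3)] by simp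
  ultimately show ?thesis using LIMSEQ_unique by blast
qed

lemma G_nonneg:
  assumes "(u, f) \<in> G"
  shows "inner f u >= 0"
proof -
  obtain x y where 1: "\<And>n. (x n, y n) \<in> G0" "x \<longlonglongrightarrow> u" "y \<longlonglongrightarrow> f" using G_sequence[OF assms(1)] by metis
  have "(%n. inner (y n) (x n)) \<longlonglongrightarrow> inner f u" by (intro tendsto_intros 1)
  then show ?thesis using nonneg0[OF 1(1)] by (intro LIMSEQ_le_const) auto
qed

lemma shifted_coercive:
  assumes "(u, f) \<in> G"
  shows "s*(norm u)^2 <= inner (f + s *\<^sub>R u) u" "norm u <= norm (f + s *\<^sub>R u)/s"
proof -
  show 1: "s*(norm u)^2 <= inner (f + s *\<^sub>R u) u"
    using G_nonneg[OF assms] by (simp add: inner_add_left power2_norm_eq_inner)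
  also have "\<dots> <= norm (f + s *\<^sub>R u)*norm u" by (rule norm_cauchy_schwarz)
  finally have "(s*norm u)*norm u <= norm (f + s *\<^sub>R u)*norm u" by (simp add: power2_eq_square)
  then have "s*norm u <= norm (f + s *\<^sub>R u)" by (cases "norm u = 0") (auto dest: mult_right_le_imp_le)
  then show "norm u <= norm (f + s *\<^sub>R u)/s" using s by (simp add: field_simps)
qed

text \<open>The range over the closed graph is closed, since coercivity bounds the inverse, and it
  is dense by assumption; the projection onto it therefore fixes every vector.\<close>

lemma shifted_surj: "\<exists>u f. (u, f) \<in> G \<and> y = f + s *\<^sub>R u"
proof -
  define Y where "Y = (%p. snd p + s *\<^sub>R fst p) ` G"
  have lin: "linear (%p::'v\<times>'v. snd p + s *\<^sub>R fst p)" by (rule linearI) (auto simp: algebra_simps)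
  have subY: "subspace Y" unfolding Y_def by (rule linear_subspace_image[OF lin G_subspace])
  have clY: "closed Y"
    unfolding closed_sequential_limits
  proof (intro allI impI, elim conjE)
    fix z l assume z: "\<forall>n. z n \<in> Y" and lim: "z \<longlonglongrightarrow> l"
    have "\<forall>n. \<exists>u f. (u, f) \<in> G \<and> z n = f + s *\<^sub>R u" using z by (fastforce simp: Y_def)
    then obtain u f where uf: "\<And>n. (u n, f n) \<in> G" "\<And>n. z n = f n + s *\<^sub>R u n" by metis
    have le: "dist (u i) (u j) <= dist (z i) (z j)/s" for i j
    proof -
      have "z i - z j = (f i - f j) + s *\<^sub>R (u i - u j)" using uf by (simp add: algebra_simps)
      then show ?thesis using shifted_coercive(2)[OF G_diff[OF uf(1) uf(1)]] by (simp add: dist_norm)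
    qed
    have "Cauchy u"
    proof (rule metric_CauchyI)
      fix e :: real assume e: "e > 0"
      have "Cauchy z" using lim by (rule LIMSEQ_imp_Cauchy)
      from metric_CauchyD[OF this, of "e * s"] e s obtain N where
        N: "\<And>i j. i >= N ==> j >= N ==> dist (z i) (z j) < e * s" by auto
      have "dist (u i) (u j) < e" if "i >= N" "j >= N" for i j
        using order.strict_trans1[OF le[of i j] divide_strict_right_mono[OF N[OF that] s]] s by simp
      then show "\<exists>N. \<forall>i\<ge>N. \<forall>j\<ge>N. dist (u i) (u j) < e" by blast
    qed
    then obtain v where v: "u \<longlonglongrightarrow> v" using Cauchy_convergent_iff convergent_def by blast
    have A: "(%n. (u n, z n - s *\<^sub>R u n)) \<longlonglongrightarrow> (v, l - s *\<^sub>R v)" by (intro tendsto_intros v lim)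
    have B: "(u n, z n - s *\<^sub>R u n) \<in> G" for n using uf by simp
    have "(v, l - s *\<^sub>R v) \<in> G" by (rule closed_sequentially[OF closed_closure B A])
    then have "snd (v, l - s *\<^sub>R v) + s *\<^sub>R fst (v, l - s *\<^sub>R v) \<in> Y" unfolding Y_def by (rule imageI)
    then show "l \<in> Y" by simp
  qed
  obtain m where m: "m \<in> Y" "\<And>z. z \<in> Y ==> inner (y - m) z = 0" using hilbert_projection[OF subY clY] by blast
  have "y - m = 0"
  proof (rule dense)
    fix u f assume "(u, f) \<in> G0"
    then have "f + s *\<^sub>R u \<in> Y" unfolding Y_def using closure_subset by (force intro!: image_eqI[where x="(u, f)"])
    then show "inner (y - m) (f + s *\<^sub>R u) = 0" by (rule m(2))
  qed
  moreover obtain p where "p \<in> G" "m = snd p + s *\<^sub>R fst p" using m(1) by (auto simp: Y_def)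
  ultimately show ?thesis by (intro exI[of _ "fst p"] exI[of _ "snd p"]) auto
qed

text \<open>The resolvent at \<open>- s\<close>; uniqueness is \<open>R_unique\<close>, existence
  \<open>shifted_surj\<close>.\<close>

definition R where "R y = (THE u. (u, y - s *\<^sub>R u) \<in> G)"

lemma R_unique: "(u, f) \<in> G ==> R (f + s *\<^sub>R u) = u"
  unfolding R_def
proof (rule the_equality)
  fix w assume u: "(u, f) \<in> G" and w: "(w, f + s *\<^sub>R u - s *\<^sub>R w) \<in> G"
  have "norm (w - u) <= norm (f + s *\<^sub>R u - s *\<^sub>R w - f + s *\<^sub>R (w - u))/s"
    by (rule shifted_coercive(2)[OF G_diff[OF w u]])
  then show "w = u" by (simp add: algebra_simps)
qed simp

lemma R_graph: "(R y, y - s *\<^sub>R R y) \<in> G"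
proof -
  obtain u f where u: "(u, f) \<in> G" "y = f + s *\<^sub>R u" using shifted_surj by blast
  then show ?thesis using R_unique[OF u(1)] by simp
qed

lemma R_linear: "linear R"
proof (rule linearI)
  fix x y c
  show "R (x + y) = R x + R y"
    using R_unique[OF G_add[OF R_graph[of x] R_graph[of y]]] by (simp add: algebra_simps)
  show "R (c *\<^sub>R x) = c *\<^sub>R R x"
    using R_unique[OF G_scale[OF R_graph[of x], of c]] by (simp add: algebra_simps)
qed

lemma R_sym: "inner (R f) g = inner f (R g)"
  using G_sym[OF R_graph[of f] R_graph[of g]] by (simp add: inner_diff_left inner_diff_right)

lemma R_nonneg: "inner (R f) f >= 0"
  using shifted_coercive(1)[OF R_graph[of f]] s by (simp add: inner_commute) (meson mult_nonneg_nonneg order_trans zero_le_power2 less_imp_le)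

lemma R_bound: "norm (R f) <= (1/s)*norm f"
  using shifted_coercive(2)[OF R_graph[of f]] by simp

text \<open>The hypotheses on the form are turned into hypotheses on \<open>R\<close>: the lower
  bound modulo \<open>L\<close> gives \<open>small\<close> with \<open>r = 1/(E + s)\<close>, the
  trial vectors get \<open>R\<close>-quotient at least \<open>1/(\<delta> + s)\<close>. The last
  conclusion is the resolvent equation at the complex number with parts \<open>a\<close> and
  \<open>b\<close>, written as a real system for real and imaginary parts.\<close>

theorem finite_spectrum_below:
  fixes L :: "'v set" and \<delta> E C :: real and F H :: "nat => 'v"
  assumes finL: "finite L" and card: "card L <= n" and C: "C >= 0" and \<delta>: "0 <= \<delta>" "\<delta> < E"
    and lower: "\<And>u f. (u, f) \<in> G0 ==> inner f u >= E*(norm u)^2 - C*(\<Sum>l\<in>L. (inner l u)^2)"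
    and FG: "\<And>i. i < n ==> (F i, H i) \<in> G0"
    and F0: "\<And>i. i < n ==> F i \<noteq> 0"
    and Forth: "\<And>i j. i < n ==> j < n ==> i \<noteq> j ==> inner (F i) (F j) = 0 \<and> inner (H i) (F j) = 0"
    and Fsmall: "\<And>i. i < n ==> inner (H i) (F i) <= \<delta>*(norm (F i))^2"
  obtains e lam where
    "\<And>i j. i < n ==> j < n ==> inner (e i) (e j) = (if i = j then 1 else 0)"
    "\<And>i. i < n ==> (e i, lam i *\<^sub>R e i) \<in> G" "\<And>i. i < n ==> 0 <= lam i" "\<And>i. i < n ==> lam i <= \<delta>"
    "\<And>u f. (u, f) \<in> G ==> (\<forall>i<n. inner (e i) u = 0) ==> inner f u >= E*(norm u)^2"
    "\<And>a b f1 f2. a < E ==> (\<forall>i<n. a \<noteq> lam i \<or> b \<noteq> 0) ==>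
       \<exists>u1 g1 u2 g2. (u1, g1) \<in> G \<and> (u2, g2) \<in> G \<and> g1 - (a *\<^sub>R u1 - b *\<^sub>R u2) = f1 \<and> g2 - (a *\<^sub>R u2 + b *\<^sub>R u1) = f2"
proof -
  define r where "r = 1/(E + s)"
  have Es: "E + s > 0" "r > 0" "\<delta> + s > 0" using \<delta> s by (auto simp: r_def)
  have lowG: "inner f u >= E*(norm u)^2 - C*(\<Sum>l\<in>L. (inner l u)^2)" if uf: "(u, f) \<in> G" for u f
  proof -
    obtain x y where 1: "\<And>k. (x k, y k) \<in> G0" "x \<longlonglongrightarrow> u" "y \<longlonglongrightarrow> f" using G_sequence[OF uf] by metis
    show ?thesis
    proof (rule LIMSEQ_le)
      show "(%k. E*(norm (x k))^2 - C*(\<Sum>l\<in>L. (inner l (x k))^2)) \<longlonglongrightarrow> E*(norm u)^2 - C*(\<Sum>l\<in>L. (inner l u)^2)"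
        by (intro tendsto_intros 1)
      show "(%k. inner (y k) (x k)) \<longlonglongrightarrow> inner f u" by (intro tendsto_intros 1)
    qed (use lower[OF 1(1)] in auto)
  qed
  \<comment> \<open>By symmetry \<open>inner l (R g) = inner (R l) g\<close>, so the functionals
    acting on \<open>g\<close> are those of \<open>R l\<close>.\<close>
  define M where "M = R ` L"
  define D where "D = sqrt (C*r*card L)"
  have D0: "D >= 0" "D^2 = C*r*card L" using C Es by (auto simp: D_def)
  have smallR: "norm (R g) <= r*norm g + D*(\<Sum>m\<in>M. \<bar>inner m g\<bar>)" for g
  proof -
    define x where "x = norm (R g)"
    define Sg where "Sg = (\<Sum>m\<in>M. \<bar>inner m g\<bar>)"
    have Sg: "Sg >= 0" by (auto simp: Sg_def intro: sum_nonneg)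
    have "(inner l (R g))^2 <= Sg^2" if "l \<in> L" for l
    proof -
      have "\<bar>inner (R l) g\<bar> <= Sg" unfolding Sg_def M_def using finL that by (intro member_le_sum) auto
      then show ?thesis using Sg by (simp add: R_sym abs_le_square_iff[symmetric])
    qed
    then have "(\<Sum>l\<in>L. (inner l (R g))^2) <= real (card L)*Sg^2" by (intro sum_bounded_above)
    then have t: "C*(\<Sum>l\<in>L. (inner l (R g))^2) <= C*(card L*Sg^2)" using C by (intro mult_left_mono) auto
    have "E*x^2 - C*(\<Sum>l\<in>L. (inner l (R g))^2) <= inner (g - s *\<^sub>R R g) (R g)"
      unfolding x_def by (rule lowG[OF R_graph])
    then have "(E + s)*x^2 <= inner g (R g) + C*(\<Sum>l\<in>L. (inner l (R g))^2)"
      by (simp add: x_def inner_diff_left dot_square_norm algebra_simps)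
    also have "\<dots> <= norm g*x + C*(card L*Sg^2)"
      using t norm_cauchy_schwarz[of g "R g"] by (simp add: x_def)
    finally have "r*((E + s)*x^2) <= r*(norm g*x + C*(card L*Sg^2))" using Es by (intro mult_left_mono) auto
    then have q: "x^2 <= (r*norm g)*x + (D*Sg)^2"
    proof -
      have "r*((E + s)*x^2) = x^2" using Es by (simp add: r_def)
      moreover have "r*(norm g*x + C*(card L*Sg^2)) = (r*norm g)*x + (D*Sg)^2"
        by (simp add: power_mult_distrib D0 algebra_simps)
      ultimately show ?thesis using \<open>r*((E + s)*x^2) <= _\<close> by linarith
    qed
    \<comment> \<open>From \<open>x^2 <= p*x + y^2\<close> with \<open>p\<close> and
      \<open>y\<close> nonnegative follows \<open>x <= p + y\<close>.\<close>
    have "x <= r*norm g + D*Sg"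
    proof (rule ccontr)
      assume *: "\<not> x <= r*norm g + D*Sg"
      have nn: "r*norm g >= 0" "D*Sg >= 0" using Es D0 Sg by auto
      have "(D*Sg)*(D*Sg) <= (D*Sg)*x" using*nn by (intro mult_left_mono) auto
      moreover have "(r*norm g + D*Sg)*x < x*x" using*nn by (intro mult_strict_right_mono) auto
      ultimately show False using q by (simp add: power2_eq_square algebra_simps)
    qed
    then show ?thesis by (simp add: x_def Sg_def)
  qed
  interpret O: nonneg_operator R M r "1/s" D
    by (rule nonneg_operator.intro) (use R_linear R_sym R_nonneg R_bound s finL Es D0 smallR in \<open>auto simp: M_def\<close>)
  define q where "q = 1/(\<delta> + s)"
  have qr: "q > r" unfolding q_def r_def using Es \<delta> by (intro divide_strict_left_mono) auto
  have cardM: "card M <= n" unfolding M_def using card card_image_le[OF finL, of R] by linarith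
  \<comment> \<open>Since \<open>u = R (f + s *\<^sub>R u)\<close>, Cauchy-Schwarz for the form of
    \<open>R\<close> links both quotients. It is used twice: to bound the \<open>R\<close>-quotient
    of trial vectors from below, and to recover the gap of the operator from the gap of
    \<open>R\<close>.\<close>
  have CS: "((norm u)^2)^2 <= inner u (f + s *\<^sub>R u)*inner (R u) u" if "(u, f) \<in> G" for u f
  proof -
    have "(inner (R (f + s *\<^sub>R u)) u)^2 <= inner (R (f + s *\<^sub>R u)) (f + s *\<^sub>R u)*inner (R u) u"
      by (intro nonneg_form_Cauchy_Schwarz R_linear R_sym R_nonneg)
    then show ?thesis by (simp only: R_unique[OF that] dot_square_norm)
  qed
  have "\<exists>e \<mu>. O.eigenfamily n e \<mu> \<and> (\<forall>i<n. \<mu> i >= q) \<and>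
     (\<forall>g. (\<forall>i<n. inner (e i) g = 0) --> inner (R g) g <= r*(norm g)^2)"
  proof (rule O.eigenfamily_exists[OF cardM qr, of F])
    fix c :: "nat => real"
    define u where "u = (\<Sum>i<n. c i *\<^sub>R F i)"
    define f where "f = (\<Sum>i<n. c i *\<^sub>R H i)"
    have uf: "(u, f) \<in> G" unfolding u_def f_def
      by (intro G_sum G_scale) (use FG closure_subset in blast)
    have diag: "inner (\<Sum>i<n. c i *\<^sub>R A i) (\<Sum>i<n. c i *\<^sub>R F i) = (\<Sum>i<n. (c i)^2*inner (A i) (F i))"
      if "\<And>i j. i < n ==> j < n ==> i \<noteq> j ==> inner (A i) (F j) = 0" for A
    proof -
      have "inner (\<Sum>i<n. c i *\<^sub>R A i) (\<Sum>i<n. c i *\<^sub>R F i)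
          = (\<Sum>i<n. \<Sum>j<n. if i = j then (c i)\<^sup>2*inner (A i) (F i) else 0)"
        unfolding inner_sum_left inner_sum_right
        by (intro sum.cong refl) (use that in \<open>auto simp: power2_eq_square\<close>)
      then show ?thesis by simp
    qed
    have nu: "(norm u)^2 = (\<Sum>i<n. (c i)^2*(norm (F i))^2)"
      unfolding power2_norm_eq_inner u_def using Forth by (intro diag) auto
    have "inner f u = (\<Sum>i<n. (c i)^2*inner (H i) (F i))"
      unfolding u_def f_def using Forth by (intro diag) auto
    also have "\<dots> <= (\<Sum>i<n. (c i)^2*(\<delta>*(norm (F i))^2))"
      by (intro sum_mono mult_left_mono Fsmall) auto
    also have "\<dots> = \<delta>*(norm u)^2" by (simp add: nu sum_distrib_left mult_ac)
    finally have "inner u (f + s *\<^sub>R u) <= (\<delta> + s)*(norm u)^2"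
      by (simp add: inner_add_right inner_commute dot_square_norm algebra_simps)
    then have "((norm u)^2)^2 <= (\<delta> + s)*(norm u)^2*inner (R u) u"
      using CS[OF uf] R_nonneg[of u] by (meson mult_right_mono order_trans)
    then have *: "(norm u)^2*(norm u)^2 <= ((\<delta> + s)*inner (R u) u)*(norm u)^2"
      by (simp add: power2_eq_square mult_ac)
    have "(norm u)^2 <= (\<delta> + s)*inner (R u) u"
      using mult_right_le_imp_le[OF *] by (cases "u = 0") (auto simp: linear_0[OF R_linear])
    then show "inner (R u) u >= q*(norm u)^2"
      using Es by (simp add: q_def field_simps)
    assume "\<exists>i<n. c i \<noteq> 0"
    then obtain i where i: "i < n" "c i \<noteq> 0" by blast
    have "0 < (\<Sum>i<n. (c i)^2*(norm (F i))^2)"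
      using i F0[of i] by (intro sum_pos2[of _ i]) auto
    then show "u \<noteq> 0" using nu by auto
  qed
  then obtain e \<mu> where ef: "O.eigenfamily n e \<mu>" and \<mu>q: "\<And>i. i < n ==> \<mu> i >= q"
    and gapR: "\<And>g. (\<forall>i<n. inner (e i) g = 0) ==> inner (R g) g <= r*(norm g)^2" by blast
  have \<mu>0: "\<mu> i > 0" if "i < n" for i using \<mu>q[OF that] qr Es by linarith
  have orth: "inner (e i) (e j) = (if i = j then 1 else 0)" if "i < n" "j < n" for i j
    using ef that unfolding O.eigenfamily_def by blast
  have Re: "R (e i) = \<mu> i *\<^sub>R e i" if "i < n" for i using ef that unfolding O.eigenfamily_def by blast
  have eR: "inner (e i) (R y) = \<mu> i*inner (e i) y" if "i < n" for i y
    using R_sym[of "e i" y] Re[OF that] by simp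
  \<comment> \<open>The spectral map belonging to the inverse of the operator shifted by
    \<open>s\<close>.\<close>
  define lam where "lam = (%i. 1/\<mu> i - s)"
  have eG: "(e i, lam i *\<^sub>R e i) \<in> G" if "i < n" for i
  proof -
    have "((1/\<mu> i) *\<^sub>R R (e i), (1/\<mu> i) *\<^sub>R (e i - s *\<^sub>R R (e i))) \<in> G" by (rule G_scale[OF R_graph])
    then show ?thesis using \<mu>0[OF that] by (simp add: Re[OF that] lam_def algebra_simps)
  qed
  have lam0: "0 <= lam i" if "i < n" for i
    using G_nonneg[OF eG[OF that]] orth[OF that that] by simp
  have lam\<delta>: "lam i <= \<delta>" if "i < n" for i
    using \<mu>q[OF that] \<mu>0[OF that] Es by (simp add: lam_def q_def field_simps)
  have gap: "inner f u >= E*(norm u)^2" if uf: "(u, f) \<in> G" and o: "\<forall>i<n. inner (e i) u = 0" for u f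
  proof -
    define y where "y = f + s *\<^sub>R u"
    have yu: "s*(norm u)^2 <= inner y u" using shifted_coercive(1)[OF uf] by (simp add: y_def)
    have "0 <= s*(norm u)^2" using s by simp
    then have "inner u y >= 0" using yu by (simp add: inner_commute)
    then have "inner u y*inner (R u) u <= inner u y*(r*(norm u)^2)" using gapR[OF o] by (rule mult_left_mono[rotated])
    then have "((norm u)^2)^2 <= inner u y*(r*(norm u)^2)"
      using CS[OF uf] unfolding y_def by linarith
    then have *: "(norm u)^2*(norm u)^2 <= (r*inner u y)*(norm u)^2" by (simp add: power2_eq_square mult_ac)
    have "(norm u)^2 <= r*inner u y"
      using mult_right_le_imp_le[OF *] by (cases "u = 0") auto
    then have "(E + s)*(norm u)^2 <= inner u y" using Es by (simp add: r_def field_simps)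
    then show ?thesis by (simp add: y_def inner_add_right dot_square_norm algebra_simps inner_commute)
  qed
  define P where "P = (%y. y - (\<Sum>i<n. inner (e i) y *\<^sub>R e i))"
  have eP: "inner (e i) (P y) = 0" if "i < n" for i y
    using that by (simp add: P_def inner_diff_right inner_sum_right orth if_distrib cong: if_cong)
  have P_id: "P y = y" if "\<forall>i<n. inner (e i) y = 0" for y using that by (simp add: P_def)
  have linP: "linear P"
    by (rule linearI) (auto simp: P_def algebra_simps inner_add_right sum.distrib scaleR_add_left scaleR_sum_right)
  have PP: "inner x y = inner x (P y)" if "\<forall>i<n. inner (e i) x = 0" for x y
    using that by (simp add: P_def inner_diff_right inner_sum_right inner_commute)
  have nP: "norm (P y) <= norm y" for y
  proof -
    have "(norm (P y))^2 = inner (P y) y" using PP[of "P y" y] eP by (simp add: power2_norm_eq_inner)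
    also have "\<dots> <= norm (P y)*norm y" by (rule norm_cauchy_schwarz)
    finally have "norm (P y)*norm (P y) <= norm y*norm (P y)" by (simp add: power2_eq_square mult_ac)
    then show ?thesis by (cases "norm (P y) = 0") (auto dest: mult_right_le_imp_le)
  qed
  \<comment> \<open>The resolvent restricted to the complement of the eigenvectors, extended by
    zero; its form is bounded by \<open>r\<close>.\<close>
  define R' where "R' = (%y. R (P y))"
  have eR': "\<forall>i<n. inner (e i) (R' y) = 0" for y by (simp add: R'_def eR eP)
  have linR': "linear R'" unfolding R'_def using linear_compose[OF linP R_linear] by (simp add: o_def)
  have R'form: "inner (R' x) y = inner (R (P x)) (P y)" for x y using PP[OF eR'] by (simp add: R'_def)
  have R'sym: "inner (R' x) y = inner (R' y) x" for x y
    unfolding R'form by (subst R_sym) (rule inner_commute)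
  have R'up: "inner (R' y) y <= r*(norm y)^2" for y
  proof -
    have "inner (R' y) y <= r*(norm (P y))^2" unfolding R'form using eP by (intro gapR) auto
    also have "\<dots> <= r*(norm y)^2" using nP[of y] Es by (intro mult_left_mono power_mono) auto
    finally show ?thesis .
  qed
  have R'nn: "inner (R' y) y >= 0" for y unfolding R'form by (rule R_nonneg)
  have R'bd: "norm (R' y) <= (1/s)*norm y" for y
    unfolding R'_def using R_bound[of "P y"] nP[of y] s by (smt (verit) mult_left_mono divide_pos_pos)
  \<comment> \<open>On the complement the equation at \<open>a + i b\<close> reads
    \<open>u = R' (P f + (\<alpha> + i b) u)\<close> with \<open>\<alpha> = a + s\<close>. In the
    quadratic form of \<open>S\<close> the \<open>b\<close>-terms cancel by symmetry, leaving
    coercivity \<open>1 - max \<alpha> 0*r\<close>, which is positive exactly because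
    \<open>a < E\<close>.\<close>
  have surj_perp: "\<exists>u1 g1 u2 g2. (u1, g1) \<in> G \<and> (u2, g2) \<in> G \<and> g1 - (a *\<^sub>R u1 - b *\<^sub>R u2) = P f1 \<and> g2 - (a *\<^sub>R u2 + b *\<^sub>R u1) = P f2"
    if aE: "a < E" for a b f1 f2
  proof -
    define \<alpha> where "\<alpha> = a + s"
    define S where "S = (%u. (fst u - R' (\<alpha> *\<^sub>R fst u - b *\<^sub>R snd u), snd u - R' (\<alpha> *\<^sub>R snd u + b *\<^sub>R fst u)))"
    define kp where "kp = 1 - max \<alpha> 0*r"
    define K where "K = 2 + 2*(1/s)*(\<bar>\<alpha>\<bar> + \<bar>b\<bar>)"
    have kp: "kp > 0" using aE Es by (auto simp: kp_def \<alpha>_def r_def max_def field_simps)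
    have "\<exists>u. S u = (R' (P f1), R' (P f2))"
    proof (rule coercive_surj[OF _ _ _ kp, of S K])
      show "linear S"
        by (rule linearI) (auto simp: S_def linear_add[OF linR'] linear_diff[OF linR'] linear_scale[OF linR'] algebra_simps)
    next
      fix u :: "'v \<times> 'v"
      have f: "norm (fst u) <= norm u" "norm (snd u) <= norm u" using norm_fst_le[of "fst u" "snd u"] norm_snd_le[of "snd u" "fst u"] by auto
      have ab: "norm (\<alpha> *\<^sub>R x + (c*b) *\<^sub>R y) <= (\<bar>\<alpha>\<bar> + \<bar>b\<bar>)*norm u"
        if "norm x <= norm u" "norm y <= norm u" "\<bar>c\<bar> = 1" for x y c
      proof -
        have "norm (\<alpha> *\<^sub>R x + (c*b) *\<^sub>R y) <= \<bar>\<alpha>\<bar>*norm x + \<bar>b\<bar>*norm y"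
          using norm_triangle_ineq[of "\<alpha> *\<^sub>R x" "(c*b) *\<^sub>R y"] that(3) by (simp add: abs_mult)
        also have "\<dots> <= \<bar>\<alpha>\<bar>*norm u + \<bar>b\<bar>*norm u" using that by (intro add_mono mult_left_mono) auto
        finally show ?thesis by (simp add: algebra_simps)
      qed
      have R'ab: "norm (R' (\<alpha> *\<^sub>R x + (c*b) *\<^sub>R y)) <= (1/s)*((\<bar>\<alpha>\<bar> + \<bar>b\<bar>)*norm u)"
        if "norm x <= norm u" "norm y <= norm u" "\<bar>c\<bar> = 1" for x y c
        using R'bd ab[OF that] s by (meson mult_left_mono order_trans divide_nonneg_pos zero_le_one)
      have "norm (S u) <= norm (fst u - R' (\<alpha> *\<^sub>R fst u - b *\<^sub>R snd u)) + norm (snd u - R' (\<alpha> *\<^sub>R snd u + b *\<^sub>R fst u))"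
        unfolding S_def by (rule norm_Pair_le)
      also have "\<dots> <= (norm (fst u) + norm (R' (\<alpha> *\<^sub>R fst u - b *\<^sub>R snd u))) + (norm (snd u) + norm (R' (\<alpha> *\<^sub>R snd u + b *\<^sub>R fst u)))"
        by (intro add_mono norm_triangle_ineq4)
      also have "\<dots> <= (norm u + (1/s)*((\<bar>\<alpha>\<bar> + \<bar>b\<bar>)*norm u)) + (norm u + (1/s)*((\<bar>\<alpha>\<bar> + \<bar>b\<bar>)*norm u))"
        using R'ab[OF f, of "-1"] R'ab[OF f(2,1), of 1] f by (intro add_mono) auto
      also have "\<dots> = K*norm u"
      proof -
        have "(x + i*(y*x)) + (x + i*(y*x)) = (2 + 2*i*y)*x" for x i y :: real by (simp add: algebra_simps)
        then show ?thesis unfolding K_def by blast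
      qed
      finally show "norm (S u) <= K*norm u" .
      have "inner (S u) u = (norm u)^2 - \<alpha>*(inner (R' (fst u)) (fst u) + inner (R' (snd u)) (snd u))"
        using R'sym[of "snd u" "fst u"]
        by (simp add: S_def inner_prod_def inner_diff_left inner_add_left linear_diff[OF linR'] linear_add[OF linR']
           linear_scale[OF linR'] norm_prod_def dot_square_norm algebra_simps)
      moreover have "\<alpha>*(inner (R' (fst u)) (fst u) + inner (R' (snd u)) (snd u))
           <= max \<alpha> 0*(inner (R' (fst u)) (fst u) + inner (R' (snd u)) (snd u))"
        using R'nn[of "fst u"] R'nn[of "snd u"] by (intro mult_right_mono) auto
      moreover have "max \<alpha> 0*(inner (R' (fst u)) (fst u) + inner (R' (snd u)) (snd u))
          <= max \<alpha> 0*(r*(norm (fst u))^2 + r*(norm (snd u))^2)"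
        using R'up[of "fst u"] R'up[of "snd u"] by (intro mult_left_mono add_mono) auto
      moreover have "max \<alpha> 0*(r*(norm (fst u))^2 + r*(norm (snd u))^2) = max \<alpha> 0*r*(norm u)^2"
        by (simp add: norm_prod_def distrib_left mult.assoc)
      ultimately have "inner (S u) u >= (norm u)^2 - max \<alpha> 0*r*(norm u)^2" by linarith
      then show "inner (S u) u >= kp*(norm u)^2" by (simp add: kp_def left_diff_distrib)
    qed
    then obtain u1 u2 where "S (u1, u2) = (R' (P f1), R' (P f2))" by auto
    then have u: "u1 = R' (P f1 + \<alpha> *\<^sub>R u1 - b *\<^sub>R u2)" "u2 = R' (P f2 + \<alpha> *\<^sub>R u2 + b *\<^sub>R u1)"
      by (auto simp: S_def linear_diff[OF linR'] linear_add[OF linR'] algebra_simps)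
    have o: "\<forall>i<n. inner (e i) u1 = 0" "\<forall>i<n. inner (e i) u2 = 0" using eR' u by metis+
    have "P (P f1 + \<alpha> *\<^sub>R u1 - b *\<^sub>R u2) = P f1 + \<alpha> *\<^sub>R u1 - b *\<^sub>R u2"
      "P (P f2 + \<alpha> *\<^sub>R u2 + b *\<^sub>R u1) = P f2 + \<alpha> *\<^sub>R u2 + b *\<^sub>R u1"
      using o eP by (auto intro!: P_id simp: inner_add_right inner_diff_right)
    then have "u1 = R (P f1 + \<alpha> *\<^sub>R u1 - b *\<^sub>R u2)" "u2 = R (P f2 + \<alpha> *\<^sub>R u2 + b *\<^sub>R u1)"
      using u by (auto simp: R'_def)
    then have "(u1, P f1 + \<alpha> *\<^sub>R u1 - b *\<^sub>R u2 - s *\<^sub>R u1) \<in> G" "(u2, P f2 + \<alpha> *\<^sub>R u2 + b *\<^sub>R u1 - s *\<^sub>R u2) \<in> G"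
      using R_graph by metis+
    moreover have "P f1 + \<alpha> *\<^sub>R u1 - b *\<^sub>R u2 - s *\<^sub>R u1 - (a *\<^sub>R u1 - b *\<^sub>R u2) = P f1"
      "P f2 + \<alpha> *\<^sub>R u2 + b *\<^sub>R u1 - s *\<^sub>R u2 - (a *\<^sub>R u2 + b *\<^sub>R u1) = P f2"
      by (simp_all add: \<alpha>_def algebra_simps)
    ultimately show ?thesis by blast
  qed
  have surj: "\<exists>u1 g1 u2 g2. (u1, g1) \<in> G \<and> (u2, g2) \<in> G \<and> g1 - (a *\<^sub>R u1 - b *\<^sub>R u2) = f1 \<and> g2 - (a *\<^sub>R u2 + b *\<^sub>R u1) = f2"
    if aE: "a < E" and ne: "\<forall>i<n. a \<noteq> lam i \<or> b \<noteq> 0" for a b f1 f2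
  proof -
    obtain u1 g1 u2 g2 where u: "(u1, g1) \<in> G" "(u2, g2) \<in> G" "g1 - (a *\<^sub>R u1 - b *\<^sub>R u2) = P f1" "g2 - (a *\<^sub>R u2 + b *\<^sub>R u1) = P f2"
      using surj_perp[OF aE] by metis
    \<comment> \<open>Along \<open>e i\<close> the equation is scalar: the coefficient is the
      complex datum divided by \<open>lam i - (a + i b)\<close>.\<close>
    define cc where "cc = (%i. Complex (inner (e i) f1) (inner (e i) f2)/(Complex (lam i - a) (- b)))"
    have cc: "(lam i - a) * Re (cc i) + b*Im (cc i) = inner (e i) f1 \<and> (lam i - a)*Im (cc i) - b * Re (cc i) = inner (e i) f2"
      if "i < n" for i
    proof -
      have nz: "Complex (lam i - a) (- b) \<noteq> 0" using ne that by (auto simp: complex_eq_iff)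
      then have *: "cc i*Complex (lam i - a) (- b) = Complex (inner (e i) f1) (inner (e i) f2)" by (simp add: cc_def)
      show ?thesis using arg_cong[OF *, of Re] arg_cong[OF *, of Im] by (simp add: algebra_simps)
    qed
    define v1 v2 w1 w2 where "v1 = (\<Sum>i<n. Re (cc i) *\<^sub>R e i)" and "v2 = (\<Sum>i<n. Im (cc i) *\<^sub>R e i)"
      and "w1 = (\<Sum>i<n. Re (cc i) *\<^sub>R lam i *\<^sub>R e i)" and "w2 = (\<Sum>i<n. Im (cc i) *\<^sub>R lam i *\<^sub>R e i)"
    have vG: "(v1, w1) \<in> G" "(v2, w2) \<in> G"
      unfolding v1_def w1_def v2_def w2_def by (intro G_sum G_scale eG; simp)+
    have "w1 - (a *\<^sub>R v1 - b *\<^sub>R v2) = (\<Sum>i<n. ((lam i - a) * Re (cc i) + b*Im (cc i)) *\<^sub>R e i)"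
      by (simp add: w1_def v1_def v2_def scaleR_sum_right sum_subtractf[symmetric] sum.distrib[symmetric] algebra_simps)
    also have "\<dots> = (\<Sum>i<n. inner (e i) f1 *\<^sub>R e i)" using cc by (intro sum.cong) auto
    finally have A1: "w1 - (a *\<^sub>R v1 - b *\<^sub>R v2) = (\<Sum>i<n. inner (e i) f1 *\<^sub>R e i)" .
    have "w2 - (a *\<^sub>R v2 + b *\<^sub>R v1) = (\<Sum>i<n. ((lam i - a)*Im (cc i) - b * Re (cc i)) *\<^sub>R e i)"
      by (simp add: w2_def v1_def v2_def scaleR_sum_right sum_subtractf[symmetric] sum.distrib[symmetric] algebra_simps)
    also have "\<dots> = (\<Sum>i<n. inner (e i) f2 *\<^sub>R e i)" using cc by (intro sum.cong) auto
    finally have A2: "w2 - (a *\<^sub>R v2 + b *\<^sub>R v1) = (\<Sum>i<n. inner (e i) f2 *\<^sub>R e i)" .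
    have "(g1 + w1) - (a *\<^sub>R (u1 + v1) - b *\<^sub>R (u2 + v2)) = (g1 - (a *\<^sub>R u1 - b *\<^sub>R u2)) + (w1 - (a *\<^sub>R v1 - b *\<^sub>R v2))"
      by (simp add: algebra_simps)
    then have B1: "(g1 + w1) - (a *\<^sub>R (u1 + v1) - b *\<^sub>R (u2 + v2)) = f1" unfolding u(3) A1 by (simp add: P_def)
    have "(g2 + w2) - (a *\<^sub>R (u2 + v2) + b *\<^sub>R (u1 + v1)) = (g2 - (a *\<^sub>R u2 + b *\<^sub>R u1)) + (w2 - (a *\<^sub>R v2 + b *\<^sub>R v1))"
      by (simp add: algebra_simps)
    then have B2: "(g2 + w2) - (a *\<^sub>R (u2 + v2) + b *\<^sub>R (u1 + v1)) = f2" unfolding u(4) A2 by (simp add: P_def)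
    show ?thesis using G_add[OF u(1) vG(1)] G_add[OF u(2) vG(2)] B1 B2 by blast
  qed
  show ?thesis by (rule that[OF orth eG lam0 lam\<delta> gap surj])
qed

end

section \<open>The real Hilbert space of square-integrable functions as a type\<close>

definition L2fun :: "('a::euclidean_space => real) => bool" where
  "L2fun f \<longleftrightarrow> f \<in> borel_measurable lebesgue \<and> integrable lebesgue (%x. (f x)^2)"

lemma L2fun_mult: "L2fun f ==> L2fun g ==> integrable lebesgue (%x. f x*g x)"
proof -
  assume f: "L2fun f" and g: "L2fun g"
  show ?thesis
  proof (rule Bochner_Integration.integrable_bound)
    show "integrable lebesgue (%x. (f x)^2 + (g x)^2)" using f g by (auto simp: L2fun_def)
    show "(%x. f x*g x) \<in> borel_measurable lebesgue" using f g by (auto simp: L2fun_def)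
    have "norm (f x*g x) <= norm ((f x)^2 + (g x)^2)" for x
    proof -
      have "0 <= (\<bar>f x\<bar> - \<bar>g x\<bar>)^2" by simp
      then have "2*(\<bar>f x\<bar>*\<bar>g x\<bar>) <= (f x)^2 + (g x)^2" by (simp add: power2_diff)
      moreover have "0 <= \<bar>f x\<bar>*\<bar>g x\<bar>" by simp
      ultimately have "\<bar>f x\<bar>*\<bar>g x\<bar> <= (f x)^2 + (g x)^2" by linarith
      then show ?thesis by (simp add: abs_mult)
    qed
    then show "AE x in lebesgue. norm (f x*g x) <= norm ((f x)^2 + (g x)^2)" by auto
  qed
qed

lemma L2fun_add: "L2fun f ==> L2fun g ==> L2fun (%x. f x + g x)"
  using L2fun_mult[of f g] by (auto simp: L2fun_def power2_sum mult.assoc)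

lemma L2fun_scale: "L2fun f ==> L2fun (%x. c*f x)"
  by (auto simp: L2fun_def power_mult_distrib)

lemma L2fun_diff: "L2fun f ==> L2fun g ==> L2fun (%x. f x - g x)"
  using L2fun_add[of f "%x. -1*g x"] L2fun_scale[of g "-1"] by simp

lemma L2fun_0: "L2fun (%x. 0)" by (simp add: L2fun_def)

definition L2eq :: "('a::euclidean_space => real) => ('a => real) => bool" where
  "L2eq f g \<longleftrightarrow> L2fun f \<and> L2fun g \<and> (AE x in lebesgue. f x = g x)"

\<comment> \<open>The abstract spectral lemmas are stated for a type of class
  \<open>real_inner\<close> and \<open>complete_space\<close>; a partial quotient identifies
  functions almost everywhere and discards those that are not square integrable.\<close>
quotient_type (overloaded) 'a rl2 = "'a::euclidean_space => real" / partial: L2eq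
proof (rule part_equivpI)
  show "\<exists>x::'a => real. L2eq x x" by (rule exI[of _ "%x. 0"]) (simp add: L2eq_def L2fun_0)
  show "symp (L2eq :: ('a => real) => _)" by (auto simp: symp_def L2eq_def)
  show "transp (L2eq :: ('a => real) => _)" by (auto simp: transp_def L2eq_def)
qed

instantiation rl2 :: (euclidean_space) real_vector
begin

lift_definition zero_rl2 :: "'a rl2" is "%x. 0" by (simp add: L2eq_def L2fun_0)
lift_definition plus_rl2 :: "'a rl2 => 'a rl2 => 'a rl2" is "%f g x. f x + g x"
  by (auto simp: L2eq_def L2fun_add)
lift_definition minus_rl2 :: "'a rl2 => 'a rl2 => 'a rl2" is "%f g x. f x - g x"
  by (auto simp: L2eq_def L2fun_diff)
lift_definition uminus_rl2 :: "'a rl2 => 'a rl2" is "%f x. - f x"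
  using L2fun_scale[of _ "-1"] by (auto simp: L2eq_def)
lift_definition scaleR_rl2 :: "real => 'a rl2 => 'a rl2" is "%c f x. c*f x"
  by (auto simp: L2eq_def L2fun_scale)
instance
proof
  fix a b c :: "'a rl2" and r s :: real
  show "a + b + c = a + (b + c)" by transfer (auto simp: L2eq_def L2fun_add)
  show "a + b = b + a" by transfer (auto simp: L2eq_def L2fun_add add.commute)
  show "0 + a = a" by transfer (auto simp: L2eq_def)
  show "- a + a = 0" by transfer (auto simp: L2eq_def L2fun_0)
  show "a - b = a + - b" by transfer (auto simp: L2eq_def L2fun_diff)
  show "r *\<^sub>R (a + b) = r *\<^sub>R a + r *\<^sub>R b"
    by transfer (auto simp: L2eq_def distrib_left intro: L2fun_add L2fun_scale)
  show "(r + s) *\<^sub>R a = r *\<^sub>R a + s *\<^sub>R a"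
    by transfer (auto simp: L2eq_def distrib_right intro: L2fun_add L2fun_scale)
  show "r *\<^sub>R s *\<^sub>R a = (r * s) *\<^sub>R a" by transfer (auto simp: L2eq_def mult.assoc intro: L2fun_scale)
  show "1 *\<^sub>R a = a" by transfer (auto simp: L2eq_def)
qed

end

instantiation rl2 :: (euclidean_space) real_inner
begin

lift_definition inner_rl2 :: "'a rl2 => 'a rl2 => real" is "%f g. \<integral>x. f x*g x \<partial>lebesgue"
proof -
  fix f f' g g' :: "'a => real" assume a: "L2eq f f'" "L2eq g g'"
  show "(\<integral>x. f x*g x \<partial>lebesgue) = (\<integral>x. f' x*g' x \<partial>lebesgue)"
  proof (rule integral_cong_AE)
    show "AE x in lebesgue. f x*g x = f' x*g' x" using a by (auto simp: L2eq_def)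
  qed (use a in \<open>auto simp: L2eq_def L2fun_def\<close>)
qed
definition "norm_rl2 (f::'a rl2) = sqrt (inner f f)"
definition "dist_rl2 (f::'a rl2) g = norm (f - g)"
definition "sgn_rl2 (f::'a rl2) = f /\<^sub>R norm f"
definition "uniformity_rl2 = (INF e\<in>{0 <..}. principal {(x::'a rl2, y). dist x y < e})"
definition "open_rl2 (U::'a rl2 set) = (\<forall>x\<in>U. eventually (%(x', y). x' = x --> y \<in> U) uniformity)"

instance
proof
  fix a b c :: "'a rl2" and r :: real
  show "inner a b = inner b a" by transfer (simp add: mult.commute)
  show "inner (a + b) c = inner a c + inner b c"
  proof transfer
    fix a b c :: "'a => real" assume a: "L2eq a a" "L2eq b b" "L2eq c c"
    then have i: "integrable lebesgue (%x. a x*c x)" "integrable lebesgue (%x. b x*c x)" by (auto simp: L2eq_def L2fun_mult)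
    show "(\<integral>x. (a x + b x)*c x \<partial>lebesgue) = (\<integral>x. a x*c x \<partial>lebesgue) + (\<integral>x. b x*c x \<partial>lebesgue)"
      unfolding distrib_right by (rule Bochner_Integration.integral_add[OF i])
  qed
  show "inner (r *\<^sub>R a) b = r*inner a b" by transfer (simp add: mult.assoc)
  show "0 <= inner a a" by transfer simp
  show "(inner a a = 0) = (a = 0)"
  proof transfer
    fix a :: "'a => real" assume a: "L2eq a a"
    then have i: "integrable lebesgue (%x. a x*a x)" by (auto simp: L2eq_def L2fun_mult)
    have "(\<integral>x. a x*a x \<partial>lebesgue) = 0 \<longleftrightarrow> (AE x in lebesgue. a x*a x = 0)"
      by (rule integral_nonneg_eq_0_iff_AE[OF i]) simp
    then show "((\<integral>x. a x*a x \<partial>lebesgue) = 0) = L2eq a (%x. 0)"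
      using a by (auto simp: L2eq_def L2fun_0)
  qed
  show "norm a = sqrt (inner a a)" by (simp add: norm_rl2_def)
  show "dist a b = norm (a - b)" by (simp add: dist_rl2_def)
  show "sgn a = a /\<^sub>R norm a" by (simp add: sgn_rl2_def)
  show "uniformity = (INF e\<in>{0 <..}. principal {(x::'a rl2, y). dist x y < e})" by (simp add: uniformity_rl2_def)
  fix U :: "'a rl2 set"
  show "open U = (\<forall>x\<in>U. eventually (%(x', y). x' = x --> y \<in> U) uniformity)" by (simp add: open_rl2_def)
qed

end

lemma inner_abs_rl2:
  "L2fun f ==> L2fun g ==> inner (abs_rl2 f) (abs_rl2 g) = (\<integral>x. f x*g x \<partial>lebesgue)"
  by (rule inner_rl2.abs_eq) (auto simp: L2eq_def)

lemma norm_abs_rl2: "L2fun f ==> norm (abs_rl2 f) = sqrt (\<integral>x. (f x)^2 \<partial>lebesgue)"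
  by (simp add: norm_rl2_def inner_abs_rl2 power2_eq_square)

lemma abs_rl2_add: "L2fun f ==> L2fun g ==> abs_rl2 f + abs_rl2 g = abs_rl2 (%x. f x + g x)"
  by (rule plus_rl2.abs_eq) (auto simp: L2eq_def)

lemma abs_rl2_diff: "L2fun f ==> L2fun g ==> abs_rl2 f - abs_rl2 g = abs_rl2 (%x. f x - g x)"
  by (rule minus_rl2.abs_eq) (auto simp: L2eq_def)

lemma abs_rl2_scale: "L2fun f ==> c *\<^sub>R abs_rl2 f = abs_rl2 (%x. c*f x)"
  by (rule scaleR_rl2.abs_eq) (auto simp: L2eq_def)

lemma rl2_cases:
  obtains f where "L2fun f" "a = abs_rl2 f"
  using Quotient3_rl2 by (metis L2eq_def Quotient3_abs_rep Quotient3_rep_reflp)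

lemma abs_rl2_eq_iff: "L2fun f ==> L2fun g ==> abs_rl2 f = abs_rl2 g \<longleftrightarrow> (AE x in lebesgue. f x = g x)"
  using Quotient3_rel[OF Quotient3_rl2, of f g] by (auto simp: L2eq_def)

lemma abs_rl2_sum:
  assumes "finite I" "\<And>i. i \<in> I ==> L2fun (f i)"
  shows "L2fun (%x. \<Sum>i\<in>I. f i x)" "(\<Sum>i\<in>I. abs_rl2 (f i)) = abs_rl2 (%x. \<Sum>i\<in>I. f i x)"
proof -
  have "L2fun (%x. \<Sum>i\<in>I. f i x) \<and> (\<Sum>i\<in>I. abs_rl2 (f i)) = abs_rl2 (%x. \<Sum>i\<in>I. f i x)"
    using assms
  proof (induction I rule: finite_induct)
    case empty
    then show ?case by (simp add: L2fun_0 zero_rl2.abs_eq)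
  next
    case (insert i I)
    then show ?case by (simp add: L2fun_add abs_rl2_add)
  qed
  then show "L2fun (%x. \<Sum>i\<in>I. f i x)" "(\<Sum>i\<in>I. abs_rl2 (f i)) = abs_rl2 (%x. \<Sum>i\<in>I. f i x)" by auto
qed

text \<open>Riesz--Fischer: a rapidly Cauchy subsequence is dominated pointwise almost everywhere.\<close>

instance rl2 :: (euclidean_space) complete_space
proof
  fix X :: "nat => 'a rl2" assume C: "Cauchy X"
  have "\<exists>N. \<forall>m\<ge>N. \<forall>n\<ge>N. dist (X m) (X n) < (1/2)^k" for k :: nat
    using metric_CauchyD[OF C, of "(1/2)^k"] by auto
  then obtain N where N: "\<And>k m n. m >= N k ==> n >= N k ==> dist (X m) (X n) < (1/2)^k" by metis
  define sg where "sg = rec_nat (N 0) (%k p. Suc (max p (N (Suc k))))"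
  have sSuc: "sg (Suc k) = Suc (max (sg k) (N (Suc k)))" for k by (simp add: sg_def)
  have sgmono: "strict_mono sg" by (rule strict_monoI_Suc) (simp add: sSuc)
  have sgN: "sg k >= N k" for k by (cases k) (auto simp: sSuc, simp add: sg_def)
  have step: "dist (X (sg (Suc k))) (X (sg k)) < (1/2)^k" for k
    using sgN[of k] strict_monoD[OF sgmono, of k "Suc k"] by (intro N) auto
  have "\<exists>f. L2fun f \<and> X (sg k) = abs_rl2 f" for k using rl2_cases[of "X (sg k)"] by metis
  then obtain f where f: "\<And>k. L2fun (f k)" "\<And>k. X (sg k) = abs_rl2 (f k)" by metis
  have fm[measurable]: "f k \<in> borel_measurable lebesgue" for k using f by (simp add: L2fun_def)
  define D where "D = (%k x. \<bar>f (Suc k) x - f k x\<bar>)"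
  define S where "S = (%n x. \<Sum>k<n. D k x)"
  have L2D: "L2fun (D k)" for k
    using L2fun_diff[OF f(1)[of "Suc k"] f(1)[of k]] by (auto simp: D_def L2fun_def)
  have nD: "norm (abs_rl2 (D k)) < (1/2)^k" for k
    using step[of k] L2fun_diff[OF f(1)[of "Suc k"] f(1)[of k]]
    by (simp add: dist_norm f abs_rl2_diff norm_abs_rl2 L2D) (simp add: D_def)
  have L2S: "L2fun (S n)" "norm (abs_rl2 (S n)) <= 2" for n
  proof -
    show "L2fun (S n)" unfolding S_def by (rule abs_rl2_sum) (auto simp: L2D)
    have "norm (abs_rl2 (S n)) <= (\<Sum>k<n. norm (abs_rl2 (D k)))"
      unfolding S_def abs_rl2_sum(2)[OF finite_lessThan, of n D, OF L2D, symmetric] by (rule norm_sum)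
    also have "\<dots> <= (\<Sum>k<n. (1/2)^k)" using nD by (intro sum_mono) (simp add: less_imp_le)
    also have "\<dots> <= 2" by (simp add: geometric_sum)
    finally show "norm (abs_rl2 (S n)) <= 2" .
  qed
  have intS: "(\<integral>x. (S n x)^2 \<partial>lebesgue) <= 4" for n
    using L2S(2)[of n] real_sqrt_le_iff[of _ 4] by (simp add: norm_abs_rl2[OF L2S(1)])
  have S0: "0 <= S n x" for n x by (auto simp: S_def D_def intro: sum_nonneg)
  have Sinc: "S n x <= S (Suc n) x" for n x by (simp add: S_def D_def)
  have nnS: "(\<integral>\<^sup>+x. ennreal ((S n x)^2) \<partial>lebesgue) <= 4" for n
    using intS[of n] L2S(1)[of n] by (subst nn_integral_eq_integral) (auto simp: L2fun_def intro: ennreal_leI[of _ 4, simplified])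
  have Sm[measurable]: "S n \<in> borel_measurable lebesgue" for n using L2S(1)[of n] by (simp add: L2fun_def)
  have "(\<integral>\<^sup>+x. (SUP n. ennreal ((S n x)^2)) \<partial>lebesgue) = (SUP n. \<integral>\<^sup>+x. ennreal ((S n x)^2) \<partial>lebesgue)"
    by (rule nn_integral_monotone_convergence_SUP)
      (auto simp: incseq_Suc_iff le_fun_def intro!: ennreal_leI power_mono Sinc S0)
  also have "\<dots> <= 4" by (rule SUP_least) (rule nnS)
  finally have sup4: "(\<integral>\<^sup>+x. (SUP n. ennreal ((S n x)^2)) \<partial>lebesgue) <= 4" .
  then have "AE x in lebesgue. (SUP n. ennreal ((S n x)^2)) \<noteq> \<infinity>"
    by (intro nn_integral_PInf_AE) (auto simp: top_unique)
  then have AEb: "AE x in lebesgue. \<exists>B. \<forall>n. S n x <= B"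
  proof eventually_elim
    case (elim x)
    then obtain b where b: "b >= 0" "(SUP n. ennreal ((S n x)^2)) = ennreal b" by (cases "(SUP n. ennreal ((S n x)^2))") auto
    have "S n x <= sqrt b" for n
    proof -
      have "ennreal ((S n x)^2) <= ennreal b" unfolding b(2)[symmetric] by (rule SUP_upper) simp
      then show ?thesis using b by (simp add: real_le_rsqrt)
    qed
    then show ?case by blast
  qed
  have conv: "summable (%k. D k x)" if "\<forall>n. S n x <= B" for x B
  proof (rule bounded_imp_summable[where B=B])
    show "sum (%k. D k x) {..n} <= B" for n
      using that[rule_format, of "Suc n"] by (simp only: S_def lessThan_Suc_atMost)
  qed (simp add: D_def)
  \<comment> \<open>Defined everywhere as a series, hence measurable; it is the pointwise limit only
    where the increments are summable, which is almost everywhere.\<close>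
  define g where "g = (%x. suminf (%k. f (Suc k) x - f k x) + f 0 x)"
  define B where "B = (%x. suminf (%k. D k x))"
  have tele: "(\<Sum>k<n. f (Suc k) x - f k x) = f n x - f 0 x" for n x by (induction n) auto
  have lim: "(%n. f n x) \<longlonglongrightarrow> g x" and bnd: "\<bar>f n x - g x\<bar> <= 2*B x" and SB: "(%n. S n x) \<longlonglongrightarrow> B x"
    if "\<forall>n. S n x <= b" for x b n
  proof -
    have sD: "summable (%k. D k x)" using conv[OF that] .
    then have sf: "summable (%k. f (Suc k) x - f k x)" unfolding D_def by (rule summable_rabs_cancel)
    from summable_LIMSEQ[OF sf] have "(%n. f n x - f 0 x + f 0 x) \<longlonglongrightarrow> suminf (%k. f (Suc k) x - f k x) + f 0 x"
      unfolding tele by (intro tendsto_intros)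
    then show 1: "(%n. f n x) \<longlonglongrightarrow> g x" by (simp add: g_def)
    show "(%n. S n x) \<longlonglongrightarrow> B x" unfolding S_def B_def by (rule summable_LIMSEQ[OF sD])
    have SleB: "S n x <= B x" for n unfolding S_def B_def using sD by (intro sum_le_suminf) (auto simp: D_def)
    have le: "\<bar>f n x - f 0 x\<bar> <= B x" for n
      using SleB[of n] sum_abs[of "%k. f (Suc k) x - f k x" "{..<n}"] by (simp add: tele S_def D_def)
    have "\<bar>g x - f 0 x\<bar> <= B x"
      by (rule LIMSEQ_le_const2[OF tendsto_rabs[OF tendsto_diff[OF 1 tendsto_const]]]) (use le in auto)
    then show "\<bar>f n x - g x\<bar> <= 2*B x" using le[of n] by linarith
  qed
  have Dm[measurable]: "D k \<in> borel_measurable lebesgue" for k using L2D by (simp add: L2fun_def)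
  have gm[measurable]: "g \<in> borel_measurable lebesgue" unfolding g_def by measurable
  have Bm[measurable]: "B \<in> borel_measurable lebesgue" unfolding B_def by measurable
  have "(\<integral>\<^sup>+x. ennreal ((B x)^2) \<partial>lebesgue) <= (\<integral>\<^sup>+x. (SUP n. ennreal ((S n x)^2)) \<partial>lebesgue)"
  proof (rule nn_integral_mono_AE)
    show "AE x in lebesgue. ennreal ((B x)^2) <= (SUP n. ennreal ((S n x)^2))"
      using AEb
    proof eventually_elim
      case (elim x)
      then obtain b where "\<forall>n. S n x <= b" by blast
      from SB[OF this] have "(%n. ennreal ((S n x)^2)) \<longlonglongrightarrow> ennreal ((B x)^2)" by (intro tendsto_intros)
      then show ?case by (rule LIMSEQ_le_const2) (intro exI allI impI SUP_upper UNIV_I)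
    qed
  qed
  then have "(\<integral>\<^sup>+x. ennreal ((B x)^2) \<partial>lebesgue) < \<infinity>" using sup4 by (auto intro: le_less_trans simp: less_top[symmetric] top_unique)
  then have Bint: "integrable lebesgue (%x. (B x)^2)" by (intro integrableI_bounded) auto
  have L2g: "L2fun (%x. g x - f 0 x)"
    unfolding L2fun_def
  proof
    show "integrable lebesgue (%x. (g x - f 0 x)^2)"
    proof (rule Bochner_Integration.integrable_bound)
      show "integrable lebesgue (%x. 4*(B x)^2)" using Bint by simp
      show "AE x in lebesgue. norm ((g x - f 0 x)^2) <= norm (4*(B x)^2)"
        using AEb
      proof eventually_elim
        case (elim x)
        then obtain b where "\<forall>n. S n x <= b" by blast
        from power_mono[OF bnd[OF this, of 0], of 2] have "(f 0 x - g x)^2 <= (2*B x)^2" by (simp only: power2_abs abs_ge_zero)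
        then show ?case by (simp add: power2_commute power_mult_distrib)
      qed
    qed auto
  qed auto
  then have L2g: "L2fun g" using L2fun_add[OF L2g f(1)[of 0]] by simp
  have "(%n. \<integral>x. (f n x - g x)^2 \<partial>lebesgue) \<longlonglongrightarrow> (\<integral>x. 0 \<partial>(lebesgue :: 'a measure))"
  proof (rule integral_dominated_convergence[where w="%x. 4*(B x)^2"])
    show "integrable lebesgue (%x. 4*(B x)^2)" using Bint by simp
    show "AE x in lebesgue. (%n. (f n x - g x)^2) \<longlonglongrightarrow> 0"
      using AEb
    proof eventually_elim
      case (elim x)
      then obtain b where "\<forall>n. S n x <= b" by blast
      from lim[OF this] have "(%n. (f n x - g x)^2) \<longlonglongrightarrow> (g x - g x)\<^sup>2" by (intro tendsto_intros)
      then show ?case by simp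
    qed
    show "AE x in lebesgue. norm ((f n x - g x)^2) <= 4*(B x)^2" for n
      using AEb
    proof eventually_elim
      case (elim x)
      then obtain b where "\<forall>n. S n x <= b" by blast
      from power_mono[OF bnd[OF this, of n], of 2] have "(f n x - g x)^2 <= (2*B x)^2" by (simp only: power2_abs abs_ge_zero)
      then show ?case by (simp add: power_mult_distrib)
    qed
  qed auto
  then have "(%n. sqrt (\<integral>x. (f n x - g x)^2 \<partial>lebesgue)) \<longlonglongrightarrow> sqrt 0" by (intro tendsto_intros) simp
  moreover have "dist (X (sg n)) (abs_rl2 g) = sqrt (\<integral>x. (f n x - g x)^2 \<partial>lebesgue)" for n
    by (simp add: dist_norm f L2g abs_rl2_diff norm_abs_rl2 L2fun_diff)
  ultimately have "(%n. dist (X (sg n)) (abs_rl2 g)) \<longlonglongrightarrow> 0" by simp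
  then have "(X \<circ> sg) \<longlonglongrightarrow> abs_rl2 g" using tendsto_dist_iff[of "X \<circ> sg"] by (simp add: o_def)
  then have "X \<longlonglongrightarrow> abs_rl2 g" using Cauchy_converges_subseq[OF C sgmono] by (auto simp: o_def)
  then show "convergent X" by (auto simp: convergent_def)
qed

section \<open>Calculus of partial derivatives and of the classes
  \<open>Ck_on UNIV k\<close>\<close>

lemma pd_eqI: "(f has_derivative f') (at x) ==> pd b f x = f' b"
  using frechet_derivative_at by (fastforce simp: pd_def)

lemma pd_cong_eventually:
  assumes "eventually (%y. f y = g y) (nhds x)"
  shows "pd b f x = pd b g x"
proof -
  obtain S where S: "open S" "x \<in> S" "\<And>y. y \<in> S ==> f y = g y" using assms by (auto simp: eventually_nhds)
  have "(f has_derivative D) (at x) \<longleftrightarrow> (g has_derivative D) (at x)" for D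
    using has_derivative_transform_within_open[OF _ S(1,2), of f D UNIV g]
      has_derivative_transform_within_open[OF _ S(1,2), of g D UNIV f] S(3) by auto
  then show ?thesis by (simp add: pd_def frechet_derivative_def)
qed

lemma has_derivative_pd: "f differentiable (at x) ==> (f has_derivative (%v. pd v f x)) (at x)"
  by (simp add: pd_def frechet_derivative_works[symmetric])

lemma pd_linear_expand:
  fixes f :: "'a::euclidean_space => 'b::real_normed_vector"
  assumes "f differentiable (at x)"
  shows "pd v f x = (\<Sum>b\<in>Basis. (v \<bullet> b) *\<^sub>R pd b f x)"
proof -
  have lin: "linear (%v. pd v f x)" using has_derivative_pd[OF assms] by (rule has_derivative_linear)
  have "pd v f x = pd (\<Sum>b\<in>Basis. (v \<bullet> b) *\<^sub>R b) f x" by (simp add: euclidean_representation)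
  then show ?thesis by (simp add: linear_sum[OF lin] linear_scale[OF lin])
qed

lemma pd_add: "f differentiable (at x) ==> g differentiable (at x) ==> pd b (%x. f x + g x) x = pd b f x + pd b g x"
  using pd_eqI[OF has_derivative_add[OF has_derivative_pd has_derivative_pd]] by blast

lemma pd_mult:
  fixes f g :: "'a::euclidean_space => real"
  shows "f differentiable (at x) ==> g differentiable (at x) ==> pd b (%x. f x*g x) x = f x*pd b g x + pd b f x*g x"
  using pd_eqI[OF has_derivative_mult[OF has_derivative_pd has_derivative_pd]] by blast

lemma pd_const [simp]: "pd b (%x. c) x = 0"
  by (rule pd_eqI) (rule has_derivative_const)

lemma pd_bounded_linear: "bounded_linear L ==> f differentiable (at x) ==> pd b (%x. L (f x)) x = L (pd b f x)"
  using pd_eqI[OF bounded_linear.has_derivative[OF _ has_derivative_pd]] by blast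

lemma pd_compose_real:
  fixes f :: "'a::euclidean_space => real" and g :: "real => real"
  assumes "f differentiable (at x)" "(g has_real_derivative g') (at (f x))"
  shows "pd b (%x. g (f x)) x = g'*pd b f x"
proof -
  have "((%x. g (f x)) has_derivative (%v. g'*pd v f x)) (at x)"
    using has_derivative_compose[OF has_derivative_pd[OF assms(1)] assms(2)[unfolded has_field_derivative_def]] by simp
  then show ?thesis by (rule pd_eqI)
qed

lemma Ck_Suc_D: "Ck_on UNIV (Suc k) f ==> Ck_on UNIV k f"
proof (induction k arbitrary: f)
  case 0
  then show ?case by (auto simp: continuous_on_eq_continuous_at intro: differentiable_imp_continuous_within)
next
  case (Suc k)
  then show ?case by simp
qed

lemma Ck_pd: "Ck_on UNIV (Suc k) f ==> b \<in> Basis ==> Ck_on UNIV k (pd b f)" by simp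

lemma Ck_continuous: "Ck_on UNIV k f ==> continuous_on UNIV f"
proof (induction k)
  case (Suc k)
  then show ?case using Ck_Suc_D by blast
qed simp

lemma Ck_const: "Ck_on UNIV k (%x. c)"
proof (induction k arbitrary: c)
  case (Suc k)
  have "pd b (%x::'a. c) = (%x. 0)" for b by (rule ext) simp
  then show ?case using Suc by simp
qed simp

lemma Ck_add: "Ck_on UNIV k f ==> Ck_on UNIV k g ==> Ck_on UNIV k (%x. f x + g x)"
proof (induction k arbitrary: f g)
  case (Suc k)
  have "pd b (%x. f x + g x) = (%x. pd b f x + pd b g x)" for b using Suc.prems by (auto simp: pd_add)
  then show ?case using Suc by auto
qed (auto intro: continuous_intros)

lemma Ck_mult:
  fixes f g :: "'a::euclidean_space => real"
  shows "Ck_on UNIV k f ==> Ck_on UNIV k g ==> Ck_on UNIV k (%x. f x*g x)"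
proof (induction k arbitrary: f g)
  case (Suc k)
  have "pd b (%x. f x*g x) = (%x. f x*pd b g x + pd b f x*g x)" for b using Suc.prems by (auto simp: pd_mult)
  moreover have "Ck_on UNIV k (%x. f x*pd b g x + pd b f x*g x)" if "b \<in> Basis" for b
    using that Suc.prems Ck_Suc_D[OF Suc.prems(1)] Ck_Suc_D[OF Suc.prems(2)] by (intro Ck_add Suc.IH) auto
  ultimately show ?case using Suc.prems by auto
qed (auto intro: continuous_intros)

lemma Ck_bounded_linear: "bounded_linear L ==> Ck_on UNIV k f ==> Ck_on UNIV k (%x. L (f x))"
proof (induction k arbitrary: f)
  case (Suc k)
  have "pd b (%x. L (f x)) = (%x. L (pd b f x))" for b using Suc.prems by (auto simp: pd_bounded_linear)
  moreover have "(%x. L (f x)) differentiable (at x)" for x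
    using bounded_linear.has_derivative[OF Suc.prems(1) has_derivative_pd[of f x]] Suc.prems(2)
    by (auto simp: differentiable_def)
  ultimately show ?case using Suc by auto
qed (auto intro: bounded_linear.continuous_on)

lemma Ck_diff: "Ck_on UNIV k f ==> Ck_on UNIV k g ==> Ck_on UNIV k (%x. f x - g x)"
  using Ck_add[OF _ Ck_bounded_linear[OF bounded_linear_minus[OF bounded_linear_ident]], of k f g] by simp

lemma Ck_sum: "finite I ==> (\<And>i. i \<in> I ==> Ck_on UNIV k (f i)) ==> Ck_on UNIV k (%x. \<Sum>i\<in>I. f i x)"
  by (induction I rule: finite_induct) (auto intro: Ck_add Ck_const)

lemma Ck_ident_linear: "bounded_linear L ==> Ck_on UNIV k L"
proof (cases k)
  case (Suc m)
  assume L: "bounded_linear L"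
  have "pd b L = (%x. L b)" for b
    by (rule ext) (rule pd_eqI, rule bounded_linear_imp_has_derivative[OF L])
  then show ?thesis using Suc L Ck_const by (auto intro: bounded_linear_imp_differentiable)
qed (auto intro: bounded_linear.continuous_on continuous_intros)

lemma Ck_inner: "Ck_on UNIV k (%x. x \<bullet> b)"
  by (rule Ck_ident_linear) (rule bounded_linear_inner_left)

lemma Ck_compose_real:
  fixes f :: "'a::euclidean_space => real" and g :: "real => real"
  shows "Ck_on UNIV k g ==> Ck_on UNIV k f ==> Ck_on UNIV k (%x. g (f x))"
proof (induction k arbitrary: f g)
  case 0
  then show ?case using continuous_on_compose2[of UNIV g UNIV f] by auto
next
  case (Suc k)
  \<comment> \<open>The only basis vector of the reals is 1, so \<open>pd 1 g\<close> is the
    ordinary derivative.\<close>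
  have dg: "(g has_real_derivative pd 1 g y) (at y)" for y
  proof -
    have "g differentiable (at y)" using Suc.prems by simp
    then have 1: "(g has_derivative (%v. pd v g y)) (at y)" by (rule has_derivative_pd)
    have "(%v. pd v g y) = (*) (pd 1 g y)"
    proof
      fix v show "pd v g y = pd 1 g y * v"
        using linear_scale[OF has_derivative_linear[OF 1], of v 1] by (simp add: mult.commute)
    qed
    then show ?thesis using 1 by (simp only: has_field_derivative_def)
  qed
  have "pd b (%x. g (f x)) = (%x. pd 1 g (f x)*pd b f x)" for b
  proof
    fix x
    have "f differentiable (at x)" using Suc.prems by simp
    from pd_compose_real[OF this dg] show "pd b (%x. g (f x)) x = pd 1 g (f x)*pd b f x" .
  qed
  moreover have "Ck_on UNIV k (%x. pd 1 g (f x)*pd b f x)" if "b \<in> Basis" for b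
    using that Suc.prems by (intro Ck_mult Suc.IH[of "pd 1 g" f] Ck_Suc_D[OF Suc.prems(2)]) auto
  moreover have "(%x. g (f x)) differentiable (at x)" for x
    using differentiable_compose[of g f x UNIV] Suc.prems by auto
  ultimately show ?case by auto
qed

lemma Ck_inverse:
  fixes f :: "'a::euclidean_space => real"
  assumes "\<And>x. f x \<noteq> 0"
  shows "Ck_on UNIV k f ==> Ck_on UNIV k (%x. inverse (f x))"
proof (induction k)
  case 0
  then show ?case using assms by (auto intro: continuous_on_inverse)
next
  case (Suc k)
  have "pd b (%x. inverse (f x)) = (%x. (-1)*(inverse (f x)*pd b f x*inverse (f x)))" for b
  proof
    fix x
    have "f differentiable (at x)" using Suc.prems by simp
    from Deriv.has_derivative_inverse[OF assms has_derivative_pd[OF this]]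
    show "pd b (%x. inverse (f x)) x = (-1)*(inverse (f x)*pd b f x*inverse (f x))"
      by (rule pd_eqI[THEN trans]) simp
  qed
  moreover have "Ck_on UNIV k (%x. (-1)*(inverse (f x)*pd b f x*inverse (f x)))" if "b \<in> Basis" for b
    using that Suc.prems Ck_Suc_D[OF Suc.prems] by (intro Ck_mult Ck_const Suc.IH) auto
  moreover have "(%x. inverse (f x)) differentiable (at x)" for x
    using Suc.prems assms by (intro differentiable_inverse) auto
  ultimately show ?case by auto
qed

section \<open>Smooth steps and cutoffs\<close>

text \<open>The powers of \<open>s\<close> in the denominator make the family closed under
  differentiation up to linear combinations, so smoothness at every order is a single
  induction.\<close>

definition theta :: "nat => real => real" where
  "theta n s = (if s > 0 then exp (- 1/s)/s^n else 0)"

text \<open>One term of the exponential series at \<open>1/s\<close>. The bound gives the derivative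
  at 0, and later compares \<open>exp (- c/h)\<close> with powers of \<open>h\<close>.\<close>

lemma theta_le: "\<bar>theta n s\<bar> <= fact (n + 1)*\<bar>s\<bar>"
proof (cases "s > 0")
  case True
  define x where "x = 1/s"
  have x: "x > 0" using True by (simp add: x_def)
  have "x^(n + 1) /\<^sub>R fact (n + 1) <= exp x"
  proof -
    have "(\<Sum>k\<in>{n+1}. x^k /\<^sub>R fact k) <= (\<Sum>k. x^k /\<^sub>R fact k)"
      using x by (intro sum_le_suminf summable_exp_generic) auto
    then show ?thesis by (simp add: exp_def)
  qed
  then have "x^(n + 1) <= fact (n + 1)*exp x" by (simp add: field_simps del: fact_Suc)
  then have "x^(n + 1)*exp (- x) <= fact (n + 1)*exp x*exp (- x)" by (intro mult_right_mono) auto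
  then have "x^(n + 1)*exp (- x) <= fact (n + 1)"
    by (simp only: mult.assoc exp_minus_inverse mult_1_right)
  moreover have "theta n s = x^(n + 1)*exp (- x) * s" using True by (simp add: theta_def x_def field_simps)
  ultimately show ?thesis using True x by (simp add: abs_mult mult_right_mono del: fact_Suc)
qed (simp add: theta_def mult_le_0_iff del: fact_Suc)

lemma theta_deriv: "(theta n has_real_derivative theta (n + 2) s - real n*theta (n + 1) s) (at s)"
proof -
  consider "s > 0" | "s < 0" | "s = 0" by linarith
  then show ?thesis
  proof cases
    case 1
    have "((%s. exp (- 1/s)/s^n) has_real_derivative theta (n + 2) s - real n*theta (n + 1) s) (at s)"
      using 1 by (auto intro!: derivative_eq_intros simp: theta_def)
         (cases n; simp add: field_simps power2_eq_square)
    then show ?thesis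
      by (rule has_field_derivative_transform_within_open[of _ _ _ "{0<..}"]) (use 1 in \<open>auto simp: theta_def\<close>)
  next
    case 2
    have "((%s. 0) has_real_derivative theta (n + 2) s - real n*theta (n + 1) s) (at s)"
      using 2 by (auto simp: theta_def)
    then show ?thesis
      by (rule has_field_derivative_transform_within_open[of _ _ _ "{..<0}"]) (use 2 in \<open>auto simp: theta_def\<close>)
  next
    case 3
    \<comment> \<open>The difference quotient at 0 is \<open>theta (n + 1)\<close>, to which
      \<open>theta_le\<close> applies.\<close>
    have "((%y. (theta n y - theta n 0)/(y - 0)) \<longlongrightarrow> 0) (at 0)"
    proof (rule Lim_null_comparison[where g="%y. fact (n + 2)*\<bar>y\<bar>"])
      have "\<bar>theta n y/y\<bar> <= fact (n + 2)*\<bar>y\<bar>" for y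
        using theta_le[of "n + 1" y] by (auto simp: theta_def mult.commute)
      then show "\<forall>\<^sub>F y in at 0. norm ((theta n y - theta n 0)/(y - 0)) <= fact (n + 2)*\<bar>y\<bar>"
        by (auto simp: theta_def[of n 0] simp del: fact_Suc)
      have "((%y::real. fact (n + 2)*\<bar>y\<bar>) \<longlongrightarrow> fact (n + 2)*\<bar>0\<bar>) (at 0)" by (intro tendsto_intros)
      then show "((%y::real. fact (n + 2)*\<bar>y\<bar>) \<longlongrightarrow> 0) (at 0)" by simp
    qed
    then show ?thesis using 3 by (simp add: has_field_derivative_iff theta_def[of _ 0])
  qed
qed

lemma Ck_theta: "Ck_on UNIV k (theta n)"
proof (induction k arbitrary: n)
  case 0
  then show ?case by (auto simp: continuous_on_eq_continuous_at intro: DERIV_isCont theta_deriv)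
next
  case (Suc k)
  have "pd 1 (theta n) = (%s. theta (n + 2) s - real n*theta (n + 1) s)"
    by (rule ext) (rule pd_eqI[OF theta_deriv[unfolded has_field_derivative_def], THEN trans], simp)
  moreover have "Ck_on UNIV k (%s. theta (n + 2) s - real n*theta (n + 1) s)"
    by (intro Ck_diff Ck_mult Ck_const Suc)
  moreover have "theta n differentiable (at s)" for s
    using theta_deriv[of n s] by (auto simp: differentiable_def has_field_derivative_def)
  ultimately show ?case by simp
qed

definition step :: "real => real" where
  "step s = theta 0 s*inverse (theta 0 s + theta 0 (1 - s))"

lemma theta_nonneg: "theta n s >= 0" by (simp add: theta_def)

lemma step_denom_pos: "theta 0 s + theta 0 (1 - s) > 0"
  by (auto simp: theta_def add_pos_pos)

lemma Ck_step: "Ck_on UNIV k step"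
proof -
  have t: "Ck_on UNIV k (%s. theta 0 (1 - s))"
    by (rule Ck_compose_real[OF Ck_theta Ck_diff[OF Ck_const Ck_ident_linear[OF bounded_linear_ident]]])
  show ?thesis unfolding step_def
    by (intro Ck_mult Ck_inverse Ck_add Ck_theta t) (use step_denom_pos in \<open>auto simp: less_le\<close>)
qed

lemma step_simps: "s <= 0 ==> step s = 0" "s >= 1 ==> step s = 1"
  by (auto simp: step_def theta_def)

lemma step_bounds: "0 <= step s" "step s <= 1"
  using theta_nonneg[of 0 s] theta_nonneg[of 0 "1 - s"] step_denom_pos[of s]
  by (auto simp: step_def divide_inverse[symmetric])

text \<open>The factor \<open>4/(3*r^2)\<close> makes the argument of \<open>step\<close> equal to 1
  at distance \<open>r/2\<close> from \<open>c\<close>, and 0 at distance \<open>r\<close>. Using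
  the squared norm keeps the function smooth at \<open>c\<close>.\<close>

definition cutoff :: "'a::euclidean_space => real => 'a => real" where
  "cutoff c r x = step ((r^2 - (norm (x - c))^2)*(4/(3*r^2)))"

lemma Ck_norm_square: "Ck_on UNIV k (%x::'a::euclidean_space. (norm (x - c))^2)"
proof -
  have eq: "(%x. (norm (x - c))^2) = (%x. \<Sum>b\<in>Basis. (x \<bullet> b - c \<bullet> b)*(x \<bullet> b - c \<bullet> b))"
    unfolding power2_norm_eq_inner by (subst euclidean_inner) (simp add: inner_diff_left)
  have "Ck_on UNIV k (%x. (x \<bullet> b - c \<bullet> b)*(x \<bullet> b - c \<bullet> b))" for b
    by (rule Ck_mult[OF Ck_diff[OF Ck_inner Ck_const] Ck_diff[OF Ck_inner Ck_const]])
  from Ck_sum[OF finite_Basis this] show ?thesis unfolding eq .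
qed

lemma Ck_cutoff: "Ck_on UNIV k (cutoff c r)"
proof -
  have "Ck_on UNIV k (%x. (r^2 - (norm (x - c))^2)*(4/(3*r^2)))"
    by (intro Ck_mult Ck_diff Ck_const Ck_norm_square)
  from Ck_compose_real[OF Ck_step this] show ?thesis unfolding cutoff_def[abs_def] .
qed

lemma cutoff_bounds: "0 <= cutoff c r x" "cutoff c r x <= 1" by (auto simp: cutoff_def step_bounds)

lemma cutoff_outside: "r > 0 ==> norm (x - c) >= r ==> cutoff c r x = 0"
  unfolding cutoff_def by (intro step_simps mult_nonpos_nonneg) (auto simp: power_mono)

lemma cutoff_inside: "r > 0 ==> norm (x - c) <= r/2 ==> cutoff c r x = 1"
proof -
  assume r: "r > 0" and x: "norm (x - c) <= r/2"
  have "(norm (x - c))^2 <= (r/2)^2" using x by (intro power_mono) auto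
  then have "3/4*r^2 <= r^2 - (norm (x - c))^2" by (simp add: power_divide)
  then show ?thesis unfolding cutoff_def using r by (intro step_simps) (simp add: field_simps)
qed

section \<open>Functions of bounded support and integration by parts\<close>

definition bsupp :: "('a::euclidean_space => 'b::zero) => bool" where
  "bsupp f \<longleftrightarrow> (\<exists>R. \<forall>x. norm x > R --> f x = 0)"

lemma bsuppE: assumes "bsupp f" obtains R where "R > 0" "\<And>x. norm x > R ==> f x = 0"
proof -
  obtain R where "\<forall>x. norm x > R --> f x = 0" using assms by (auto simp: bsupp_def)
  then show ?thesis by (intro that[of "max R 1"]) auto
qed

lemma bsupp_mult_left: "bsupp f ==> bsupp (%x. f x*g x :: 'b::mult_zero)" by (fastforce simp: bsupp_def)
lemma bsupp_mult_right: "bsupp g ==> bsupp (%x. f x*g x :: 'b::mult_zero)" by (fastforce simp: bsupp_def)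
lemma bsupp_add: "bsupp f ==> bsupp g ==> bsupp (%x. f x + g x :: 'b::monoid_add)"
  unfolding bsupp_def by (metis add_0 max.strict_boundedE max_less_iff_conj)
lemma bsupp_power: "bsupp f ==> bsupp (%x. (f x)^2 :: real)" by (fastforce simp: bsupp_def)
lemma bsupp_sum: "finite I ==> (\<And>i. i \<in> I ==> bsupp (f i)) ==> bsupp (%x. \<Sum>i\<in>I. f i x :: 'b::comm_monoid_add)"
proof (induction I rule: finite_induct)
  case (insert i I)
  then have "bsupp (%x. f i x + (\<Sum>i\<in>I. f i x))" by (intro bsupp_add) auto
  then show ?case using insert by simp
qed (simp add: bsupp_def)

lemma bsupp_pd:
  assumes "bsupp f" shows "bsupp (pd b f)"
proof -
  obtain R where R: "\<And>x. norm x > R ==> f x = 0" using assms by (auto simp: bsupp_def)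
  have "pd b f x = 0" if "norm x > R" for x
  proof -
    have "open {x. norm x > R}" by (intro open_Collect_less continuous_intros)
    then have "eventually (%y. y \<in> {x. norm x > R}) (nhds x)" using that by (intro eventually_nhds_in_open) auto
    then have "eventually (%y. f y = 0) (nhds x)" by (rule eventually_mono) (auto simp: R)
    from pd_cong_eventually[OF this] show ?thesis by simp
  qed
  then show ?thesis unfolding bsupp_def by blast
qed

lemma bsupp_bounded_continuous:
  fixes f :: "'a::euclidean_space => 'b::real_normed_vector"
  assumes "continuous_on UNIV f" "bsupp f"
  obtains M where "M > 0" "\<And>x. norm (f x) <= M"
proof -
  obtain R where R: "\<And>x. norm x > R ==> f x = 0" using assms(2) by (auto simp: bsupp_def)
  have "compact (f ` cball 0 R)" using assms(1) by (intro compact_continuous_image) (auto intro: continuous_on_subset)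
  then have "bounded (f ` cball 0 R)" by (rule compact_imp_bounded)
  then obtain M where M: "M > 0" "\<forall>x\<in>f ` cball 0 R. norm x <= M" by (meson bounded_pos)
  have "norm (f x) <= M" for x
    using M R[of x] by (cases "norm x <= R") auto
  then show ?thesis using that M by blast
qed

lemma integrable_bsupp_bounded:
  fixes f :: "'a::euclidean_space => real"
  assumes "f \<in> borel_measurable borel" "bsupp f" "\<And>x. \<bar>f x\<bar> <= M"
  shows "integrable lborel f"
proof -
  obtain R where R: "\<And>x. norm x > R ==> f x = 0" using assms(2) by (auto simp: bsupp_def)
  show ?thesis
  proof (rule Bochner_Integration.integrable_bound)
    show "integrable lborel (%x::'a. M*indicator (cball 0 R) x)"
      using emeasure_bounded_finite[of "cball (0::'a) R"]
      by (intro integrable_mult_right integrable_real_indicator) auto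
    show "AE x in lborel. norm (f x) <= norm (M*indicator (cball 0 R) x)"
    proof (rule AE_I2)
      fix x show "norm (f x) <= norm (M*indicator (cball 0 R) x)"
        using assms(3)[of x] R[of x] by (cases "norm x <= R") auto
    qed
  qed (use assms in auto)
qed

lemma integrable_bsupp:
  fixes f :: "'a::euclidean_space => real"
  assumes "continuous_on UNIV f" "bsupp f"
  shows "integrable lborel f"
proof -
  obtain M where "M > 0" "\<And>x. norm (f x) <= M" using bsupp_bounded_continuous[OF assms] by blast
  then show ?thesis using assms by (intro integrable_bsupp_bounded[of f M]) (auto intro: borel_measurable_continuous_onI)
qed

lemma integral_translation:
  fixes f :: "'a::euclidean_space => real"
  assumes "f \<in> borel_measurable borel"
  shows "(LBINT x. f (c + x)) = (LBINT x. f x)"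
proof -
  have "(LBINT x. f x) = (\<integral>x. f x \<partial>(distr lborel borel ((+) c)))" by (simp add: lborel_distr_plus)
  also have "\<dots> = (LBINT x. f (c + x))" using assms by (intro integral_distr) auto
  finally show ?thesis by simp
qed

text \<open>Difference quotients in direction \<open>b\<close> have integral zero by translation
  invariance; they converge to the derivative and are dominated on a fixed ball.\<close>

lemma integral_pd_eq_0:
  fixes f :: "'a::euclidean_space => real"
  assumes C1: "Ck_on UNIV (Suc 0) f" and bs: "bsupp f" and b: "b \<in> Basis"
  shows "(LBINT x. pd b f x) = 0"
proof -
  have cf: "continuous_on UNIV f" using Ck_continuous[OF C1] .
  have fm[measurable]: "f \<in> borel_measurable borel" using cf by (rule borel_measurable_continuous_onI)
  have cpd: "continuous_on UNIV (pd b f)" using C1 b by simp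
  have pm[measurable]: "pd b f \<in> borel_measurable borel" using cpd by (rule borel_measurable_continuous_onI)
  obtain M where M: "M > 0" "\<And>x. norm (pd b f x) <= M" using bsupp_bounded_continuous[OF cpd bsupp_pd[OF bs]] by blast
  obtain R where R: "R > 0" "\<And>x. norm x > R ==> f x = 0" using bsuppE[OF bs] by metis
  define q where "q = (%n x. (f (inverse (real (Suc n)) *\<^sub>R b + x) - f x)*real (Suc n))"
  have der: "((%t. f (t *\<^sub>R b + x)) has_vector_derivative pd b f (t *\<^sub>R b + x)) (at t)" for t x
  proof -
    have "((%t. t *\<^sub>R b + x) has_derivative (%s. s *\<^sub>R b)) (at t)" by (auto intro!: derivative_eq_intros)
    moreover have fd: "(f has_derivative (%v. pd v f (t *\<^sub>R b + x))) (at (t *\<^sub>R b + x))" using C1 by (intro has_derivative_pd) simp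
    ultimately have "((%t. f (t *\<^sub>R b + x)) has_derivative (%s. pd (s *\<^sub>R b) f (t *\<^sub>R b + x))) (at t)"
      by (rule has_derivative_compose)
    moreover have "pd (s *\<^sub>R b) f (t *\<^sub>R b + x) = s *\<^sub>R pd b f (t *\<^sub>R b + x)" for s
      using linear_scale[OF has_derivative_linear[OF fd]] .
    ultimately show ?thesis by (simp add: has_vector_derivative_def)
  qed
  have lip: "\<bar>f (t *\<^sub>R b + x) - f x\<bar> <= M*t" if "t >= 0" for t x
  proof -
    have "norm (f (t *\<^sub>R b + x) - f (0 *\<^sub>R b + x)) <= M*norm (t - 0)"
    proof (rule differentiable_bound[of "{0..t}" "%t. f (t *\<^sub>R b + x)" "%t s. s *\<^sub>R pd b f (t *\<^sub>R b + x)"])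
      show "((%t. f (t *\<^sub>R b + x)) has_derivative (%s. s *\<^sub>R pd b f (y *\<^sub>R b + x))) (at y within {0..t})" for y
        using der[of x y] by (auto simp: has_vector_derivative_def intro: has_derivative_at_withinI)
      show "onorm (%s. s *\<^sub>R pd b f (y *\<^sub>R b + x)) <= M" for y
        using M(2)[of "y *\<^sub>R b + x"] by (intro onorm_le) (auto simp: abs_mult mult.commute[of M] intro!: mult_left_mono)
    qed (use that in auto)
    then show ?thesis using that by simp
  qed
  have "(%n. \<integral>x. q n x \<partial>lborel) \<longlonglongrightarrow> (LBINT x. pd b f x)"
  \<comment> \<open>The shifts have length at most 1, so enlarging the support radius by 1 covers
    all quotients.\<close>
  proof (rule integral_dominated_convergence[where w="%x. M*indicator (cball 0 (R + 1)) x"])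
    show "integrable lborel (%x::'a. M*indicator (cball 0 (R + 1)) x)"
      using emeasure_bounded_finite[of "cball (0::'a) (R+1)"]
      by (intro integrable_mult_right integrable_real_indicator) auto
    show "q n \<in> borel_measurable lborel" for n unfolding q_def by measurable
    show "AE x in lborel. norm (q n x) <= M*indicator (cball 0 (R + 1)) x" for n
    proof (rule AE_I2)
      fix x
      define t where "t = inverse (real (Suc n))"
      have t: "t > 0" "t <= 1" by (auto simp: t_def inverse_le_1_iff)
      show "norm (q n x) <= M*indicator (cball 0 (R + 1)) x"
      proof (cases "norm x <= R + 1")
        case True
        have "\<bar>f (t *\<^sub>R b + x) - f x\<bar>*real (Suc n) <= M*t*real (Suc n)" using lip[of t x] t by (intro mult_right_mono) auto
        moreover have "M*t*real (Suc n) = M" by (simp add: t_def)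
        moreover have "norm (q n x) = \<bar>f (t *\<^sub>R b + x) - f x\<bar>*real (Suc n)"
          by (simp only: q_def t_def[symmetric] real_norm_def abs_mult abs_of_nat)
        ultimately have "norm (q n x) <= M" by linarith
        then show ?thesis using True by simp
      next
        case False
        have "norm x <= norm (t *\<^sub>R b + x) + norm (t *\<^sub>R b)" using norm_triangle_ineq4[of "t *\<^sub>R b + x" "t *\<^sub>R b"] by simp
        also have "norm (t *\<^sub>R b) <= 1" using t b by simp
        finally have "norm (t *\<^sub>R b + x) > R" using False by linarith
        then show ?thesis using False R(2)[of x] R(2)[of "t *\<^sub>R b + x"] by (simp add: q_def t_def)
      qed
    qed
    show "AE x in lborel. (%n. q n x) \<longlonglongrightarrow> pd b f x"
    proof (rule AE_I2)
      fix x
      have "((%t. (f (t *\<^sub>R b + x) - f x)/t) \<longlongrightarrow> pd b f x) (at 0)"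
        using der[of x 0] by (simp add: has_field_derivative_iff has_real_derivative_iff_has_vector_derivative[symmetric])
      moreover have "filterlim (%n. inverse (real (Suc n))) (at 0) sequentially"
        by (rule filterlim_atI) (use LIMSEQ_inverse_real_of_nat in auto)
      ultimately have "(%n. (f (inverse (real (Suc n)) *\<^sub>R b + x) - f x)/inverse (real (Suc n))) \<longlonglongrightarrow> pd b f x"
        by (rule filterlim_compose)
      then show "(%n. q n x) \<longlonglongrightarrow> pd b f x" by (simp add: q_def divide_inverse)
    qed
  qed auto
  moreover have "(LBINT x. q n x) = 0" for n
  proof -
    have i: "integrable lborel f" using cf bs by (rule integrable_bsupp)
    have i2: "integrable lborel (%x. f (c + x))" for c
      using integrable_distr[of "(+) c" lborel borel f] i by (simp add: lborel_distr_plus)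
    show ?thesis unfolding q_def using i i2 by (simp add: integral_translation)
  qed
  ultimately show ?thesis by (simp add: LIMSEQ_const_iff)
qed

section \<open>The real operator and its quadratic form\<close>

definition rwitten :: "('a::euclidean_space => real) => real => ('a => real) => 'a => real" where
  "rwitten V h u x = - h\<^sup>2*lap u x + ((grad_norm V x)^2 - h*lap V x)*u x"

definition Qform :: "('a::euclidean_space => real) => real => ('a => real) => real" where
  "Qform V h u = (LBINT x. (\<Sum>b\<in>Basis. (h*pd b u x + u x*pd b V x)^2))"

definition rtest :: "('a::euclidean_space => real) => bool" where
  "rtest u \<longleftrightarrow> smooth_on UNIV u \<and> bsupp u"

lemma smooth_Ck: "smooth_on UNIV u ==> Ck_on UNIV k u" by (simp add: smooth_on_def)

lemma grad_norm_square: "(grad_norm V x)^2 = (\<Sum>b\<in>Basis. (pd b V x)^2)"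
  by (simp add: grad_norm_def sum_nonneg)

lemma Ck1_differentiable: "Ck_on UNIV (Suc 0) f ==> f differentiable (at x)" by simp

lemma integral_divergence_eq_0:
  fixes Z :: "'a::euclidean_space => 'a => real"
  assumes "\<And>b. b \<in> Basis ==> Ck_on UNIV (Suc 0) (Z b)" "\<And>b. b \<in> Basis ==> bsupp (Z b)"
  shows "(LBINT x. (\<Sum>b\<in>Basis. pd b (Z b) x)) = 0" "integrable lborel (%x. \<Sum>b\<in>Basis. pd b (Z b) x)"
proof -
  have i: "integrable lborel (pd b (Z b))" if "b \<in> Basis" for b
    using that assms(1)[OF that] bsupp_pd[OF assms(2)[OF that]] by (intro integrable_bsupp) auto
  then show "integrable lborel (%x. \<Sum>b\<in>Basis. pd b (Z b) x)" by (intro Bochner_Integration.integrable_sum)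
  have "(LBINT x. (\<Sum>b\<in>Basis. pd b (Z b) x)) = (\<Sum>b\<in>Basis. \<integral>x. pd b (Z b) x \<partial>lborel)"
    using i by (intro Bochner_Integration.integral_sum)
  also have "\<dots> = 0" using assms by (intro sum.neutral ballI integral_pd_eq_0) auto
  finally show "(LBINT x. (\<Sum>b\<in>Basis. pd b (Z b) x)) = 0" .
qed

text \<open>The two integrands differ by the divergence of the field with components
  \<open>Z b\<close>, whose integral vanishes.\<close>

lemma rwitten_form:
  fixes u v V :: "'a::euclidean_space => real"
  assumes V: "smooth_on UNIV V" and u: "rtest u" and v: "rtest v"
  shows "(LBINT x. rwitten V h u x * v x)
     = (LBINT x. (\<Sum>b\<in>Basis. (h*pd b u x + u x*pd b V x)*(h*pd b v x + v x*pd b V x)))"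
proof -
  have Cu: "Ck_on UNIV k u" and Cv: "Ck_on UNIV k v" and CV: "Ck_on UNIV k V" for k
    using u v V by (auto simp: rtest_def smooth_on_def)
  have bu: "bsupp u" and bv: "bsupp v" using u v by (auto simp: rtest_def)
  have Cpd: "Ck_on UNIV k (pd b u)" "Ck_on UNIV k (pd b V)" "Ck_on UNIV k (pd b v)" if "b \<in> Basis" for k b
    using Cu[of "Suc k"] CV[of "Suc k"] Cv[of "Suc k"] that by auto
  define Z where "Z = (%b x. h^2*(pd b u x * v x) + h*(u x * v x*pd b V x))"
  have CZ: "Ck_on UNIV (Suc 0) (Z b)" if "b \<in> Basis" for b
    unfolding Z_def using that by (intro Ck_add Ck_mult Ck_const Cpd Cu Cv)
  have bZ: "bsupp (Z b)" for b unfolding Z_def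
    by (intro bsupp_add bsupp_mult_right bsupp_mult_left bv)
  have pdZ: "pd b (Z b) x = h^2*(pd b (pd b u) x * v x + pd b u x*pd b v x)
     + h*((u x*pd b v x + pd b u x * v x)*pd b V x + u x * v x*pd b (pd b V) x)" if b: "b \<in> Basis" for b x
  proof -
    note d = Ck1_differentiable[OF Cpd(1)[OF b]] Ck1_differentiable[OF Cpd(2)[OF b]] Ck1_differentiable[OF Cu] Ck1_differentiable[OF Cv]
    have d1: "(%x. pd b u x * v x) differentiable (at x)" "(%x. u x * v x) differentiable (at x)"
      "(%x. u x * v x*pd b V x) differentiable (at x)" by (intro differentiable_mult d)+
    have d2: "(%x. h^2*(pd b u x * v x)) differentiable (at x)" "(%x. h*(u x * v x*pd b V x)) differentiable (at x)"
      by (intro differentiable_mult differentiable_const d)+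
    show ?thesis unfolding Z_def
      by (simp only: pd_add[OF d2] pd_mult[OF differentiable_const d1(1)] pd_mult[OF differentiable_const d1(3)]
          pd_mult[OF d(1) d(4)] pd_mult[OF d1(2) d(2)] pd_mult[OF d(3) d(4)] pd_const) (simp add: algebra_simps)
  qed
  have "rwitten V h u x * v x = (\<Sum>b\<in>Basis. (h*pd b u x + u x*pd b V x)*(h*pd b v x + v x*pd b V x))
     - (\<Sum>b\<in>Basis. pd b (Z b) x)" for x
  proof -
    have "rwitten V h u x * v x = (\<Sum>b\<in>Basis. (- h\<^sup>2*pd b (pd b u) x + ((pd b V x)^2 - h*pd b (pd b V) x)*u x) * v x)"
      unfolding rwitten_def lap_def grad_norm_square
      by (simp add: sum_distrib_left sum_distrib_right sum_subtractf sum.distrib algebra_simps sum_negf)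
    also have "\<dots> = (\<Sum>b\<in>Basis. (h*pd b u x + u x*pd b V x)*(h*pd b v x + v x*pd b V x) - pd b (Z b) x)"
      by (intro sum.cong refl) (simp add: pdZ power2_eq_square algebra_simps)
    finally show ?thesis by (simp add: sum_subtractf)
  qed
  moreover have "integrable lborel (%x. \<Sum>b\<in>Basis. (h*pd b u x + u x*pd b V x)*(h*pd b v x + v x*pd b V x))"
  proof (rule integrable_bsupp)
    show "continuous_on UNIV (%x. \<Sum>b\<in>Basis. (h*pd b u x + u x*pd b V x)*(h*pd b v x + v x*pd b V x))"
      using Ck_continuous[OF Cu] Ck_continuous[OF Cv] Ck_continuous[OF Cpd(1)] Ck_continuous[OF Cpd(2)] Ck_continuous[OF Cpd(3)]
      by (intro continuous_intros)
    show "bsupp (%x. \<Sum>b\<in>Basis. (h*pd b u x + u x*pd b V x)*(h*pd b v x + v x*pd b V x))"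
      by (intro bsupp_sum bsupp_add bsupp_mult_left bsupp_mult_right bsupp_pd bu bv finite_Basis)
  qed
  ultimately show ?thesis using integral_divergence_eq_0[of Z, OF CZ bZ] by simp
qed

text \<open>Expand the square: the cross term is a divergence minus
  \<open>h*lap V x*(u x)^2\<close>, and the term \<open>h^2\<close> times the squared gradient of
  \<open>u\<close> is dropped.\<close>

lemma Qform_ge_potential:
  fixes u V :: "'a::euclidean_space => real"
  assumes V: "smooth_on UNIV V" and u: "Ck_on UNIV (Suc 0) u" "bsupp u"
  shows "Qform V h u >= (LBINT x. ((grad_norm V x)^2 - h*lap V x)*(u x)^2)"
proof -
  have CV: "Ck_on UNIV k V" for k using V by (auto simp: smooth_on_def)
  have Cpd: "Ck_on UNIV k (pd b V)" if "b \<in> Basis" for k b using CV[of "Suc k"] that by auto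
  have cu: "continuous_on UNIV u" "\<And>b. b \<in> Basis ==> continuous_on UNIV (pd b u)" using Ck_continuous[OF u(1)] u by auto
  define Z where "Z = (%b x. h*(u x*u x*pd b V x))"
  have CZ: "Ck_on UNIV (Suc 0) (Z b)" if "b \<in> Basis" for b
    unfolding Z_def using that by (intro Ck_add Ck_mult Ck_const Cpd u)
  have bZ: "bsupp (Z b)" for b unfolding Z_def
    by (intro bsupp_mult_right bsupp_mult_left u)
  have pdZ: "pd b (Z b) x = h*(2*u x*pd b u x*pd b V x + u x*u x*pd b (pd b V) x)" if b: "b \<in> Basis" for b x
  proof -
    note d = Ck1_differentiable[OF Cpd(1)[OF b]] Ck1_differentiable[OF u(1)]
    have d1: "(%x. u x*u x) differentiable (at x)"
      "(%x. u x*u x*pd b V x) differentiable (at x)" by (intro differentiable_mult d)+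
    show ?thesis unfolding Z_def
      by (simp only: pd_mult[OF differentiable_const d1(2)] pd_mult[OF d1(1) d(1)] pd_mult[OF d(2) d(2)] pd_const) (simp add: algebra_simps)
  qed
  have i1: "integrable lborel (%x. ((grad_norm V x)^2 - h*lap V x)*(u x)^2)"
  proof (rule integrable_bsupp)
    show "continuous_on UNIV (%x. ((grad_norm V x)^2 - h*lap V x)*(u x)^2)"
      unfolding grad_norm_square lap_def using cu Ck_continuous[OF Cpd] Ck_continuous[OF Ck_pd[OF Cpd[of _ "Suc 0"]]]
      by (intro continuous_intros) auto
  qed (intro bsupp_mult_right bsupp_power u)
  have i2: "integrable lborel (%x. \<Sum>b\<in>Basis. (h*pd b u x + u x*pd b V x)^2)"
  proof (rule integrable_bsupp)
    show "continuous_on UNIV (%x. \<Sum>b\<in>Basis. (h*pd b u x + u x*pd b V x)^2)"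
      using cu Ck_continuous[OF Cpd] by (intro continuous_intros) auto
  qed (intro bsupp_sum bsupp_power bsupp_add bsupp_mult_right[OF bsupp_pd] bsupp_mult_left u finite_Basis)
  note i3 = integral_divergence_eq_0[of Z, OF CZ bZ]
  have "(LBINT x. ((grad_norm V x)^2 - h*lap V x)*(u x)^2)
      = (LBINT x. ((grad_norm V x)^2 - h*lap V x)*(u x)^2 + (\<Sum>b\<in>Basis. pd b (Z b) x))"
    using i1 i3 by simp
  also have "\<dots> <= Qform V h u"
    unfolding Qform_def
  proof (rule integral_mono)
    fix x
    have "((grad_norm V x)^2 - h*lap V x)*(u x)^2 + (\<Sum>b\<in>Basis. pd b (Z b) x)
      = (\<Sum>b\<in>Basis. ((pd b V x)^2 - h*pd b (pd b V) x)*(u x)^2 + pd b (Z b) x)"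
      unfolding lap_def grad_norm_square by (simp add: sum_distrib_left sum_distrib_right sum_subtractf sum.distrib algebra_simps)
    also have "\<dots> <= (\<Sum>b\<in>Basis. (h*pd b u x + u x*pd b V x)^2)"
    proof (rule sum_mono)
      fix b :: 'a assume b: "b \<in> Basis"
      have "(h*pd b u x + u x*pd b V x)^2 = ((pd b V x)^2 - h*pd b (pd b V) x)*(u x)^2 + pd b (Z b) x + (h*pd b u x)^2"
        unfolding pdZ[OF b] by (simp add: power2_eq_square algebra_simps)
      then show "((pd b V x)^2 - h*pd b (pd b V) x)*(u x)^2 + pd b (Z b) x <= (h*pd b u x + u x*pd b V x)^2" by simp
    qed
    finally show "((grad_norm V x)^2 - h*lap V x)*(u x)^2 + (\<Sum>b\<in>Basis. pd b (Z b) x) <= (\<Sum>b\<in>Basis. (h*pd b u x + u x*pd b V x)^2)" .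
  qed (use i1 i2 i3 in auto)
  finally show ?thesis .
qed

section \<open>Borel square-integrable functions, convolution and mollification\<close>

text \<open>Translation invariance and Fubini are applied to \<open>lborel\<close> and Borel
  functions, while \<open>L2\<close> in the statement uses its completion; \<open>B2\<close> is the
  bridge between the two.\<close>

definition B2 :: "('a::euclidean_space => real) => bool" where
  "B2 f \<longleftrightarrow> f \<in> borel_measurable borel \<and> integrable lborel (%x. (f x)^2)"

lemma B2_L2fun: "B2 f ==> L2fun f"
  by (auto simp: B2_def L2fun_def integrable_completion intro: measurable_completion)

lemma B2_integral: "B2 f ==> B2 g ==> (\<integral>x. f x*g x \<partial>lebesgue) = (LBINT x. f x*g x)"
  by (rule integral_completion) (auto simp: B2_def)

lemma B2_inner: "B2 f ==> B2 g ==> inner (abs_rl2 f) (abs_rl2 g) = (LBINT x. f x*g x)"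
  by (simp add: inner_abs_rl2 B2_L2fun B2_integral)

lemma B2_norm: "B2 f ==> (norm (abs_rl2 f))^2 = (LBINT x. (f x)^2)"
  unfolding power2_norm_eq_inner by (simp add: B2_inner power2_eq_square)

lemma B2_mult: "B2 f ==> B2 g ==> integrable lborel (%x. f x*g x)"
proof -
  assume f: "B2 f" and g: "B2 g"
  have "integrable lebesgue (%x. f x*g x)" by (rule L2fun_mult[OF B2_L2fun[OF f] B2_L2fun[OF g]])
  moreover have "(%x. f x*g x) \<in> borel_measurable lborel" using f g by (auto simp: B2_def)
  ultimately show ?thesis by (simp add: integrable_completion)
qed

lemma B2_add: "B2 f ==> B2 g ==> B2 (%x. f x + g x)"
  using B2_mult[of f g] by (auto simp: B2_def power2_sum mult.assoc)

lemma B2_scale: "B2 f ==> B2 (%x. c*f x)"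
  by (auto simp: B2_def power_mult_distrib)

lemma B2_diff: "B2 f ==> B2 g ==> B2 (%x. f x - g x)"
  using B2_add[of f "%x. -1*g x"] B2_scale[of g "-1"] by simp

lemma B2_bounded_mult:
  assumes "B2 f" "g \<in> borel_measurable borel" "\<And>x. \<bar>g x\<bar> <= M"
  shows "B2 (%x. g x*f x)" "(LBINT x. (g x*f x)^2) <= M^2*(LBINT x. (f x)^2)"
proof -
  have le: "(g x*f x)^2 <= M^2*(f x)^2" for x
    using power_mono[OF assms(3)[of x], of 2] by (simp add: power_mult_distrib mult_right_mono)
  have i: "integrable lborel (%x. (g x*f x)^2)"
  proof (rule Bochner_Integration.integrable_bound)
    show "integrable lborel (%x. M^2*(f x)^2)" using assms by (simp add: B2_def)
    show "AE x in lborel. norm ((g x*f x)^2) <= norm (M^2*(f x)^2)" using le by auto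
  qed (use assms in \<open>auto simp: B2_def\<close>)
  then show "B2 (%x. g x*f x)" using assms by (auto simp: B2_def)
  have "(LBINT x. (g x*f x)^2) <= (LBINT x. M^2*(f x)^2)"
    using i assms le by (intro integral_mono) (auto simp: B2_def)
  then show "(LBINT x. (g x*f x)^2) <= M^2*(LBINT x. (f x)^2)" by simp
qed

lemma B2_continuous:
  assumes "continuous_on UNIV f" "bsupp f" shows "B2 f"
  unfolding B2_def using assms
  by (auto intro!: borel_measurable_continuous_onI integrable_bsupp continuous_intros bsupp_power)

lemma rtest_B2: "rtest f ==> B2 f"
  by (auto simp: rtest_def intro: B2_continuous Ck_continuous[OF smooth_Ck])

lemma rtest_pd: "rtest K ==> b \<in> Basis ==> rtest (pd b K)"
  using smooth_Ck[of K "Suc _"] by (auto simp: rtest_def smooth_on_def bsupp_pd)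

lemma rtest_continuous: "rtest K ==> continuous_on UNIV K"
  by (auto simp: rtest_def intro: Ck_continuous[OF smooth_Ck])

lemma rtest_differentiable: "rtest K ==> K differentiable (at x)"
  using smooth_Ck[of K "Suc 0"] by (simp add: rtest_def)

lemma rtest_lipschitz:
  fixes K :: "'a::euclidean_space => real"
  assumes K: "rtest K"
  obtains L where "L >= 0" "\<And>x y. \<bar>K x - K y\<bar> <= L*norm (x - y)"
proof -
  have "\<exists>M. \<forall>x. norm (pd b K x) <= M" if "b \<in> Basis" for b
    using rtest_pd[OF K that] bsupp_bounded_continuous[of "pd b K"] rtest_continuous by (metis rtest_def)
  then obtain M where M: "\<And>b x. b \<in> Basis ==> norm (pd b K x) <= M b" by metis
  define L where "L = (\<Sum>b\<in>Basis. M b)"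
  have bound: "\<bar>pd v K x\<bar> <= L*norm v" for v x
  proof -
    have "\<bar>pd v K x\<bar> <= (\<Sum>b\<in>Basis. \<bar>(v \<bullet> b) *\<^sub>R pd b K x\<bar>)"
      unfolding pd_linear_expand[OF rtest_differentiable[OF K], of v] by (rule sum_abs)
    also have "\<dots> <= (\<Sum>b\<in>Basis. norm v * M b)"
      using M by (intro sum_mono) (auto simp: abs_mult intro!: mult_mono Basis_le_norm)
    finally show ?thesis by (simp add: L_def sum_distrib_left mult.commute)
  qed
  have "M b >= 0" if "b \<in> Basis" for b using M[OF that, of 0] norm_ge_zero order_trans by blast
  then have L0: "L >= 0" unfolding L_def by (intro sum_nonneg)
  have "norm (K x - K y) <= L*norm (x - y)" for x y
  proof (rule differentiable_bound[of UNIV K "%x v. pd v K x"])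
    show "(K has_derivative (%v. pd v K x)) (at x within UNIV)" for x
      using has_derivative_pd[OF rtest_differentiable[OF K]] by simp
    show "onorm (%v. pd v K x) <= L" for x using bound by (intro onorm_le) auto
  qed auto
  then show ?thesis using that L0 by auto
qed

lemma bsupp_reflect: "bsupp K ==> bsupp (%y. K (x - y))"
  unfolding bsupp_def
proof -
  assume "\<exists>R. \<forall>x. R < norm x --> K x = 0"
  then obtain R where R: "\<And>x. R < norm x ==> K x = 0" by blast
  have "K (x - y) = 0" if "R + norm x < norm y" for y
    using that norm_triangle_ineq2[of y x] by (intro R) (simp add: norm_minus_commute)
  then show "\<exists>R. \<forall>y. R < norm y --> K (x - y) = 0" by blast
qed

lemma reflect_continuous: "continuous_on UNIV K ==> continuous_on UNIV (%y. K (x - y))" for x :: "'a::euclidean_space"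
  by (rule continuous_on_compose2[of UNIV K UNIV "%y. x - y"]) (auto intro!: continuous_on_diff continuous_on_const continuous_on_id)

definition conv :: "('a::euclidean_space => real) => ('a => real) => 'a => real" where
  "conv K f x = (LBINT y. K (x - y)*f y)"

lemma conv_integrable:
  assumes "continuous_on UNIV K" "bsupp K" "B2 f"
  shows "integrable lborel (%y. K (x - y)*f y)"
  by (rule B2_mult[OF B2_continuous[OF reflect_continuous[OF assms(1)] bsupp_reflect[OF assms(2)]] assms(3)])

text \<open>A kernel with Lipschitz first derivatives has a Taylor remainder bounded by
  \<open>LL*(norm k)^2\<close> uniformly in the point, and this remains quadratic after integration
  against \<open>\<bar>f\<bar>\<close> on a bounded set.\<close>

lemma conv_has_derivative:
  fixes K f :: "'a::euclidean_space => real"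
  assumes K: "rtest K" and f: "B2 f"
  shows "(conv K f has_derivative (%v. \<Sum>b\<in>Basis. (v \<bullet> b)*conv (pd b K) f x)) (at x)"
proof -
  have "\<forall>b\<in>Basis. \<exists>L\<ge>0. \<forall>x y. \<bar>pd b K x - pd b K y\<bar> <= L*norm (x - y)"
    using rtest_lipschitz[OF rtest_pd[OF K]] by metis
  then obtain L where L: "\<And>b. b \<in> Basis ==> L b >= 0" "\<And>b x y. b \<in> Basis ==> \<bar>pd b K x - pd b K y\<bar> <= L b*norm (x - y)" by metis
  define LL where "LL = (\<Sum>b\<in>Basis. L b)"
  have bK: "bsupp K" and cK: "continuous_on UNIV K" using K rtest_continuous by (auto simp: rtest_def)
  obtain rh where rh: "rh > 0" "\<And>x. norm x > rh ==> K x = 0" using bsuppE[OF bK] by metis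
  \<comment> \<open>For increments of length at most 1 all kernels involved vanish outside this
    ball, which is bounded, so that \<open>f\<close> is integrable on it.\<close>
  define I where "I = (%y::'a. indicator (cball 0 (rh + norm x + 1)) y :: real)"
  have B2I: "B2 I"
    using emeasure_bounded_finite[of "cball (0::'a) (rh + norm x + 1)"]
    by (auto simp: B2_def I_def power2_eq_square indicator_inter_arith[symmetric] intro!: integrable_real_indicator borel_measurable_indicator)
  define A where "A = (LBINT y. I y*\<bar>f y\<bar>)"
  have B2af: "B2 (%y. \<bar>f y\<bar>)" using f by (auto simp: B2_def)
  have iA: "integrable lborel (%y. I y*\<bar>f y\<bar>)" using B2I B2af by (rule B2_mult)
  have rem: "\<bar>K (z + k) - K z - (\<Sum>b\<in>Basis. (k \<bullet> b)*pd b K z)\<bar> <= LL*(norm k)^2" for z k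
  proof -
    have der: "((%t. K (z + t *\<^sub>R k)) has_real_derivative pd k K (z + t *\<^sub>R k)) (at t)" for t
    proof -
      have "((%t. z + t *\<^sub>R k) has_derivative (%s. s *\<^sub>R k)) (at t)" by (auto intro!: derivative_eq_intros)
      moreover have fd: "(K has_derivative (%v. pd v K (z + t *\<^sub>R k))) (at (z + t *\<^sub>R k))"
        by (rule has_derivative_pd[OF rtest_differentiable[OF K]])
      ultimately have "((%t. K (z + t *\<^sub>R k)) has_derivative (%s. pd (s *\<^sub>R k) K (z + t *\<^sub>R k))) (at t)"
        by (rule has_derivative_compose)
      moreover have "(%s. pd (s *\<^sub>R k) K (z + t *\<^sub>R k)) = (*) (pd k K (z + t *\<^sub>R k))"
        using linear_scale[OF has_derivative_linear[OF fd]] by (auto simp: mult.commute)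
      ultimately show ?thesis by (simp add: has_field_derivative_def)
    qed
    obtain \<xi> where \<xi>: "0 < \<xi>" "\<xi> < 1" "K (z + 1 *\<^sub>R k) - K (z + 0 *\<^sub>R k) = (1 - 0)*pd k K (z + \<xi> *\<^sub>R k)"
      using MVT2[of 0 1 "%t. K (z + t *\<^sub>R k)" "%t. pd k K (z + t *\<^sub>R k)"] der by auto
    have "K (z + k) - K z - (\<Sum>b\<in>Basis. (k \<bullet> b)*pd b K z) = (\<Sum>b\<in>Basis. (k \<bullet> b)*(pd b K (z + \<xi> *\<^sub>R k) - pd b K z))"
      using \<xi>(3) pd_linear_expand[OF rtest_differentiable[OF K], of k "z + \<xi> *\<^sub>R k"]
      by (simp add: right_diff_distrib sum_subtractf)
    also have "\<bar>\<dots>\<bar> <= (\<Sum>b\<in>Basis. \<bar>(k \<bullet> b)*(pd b K (z + \<xi> *\<^sub>R k) - pd b K z)\<bar>)" by (rule sum_abs)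
    also have "\<dots> <= (\<Sum>b\<in>Basis. norm k*(L b*norm k))"
    proof (rule sum_mono)
      fix b :: 'a assume b: "b \<in> Basis"
      have "\<bar>pd b K (z + \<xi> *\<^sub>R k) - pd b K z\<bar> <= L b*(\<xi>*norm k)" using L(2)[OF b, of "z + \<xi> *\<^sub>R k" z] \<xi> by simp
      also have "\<dots> <= L b*(1*norm k)" using L(1)[OF b] \<xi> by (intro mult_left_mono mult_right_mono) auto
      finally show "\<bar>(k \<bullet> b)*(pd b K (z + \<xi> *\<^sub>R k) - pd b K z)\<bar> <= norm k*(L b*norm k)"
        using b by (auto simp: abs_mult intro!: mult_mono Basis_le_norm)
    qed
    finally show ?thesis by (simp add: LL_def sum_distrib_left sum_distrib_right power2_eq_square mult_ac)
  qed
  have pK0: "pd b K z = 0" if "norm z > rh" for b z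
  proof -
    have "open {x. norm x > rh}" by (intro open_Collect_less continuous_intros)
    then have "eventually (%y. y \<in> {x. norm x > rh}) (nhds z)" using that by (intro eventually_nhds_in_open) auto
    then have "eventually (%y. K y = 0) (nhds z)" by (rule eventually_mono) (auto simp: rh)
    from pd_cong_eventually[OF this] show ?thesis by simp
  qed
  have LL0: "LL >= 0" unfolding LL_def using L by (intro sum_nonneg) auto
  have main: "\<bar>conv K f (x + k) - conv K f x - (\<Sum>b\<in>Basis. (k \<bullet> b)*conv (pd b K) f x)\<bar> <= LL*(norm k)^2*A" if k: "norm k <= 1" for k
  proof -
    have i: "integrable lborel (%y. K (z - y)*f y)" for z by (rule conv_integrable[OF cK bK f])
    have ib: "integrable lborel (%y. pd b K (z - y)*f y)" if "b \<in> Basis" for z b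
      using rtest_pd[OF K that] f by (intro conv_integrable) (auto simp: rtest_continuous, auto simp: rtest_def)
    have "conv K f (x + k) - conv K f x - (\<Sum>b\<in>Basis. (k \<bullet> b)*conv (pd b K) f x)
        = (LBINT y. K (x + k - y)*f y - K (x - y)*f y - (\<Sum>b\<in>Basis. (k \<bullet> b)*(pd b K (x - y)*f y)))"
      unfolding conv_def using i ib by simp
    also have "\<bar>\<dots>\<bar> <= (LBINT y. LL*(norm k)^2*(I y*\<bar>f y\<bar>))"
    proof (rule integral_abs_bound_integral)
      fix y
      have eq: "K (x + k - y)*f y - K (x - y)*f y - (\<Sum>b\<in>Basis. (k \<bullet> b)*(pd b K (x - y)*f y))
         = (K (x - y + k) - K (x - y) - (\<Sum>b\<in>Basis. (k \<bullet> b)*pd b K (x - y)))*f y"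
      proof -
        have e: "x + k - y = x - y + k" by simp
        show ?thesis unfolding e by (simp only: left_diff_distrib sum_distrib_right mult.assoc)
      qed
      show "\<bar>K (x + k - y)*f y - K (x - y)*f y - (\<Sum>b\<in>Basis. (k \<bullet> b)*(pd b K (x - y)*f y))\<bar> <= LL*(norm k)^2*(I y*\<bar>f y\<bar>)"
      proof (cases "norm y <= rh + norm x + 1")
        case True
        then show ?thesis unfolding eq abs_mult I_def using rem[of "x - y" k] by (simp add: mult_right_mono)
      next
        case False
        have "norm y <= norm (x - y) + norm x" using norm_triangle_ineq2[of y x] by (simp add: norm_minus_commute)
        then have 1: "norm (x - y) > rh + 1" using False by linarith
        moreover have "norm (x - y) <= norm (x - y + k) + norm k" using norm_triangle_ineq4[of "x - y + k" k] by simp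
        ultimately have "norm (x - y + k) > rh" using k by linarith
        then show ?thesis unfolding eq using 1 rh(2)[of "x - y"] rh(2)[of "x - y + k"] pK0[of "x - y"] LL0 by (simp add: I_def)
      qed
    qed (use i ib iA in auto)
    finally show ?thesis by (simp add: A_def)
  qed
  show ?thesis
  proof (rule has_derivativeI_sandwich[of 1 _ _ _ _ "%y. LL*A*norm (y - x)"])
    show "bounded_linear (%v. \<Sum>b\<in>Basis. (v \<bullet> b)*conv (pd b K) f x)"
      by (intro bounded_linear_sum bounded_linear_mult_left[THEN bounded_linear_compose] bounded_linear_inner_left)
    fix y assume y: "y \<noteq> x" "dist y x < 1"
    have "\<bar>conv K f y - conv K f x - (\<Sum>b\<in>Basis. ((y - x) \<bullet> b)*conv (pd b K) f x)\<bar> <= LL*(norm (y - x))^2*A"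
      using main[of "y - x"] y by (simp add: dist_norm)
    then show "norm (conv K f y - conv K f x - (\<Sum>b\<in>Basis. ((y - x) \<bullet> b)*conv (pd b K) f x))/norm (y - x) <= LL*A*norm (y - x)"
      using y by (simp add: divide_le_eq power2_eq_square mult_ac)
  next
    have "((%y. LL*A*norm (y - x)) \<longlongrightarrow> LL*A*norm (x - x)) (at x)" by (intro tendsto_intros)
    then show "((%y. LL*A*norm (y - x)) \<longlongrightarrow> 0) (at x)" by simp
  qed simp
qed

lemma pd_conv: "rtest K ==> B2 f ==> b \<in> Basis ==> pd b (conv K f) x = conv (pd b K) f x"
  by (subst pd_eqI[OF conv_has_derivative]) (auto simp: inner_Basis if_distrib[of "%z. z * _"] cong: if_cong)

lemma Ck_conv: "rtest K ==> B2 f ==> Ck_on UNIV k (conv K f)"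
proof (induction k arbitrary: K)
  case 0
  then show ?case
    using has_derivative_continuous[OF conv_has_derivative] by (auto simp: continuous_on_eq_continuous_at)
next
  case (Suc k)
  have "conv K f differentiable (at x)" for x using conv_has_derivative[OF Suc.prems] by (auto simp: differentiable_def)
  moreover have "pd b (conv K f) = conv (pd b K) f" if "b \<in> Basis" for b using pd_conv Suc.prems that by blast
  ultimately show ?case using Suc by (auto intro: rtest_pd)
qed

definition mollifier :: "real => 'a::euclidean_space => real" where
  "mollifier r z = theta 0 (r^2 - (norm z)^2)*inverse (LBINT z. theta 0 (r^2 - (norm (z::'a))^2))"

lemma mollifier_props:
  assumes r: "r > 0"
  shows "rtest (mollifier r :: 'a::euclidean_space => real)" "\<And>z::'a. mollifier r z >= 0"
    "(LBINT z. mollifier r (z::'a)) = 1" "\<And>z::'a. norm z >= r ==> mollifier r z = 0"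
proof -
  let ?b = "%z::'a. theta 0 (r^2 - (norm z)^2)"
  have C: "Ck_on UNIV k ?b" for k
    using Ck_compose_real[OF Ck_theta[of k 0] Ck_diff[OF Ck_const[of k "r^2"] Ck_norm_square[of k 0]]] by simp
  have z: "?b z = 0" if "norm z >= r" for z
  proof -
    have "r^2 <= (norm z)^2" using that r by (intro power_mono) auto
    then show ?thesis by (simp add: theta_def)
  qed
  have bs: "bsupp ?b" unfolding bsupp_def using z by (intro exI[of _ r]) auto
  have i: "integrable lborel ?b" by (intro integrable_bsupp bs Ck_continuous[OF C])
  have cb: "continuous_on UNIV ?b" by (rule Ck_continuous[OF C])
  have b0: "?b z >= 0" for z by (rule theta_nonneg)
  have pos: "(LBINT z. ?b z) > 0"
  proof (rule ccontr)
    assume "\<not> ?thesis"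
    moreover have "(LBINT z. ?b z) >= 0" using b0 by (intro integral_nonneg_AE) auto
    ultimately have "(LBINT z. ?b z) = 0" by simp
    then have "AE z in lborel. ?b z = 0" using integral_nonneg_eq_0_iff_AE[OF i] b0 by auto
    moreover have "?b z \<noteq> 0" if "z \<in> ball 0 r" for z :: 'a
    proof -
      have "(norm z)^2 < r^2" using that by (intro power_strict_mono) auto
      then show ?thesis by (simp add: theta_def)
    qed
    ultimately have "AE z::'a in lborel. z \<notin> ball 0 r" by (auto elim: AE_mp)
    then have "emeasure lborel (ball (0::'a) r) = 0"
      by (subst AE_iff_measurable[symmetric]) auto
    then show False using content_ball_pos[OF r, of "0::'a"] by (simp add: measure_def)
  qed
  show "rtest (mollifier r :: 'a => real)"
    unfolding rtest_def smooth_on_def mollifier_def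
    using bs by (auto intro!: bsupp_mult_left) (rule Ck_mult[OF C Ck_const])
  show "mollifier r z >= 0" for z :: 'a using pos b0 by (simp add: mollifier_def)
  show "(LBINT z. mollifier r (z::'a)) = 1" unfolding mollifier_def using i pos by simp
  show "mollifier r z = 0" if "norm z >= r" for z :: 'a using z[OF that] by (simp add: mollifier_def)
qed

text \<open>Pointwise Jensen inequality for the probability density
  \<open>mollifier r (x - y)\<close>, followed by Tonelli and the fact that the density also
  integrates to 1 in \<open>x\<close>.\<close>

lemma conv_L2_contraction:
  fixes f :: "'a::euclidean_space => real"
  assumes r: "r > 0" and f: "B2 f"
  shows "B2 (conv (mollifier r) f)" "(LBINT x. (conv (mollifier r) f x)^2) <= (LBINT x. (f x)^2)"
proof -
  let ?k = "mollifier r :: 'a => real"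
  note k = mollifier_props[OF r, where 'a='a]
  have ck: "continuous_on UNIV ?k" and bk: "bsupp ?k" using k(1) rtest_continuous by (auto simp: rtest_def)
  have km[measurable]: "?k \<in> borel_measurable borel" by (rule borel_measurable_continuous_onI[OF ck])
  have fm[measurable]: "f \<in> borel_measurable borel" using f by (simp add: B2_def)
  have gm[measurable]: "conv ?k f \<in> borel_measurable borel"
    using Ck_conv[OF k(1) f, of 0] by (auto intro: borel_measurable_continuous_onI)
  obtain M where M: "M > 0" "\<And>x. norm (?k x) <= M" using bsupp_bounded_continuous[OF ck bk] by blast
  have ikf2: "integrable lborel (%y. ?k (x - y)*(f y)^2)" for x
  proof (rule Bochner_Integration.integrable_bound)
    show "integrable lborel (%y. M*(f y)^2)" using f by (simp add: B2_def)
    show "AE y in lborel. norm (?k (x - y)*(f y)^2) <= norm (M*(f y)^2)"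
      using M by (auto simp: abs_mult intro!: mult_right_mono)
  qed auto
  have ik: "integrable lborel (%y. ?k (x - y))" for x by (intro integrable_bsupp reflect_continuous bsupp_reflect ck bk)
  have k1: "(LBINT y. ?k (x - y)) = 1" for x
  proof -
    have "?k (x - y) = ?k (- x + y)" for y unfolding mollifier_def by (simp add: norm_minus_commute)
    moreover have "(LBINT y. ?k (- x + y)) = (LBINT y. ?k y)" by (intro integral_translation km)
    ultimately show ?thesis using k(3) by simp
  qed
  have jensen: "(conv ?k f x)^2 <= (LBINT y. ?k (x - y)*(f y)^2)" for x
  proof -
    define m where "m = conv ?k f x"
    have ikf: "integrable lborel (%y. ?k (x - y)*f y)" by (rule conv_integrable[OF ck bk f])
    \<comment> \<open>Jensen's inequality as nonnegativity of a variance about the mean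
      \<open>m\<close>.\<close>
    have "0 <= (LBINT y. ?k (x - y)*(f y - m)^2)" using k(2) by (intro integral_nonneg_AE) auto
    also have "(%y. ?k (x - y)*(f y - m)^2) = (%y. ?k (x - y)*(f y)^2 - 2*m*(?k (x - y)*f y) + m^2 * ?k (x - y))"
      by (auto simp: power2_eq_square algebra_simps)
    also have "(LBINT y. ?k (x - y)*(f y)^2 - 2*m*(?k (x - y)*f y) + m^2 * ?k (x - y))
       = (LBINT y. ?k (x - y)*(f y)^2) - 2*m*m + m^2"
      using ikf ikf2 ik k1 by (simp add: m_def conv_def)
    finally show ?thesis by (simp add: m_def power2_eq_square)
  qed
  have "(\<integral>\<^sup>+x. ennreal ((conv ?k f x)^2) \<partial>lborel) <= (\<integral>\<^sup>+x. (\<integral>\<^sup>+y. ennreal (?k (x - y)*(f y)^2) \<partial>lborel) \<partial>lborel)"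
  proof (rule nn_integral_mono)
    fix x
    have "ennreal ((conv ?k f x)^2) <= ennreal (LBINT y. ?k (x - y)*(f y)^2)" by (rule ennreal_leI[OF jensen])
    also have "\<dots> = (\<integral>\<^sup>+y. ennreal (?k (x - y)*(f y)^2) \<partial>lborel)"
      using k(2) by (intro nn_integral_eq_integral[symmetric] ikf2) auto
    finally show "ennreal ((conv ?k f x)^2) <= (\<integral>\<^sup>+y. ennreal (?k (x - y)*(f y)^2) \<partial>lborel)" .
  qed
  also have "\<dots> = (\<integral>\<^sup>+y. (\<integral>\<^sup>+x. ennreal (?k (x - y)*(f y)^2) \<partial>lborel) \<partial>lborel)"
    by (rule lborel_pair.Fubini'[symmetric]) measurable
  also have "\<dots> = (\<integral>\<^sup>+y. ennreal ((f y)^2) \<partial>lborel)"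
  proof (rule nn_integral_cong)
    fix y
    have ix: "integrable lborel (%x. ?k (x - y))"
    proof -
      have "?k (x - y) = ?k (y - x)" for x by (simp add: mollifier_def norm_minus_commute)
      then show ?thesis using ik[of y] by simp
    qed
    have "(LBINT x. ?k (x - y)) = 1"
    proof -
      have "?k (x - y) = ?k (y - x)" for x by (simp add: mollifier_def norm_minus_commute)
      then show ?thesis using k1[of y] by simp
    qed
    then have "(\<integral>\<^sup>+x. ennreal (?k (x - y)) \<partial>lborel) = 1" using ix k(2) by (subst nn_integral_eq_integral) auto
    then show "(\<integral>\<^sup>+x. ennreal (?k (x - y)*(f y)^2) \<partial>lborel) = ennreal ((f y)^2)"
      using k(2) by (simp add: ennreal_mult'' nn_integral_multc)
  qed
  also have "\<dots> = ennreal (LBINT y. (f y)^2)" using f by (intro nn_integral_eq_integral) (auto simp: B2_def)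
  finally have le: "(\<integral>\<^sup>+x. ennreal ((conv ?k f x)^2) \<partial>lborel) <= ennreal (LBINT y. (f y)^2)" .
  have i: "integrable lborel (%x. (conv ?k f x)^2)"
    using le by (intro integrableI_bounded) (auto intro: le_less_trans)
  then show "B2 (conv ?k f)" by (simp add: B2_def)
  show "(LBINT x. (conv ?k f x)^2) <= (LBINT x. (f x)^2)"
    using le i by (subst (asm) nn_integral_eq_integral) (auto simp: ennreal_le_iff integral_nonneg_AE)
qed

text \<open>Two approximations: first truncate \<open>f\<close> in space by \<open>\<eta> m\<close>
  and in size by the clamp \<open>cl m\<close>, then apply the same truncation to continuous
  functions converging to \<open>f\<close> almost everywhere. The truncation provides the dominating
  function in the second limit.\<close>

lemma continuous_dense_L2:
  fixes f :: "'a::euclidean_space => real"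
  assumes f: "B2 f" and e: "e > 0"
  shows "\<exists>g. continuous_on UNIV g \<and> bsupp g \<and> (LBINT x. (f x - g x)^2) < e"
proof -
  have fm[measurable]: "f \<in> borel_measurable borel" using f by (simp add: B2_def)
  define cl where "cl = (%(m::nat) t. max (- real m) (min (real m) t))"
  define \<eta> where "\<eta> = (%m. cutoff (0::'a) (2*real (Suc m)))"
  have \<eta>: "0 <= \<eta> m x" "\<eta> m x <= 1" "continuous_on UNIV (\<eta> m)" "\<eta> m \<in> borel_measurable borel" "bsupp (\<eta> m)" for m x
  proof -
    show "continuous_on UNIV (\<eta> m)" unfolding \<eta>_def by (rule Ck_continuous[OF Ck_cutoff[of 0]])
    then show "\<eta> m \<in> borel_measurable borel" by (rule borel_measurable_continuous_onI)
    show "bsupp (\<eta> m)" unfolding bsupp_def \<eta>_def by (intro exI[of _ "2*real (Suc m)"]) (auto intro!: cutoff_outside)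
  qed (auto simp: \<eta>_def cutoff_bounds)
  note [measurable] = \<eta>(4)
  define F where "F = (%m x. \<eta> m x*cl m (f x))"
  have clm[measurable]: "cl m \<in> borel_measurable borel" for m unfolding cl_def by measurable
  have cle: "\<bar>cl m t\<bar> <= \<bar>t\<bar>" "\<bar>cl m t\<bar> <= real m" for m t by (auto simp: cl_def max_def min_def)
  have Fle: "\<bar>F m x\<bar> <= \<bar>f x\<bar>" for m x
  proof -
    have "\<bar>F m x\<bar> <= 1*\<bar>f x\<bar>" unfolding F_def abs_mult using \<eta> cle by (intro mult_mono) auto
    then show ?thesis by simp
  qed
  have "(%m. \<integral>x. (f x - F m x)^2 \<partial>lborel) \<longlonglongrightarrow> (\<integral>x. 0 \<partial>(lborel::'a measure))"
  proof (rule integral_dominated_convergence[where w="%x. 4*(f x)^2"])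
    show "AE x in lborel. norm ((f x - F m x)^2) <= 4*(f x)^2" for m
    proof (rule AE_I2)
      fix x
      have "\<bar>f x - F m x\<bar> <= 2*\<bar>f x\<bar>" using Fle[of m x] by linarith
      from power_mono[OF this, of 2] show "norm ((f x - F m x)^2) <= 4*(f x)^2" by (simp add: power_mult_distrib)
    qed
    show "AE x in lborel. (%m. (f x - F m x)^2) \<longlonglongrightarrow> 0"
    proof (rule AE_I2, rule tendsto_eventually)
      fix x
      obtain N where N: "real N >= max \<bar>f x\<bar> (norm x)" using real_arch_simple by blast
      have "(f x - F m x)^2 = 0" if "m >= N" for m
      proof -
        have m: "real m >= \<bar>f x\<bar>" "real m >= norm x" using N that by auto
        have "\<eta> m x = 1" unfolding \<eta>_def using m by (intro cutoff_inside) auto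
        moreover have "cl m (f x) = f x" using m by (auto simp: cl_def)
        ultimately show ?thesis by (simp add: F_def)
      qed
      then show "\<forall>\<^sub>F m in sequentially. (f x - F m x)^2 = 0" unfolding eventually_sequentially by blast
    qed
  qed (use f in \<open>auto simp: B2_def F_def\<close>)
  then have "\<forall>\<^sub>F m in sequentially. (LBINT x. (f x - F m x)^2) < e/4" using e by (intro order_tendstoD) auto
  then obtain m where m: "(LBINT x. (f x - F m x)^2) < e/4" by (auto simp: eventually_sequentially)
  have "f measurable_on UNIV"
    by (rule lebesgue_measurable_imp_measurable_on) (auto intro: measurable_completion)
  then obtain N g where N: "negligible N" and g: "\<And>n. continuous_on UNIV (g n)" "\<And>x. x \<notin> N ==> (%n. g n x) \<longlonglongrightarrow> f x"
    by (auto simp: measurable_on_def)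
  have gm[measurable]: "g n \<in> borel_measurable borel" for n using g(1) by (rule borel_measurable_continuous_onI)
  define G where "G = (%n x. \<eta> m x*cl m (g n x))"
  have "AE x in lebesgue. x \<notin> N" using N by (simp add: AE_not_in negligible_iff_null_sets)
  have AEG: "AE x in lborel. (%n. g n x) \<longlonglongrightarrow> f x"
  proof -
    have "AE x in lebesgue. (%n. g n x) \<longlonglongrightarrow> f x" using \<open>AE x in lebesgue. x \<notin> N\<close> by eventually_elim (rule g(2))
    moreover have "{x \<in> space lborel. \<not> (%n. g n x) \<longlonglongrightarrow> f x} \<in> sets lborel" by measurable
    ultimately show ?thesis by (simp add: AE_completion_iff)
  qed
  have "(%n. \<integral>x. (F m x - G n x)^2 \<partial>lborel) \<longlonglongrightarrow> (\<integral>x. 0 \<partial>(lborel::'a measure))"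
  proof (rule integral_dominated_convergence[where w="%x. (\<eta> m x*(2*real m))^2"])
    show "integrable lborel (%x. (\<eta> m x*(2*real m))^2)"
      by (intro integrable_bsupp bsupp_power bsupp_mult_left continuous_intros \<eta>)
    show "AE x in lborel. norm ((F m x - G n x)^2) <= (\<eta> m x*(2*real m))^2" for n
    proof (rule AE_I2)
      fix x
      have "\<bar>cl m (f x) - cl m (g n x)\<bar> <= 2*real m" using cle(2)[of m "f x"] cle(2)[of m "g n x"] by linarith
      then have "\<bar>F m x - G n x\<bar> <= \<eta> m x*(2*real m)"
        unfolding F_def G_def right_diff_distrib[symmetric] abs_mult using \<eta>(1)[of m x] by (simp add: mult_left_mono)
      from power_mono[OF this, of 2] show "norm ((F m x - G n x)^2) <= (\<eta> m x*(2*real m))^2" by simp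
    qed
    show "AE x in lborel. (%n. (F m x - G n x)^2) \<longlonglongrightarrow> 0"
      using AEG
    proof eventually_elim
      case (elim x)
      then have "(%n. (F m x - G n x)^2) \<longlonglongrightarrow> (F m x - \<eta> m x*cl m (f x))\<^sup>2"
        unfolding G_def cl_def by (intro tendsto_intros)
      then show ?case by (simp add: F_def)
    qed
  qed (auto simp: F_def G_def)
  then have "\<forall>\<^sub>F n in sequentially. (LBINT x. (F m x - G n x)^2) < e/4" using e by (intro order_tendstoD) auto
  then obtain n where n: "(LBINT x. (F m x - G n x)^2) < e/4" by (auto simp: eventually_sequentially)
  have cG: "continuous_on UNIV (G n)" unfolding G_def cl_def by (intro continuous_intros \<eta> g)
  have bG: "bsupp (G n)" unfolding G_def by (intro bsupp_mult_left \<eta>)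
  have B2F: "B2 (F m)"
    unfolding B2_def
  proof
    show "integrable lborel (%x. (F m x)^2)"
    proof (rule Bochner_Integration.integrable_bound)
      show "integrable lborel (%x. (f x)^2)" using f by (simp add: B2_def)
      show "AE x in lborel. norm ((F m x)^2) <= norm ((f x)^2)"
        using Fle by (auto simp: abs_le_square_iff)
    qed (auto simp: F_def)
  qed (auto simp: F_def)
  have i1: "integrable lborel (%x. (f x - F m x)^2)" "integrable lborel (%x. (F m x - G n x)^2)"
    using B2_diff[OF f B2F] B2_diff[OF B2F B2_continuous[OF cG bG]] by (auto simp: B2_def)
  have "(LBINT x. (f x - G n x)^2) <= (LBINT x. 2*(f x - F m x)^2 + 2*(F m x - G n x)^2)"
  proof (rule integral_mono)
    show "integrable lborel (%x. (f x - G n x)^2)" using B2_diff[OF f B2_continuous[OF cG bG]] by (auto simp: B2_def)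
    fix x
    have "0 <= ((f x - F m x) - (F m x - G n x))^2" by simp
    then show "(f x - G n x)^2 <= 2*(f x - F m x)^2 + 2*(F m x - G n x)^2" by (simp add: power2_eq_square algebra_simps)
  qed (use i1 in auto)
  also have "\<dots> < e" using m n i1 by simp
  finally show ?thesis using cG bG by blast
qed

text \<open>For continuous \<open>g\<close> of bounded support, uniform continuity gives
  convergence; the contraction property carries it over to \<open>f\<close>, because the mollified
  difference \<open>f - g\<close> is no larger than \<open>f - g\<close>.\<close>

lemma conv_L2_tendsto:
  fixes f :: "'a::euclidean_space => real"
  assumes f: "B2 f"
  shows "(%n. abs_rl2 (conv (mollifier (1/real (Suc n))) f)) \<longlonglongrightarrow> abs_rl2 f"
proof (rule metric_LIMSEQ_I)
  fix e :: real assume e: "e > 0"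
  obtain g where g: "continuous_on UNIV g" "bsupp g" "(LBINT x. (f x - g x)^2) < (e/4)^2"
    using continuous_dense_L2[OF f, of "(e/4)^2"] e by auto
  have B2g: "B2 g" by (rule B2_continuous[OF g(1,2)])
  have B2d: "B2 (%x. f x - g x)" by (rule B2_diff[OF f B2g])
  have fg: "norm (abs_rl2 f - abs_rl2 g) < e/4"
  proof -
    have "(norm (abs_rl2 f - abs_rl2 g))^2 < (e/4)^2"
      using g(3) by (simp add: abs_rl2_diff B2_L2fun f B2g B2_norm[OF B2d])
    then show ?thesis by (rule power2_less_imp_less) (use e in simp)
  qed
  obtain R where R: "R > 0" "\<And>x. norm x > R ==> g x = 0" using bsuppE[OF g(2)] by metis
  define vol where "vol = measure lborel (cball (0::'a) (R + 1))"
  \<comment> \<open>A uniform error \<open>d\<close> on a set of volume \<open>vol\<close> has norm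
    at most \<open>d * sqrt vol\<close>; adding 1 avoids a vanishing denominator.\<close>
  define d where "d = e/4/(sqrt vol + 1)"
  have d: "d > 0" using e by (simp add: d_def vol_def add_nonneg_pos)
  have "uniformly_continuous_on (cball 0 (R + 2)) g"
    by (intro compact_uniformly_continuous continuous_on_subset[OF g(1)]) auto
  then obtain \<delta> where \<delta>: "\<delta> > 0" "\<And>x y. norm x <= R + 2 ==> norm y <= R + 2 ==> dist y x < \<delta> ==> dist (g y) (g x) < d"
    unfolding uniformly_continuous_on_def using d by (metis mem_cball_0)
  obtain N where N: "1/real (Suc N) < \<delta>" using \<delta>(1) nat_approx_posE by blast
  have "dist (abs_rl2 (conv (mollifier (1/real (Suc n))) f)) (abs_rl2 f) < e" if n: "n >= N" for n
  proof -
    define r where "r = 1/real (Suc n)"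
    have "1/real (Suc n) <= 1/real (Suc N)" using n by (intro divide_left_mono) auto
    then have r: "r > 0" "r < \<delta>" "r <= 1" using N by (auto simp: r_def)
    let ?k = "mollifier r :: 'a => real"
    note k = mollifier_props[OF r(1), where 'a='a]
    have ck: "continuous_on UNIV ?k" and bk: "bsupp ?k" using k(1) rtest_continuous by (auto simp: rtest_def)
    have lin: "conv ?k f x = conv ?k (%x. f x - g x) x + conv ?k g x" for x
      unfolding conv_def
      using conv_integrable[OF ck bk B2g, of x] conv_integrable[OF ck bk f, of x]
      by (simp add: right_diff_distrib)
    have kr: "(LBINT y. ?k (x - y)) = 1" for x
    proof -
      have "?k (x - y) = ?k (- x + y)" for y unfolding mollifier_def by (simp add: norm_minus_commute)
      moreover have "(LBINT y. ?k (- x + y)) = (LBINT y. ?k y)"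
        by (intro integral_translation borel_measurable_continuous_onI[OF ck])
      ultimately show ?thesis using k(3) by simp
    qed
    have ik: "integrable lborel (%y. ?k (x - y))" for x by (intro integrable_bsupp reflect_continuous bsupp_reflect ck bk)
    have unif: "\<bar>conv ?k g x - g x\<bar> <= d*indicator (cball 0 (R + 1)) x" for x
    proof -
      have "conv ?k g x - g x = (LBINT y. ?k (x - y)*g y - g x * ?k (x - y))"
        using conv_integrable[OF ck bk B2g, of x] ik kr by (simp add: conv_def)
      also have "\<bar>\<dots>\<bar> <= (LBINT y. (d*indicator (cball 0 (R + 1)) x) * ?k (x - y))"
      proof (rule integral_abs_bound_integral)
        fix y
        have "\<bar>g y - g x\<bar> * ?k (x - y) <= (d*indicator (cball 0 (R + 1)) x) * ?k (x - y)"
        proof (cases "norm (x - y) < r")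
          case True
          show ?thesis
          proof (cases "norm x <= R + 1")
            case x: True
            have "norm y <= R + 2" using x True r norm_triangle_ineq4[of x "x - y"] by simp
            then have "dist (g y) (g x) < d" using x True r by (intro \<delta>) (auto simp: dist_norm norm_minus_commute)
            then show ?thesis using x k(2) by (intro mult_right_mono) (auto simp: dist_norm)
          next
            case x: False
            have "norm y > R" using x True r norm_triangle_ineq2[of x y] by linarith
            moreover have "norm x > R" using x by linarith
            ultimately show ?thesis using R x by simp
          qed
        next
          case False
          then show ?thesis using k(4)[of "x - y"] by simp
        qed
        then show "\<bar>?k (x - y)*g y - g x * ?k (x - y)\<bar> <= (d*indicator (cball 0 (R + 1)) x) * ?k (x - y)"
          using k(2)[of "x - y"] by (simp add: left_diff_distrib[symmetric] abs_mult mult.commute)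
      qed (use ik conv_integrable[OF ck bk B2g, of x] in auto)
      also have "\<dots> = d*indicator (cball 0 (R + 1)) x" using kr by simp
      finally show ?thesis .
    qed
    have B2c: "B2 (conv ?k g)" "B2 (conv ?k f)" "B2 (conv ?k (%x. f x - g x))" using conv_L2_contraction[OF r(1)] B2g f B2d by auto
    have "norm (abs_rl2 (conv ?k g) - abs_rl2 g) <= e/4"
    proof -
      have iI: "integrable lborel (%x::'a. d^2*indicator (cball 0 (R + 1)) x)"
        using emeasure_bounded_finite[of "cball (0::'a) (R+1)"]
        by (intro integrable_mult_right integrable_real_indicator) auto
      have "(norm (abs_rl2 (conv ?k g) - abs_rl2 g))^2 = (LBINT x. (conv ?k g x - g x)^2)"
        by (simp add: abs_rl2_diff B2_L2fun B2c B2g B2_norm[OF B2_diff[OF B2c(1) B2g]])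
      also have "\<dots> <= (LBINT x. d^2*indicator (cball (0::'a) (R + 1)) x)"
      proof (rule integral_mono)
        show "integrable lborel (%x::'a. d^2*indicator (cball 0 (R + 1)) x)" by (rule iI)
        show "integrable lborel (%x. (conv ?k g x - g x)^2)" using B2_diff[OF B2c(1) B2g] by (simp add: B2_def)
        fix x show "(conv ?k g x - g x)^2 <= d^2*indicator (cball 0 (R + 1)) x"
          using power_mono[OF unif[of x], of 2] by (auto simp: indicator_def split: if_splits)
      qed
      also have "\<dots> = d^2 * vol" by (simp add: vol_def)
      also have "\<dots> = (d * sqrt vol)^2" by (simp add: power_mult_distrib vol_def)
      finally have "norm (abs_rl2 (conv ?k g) - abs_rl2 g) <= d * sqrt vol" by (rule power2_le_imp_le) (use d in \<open>auto simp: vol_def\<close>)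
      also have "\<dots> <= d*(sqrt vol + 1)" using d by (intro mult_left_mono) auto
      also have "\<dots> = e/4"
      proof -
        have "sqrt vol + 1 \<noteq> 0" using real_sqrt_ge_zero[of vol] by (simp add: vol_def add_nonneg_eq_0_iff)
        then show ?thesis using nonzero_eq_divide_eq[of "sqrt vol + 1" d "e/4"] d_def by blast
      qed
      finally show ?thesis .
    qed
    moreover have "norm (abs_rl2 (conv ?k (%x. f x - g x))) <= norm (abs_rl2 f - abs_rl2 g)"
    proof (rule power2_le_imp_le)
      show "(norm (abs_rl2 (conv ?k (%x. f x - g x))))^2 <= (norm (abs_rl2 f - abs_rl2 g))^2"
        using conv_L2_contraction(2)[OF r(1) B2d] by (simp add: abs_rl2_diff B2_L2fun f B2g B2_norm[OF B2d] B2_norm[OF B2c(3)])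
    qed simp
    moreover have "abs_rl2 (conv ?k f) = abs_rl2 (conv ?k (%x. f x - g x)) + abs_rl2 (conv ?k g)"
      unfolding abs_rl2_add[OF B2_L2fun[OF B2c(3)] B2_L2fun[OF B2c(1)]] by (rule arg_cong[of _ _ abs_rl2]) (rule ext, rule lin)
    then have "abs_rl2 (conv ?k f) - abs_rl2 f = abs_rl2 (conv ?k (%x. f x - g x)) + (abs_rl2 (conv ?k g) - abs_rl2 g) - (abs_rl2 f - abs_rl2 g)"
      by simp
    then have "norm (abs_rl2 (conv ?k f) - abs_rl2 f) <= norm (abs_rl2 (conv ?k (%x. f x - g x))) + norm (abs_rl2 (conv ?k g) - abs_rl2 g) + norm (abs_rl2 f - abs_rl2 g)"
    proof -
      have "norm (a + b - c) <= norm a + norm b + norm c" for a b c :: "'a rl2"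
        using norm_triangle_ineq4[of "a + b" c] norm_triangle_ineq[of a b] by linarith
      then show ?thesis unfolding \<open>abs_rl2 (conv ?k f) - abs_rl2 f = _\<close> .
    qed
    ultimately show ?thesis using fg e unfolding dist_norm r_def by linarith
  qed
  then show "\<exists>N. \<forall>n\<ge>N. dist (abs_rl2 (conv (mollifier (1/real (Suc n))) f)) (abs_rl2 f) < e" by blast
qed

lemma pd_reflect:
  fixes K :: "'a::euclidean_space => real"
  assumes "\<And>x. K differentiable (at x)"
  shows "pd b (%y. K (x - y)) y = - pd b K (x - y)"
proof -
  have d: "((%y. x - y) has_derivative (%v. - v)) (at y)" by (auto intro!: derivative_eq_intros)
  have fd: "(K has_derivative (%v. pd v K (x - y))) (at (x - y))" by (rule has_derivative_pd[OF assms])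
  have "((%y. K (x - y)) has_derivative (%v. pd (- v) K (x - y))) (at y)" by (rule has_derivative_compose[OF d fd])
  from pd_eqI[OF this, of b] show ?thesis using linear_neg[OF has_derivative_linear[OF fd]] by simp
qed

lemma Ck_reflect:
  fixes K :: "'a::euclidean_space => real"
  shows "Ck_on UNIV k K ==> Ck_on UNIV k (%y. K (x - y))"
proof (induction k arbitrary: K)
  case 0
  then show ?case using reflect_continuous[of K x] by simp
next
  case (Suc k)
  have "pd b (%y. K (x - y)) = (%y. - 1*pd b K (x - y))" for b
    by (rule ext) (use pd_reflect[of K b x] Suc.prems in simp)
  moreover have "Ck_on UNIV k (%y. - 1*pd b K (x - y))" if "b \<in> Basis" for b
    using that Suc by (intro Ck_mult[OF Ck_const]) auto
  moreover have "(%y. K (x - y)) differentiable (at y)" for y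
    using Suc.prems by (intro differentiable_compose[of K "%y. x - y"]) auto
  ultimately show ?case by auto
qed

lemma B2_mult_tendsto:
  fixes f :: "nat => 'a::euclidean_space => real"
  assumes f: "\<And>n. B2 (f n)" and g: "B2 g" and lim: "(%n. abs_rl2 (f n)) \<longlonglongrightarrow> abs_rl2 g"
    and m: "m \<in> borel_measurable borel" "\<And>x. \<bar>m x\<bar> <= M"
  shows "(%n. abs_rl2 (%x. m x*f n x)) \<longlonglongrightarrow> abs_rl2 (%x. m x*g x)"
proof -
  have M0: "M >= 0" using m(2)[of 0] by linarith
  have B: "B2 (%x. m x*f n x)" "B2 (%x. m x*g x)" for n using B2_bounded_mult(1)[OF _ m] f g by auto
  have "norm (abs_rl2 (%x. m x*f n x) - abs_rl2 (%x. m x*g x)) <= M*norm (abs_rl2 (f n) - abs_rl2 g)" for n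
  proof (rule power2_le_imp_le)
    have "(norm (abs_rl2 (%x. m x*f n x) - abs_rl2 (%x. m x*g x)))^2 = (LBINT x. (m x*(f n x - g x))^2)"
      by (simp add: abs_rl2_diff B2_L2fun B B2_norm[OF B2_diff[OF B]] right_diff_distrib)
    also have "\<dots> <= M^2*(LBINT x. (f n x - g x)^2)" by (rule B2_bounded_mult(2)[OF B2_diff[OF f g] m])
    also have "\<dots> = (M*norm (abs_rl2 (f n) - abs_rl2 g))^2"
      by (simp add: power_mult_distrib abs_rl2_diff B2_L2fun f g B2_norm[OF B2_diff[OF f g]])
    finally show "(norm (abs_rl2 (%x. m x*f n x) - abs_rl2 (%x. m x*g x)))^2 <= (M*norm (abs_rl2 (f n) - abs_rl2 g))^2" .
  qed (use M0 in simp)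
  moreover have "(%n. M*norm (abs_rl2 (f n) - abs_rl2 g)) \<longlonglongrightarrow> 0"
    using tendsto_mult_right_zero[OF tendsto_norm_zero[OF LIM_zero[OF lim]], of M] .
  ultimately have "(%n. abs_rl2 (%x. m x*f n x) - abs_rl2 (%x. m x*g x)) \<longlonglongrightarrow> 0"
    by (rule Lim_null_comparison[OF always_eventually[OF allI]])
  then show ?thesis by (rule LIM_zero_cancel)
qed

section \<open>Weak solutions with positive potential vanish\<close>

text \<open>The point is that \<open>C\<close> does not depend on \<open>R\<close>: the inner
  derivative is of size \<open>1/R\<close> on the ball of radius \<open>2 * R\<close>. Since the
  gradient lives where \<open>norm x >= R\<close>, boundedness without decay is already enough for
  the limit.\<close>

lemma cutoff_gradient:
  obtains C where "C >= 0" "\<And>(R::real) (x::'a::euclidean_space). R >= 1 ==>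
     (\<Sum>b\<in>Basis. (pd b (cutoff 0 (2 * R)) x)^2) <= C*indicator {x. norm x >= R} x"
proof -
  define s' where "s' = pd 1 step"
  have ds: "(step has_real_derivative s' t) (at t)" for t
  proof -
    have "step differentiable (at t)" using Ck_step[of "Suc 0"] by simp
    then have 1: "(step has_derivative (%v. pd v step t)) (at t)" by (rule has_derivative_pd)
    have "(%v. pd v step t) = (*) (s' t)"
    proof
      fix v show "pd v step t = s' t * v" unfolding s'_def
        using linear_scale[OF has_derivative_linear[OF 1], of v 1] by (simp add: mult.commute)
    qed
    then show ?thesis using 1 by (simp only: has_field_derivative_def)
  qed
  have s'0: "s' t = 0" if "\<bar>t\<bar> > 1" for t
  proof -
    have "eventually (%y. y \<in> {..<-1} \<union> {1<..}) (nhds t)" using that by (intro eventually_nhds_in_open) auto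
    have "eventually (%y. step y = (if t > 0 then 1 else 0)) (nhds t)"
    proof (cases "t > 0")
      case True
      then have "eventually (%y. y \<in> {1<..}) (nhds t)" using that by (intro eventually_nhds_in_open) auto
      then show ?thesis by (rule eventually_mono) (use True in \<open>auto simp: step_simps\<close>)
    next
      case False
      then have "eventually (%y. y \<in> {..<0}) (nhds t)" using that by (intro eventually_nhds_in_open) auto
      then show ?thesis by (rule eventually_mono) (use False in \<open>auto simp: step_simps\<close>)
    qed
    from pd_cong_eventually[OF this, of 1] show ?thesis by (simp add: s'_def)
  qed
  have "bsupp s'" unfolding bsupp_def using s'0 by (intro exI[of _ 1]) auto
  moreover have "continuous_on UNIV s'" using Ck_step[of "Suc 0"] by (simp add: s'_def)
  ultimately obtain S where S: "S > 0" "\<And>t. norm (s' t) <= S" using bsupp_bounded_continuous by metis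
  define D where "D = S*(4/3)"
  have pdc: "pd b (cutoff (0::'a) (2 * R)) x = s' (((2 * R)^2 - (norm x)^2)*(4/(3*(2 * R)^2)))*(- (2*(x \<bullet> b))*(4/(3*(2 * R)^2)))" for b x R
  proof -
    define c where "c = 4/(3*(2 * R)^2)"
    have "((%x::'a. ((2 * R)^2 - (norm (x - 0))^2)*c) has_derivative (%v. - (2*(x \<bullet> v))*c)) (at x)"
      unfolding power2_norm_eq_inner by (auto intro!: derivative_eq_intros simp: inner_commute)
    from has_derivative_compose[OF this ds[unfolded has_field_derivative_def]]
    have "(cutoff (0::'a) (2 * R) has_derivative (%v. s' (((2 * R)^2 - (norm (x - 0))^2)*c)*(- (2*(x \<bullet> v))*c))) (at x)"
      unfolding cutoff_def[abs_def] c_def .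
    from pd_eqI[OF this] show ?thesis by (simp add: c_def)
  qed
  show ?thesis
  proof (rule that[of "real DIM('a)*D^2"])
    fix R :: real and x :: 'a assume R: "R >= 1"
    consider "norm x < R" | "norm x >= R" "norm x <= 2 * R" | "norm x > 2 * R" by linarith
    then show "(\<Sum>b\<in>Basis. (pd b (cutoff 0 (2 * R)) x)^2) <= real DIM('a)*D^2*indicator {x. norm x >= R} x"
    proof cases
      case 1
      have "eventually (%y. y \<in> ball 0 R) (nhds x)" using 1 by (intro eventually_nhds_in_open) auto
      then have "eventually (%y. cutoff 0 (2 * R) y = 1) (nhds x)" by (rule eventually_mono) (use R in \<open>auto intro!: cutoff_inside\<close>)
      from pd_cong_eventually[OF this] have "pd b (cutoff 0 (2 * R)) x = 0" for b by simp
      then show ?thesis by simp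
    next
      case 2
      have "\<bar>pd b (cutoff 0 (2 * R)) x\<bar> <= D" if b: "b \<in> Basis" for b
      proof -
        have "\<bar>2*(x \<bullet> b)\<bar> <= 4 * R" using Basis_le_norm[OF b, of x] 2 by simp
        then have "\<bar>- (2*(x \<bullet> b))*(4/(3*(2 * R)^2))\<bar> <= 4 * R*(4/(3*(2 * R)^2))"
          unfolding abs_mult using R by (intro mult_mono) auto
        also have "\<dots> = 4/3*(1/R)" using R by (simp add: power2_eq_square field_simps)
        also have "\<dots> <= 4/3*1" using R by (intro mult_left_mono) auto
        finally have "\<bar>- (2*(x \<bullet> b))*(4/(3*(2 * R)^2))\<bar> <= 4/3" by simp
        then show ?thesis unfolding pdc D_def abs_mult[of "s' _"] using S by (intro mult_mono) auto
      qed
      then have "(pd b (cutoff 0 (2 * R)) x)^2 <= D^2" if "b \<in> Basis" for b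
        using that power_mono[of "\<bar>pd b (cutoff 0 (2 * R)) x\<bar>" D 2] by simp
      then have "(\<Sum>b\<in>Basis. (pd b (cutoff 0 (2 * R)) x)^2) <= real DIM('a)*D^2" by (rule sum_bounded_above)
      then show ?thesis using 2 by simp
    next
      case 3
      have "open {y::'a. norm y > 2 * R}" by (intro open_Collect_less continuous_intros)
      then have "eventually (%y. y \<in> {y::'a. norm y > 2 * R}) (nhds x)" using 3 by (intro eventually_nhds_in_open) auto
      then have "eventually (%y. cutoff 0 (2 * R) y = 0) (nhds x)" by (rule eventually_mono) (use R in \<open>auto intro!: cutoff_outside\<close>)
      from pd_cong_eventually[OF this] have "pd b (cutoff 0 (2 * R)) x = 0" for b by simp
      then show ?thesis by simp
    qed
  qed simp
qed

text \<open>Caccioppoli argument: testing \<open>h^2*lap w = W*w\<close> with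
  \<open>\<eta>^2*w\<close> bounds the integral of \<open>w^2\<close> over a ball by the gradient of
  \<open>\<eta>\<close> times the mass of \<open>w\<close> far out, which tends to zero. As
  \<open>w\<close> is only square integrable, the computation is done for mollifications.\<close>

lemma weak_solution_zero:
  fixes w W :: "'a::euclidean_space => real"
  assumes w: "B2 w" and W: "continuous_on UNIV W" "\<And>x. W x >= 1"
    and weak: "\<And>\<phi>. rtest \<phi> ==> (LBINT x. w x*(- h\<^sup>2*lap \<phi> x + W x*\<phi> x)) = 0"
  shows "AE x in lborel. w x = 0"
proof -
  obtain C where C: "C >= 0" "\<And>(R::real) (x::'a). R >= 1 ==>
     (\<Sum>b\<in>Basis. (pd b (cutoff 0 (2 * R)) x)^2) <= C*indicator {x. norm x >= R} x" using cutoff_gradient by metis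
  have wm[measurable]: "w \<in> borel_measurable borel" using w by (simp add: B2_def)
  have Wm[measurable]: "W \<in> borel_measurable borel" using W by (intro borel_measurable_continuous_onI)
  have iw: "integrable lborel (%x. (w x)^2)" using w by (simp add: B2_def)
  have key: "(LBINT x. indicator (cball 0 R) x*(w x)^2) <= h^2*C*(LBINT x. indicator {x. norm x >= R} x*(w x)^2)"
    if R: "R >= 1" for R
  proof -
    define \<eta> where "\<eta> = cutoff (0::'a) (2 * R)"
    have C\<eta>: "Ck_on UNIV k \<eta>" for k unfolding \<eta>_def by (rule Ck_cutoff)
    have c\<eta>: "continuous_on UNIV \<eta>" by (rule Ck_continuous[OF C\<eta>])
    have \<eta>m[measurable]: "\<eta> \<in> borel_measurable borel" by (rule borel_measurable_continuous_onI[OF c\<eta>])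
    have \<eta>b: "0 <= \<eta> x" "\<eta> x <= 1" for x by (auto simp: \<eta>_def cutoff_bounds)
    have b\<eta>: "bsupp \<eta>" unfolding bsupp_def \<eta>_def using R by (intro exI[of _ "2 * R"]) (auto intro!: cutoff_outside)
    \<comment> \<open>\<open>W\<close> may be unbounded, so \<open>W*w\<close> is localised to be
      square integrable. The radius \<open>2 * R + 1\<close> is the support of the cutoff plus the
      largest mollification radius.\<close>
    define I where "I = (%y::'a. indicator (cball 0 (2 * R + 1)) y :: real)"
    define g where "g = (%y. (W y*I y)*w y)"
    obtain B where B: "\<And>x. \<bar>W x*I x\<bar> <= B"
    proof -
      have "bounded (W ` cball 0 (2 * R + 1))"
        using W by (intro compact_imp_bounded compact_continuous_image) (auto intro: continuous_on_subset)
      then obtain B where "B > 0" "\<forall>y\<in>W ` cball 0 (2 * R + 1). norm y <= B" by (meson bounded_pos)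
      then show ?thesis by (intro that[of B]) (auto simp: I_def indicator_def)
    qed
    have Im[measurable]: "I \<in> borel_measurable borel" unfolding I_def by (intro borel_measurable_indicator) simp
    have B2g: "B2 g" unfolding g_def by (rule B2_bounded_mult(1)[OF w _ B]) measurable
    define k where "k = (%n. mollifier (1/real (Suc n)) :: 'a => real)"
    have k: "rtest (k n)" "\<And>z. norm z >= 1 ==> k n z = 0" for n
    proof -
      show "rtest (k n)" unfolding k_def by (rule mollifier_props) simp
      have "1/real (Suc n) <= 1" by simp
      then show "k n z = 0" if "norm z >= 1" for z unfolding k_def
        using that by (intro mollifier_props(4)[OF _ order_trans[OF \<open>1/real (Suc n) <= 1\<close> that]]) simp
    qed
    define wn where "wn = (%n. conv (k n) w)"
    define gn where "gn = (%n. conv (k n) g)"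
    have B2wn: "B2 (wn n)" and B2gn: "B2 (gn n)" for n
      unfolding wn_def gn_def k_def by (intro conv_L2_contraction(1) w B2g; simp)+
    have Cwn: "Ck_on UNIV j (wn n)" for j n unfolding wn_def by (rule Ck_conv[OF k(1) w])
    \<comment> \<open>The weak equation tested with the translated kernel \<open>k n (x - y)\<close>
      as a function of \<open>y\<close>.\<close>
    have eqn: "h^2*lap (wn n) x = gn n x" if x: "norm x <= 2 * R" for n x
    proof -
      define \<phi> where "\<phi> = (%y. k n (x - y))"
      have dk: "k n differentiable (at z)" "b \<in> Basis ==> pd b (k n) differentiable (at z)" for z b
        using rtest_differentiable k(1) rtest_pd by blast+
      have test: "rtest \<phi>" using k(1)[of n] unfolding rtest_def \<phi>_def smooth_on_def by (auto intro: Ck_reflect bsupp_reflect)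
      have pd1: "pd b \<phi> = (%y. - 1*pd b (k n) (x - y))" for b unfolding \<phi>_def using pd_reflect[OF dk(1)] by auto
      have pd2: "pd b (pd b \<phi>) y = pd b (pd b (k n)) (x - y)" if b: "b \<in> Basis" for b y
      proof -
        have d: "(%y. pd b (k n) (x - y)) differentiable (at y)"
          using dk(2)[OF b] by (intro differentiable_compose[of "pd b (k n)" "%y. x - y"]) auto
        show ?thesis unfolding pd1 by (subst pd_mult[OF differentiable_const d]) (simp add: pd_reflect[OF dk(2)[OF b]])
      qed
      have lapphi: "lap \<phi> y = (\<Sum>b\<in>Basis. pd b (pd b (k n)) (x - y))" for y unfolding lap_def by (intro sum.cong) (auto simp: pd2)
      have rt2: "rtest (pd b (pd b (k n)))" if "b \<in> Basis" for b using k(1) rtest_pd that by blast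
      have i2: "integrable lborel (%y. pd b (pd b (k n)) (x - y)*w y)" if "b \<in> Basis" for b
        using rt2[OF that] w by (intro conv_integrable) (auto simp: rtest_continuous, auto simp: rtest_def)
      have "lap (wn n) x = (\<Sum>b\<in>Basis. conv (pd b (pd b (k n))) w x)"
        unfolding lap_def
      proof (rule sum.cong[OF refl])
        fix b :: 'a assume b: "b \<in> Basis"
        have "pd b (wn n) = conv (pd b (k n)) w" unfolding wn_def using pd_conv[OF k(1) w b] by auto
        then show "pd b (pd b (wn n)) x = conv (pd b (pd b (k n))) w x" using pd_conv[OF rtest_pd[OF k(1) b] w b] by simp
      qed
      also have "\<dots> = (LBINT y. (\<Sum>b\<in>Basis. pd b (pd b (k n)) (x - y)*w y))"
        unfolding conv_def using i2 by (intro Bochner_Integration.integral_sum[symmetric])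
      also have "\<dots> = (LBINT y. w y*lap \<phi> y)" by (simp add: lapphi sum_distrib_left mult.commute)
      finally have l: "lap (wn n) x = (LBINT y. w y*lap \<phi> y)" .
      have il: "integrable lborel (%y. w y*lap \<phi> y)"
        using Bochner_Integration.integrable_sum[OF i2, of Basis "%b. b"] by (simp add: lapphi sum_distrib_left mult.commute)
      have gphi: "w y*(W y*\<phi> y) = k n (x - y)*g y" for y
      proof (cases "norm y <= 2 * R + 1")
        case False
        have "norm (x - y) >= 1" using False x norm_triangle_ineq2[of y x] by (simp add: norm_minus_commute)
        then show ?thesis using k(2) by (simp add: \<phi>_def)
      qed (simp add: g_def I_def \<phi>_def)
      have ig: "integrable lborel (%y. w y*(W y*\<phi> y))" unfolding gphi
        using k(1) B2g by (intro conv_integrable) (auto simp: rtest_continuous, auto simp: rtest_def)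
      have "0 = (LBINT y. - h\<^sup>2*(w y*lap \<phi> y) + w y*(W y*\<phi> y))"
        using weak[OF test] by (simp add: algebra_simps)
      also have "\<dots> = - h\<^sup>2*lap (wn n) x + gn n x"
        using il ig by (simp add: l gn_def conv_def gphi)
      finally show ?thesis by simp
    qed
    have parts: "(LBINT x. ((\<eta> x)^2*wn n x)*gn n x) <= h^2*C*(LBINT x. (indicator {x. norm x >= R} x*wn n x)*wn n x)" for n
    proof -
      define Z where "Z = (%b x. \<eta> x*\<eta> x*wn n x*pd b (wn n) x)"
      have Cp: "Ck_on UNIV j (pd b (wn n))" if "b \<in> Basis" for b j using Cwn[of "Suc j"] that by simp
      have CZ: "Ck_on UNIV (Suc 0) (Z b)" if "b \<in> Basis" for b
        unfolding Z_def using that by (intro Ck_mult C\<eta> Cwn Cp)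
      have bZ: "bsupp (Z b)" for b unfolding Z_def by (intro bsupp_mult_left b\<eta>)
      \<comment> \<open>Completing the square: in the divergence only
        \<open>(pd b \<eta> x)^2*(wn n x)^2\<close> enters with the wrong sign.\<close>
      have pdZ: "pd b (Z b) x = (\<eta> x*pd b (wn n) x + pd b \<eta> x*wn n x)^2 - (pd b \<eta> x)^2*(wn n x)^2 + (\<eta> x)^2*wn n x*pd b (pd b (wn n)) x"
        if b: "b \<in> Basis" for b x
      proof -
        note d = Ck1_differentiable[OF C\<eta>] Ck1_differentiable[OF Cwn] Ck1_differentiable[OF Cp[OF b]]
        have d1: "(%x. \<eta> x*\<eta> x) differentiable (at x)" "(%x. \<eta> x*\<eta> x*wn n x) differentiable (at x)"
          by (intro differentiable_mult d)+
        show ?thesis unfolding Z_def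
          by (simp only: pd_mult[OF d1(2) d(3)] pd_mult[OF d1(1) d(2)] pd_mult[OF d(1) d(1)]) (simp add: power2_eq_square algebra_simps)
      qed
      note div = integral_divergence_eq_0[of Z, OF CZ bZ]
      define P where "P = (%x. ((\<eta> x)^2*wn n x)*lap (wn n) x)"
      have cl: "continuous_on UNIV (lap (wn n))"
        unfolding lap_def[abs_def] using Cp[of _ "Suc 0"] by (intro continuous_on_sum) auto
      have iP: "integrable lborel P" unfolding P_def
        by (intro integrable_bsupp continuous_intros c\<eta> Ck_continuous[OF Cwn] cl bsupp_mult_left bsupp_power b\<eta>)
      have iR: "integrable lborel (%x. C*((indicator {x. norm x >= R} x*wn n x)*wn n x))"
        by (intro integrable_mult_right B2_mult B2_bounded_mult(1)[where M=1] B2wn) (auto intro!: borel_measurable_indicator simp: indicator_def)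
      have "(LBINT x. P x) = (LBINT x. P x - (\<Sum>b\<in>Basis. pd b (Z b) x))" using iP div by simp
      also have "\<dots> <= (LBINT x. C*((indicator {x. norm x >= R} x*wn n x)*wn n x))"
      proof (rule integral_mono)
        fix x
        have "P x - (\<Sum>b\<in>Basis. pd b (Z b) x) = (\<Sum>b\<in>Basis. (\<eta> x)^2*wn n x*pd b (pd b (wn n)) x - pd b (Z b) x)"
          unfolding P_def lap_def by (simp add: sum_distrib_left sum_subtractf)
        also have "\<dots> <= (\<Sum>b\<in>Basis. (pd b \<eta> x)^2*(wn n x)^2)" by (intro sum_mono) (simp add: pdZ)
        also have "\<dots> = (\<Sum>b\<in>Basis. (pd b \<eta> x)^2)*(wn n x)^2" by (simp add: sum_distrib_right)
        also have "\<dots> <= (C*indicator {x. norm x >= R} x)*(wn n x)^2" unfolding \<eta>_def by (intro mult_right_mono C R) auto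
        finally show "P x - (\<Sum>b\<in>Basis. pd b (Z b) x) <= C*((indicator {x. norm x >= R} x*wn n x)*wn n x)"
          by (simp add: power2_eq_square mult.assoc)
      qed (use iP div iR in auto)
      finally have "h^2*(LBINT x. P x) <= h^2*(C*(LBINT x. (indicator {x. norm x >= R} x*wn n x)*wn n x))"
        by (intro mult_left_mono) auto
      moreover have "((\<eta> x)^2*wn n x)*gn n x = h^2*P x" for x
      proof (cases "norm x <= 2 * R")
        case False
        then have "\<eta> x = 0" unfolding \<eta>_def using R by (intro cutoff_outside) auto
        then show ?thesis by (simp add: P_def)
      qed (simp add: P_def eqn[symmetric])
      ultimately show ?thesis by (simp add: mult.assoc)
    qed
    have lw: "(%n. abs_rl2 (wn n)) \<longlonglongrightarrow> abs_rl2 w" unfolding wn_def k_def by (rule conv_L2_tendsto[OF w])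
    have lg: "(%n. abs_rl2 (gn n)) \<longlonglongrightarrow> abs_rl2 g" unfolding gn_def k_def by (rule conv_L2_tendsto[OF B2g])
    have e2: "\<bar>(\<eta> x)\<^sup>2\<bar> <= 1" for x using \<eta>b[of x] by (simp add: power_le_one)
    have Jm: "(%x::'a. indicator {x. norm x >= R} x :: real) \<in> borel_measurable borel" by (intro borel_measurable_indicator) auto
    have J1: "\<bar>indicator {x. norm x >= R} x :: real\<bar> <= 1" for x :: 'a by (simp add: indicator_def)
    have e2m: "(%x. (\<eta> x)^2) \<in> borel_measurable borel" by measurable
    have "(LBINT x. ((\<eta> x)^2*w x)*g x) <= h^2*C*(LBINT x. (indicator {x. norm x >= R} x*w x)*w x)"
    proof (rule LIMSEQ_le)
      show "(%n. \<integral>x. ((\<eta> x)^2*wn n x)*gn n x \<partial>lborel) \<longlonglongrightarrow> (LBINT x. ((\<eta> x)^2*w x)*g x)"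
        using tendsto_inner[OF B2_mult_tendsto[OF B2wn w lw e2m e2] lg]
        by (simp add: B2_inner B2_bounded_mult(1)[OF B2wn e2m e2] B2_bounded_mult(1)[OF w e2m e2] B2gn B2g)
      have "(%n. \<integral>x. (indicator {x. norm x >= R} x*wn n x)*wn n x \<partial>lborel) \<longlonglongrightarrow> (LBINT x. (indicator {x. norm x >= R} x*w x)*w x)"
        using tendsto_inner[OF B2_mult_tendsto[OF B2wn w lw Jm J1] lw]
        by (simp add: B2_inner B2_bounded_mult(1)[OF B2wn Jm J1] B2_bounded_mult(1)[OF w Jm J1] B2wn w)
      then show "(%n. h^2*C*(LBINT x. (indicator {x. norm x >= R} x*wn n x)*wn n x)) \<longlonglongrightarrow> h\<^sup>2*C*(LBINT x. (indicator {x. norm x >= R} x*w x)*w x)"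
        by (intro tendsto_intros)
    qed (use parts in auto)
    moreover have "(LBINT x. indicator (cball 0 R) x*(w x)^2) <= (LBINT x. ((\<eta> x)^2*w x)*g x)"
    proof (rule integral_mono)
      show "integrable lborel (%x. indicator (cball 0 R) x*(w x)^2)"
        using integrable_real_mult_indicator[OF _ iw, of "cball 0 R"] by (simp add: mult.commute)
      show "integrable lborel (%x. ((\<eta> x)^2*w x)*g x)" by (intro B2_mult B2_bounded_mult(1)[OF w e2m e2] B2g)
      fix x
      show "indicator (cball 0 R) x*(w x)^2 <= ((\<eta> x)^2*w x)*g x"
      proof (cases "norm x <= R")
        case True
        have "\<eta> x = 1" unfolding \<eta>_def using R True by (intro cutoff_inside) auto
        moreover have "I x = 1" using True R by (simp add: I_def)
        moreover have "1*(w x)^2 <= W x*(w x)^2" using W(2) by (intro mult_right_mono) auto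
        ultimately show ?thesis using True by (simp add: g_def power2_eq_square mult_ac)
      next
        case False
        have "0 <= (\<eta> x)^2*(W x*I x)*(w x)^2" using W(2)[of x] by (intro mult_nonneg_nonneg) (auto simp: I_def)
        then show ?thesis using False by (simp add: g_def power2_eq_square mult_ac)
      qed
    qed
    ultimately show ?thesis by (simp add: power2_eq_square mult.assoc)
  qed
  \<comment> \<open>Let the radius run through \<open>real (Suc n)\<close> in \<open>key\<close>:
    the left side increases to the full mass, the right side is the tail of an integrable
    function.\<close>
  have "(LBINT x. (w x)^2) <= h^2*C*(\<integral>x. 0 \<partial>(lborel::'a measure))"
  proof (rule LIMSEQ_le)
    show "(%n. \<integral>x. indicator (cball 0 (real (Suc n))) x*(w x)^2 \<partial>lborel) \<longlonglongrightarrow> (LBINT x. (w x)^2)"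
    proof (rule integral_dominated_convergence[where w="%x. (w x)^2"])
      show "AE x in lborel. (%n. indicator (cball 0 (real (Suc n))) x*(w x)^2) \<longlonglongrightarrow> (w x)\<^sup>2"
      proof (rule AE_I2, rule tendsto_eventually)
        fix x :: 'a
        obtain N where "real N >= norm x" using real_arch_simple by blast
        then show "\<forall>\<^sub>F n in sequentially. indicator (cball 0 (real (Suc n))) x*(w x)^2 = (w x)^2"
          unfolding eventually_sequentially by (intro exI[of _ N]) (auto simp: indicator_def)
      qed
    qed (use iw in \<open>auto simp: indicator_def\<close>)
    have "(%n. \<integral>x. indicator {x. norm x >= real (Suc n)} x*(w x)^2 \<partial>lborel) \<longlonglongrightarrow> (\<integral>x. 0 \<partial>(lborel::'a measure))"
    proof (rule integral_dominated_convergence[where w="%x. (w x)^2"])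
      show "AE x in lborel. (%n. indicator {x. norm x >= real (Suc n)} x*(w x)^2) \<longlonglongrightarrow> 0"
      proof (rule AE_I2, rule tendsto_eventually)
        fix x :: 'a
        obtain N where "real N >= norm x" using real_arch_simple by blast
        then show "\<forall>\<^sub>F n in sequentially. indicator {x. norm x >= real (Suc n)} x*(w x)^2 = 0"
          unfolding eventually_sequentially by (intro exI[of _ N]) (auto simp: indicator_def)
      qed
    qed (use iw in \<open>auto simp: indicator_def\<close>)
    then show "(%n. h^2*C*(LBINT x. indicator {x. norm x >= real (Suc n)} x*(w x)^2)) \<longlonglongrightarrow> h\<^sup>2*C*(\<integral>x. 0 \<partial>(lborel::'a measure))"
      by (intro tendsto_intros)
  qed (use key in auto)
  then have "(LBINT x. (w x)^2) <= 0" by simp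
  moreover have "(LBINT x. (w x)^2) >= 0" by (intro integral_nonneg_AE) auto
  ultimately have "(LBINT x. (w x)^2) = 0" by simp
  then show ?thesis using integral_nonneg_eq_0_iff_AE[OF iw] by auto
qed

section \<open>A one-sided change of variables for maps that do not contract too much\<close>

text \<open>Two points of the preimage of a cube of side \<open>s\<close> have distance at most
  \<open>L\<close> times the diameter bound \<open>DIM('a) * s\<close>, so one cube of twice that
  radius around any of them contains the preimage.\<close>

lemma emeasure_cube_preimage:
  fixes \<psi> :: "'a::euclidean_space => 'a"
  assumes expand: "\<And>x y. x \<in> Om ==> y \<in> Om ==> norm (x - y) <= L*norm (\<psi> x - \<psi> y)" and L: "L > 0"
    and cube: "\<And>i. i \<in> Basis ==> v \<bullet> i - u \<bullet> i = s" and s: "s > 0"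
  shows "\<exists>a b. {x \<in> Om. \<psi> x \<in> cbox u v} \<subseteq> cbox a b \<and>
     emeasure lborel (cbox a b) <= ennreal ((2*L*real DIM('a))^DIM('a))*emeasure lborel (cbox u v)"
proof (cases "{x \<in> Om. \<psi> x \<in> cbox u v} = {}")
  case True
  then show ?thesis by (intro exI[of _ One] exI[of _ "-One::'a"]) (auto simp: emeasure_lborel_cbox_eq)
next
  case False
  then obtain p where p: "p \<in> Om" "\<psi> p \<in> cbox u v" by auto
  define rh where "rh = L*(real DIM('a) * s)"
  have rh: "rh > 0" using L s by (simp add: rh_def)
  have near: "norm (x - p) <= rh" if "x \<in> Om" "\<psi> x \<in> cbox u v" for x
  proof -
    have "norm (\<psi> x - \<psi> p) <= (\<Sum>i\<in>Basis. \<bar>(\<psi> x - \<psi> p) \<bullet> i\<bar>)" by (rule norm_le_l1)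
    also have "\<dots> <= (\<Sum>i\<in>(Basis::'a set). s)"
    proof (rule sum_mono)
      fix i :: 'a assume i: "i \<in> Basis"
      have "u \<bullet> i <= \<psi> x \<bullet> i" "\<psi> x \<bullet> i <= v \<bullet> i" "u \<bullet> i <= \<psi> p \<bullet> i" "\<psi> p \<bullet> i <= v \<bullet> i"
        using that(2) p(2) i by (auto simp: mem_box)
      then show "\<bar>(\<psi> x - \<psi> p) \<bullet> i\<bar> <= s" using cube[OF i] by (simp add: inner_diff_left)
    qed
    finally have "L*norm (\<psi> x - \<psi> p) <= L*(real DIM('a) * s)" using L by (intro mult_left_mono) auto
    then show ?thesis using expand[OF that(1) p(1)] by (simp add: rh_def)
  qed
  let ?a = "p - rh *\<^sub>R One" and ?b = "p + rh *\<^sub>R One"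
  have "{x \<in> Om. \<psi> x \<in> cbox u v} \<subseteq> cbox ?a ?b"
  proof
    fix x assume "x \<in> {x \<in> Om. \<psi> x \<in> cbox u v}"
    then have "norm (x - p) <= rh" using near by auto
    then have "\<bar>(x - p) \<bullet> i\<bar> <= rh" if "i \<in> Basis" for i using Basis_le_norm[OF that, of "x - p"] by linarith
    then show "x \<in> cbox ?a ?b" by (auto simp: mem_box inner_diff_left inner_add_left abs_le_iff algebra_simps)
  qed
  moreover have "emeasure lborel (cbox ?a ?b) = ennreal ((2*rh)^DIM('a))"
    using rh by (subst emeasure_lborel_cbox) (auto simp: inner_diff_left inner_add_left)
  moreover have "emeasure lborel (cbox u v) = ennreal (s^DIM('a))"
    using cube s by (subst emeasure_lborel_cbox) (auto simp: inner_diff_left, smt (verit) cube)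
  moreover have "(2*rh)^DIM('a) = (2*L*real DIM('a))^DIM('a) * s^DIM('a)"
    by (simp add: rh_def power_mult_distrib[symmetric] mult_ac)
  ultimately have "emeasure lborel (cbox ?a ?b) <= ennreal ((2*L*real DIM('a))^DIM('a))*emeasure lborel (cbox u v)"
    using L s by (simp add: ennreal_mult)
  then show ?thesis using \<open>_ \<subseteq> cbox ?a ?b\<close> by blast
qed

text \<open>Cover \<open>B\<close> inside an open set of nearly the same measure by dyadic cubes
  with disjoint interiors, apply the cube estimate to each one, and use outer regularity.\<close>

lemma emeasure_preimage_le:
  fixes \<psi> :: "'a::euclidean_space => 'a"
  assumes expand: "\<And>x y. x \<in> Om ==> y \<in> Om ==> norm (x - y) <= L*norm (\<psi> x - \<psi> y)" and L: "L > 0"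
    and B: "B \<in> sets borel" "bounded B" and A: "{x \<in> Om. \<psi> x \<in> B} \<in> sets borel"
  shows "emeasure lborel {x \<in> Om. \<psi> x \<in> B} <= ennreal ((2*L*real DIM('a))^DIM('a))*emeasure lborel B"
proof -
  let ?C = "(2*L*real DIM('a))^DIM('a)"
  have C0: "?C > 0" using L by simp
  obtain n where n: "n > 0" "\<And>x. x \<in> B ==> norm x <= n" using B(2) by (meson bounded_pos)
  let ?a = "- n *\<^sub>R One :: 'a" and ?b = "n *\<^sub>R One :: 'a"
  have Bsub: "B \<subseteq> cbox ?a ?b"
  proof
    fix x assume "x \<in> B"
    then have "\<bar>x \<bullet> i\<bar> <= n" if "i \<in> Basis" for i using n(2) Basis_le_norm[OF that, of x] by fastforce
    then show "x \<in> cbox ?a ?b" by (auto simp: mem_box abs_le_iff) (metis minus_le_iff)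
  qed
  have main: "emeasure lborel {x \<in> Om. \<psi> x \<in> B} <= ennreal ?C*emeasure lborel S" if S: "open S" "B \<subseteq> S" for S
  proof -
    \<comment> \<open>Each cube of the covering lies in \<open>ga x\<close> for some
      \<open>x\<close> of \<open>B\<close>; this gauge therefore keeps all cubes inside
      \<open>S\<close>.\<close>
    define ga where "ga = (%x. if x \<in> S then S else UNIV)"
    have gauge: "gauge ga" using S by (auto simp: gauge_def ga_def)
    have ne: "box ?a ?b \<noteq> {}" using n by (auto simp: box_ne_empty)
    obtain \<D> where D: "countable \<D>" "\<And>K. K \<in> \<D> ==> interior K \<noteq> {} \<and> (\<exists>c d. K = cbox c d)"
      "pairwise (%A B. interior A \<inter> interior B = {}) \<D>" "\<And>K. K \<in> \<D> ==> \<exists>x \<in> B \<inter> K. K \<subseteq> ga x"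
      "\<And>u v. cbox u v \<in> \<D> ==> \<exists>k. \<forall>i \<in> Basis. v \<bullet> i - u \<bullet> i = (?b \<bullet> i - ?a \<bullet> i)/2^k" "B \<subseteq> \<Union>\<D>"
      using covering_lemma[OF Bsub ne gauge] by metis
    have KO: "K \<subseteq> S" if K: "K \<in> \<D>" for K
    proof -
      obtain x where x: "x \<in> B" "K \<subseteq> ga x" using D(4)[OF K] by blast
      then have "ga x = S" using S by (auto simp: ga_def)
      then show ?thesis using x by simp
    qed
    \<comment> \<open>Comparison with the interiors, because only these are disjoint; a box and its
      interior have the same measure.\<close>
    have "\<forall>K\<in>\<D>. \<exists>E. {x \<in> Om. \<psi> x \<in> K} \<subseteq> E \<and> E \<in> sets borel \<and> emeasure lborel E <= ennreal ?C*emeasure lborel (interior K)"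
    proof
      fix K assume K: "K \<in> \<D>"
      then obtain u v where uv: "K = cbox u v" using D(2) by blast
      obtain k where k: "\<forall>i \<in> Basis. v \<bullet> i - u \<bullet> i = (?b \<bullet> i - ?a \<bullet> i)/2^k" using D(5) K uv by blast
      have side: "v \<bullet> i - u \<bullet> i = 2*n/2^k" if "i \<in> Basis" for i using k that by simp
      obtain a b where ab: "{x \<in> Om. \<psi> x \<in> cbox u v} \<subseteq> cbox a b"
        "emeasure lborel (cbox a b) <= ennreal ?C*emeasure lborel (cbox u v)"
        using emeasure_cube_preimage[where Om=Om and \<psi>=\<psi> and u=u and v=v, OF expand L side _] n
        by (metis (no_types, lifting) divide_pos_pos mult_pos_pos zero_less_numeral zero_less_power)
      have "emeasure lborel (cbox u v) = emeasure lborel (interior K)"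
        by (simp add: uv interior_cbox emeasure_lborel_box_eq emeasure_lborel_cbox_eq)
      then show "\<exists>E. {x \<in> Om. \<psi> x \<in> K} \<subseteq> E \<and> E \<in> sets borel \<and> emeasure lborel E <= ennreal ?C*emeasure lborel (interior K)"
        using ab by (intro exI[of _ "cbox a b"]) (auto simp: uv)
    qed
    from bchoice[OF this] obtain E where "\<forall>K\<in>\<D>. {x \<in> Om. \<psi> x \<in> K} \<subseteq> E K \<and> E K \<in> sets borel \<and>
        emeasure lborel (E K) <= ennreal ?C*emeasure lborel (interior K)" by auto
    then have E: "\<And>K. K \<in> \<D> ==> {x \<in> Om. \<psi> x \<in> K} \<subseteq> E K" "\<And>K. K \<in> \<D> ==> E K \<in> sets borel"
      "\<And>K. K \<in> \<D> ==> emeasure lborel (E K) <= ennreal ?C*emeasure lborel (interior K)" by blast+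
    define J where "J = to_nat_on \<D> ` \<D>"
    define X where "X = (%i. from_nat_into \<D> i)"
    have XJ: "X i \<in> \<D>" if "i \<in> J" for i using that D(1) by (auto simp: J_def X_def)
    have cover: "\<exists>i\<in>J. X i = K" if "K \<in> \<D>" for K using that D(1) by (auto simp: J_def X_def)
    have inj: "X i \<noteq> X j" if "i \<in> J" "j \<in> J" "i \<noteq> j" for i j using that D(1) by (auto simp: J_def X_def)
    define E' where "E' = (%i. if i \<in> J then E (X i) else {})"
    define I' where "I' = (%i. if i \<in> J then interior (X i) else {})"
    have "{x \<in> Om. \<psi> x \<in> B} \<subseteq> (\<Union>i. E' i)"
    proof
      fix x assume x: "x \<in> {x \<in> Om. \<psi> x \<in> B}"
      then obtain K where K: "K \<in> \<D>" "\<psi> x \<in> K" using D(6) by blast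
      then obtain i where "i \<in> J" "X i = K" using cover by blast
      then show "x \<in> (\<Union>i. E' i)" using E(1)[OF K(1)] x K by (auto simp: E'_def)
    qed
    then have "emeasure lborel {x \<in> Om. \<psi> x \<in> B} <= emeasure lborel (\<Union>i. E' i)"
      using E(2) XJ by (intro emeasure_mono) (auto simp: E'_def)
    also have "\<dots> <= (\<Sum>i. emeasure lborel (E' i))"
      using E(2) XJ by (intro emeasure_subadditive_countably) (auto simp: E'_def)
    also have "\<dots> <= (\<Sum>i. ennreal ?C*emeasure lborel (I' i))"
      using E(3) XJ by (intro suminf_le) (auto simp: E'_def I'_def)
    also have "\<dots> = ennreal ?C*(\<Sum>i. emeasure lborel (I' i))" by simp
    also have "(\<Sum>i. emeasure lborel (I' i)) = emeasure lborel (\<Union>i. I' i)"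
    proof (rule suminf_emeasure)
      show "range I' \<subseteq> sets lborel" by (auto simp: I'_def)
      show "disjoint_family I'"
        using D(3) XJ inj by (fastforce simp: disjoint_family_on_def I'_def pairwise_def)
    qed
    also have "emeasure lborel (\<Union>i. I' i) <= emeasure lborel S"
      using S KO XJ interior_subset by (intro emeasure_mono) (fastforce simp: I'_def split: if_splits)+
    finally show ?thesis by (simp add: mult_left_mono)
  qed
  show ?thesis
  proof (rule ennreal_le_epsilon)
    fix e :: real assume e: "e > 0"
    obtain S where S: "open S" "B \<subseteq> S" "emeasure lborel (S - B) < ennreal (e / ?C)"
      using outer_regular_lborel[of B "e / ?C"] B(1) e C0 by auto
    have "emeasure lborel S = emeasure lborel B + emeasure lborel (S - B)"
      using S B by (subst plus_emeasure) (auto simp: Un_absorb1)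
    also have "\<dots> <= emeasure lborel B + ennreal (e / ?C)" using S(3) by (intro add_left_mono) auto
    finally have "ennreal ?C*emeasure lborel S <= ennreal ?C*(emeasure lborel B + ennreal (e / ?C))" by (rule mult_left_mono) simp
    also have "\<dots> = ennreal ?C*emeasure lborel B + ennreal e"
    proof -
      have "ennreal c*(m + ennreal (e/c)) = ennreal c*m + ennreal e" if "c > 0" for c m
        using that e by (simp add: distrib_left ennreal_mult[symmetric])
      then show ?thesis using C0 by blast
    qed
    finally show "emeasure lborel {x \<in> Om. \<psi> x \<in> B} <= ennreal ?C*emeasure lborel B + ennreal e"
      using main[OF S(1,2)] by (rule order_trans[rotated])
  qed
qed

text \<open>The measure estimate says that the push-forward of Lebesgue measure on \<open>Om\<close>
  is dominated by a multiple of Lebesgue measure on \<open>Om'\<close>; integrate \<open>F\<close>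
  against both.\<close>

lemma nn_integral_substitution_le:
  fixes \<psi> :: "'a::euclidean_space => 'a" and F :: "'a => ennreal"
  assumes expand: "\<And>x y. x \<in> Om ==> y \<in> Om ==> norm (x - y) <= L*norm (\<psi> x - \<psi> y)" and L: "L > 0"
    and Om: "Om \<in> sets borel" and Om': "Om' \<in> sets borel" "bounded Om'" "\<psi> ` Om \<subseteq> Om'"
    and m: "continuous_on Om \<psi>" and F: "F \<in> borel_measurable borel"
  shows "(\<integral>\<^sup>+x. F (\<psi> x)*indicator Om x \<partial>lborel)
     <= ennreal ((2*L*real DIM('a))^DIM('a))*(\<integral>\<^sup>+x. F x*indicator Om' x \<partial>lborel)"
proof -
  let ?C = "ennreal ((2*L*real DIM('a))^DIM('a))"
  let ?R = "restrict_space lborel Om"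
  have mm: "\<psi> \<in> measurable ?R borel"
    using m by (auto intro: borel_measurable_continuous_on_restrict simp: measurable_cong_sets[OF sets_restrict_space_cong[OF sets_lborel] refl])
  define \<mu> where "\<mu> = distr ?R borel \<psi>"
  define \<nu> where "\<nu> = density lborel (%x. ?C*indicator Om' x)"
  have "(\<integral>\<^sup>+x. F (\<psi> x)*indicator Om x \<partial>lborel) = (\<integral>\<^sup>+x. F (\<psi> x) \<partial>?R)"
    using Om by (subst nn_integral_restrict_space) auto
  also have "\<dots> = (\<integral>\<^sup>+x. F x \<partial>\<mu>)" unfolding \<mu>_def using mm F by (subst nn_integral_distr) auto
  also have "\<dots> <= (\<integral>\<^sup>+x. F x \<partial>\<nu>)"
  proof (rule nn_integral_mono_measure)
    show "sets \<mu> = sets \<nu>" by (simp add: \<mu>_def \<nu>_def)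
    show "\<mu> <= \<nu>"
    proof (subst le_measure)
      show "sets \<mu> = sets \<nu>" by (simp add: \<mu>_def \<nu>_def)
      show "\<forall>A\<in>sets \<mu>. emeasure \<mu> A <= emeasure \<nu> A"
      proof
        fix A assume "A \<in> sets \<mu>"
        then have A: "A \<in> sets borel" by (simp add: \<mu>_def)
        have pre: "\<psi> -` A \<inter> space ?R = {x \<in> Om. \<psi> x \<in> A \<inter> Om'}" using Om'(3) by (auto simp: space_restrict_space)
        have ms: "\<psi> -` A \<inter> space ?R \<in> sets ?R" using measurable_sets[OF mm A] .
        then have mb: "{x \<in> Om. \<psi> x \<in> A \<inter> Om'} \<in> sets borel" unfolding pre using Om by (auto simp: sets_restrict_space_iff)
        have "emeasure \<mu> A = emeasure lborel {x \<in> Om. \<psi> x \<in> A \<inter> Om'}"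
          unfolding \<mu>_def emeasure_distr[OF mm A] pre using Om by (subst emeasure_restrict_space) auto
        also have "\<dots> <= ?C*emeasure lborel (A \<inter> Om')"
          using A Om' mb by (intro emeasure_preimage_le[OF expand L]) (auto intro: bounded_subset)
        also have "\<dots> = emeasure \<nu> A"
          unfolding \<nu>_def using A Om'
          by (subst emeasure_density) (auto simp: mult.assoc nn_integral_cmult indicator_inter_arith[symmetric] Int_commute)
        finally show "emeasure \<mu> A <= emeasure \<nu> A" .
      qed
    qed
  qed
  also have "\<dots> = (\<integral>\<^sup>+x. (?C*indicator Om' x)*F x \<partial>lborel)" unfolding \<nu>_def using F Om' by (intro nn_integral_density) auto
  also have "\<dots> = ?C*(\<integral>\<^sup>+x. F x*indicator Om' x \<partial>lborel)"
    using F Om' by (subst nn_integral_cmult[symmetric]) (auto simp: mult_ac)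
  finally show ?thesis .
qed

section \<open>Bi-Lipschitz charts\<close>

lemma pd_norm_le_lipschitz:
  fixes f :: "'a::euclidean_space => 'b::real_normed_vector"
  assumes d: "f differentiable (at x)" and S: "open S" "x \<in> S"
    and lip: "\<And>y. y \<in> S ==> norm (f y - f x) <= L*norm (y - x)"
  shows "norm (pd v f x) <= L*norm v"
proof (cases "v = 0")
  case True
  have "linear (%v. pd v f x)" by (rule has_derivative_linear[OF has_derivative_pd[OF d]])
  then show ?thesis using True linear_0 by fastforce
next
  case False
  have lin: "linear (%v. pd v f x)" by (rule has_derivative_linear[OF has_derivative_pd[OF d]])
  have "norm (pd v f x)/norm v <= L + e" if e: "e > 0" for e
  proof -
    obtain \<delta> where \<delta>: "\<delta> > 0" "\<And>y. norm (y - x) < \<delta> ==> norm (f y - f x - pd (y - x) f x) <= e*norm (y - x)"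
      using has_derivative_pd[OF d] e unfolding has_derivative_at_alt by blast
    obtain rh where rh: "rh > 0" "ball x rh \<subseteq> S" using S openE by blast
    define t where "t = min \<delta> rh/(2*norm v)"
    have t: "t > 0" using \<delta> rh False by (simp add: t_def)
    have tv: "t*norm v < \<delta>" "t*norm v < rh" using \<delta> rh False by (auto simp: t_def)
    have "x + t *\<^sub>R v \<in> S" using rh(2) tv t by (auto simp: dist_norm subset_eq)
    from lip[OF this] have 1: "norm (f (x + t *\<^sub>R v) - f x) <= L*(t*norm v)" using t by simp
    have 2: "norm (f (x + t *\<^sub>R v) - f x - pd (t *\<^sub>R v) f x) <= e*(t*norm v)"
      using \<delta>(2)[of "x + t *\<^sub>R v"] tv t by simp
    have "norm (pd (t *\<^sub>R v) f x) <= norm (f (x + t *\<^sub>R v) - f x) + norm (f (x + t *\<^sub>R v) - f x - pd (t *\<^sub>R v) f x)"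
      using norm_triangle_ineq4[of "f (x + t *\<^sub>R v) - f x" "f (x + t *\<^sub>R v) - f x - pd (t *\<^sub>R v) f x"] by simp
    also have "\<dots> <= (L + e)*(t*norm v)" using 1 2 by (simp add: distrib_right)
    finally have "t*norm (pd v f x) <= t*((L + e)*norm v)"
      using t by (simp add: linear_scale[OF lin] mult_ac)
    then have "norm (pd v f x) <= (L + e)*norm v" using t by simp
    then show ?thesis using False by (simp add: divide_le_eq)
  qed
  then have "norm (pd v f x)/norm v <= L" by (rule field_le_epsilon)
  then show ?thesis using False by (simp add: divide_le_eq)
qed

text \<open>\<open>U\<close> maps coordinates in \<open>W\<close> to points in \<open>N\<close>, and
  \<open>g\<close> is its inverse. Convexity of \<open>W\<close> serves mean value arguments; the
  common constant \<open>L\<close> bounds \<open>U\<close>, \<open>g\<close> and their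
  derivatives.\<close>

locale chart =
  fixes x0 :: "'a::euclidean_space" and U g :: "'a => 'a" and W N :: "'a set" and L :: real
  assumes oW: "open W" and cW: "convex W" and x0W: "x0 \<in> W" and oN: "open N"
    and Ux0: "U x0 = x0" and UW: "U ` W = N" and gU: "\<And>y. y \<in> W ==> g (U y) = y"
    and dU: "\<And>y. y \<in> W ==> U differentiable (at y)" and dg: "\<And>x. x \<in> N ==> g differentiable (at x)"
    and dpU: "\<And>y b. y \<in> W ==> b \<in> Basis ==> pd b U differentiable (at y)"
    and ccU: "\<And>b c. b \<in> Basis ==> c \<in> Basis ==> continuous_on W (pd c (pd b U))"
    and L0: "L > 0"
    and lipU: "\<And>y y'. y \<in> W ==> y' \<in> W ==> norm (U y - U y') <= L*norm (y - y')"
    and lipg: "\<And>y y'. y \<in> W ==> y' \<in> W ==> norm (y - y') <= L*norm (U y - U y')"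
begin

lemma gW: "x \<in> N ==> g x \<in> W" and Ug: "x \<in> N ==> U (g x) = x"
  using UW gU by auto

lemma UN: "y \<in> W ==> U y \<in> N" using UW by auto

lemma x0N: "x0 \<in> N" using UN[OF x0W] Ux0 by simp

lemma gx0: "g x0 = x0" using gU[OF x0W] Ux0 by simp

lemma lip_g: "x \<in> N ==> x' \<in> N ==> norm (g x - g x') <= L*norm (x - x')"
  using lipg[OF gW gW] Ug by simp

lemma pd_U_le: "y \<in> W ==> norm (pd v U y) <= L*norm v"
  by (rule pd_norm_le_lipschitz[OF dU oW]) (auto intro: lipU)

lemma pd_g_le: "x \<in> N ==> norm (pd v g x) <= L*norm v"
  by (rule pd_norm_le_lipschitz[OF dg oN]) (auto intro: lip_g)

lemma linear_pd_g: "x \<in> N ==> linear (%v. pd v g x)"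
  using has_derivative_linear[OF has_derivative_pd[OF dg]] .

lemma linear_pd_U: "y \<in> W ==> linear (%v. pd v U y)"
  using has_derivative_linear[OF has_derivative_pd[OF dU]] .

lemma pd_g_pd_U:
  assumes "x \<in> N" shows "pd (pd v U (g x)) g x = v"
proof -
  have y: "g x \<in> W" and x: "U (g x) = x" using gW Ug assms by auto
  have "(U has_derivative (%v. pd v U (g x))) (at (g x))" by (rule has_derivative_pd[OF dU[OF y]])
  moreover have "(g has_derivative (%v. pd v g x)) (at (U (g x)))" unfolding x by (rule has_derivative_pd[OF dg[OF assms]])
  ultimately have "((%y. g (U y)) has_derivative (%v. pd (pd v U (g x)) g x)) (at (g x))" by (rule has_derivative_compose)
  then have "((%y. y) has_derivative (%v. pd (pd v U (g x)) g x)) (at (g x))"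
    by (rule has_derivative_transform_within_open[OF _ oW y]) (rule gU)
  moreover have "((%y. y) has_derivative (%v. v)) (at (g x))" by simp
  ultimately have "(%v. pd (pd v U (g x)) g x) = (%v. v)" by (rule has_derivative_unique)
  then show ?thesis by meson
qed

lemma pd_U_pd_g:
  assumes "x \<in> N" shows "pd (pd c g x) U (g x) = c"
proof -
  have "inj (%v. pd v U (g x))" by (rule inj_on_inverseI[of _ "%w. pd w g x"]) (rule pd_g_pd_U[OF assms])
  then have "surj (%v. pd v U (g x))" using linear_pd_U[OF gW[OF assms]] linear_injective_imp_surjective by blast
  then obtain w where w: "c = pd w U (g x)" by (meson surjD)
  then show ?thesis using pd_g_pd_U[OF assms] by simp
qed

lemma continuous_g: "continuous_on N g"
  using dg differentiable_imp_continuous_within continuous_at_imp_continuous_on by blast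

lemma continuous_U: "continuous_on W U"
  using dU differentiable_imp_continuous_within continuous_at_imp_continuous_on by blast

lemma continuous_pd_U: "b \<in> Basis ==> continuous_on W (pd b U)"
  using dpU differentiable_imp_continuous_within continuous_at_imp_continuous_on by blast

text \<open>From \<open>A\<^sup>-\<^sup>1 - B\<^sup>-\<^sup>1 = A\<^sup>-\<^sup>1 (B - A) B\<^sup>-\<^sup>1\<close> and the Lipschitz bound on \<open>g\<close>.\<close>

lemma continuous_pd_g: "continuous_on N (pd c g)"
proof (rule continuous_at_imp_continuous_on, rule ballI)
  fix x1 assume x1: "x1 \<in> N"
  define z where "z = pd c g x1"
  have c: "c = pd z U (g x1)" unfolding z_def using pd_U_pd_g[OF x1] by simp
  have cont: "continuous_on N (%x. pd z U (g x))"
  proof -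
    have "pd z U (g x) = (\<Sum>b\<in>Basis. (z \<bullet> b) *\<^sub>R pd b U (g x))" if "x \<in> N" for x
      by (rule pd_linear_expand[OF dU[OF gW[OF that]]])
    moreover have "continuous_on N (%x. \<Sum>b\<in>Basis. (z \<bullet> b) *\<^sub>R pd b U (g x))"
      using gW by (intro continuous_intros continuous_on_compose2[OF continuous_pd_U continuous_g]) auto
    ultimately show ?thesis by (simp cong: continuous_on_cong)
  qed
  have est: "norm (pd c g x - pd c g x1) <= L*norm (pd z U (g x1) - pd z U (g x))" if "x \<in> N" for x
  proof -
    have "pd c g x - pd c g x1 = pd (pd z U (g x1)) g x - pd (pd z U (g x)) g x"
      unfolding pd_g_pd_U[OF that, of z] using arg_cong[OF c, of "%w. pd w g x"] unfolding z_def[symmetric] by simp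
    also have "\<dots> = pd (pd z U (g x1) - pd z U (g x)) g x" using linear_diff[OF linear_pd_g[OF that]] by simp
    finally show ?thesis using pd_g_le[OF that] by simp
  qed
  have "((%x. L*norm (pd z U (g x1) - pd z U (g x))) \<longlongrightarrow> L*norm (pd z U (g x1) - pd z U (g x1))) (at x1)"
    using cont x1 oN by (intro tendsto_intros) (auto simp: continuous_on_eq_continuous_at isCont_def)
  then have "((%x. L*norm (pd z U (g x1) - pd z U (g x))) \<longlongrightarrow> 0) (at x1)" by simp
  moreover have "\<forall>\<^sub>F x in at x1. norm (pd c g x - pd c g x1) <= L*norm (pd z U (g x1) - pd z U (g x))"
    using eventually_at_in_open'[OF oN x1] by eventually_elim (rule est)
  ultimately have "((%x. pd c g x - pd c g x1) \<longlongrightarrow> 0) (at x1)" by (rule Lim_null_comparison[rotated])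
  then show "isCont (pd c g) x1" unfolding isCont_def by (rule LIM_zero_cancel)
qed

text \<open>The coordinate field in direction \<open>b\<close>, transported to \<open>N\<close>;
  \<open>pd_g_X\<close> says that it differentiates the coordinates like a standard basis
  vector.\<close>

definition X :: "'a => 'a => 'a" where "X b x = pd b U (g x)"

lemma X_differentiable: "x \<in> N ==> b \<in> Basis ==> X b differentiable (at x)"
  unfolding X_def[abs_def] by (rule differentiable_compose[of "pd b U" g]) (auto intro: dpU dg gW)

lemma pd_X:
  assumes x: "x \<in> N" and b: "b \<in> Basis"
  shows "pd c (X b) x = (\<Sum>e\<in>Basis. (pd c g x \<bullet> e) *\<^sub>R pd e (pd b U) (g x))"
proof -
  have 1: "(pd b U has_derivative (%v. pd v (pd b U) (g x))) (at (g x))" by (rule has_derivative_pd[OF dpU[OF gW[OF x] b]])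
  have 2: "(g has_derivative (%v. pd v g x)) (at x)" by (rule has_derivative_pd[OF dg[OF x]])
  have "(X b has_derivative (%v. pd (pd v g x) (pd b U) (g x))) (at x)"
    unfolding X_def[abs_def] by (rule has_derivative_compose[OF 2 1])
  from trans[OF pd_eqI[OF this] pd_linear_expand[OF dpU[OF gW[OF x] b]]] show ?thesis .
qed

lemma continuous_pd_X: "b \<in> Basis ==> continuous_on N (pd c (X b))"
proof -
  assume b: "b \<in> Basis"
  have "continuous_on N (%x. \<Sum>e\<in>Basis. (pd c g x \<bullet> e) *\<^sub>R pd e (pd b U) (g x))"
    using b gW by (intro continuous_intros continuous_pd_g continuous_on_compose2[OF ccU continuous_g]) auto
  then show ?thesis using pd_X b by (simp cong: continuous_on_cong)
qed

lemma continuous_X: "b \<in> Basis ==> continuous_on N (X b)"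
  using X_differentiable differentiable_imp_continuous_within continuous_at_imp_continuous_on by blast

lemma X_le: "x \<in> N ==> b \<in> Basis ==> norm (X b x) <= L"
  unfolding X_def using pd_U_le[OF gW, of x b] by simp

lemma pd_g_X: "x \<in> N ==> pd (X b x) g x = b"
  unfolding X_def by (rule pd_g_pd_U)

end

text \<open>On a small ball the differential, multiplied by the inverse \<open>invf\<close> of its
  value at \<open>x0\<close>, stays within 1/2 of the identity. Hence \<open>invf\<close> after
  \<open>U\<close> is a perturbation of the identity by a 1/2-Lipschitz map, which gives the lower
  Lipschitz bound; the inverse function theorem supplies \<open>g\<close>.\<close>

lemma chart_exists:
  fixes U :: "'a::euclidean_space => 'a"
  assumes W0: "open W0" "x0 \<in> W0" and sm: "smooth_on W0 U" and Ux0: "U x0 = x0"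
    and bij: "bij (frechet_derivative U (at x0))"
  obtains W g N L where "chart x0 U g W N L" "W \<subseteq> W0"
proof -
  have dU: "U differentiable (at y)" if "y \<in> W0" for y using sm that by (auto simp: smooth_on_def dest: spec[of _ "Suc 0"])
  have dpU: "pd b U differentiable (at y)" "continuous_on W0 (pd b U)" if "y \<in> W0" "b \<in> Basis" for y b
    using sm that unfolding smooth_on_def by (auto dest: spec[of _ "Suc (Suc 0)"], auto dest: spec[of _ "Suc 0"])
  have ccU: "continuous_on W0 (pd c (pd b U))" if "b \<in> Basis" "c \<in> Basis" for b c
    using sm that unfolding smooth_on_def by (auto dest: spec[of _ "Suc (Suc 0)"])
  define f' where "f' = (%y. Blinfun (%v. pd v U y))"
  have f': "blinfun_apply (f' y) = (%v. pd v U y)" if "y \<in> W0" for y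
    unfolding f'_def using has_derivative_bounded_linear[OF has_derivative_pd[OF dU[OF that]]] by (rule bounded_linear_Blinfun_apply)
  have der: "(U has_derivative blinfun_apply (f' y)) (at y)" if "y \<in> W0" for y
    unfolding f'[OF that] by (rule has_derivative_pd[OF dU[OF that]])
  have contf: "continuous_on W0 f'"
  proof (rule continuous_on_blinfun_componentwise)
    fix i :: 'a assume i: "i \<in> Basis"
    have "continuous_on W0 (pd i U)" using dpU(2)[OF W0(2) i] .
    then show "continuous_on W0 (%y. blinfun_apply (f' y) i)" by (simp add: f' cong: continuous_on_cong)
  qed
  have lin: "linear (%v. pd v U x0)" by (rule has_derivative_linear[OF has_derivative_pd[OF dU[OF W0(2)]]])
  have inj: "inj (%v. pd v U x0)" using bij unfolding pd_def by (simp add: bij_def)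
  obtain a where a: "linear a" "a \<circ> (%v. pd v U x0) = id" using linear_injective_left_inverse[OF lin inj] by blast
  define invf where "invf = Blinfun a"
  have invf: "blinfun_apply invf = a" unfolding invf_def by (rule bounded_linear_Blinfun_apply) (rule linear_conv_bounded_linear[THEN iffD1, OF a(1)])
  have id0: "invf o\<^sub>L f' x0 = id_blinfun"
    using fun_cong[OF a(2)] by (intro blinfun_eqI) (simp add: invf f'[OF W0(2)])
  obtain U' V g g' where ift: "open U'" "U' \<subseteq> W0" "x0 \<in> U'" "open V" "U x0 \<in> V" "homeomorphism U' V U g"
    "\<And>y. y \<in> V ==> (g has_derivative (g' y)) (at y)"
    using inverse_function_theorem[OF W0(1) der contf W0(2) id0] by metis
  have cont2: "continuous_on W0 (%y. norm ((invf o\<^sub>L f' y) - id_blinfun) + norm (f' y - f' x0))"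
    by (intro continuous_intros contf bounded_bilinear.continuous_on[OF bounded_bilinear_blinfun_compose])
  have "isCont (%y. norm ((invf o\<^sub>L f' y) - id_blinfun) + norm (f' y - f' x0)) x0"
    using cont2 W0 by (simp add: continuous_on_eq_continuous_at)
  then have "((%y. norm ((invf o\<^sub>L f' y) - id_blinfun) + norm (f' y - f' x0)) \<longlongrightarrow> norm ((invf o\<^sub>L f' x0) - id_blinfun) + norm (f' x0 - f' x0)) (nhds x0)"
    unfolding isCont_def by (rule tendsto_at_iff_tendsto_nhds[THEN iffD1])
  then have "((%y. norm ((invf o\<^sub>L f' y) - id_blinfun) + norm (f' y - f' x0)) \<longlongrightarrow> 0) (nhds x0)"
    by (simp add: id0)
  then have "\<forall>\<^sub>F y in nhds x0. norm ((invf o\<^sub>L f' y) - id_blinfun) + norm (f' y - f' x0) < 1/2" by (rule order_tendstoD) simp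
  then have "\<forall>\<^sub>F y in nhds x0. norm ((invf o\<^sub>L f' y) - id_blinfun) + norm (f' y - f' x0) < 1/2 \<and> y \<in> U'"
    using eventually_nhds_in_open[OF ift(1,3)] by (rule eventually_conj)
  then obtain r where r: "r > 0" "\<And>y. dist y x0 < r ==> norm ((invf o\<^sub>L f' y) - id_blinfun) + norm (f' y - f' x0) < 1/2 \<and> y \<in> U'"
    unfolding eventually_nhds_metric by blast
  define W where "W = ball x0 r"
  have WU: "W \<subseteq> U'" using r(2) by (auto simp: W_def dist_commute)
  have WW0: "W \<subseteq> W0" using WU ift(2) by blast
  have n1: "norm ((invf o\<^sub>L f' y) - id_blinfun) <= 1/2" "norm (f' y) <= norm (f' x0) + 1" if "y \<in> W" for y
  proof -
    have *: "norm ((invf o\<^sub>L f' y) - id_blinfun) + norm (f' y - f' x0) < 1/2" using r(2)[of y] that by (simp add: W_def dist_commute)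
    then show "norm ((invf o\<^sub>L f' y) - id_blinfun) <= 1/2" using norm_ge_zero[of "f' y - f' x0"] by linarith
    have "norm (f' y) <= norm (f' x0) + norm (f' y - f' x0)" by (metis add.commute norm_triangle_sub)
    then show "norm (f' y) <= norm (f' x0) + 1" using*norm_ge_zero[of "(invf o\<^sub>L f' y) - id_blinfun"] by linarith
  qed
  define L where "L = max (norm (f' x0) + 1) (2*norm invf) + 1"
  have cvx: "convex W" by (simp add: W_def)
  have up: "norm (U y - U y') <= L*norm (y - y')" if "y \<in> W" "y' \<in> W" for y y'
  proof -
    have "norm (U y - U y') <= (norm (f' x0) + 1)*norm (y - y')"
    proof (rule differentiable_bound[OF cvx _ _ that])
      show "(U has_derivative blinfun_apply (f' z)) (at z within W)" if "z \<in> W" for z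
        using der that WW0 by (auto intro: has_derivative_at_withinI)
      show "onorm (blinfun_apply (f' z)) <= norm (f' x0) + 1" if "z \<in> W" for z
        using n1(2)[OF that] by (simp add: norm_blinfun.rep_eq)
    qed
    also have "\<dots> <= L*norm (y - y')" by (intro mult_right_mono) (auto simp: L_def)
    finally show ?thesis .
  qed
  have low: "norm (y - y') <= L*norm (U y - U y')" if yy: "y \<in> W" "y' \<in> W" for y y'
  proof -
    have "norm ((blinfun_apply invf (U y) - y) - (blinfun_apply invf (U y') - y')) <= 1/2*norm (y - y')"
    proof (rule differentiable_bound[OF cvx _ _ yy, of "%y. blinfun_apply invf (U y) - y" "%z. blinfun_apply ((invf o\<^sub>L f' z) - id_blinfun)"])
      show "((%y. blinfun_apply invf (U y) - y) has_derivative blinfun_apply ((invf o\<^sub>L f' z) - id_blinfun)) (at z within W)" if "z \<in> W" for z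
      proof -
        have "(U has_derivative blinfun_apply (f' z)) (at z within W)" using der that WW0 by (auto intro: has_derivative_at_withinI)
        from has_derivative_diff[OF bounded_linear.has_derivative[OF blinfun.bounded_linear_right this, of invf] has_derivative_ident]
        show ?thesis by (rule has_derivative_eq_rhs) (auto simp: blinfun.diff_left)
      qed
      show "onorm (blinfun_apply ((invf o\<^sub>L f' z) - id_blinfun)) <= 1/2" if "z \<in> W" for z
        using n1(1)[OF that] by (simp add: norm_blinfun.rep_eq)
    qed
    moreover have "(blinfun_apply invf (U y) - y) - (blinfun_apply invf (U y') - y') = blinfun_apply invf (U y - U y') - (y - y')"
      by (simp add: blinfun.diff_right)
    ultimately have "norm (blinfun_apply invf (U y - U y') - (y - y')) <= 1/2*norm (y - y')" by simp
    then have "norm (y - y') <= 2*norm (blinfun_apply invf (U y - U y'))"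
      using norm_triangle_ineq2[of "y - y'" "blinfun_apply invf (U y - U y')"] by (simp add: norm_minus_commute)
    also have "\<dots> <= 2*(norm invf*norm (U y - U y'))" by (intro mult_left_mono norm_blinfun) auto
    also have "\<dots> <= L*norm (U y - U y')"
      unfolding mult.assoc[symmetric] by (intro mult_right_mono) (auto simp: L_def)
    finally show ?thesis .
  qed
  \<comment> \<open>Shrinking the domain to a ball keeps the image open, since \<open>U\<close> is a
    homeomorphism onto the open set \<open>V\<close>.\<close>
  have "openin (top_of_set V) (U ` W)"
    by (rule homeomorphism_imp_open_map[OF ift(6)]) (use WU in \<open>auto simp: W_def openin_open_eq[OF ift(1)]\<close>)
  then have oN: "open (U ` W)" and NV: "U ` W \<subseteq> V" using openin_open_eq[OF ift(4)] by auto
  have "chart x0 U g W (U ` W) L"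
  proof
    show "g (U y) = y" if "y \<in> W" for y using homeomorphism_apply1[OF ift(6)] that WU by blast
    show "g differentiable (at x)" if "x \<in> U ` W" for x using ift(7)[of x] that NV by (auto simp: differentiable_def)
    show "continuous_on W (pd c (pd b U))" if "b \<in> Basis" "c \<in> Basis" for b c using ccU[OF that] WW0 continuous_on_subset by blast
    show "L > 0" unfolding L_def using norm_ge_zero[of "f' x0"] max.cobounded1[of "norm (f' x0) + 1" "2*norm invf"] by linarith
  qed (use r dU dpU up low oN WW0 Ux0 cvx in \<open>auto simp: W_def\<close>)
  then show ?thesis using that WW0 by blast
qed

section \<open>Vector field multipliers in a Morse chart\<close>

lemma continuous_extend_zero:
  fixes f :: "'a::euclidean_space => 'b::real_normed_vector"
  assumes N: "open N" and K: "closed K" "K \<subseteq> N" and c: "continuous_on N f" and z: "\<And>x. x \<in> N ==> x \<notin> K ==> f x = 0"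
  shows "continuous_on UNIV (%x. if x \<in> N then f x else 0)"
proof -
  let ?F = "%x. if x \<in> N then f x else 0"
  have "continuous_on N ?F" using c by (simp cong: continuous_on_cong)
  moreover have "continuous_on (- K) ?F"
  proof -
    have "continuous_on (- K) (%x. 0 :: 'b)" by simp
    then show ?thesis by (rule continuous_on_eq) (use z in auto)
  qed
  ultimately have "continuous_on (N \<union> - K) ?F" using N K by (intro continuous_on_open_Un) auto
  moreover have "N \<union> - K = UNIV" using K by auto
  ultimately show ?thesis by simp
qed

text \<open>Chart objects make sense only on \<open>N\<close>, whereas the divergence theorem above
  is on the whole space; multiplied by a function supported in a closed subset of \<open>N\<close>
  they extend by zero.\<close>

lemma C1_extend_zero:
  fixes f :: "'a::euclidean_space => 'b::real_normed_vector"
  assumes N: "open N" and K: "closed K" "K \<subseteq> N" and d: "\<And>x. x \<in> N ==> f differentiable (at x)"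
    and c: "\<And>b. b \<in> Basis ==> continuous_on N (pd b f)" and z: "\<And>x. x \<in> N ==> x \<notin> K ==> f x = 0"
  shows "Ck_on UNIV (Suc 0) (%x. if x \<in> N then f x else 0)"
    "\<And>b x. pd b (%x. if x \<in> N then f x else 0) x = (if x \<in> N then pd b f x else 0)"
proof -
  let ?F = "%x. if x \<in> N then f x else 0"
  have evN: "eventually (%y. ?F y = f y) (nhds x)" if "x \<in> N" for x
    using eventually_nhds_in_open[OF N that] by (rule eventually_mono) simp
  have evK: "eventually (%y. ?F y = 0) (nhds x)" if "x \<notin> K" for x
  proof -
    have "eventually (%y. y \<in> - K) (nhds x)" using that K by (intro eventually_nhds_in_open) auto
    then show ?thesis by (rule eventually_mono) (use z in auto)
  qed
  show pdF: "pd b ?F x = (if x \<in> N then pd b f x else 0)" for b x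
  proof (cases "x \<in> N")
    case True
    then show ?thesis using pd_cong_eventually[OF evN] by simp
  next
    case False
    then have "x \<notin> K" using K by auto
    from pd_cong_eventually[OF evK[OF this]] show ?thesis using False by simp
  qed
  have "?F differentiable (at x)" for x
  proof (cases "x \<in> N")
    case True
    have "(f has_derivative (%v. pd v f x)) (at x)" by (rule has_derivative_pd[OF d[OF True]])
    then have "(?F has_derivative (%v. pd v f x)) (at x)"
      by (rule has_derivative_transform_within_open[OF _ N True]) simp
    then show ?thesis by (auto simp: differentiable_def)
  next
    case False
    then have x: "x \<in> - K" using K by auto
    have "((%x. 0) has_derivative (%v. 0::'b)) (at x)" by simp
    then have "(?F has_derivative (%v. 0)) (at x)"
      by (rule has_derivative_transform_within_open[OF _ _ x]) (use z K in auto)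
    then show ?thesis by (auto simp: differentiable_def)
  qed
  moreover have "continuous_on UNIV (pd b ?F)" if "b \<in> Basis" for b
  proof -
    have pz: "pd b f x = 0" if "x \<in> N" "x \<notin> K" for x
    proof -
      have "pd b f x = pd b ?F x" using pdF that by simp
      also have "\<dots> = 0" using pd_cong_eventually[OF evK[OF that(2)]] by simp
      finally show ?thesis .
    qed
    have "continuous_on UNIV (%x. if x \<in> N then pd b f x else 0)"
      by (rule continuous_extend_zero[OF N K c[OF that] pz])
    then show ?thesis using pdF by presburger
  qed
  ultimately show "Ck_on UNIV (Suc 0) ?F" by simp
qed

text \<open>Cauchy-Schwarz for \<open>v\<close> and the vector with components
  \<open>h*pd c u x + u x*pd c V x\<close>, whose squared length is the density of
  \<open>Qform\<close>.\<close>

lemma directional_le: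
  fixes u V :: "'a::euclidean_space => real"
  assumes "u differentiable (at x)" "V differentiable (at x)"
  shows "\<bar>h*pd v u x + u x*pd v V x\<bar> <= norm v * sqrt (\<Sum>c\<in>Basis. (h*pd c u x + u x*pd c V x)^2)"
proof -
  define w where "w = (\<Sum>c\<in>Basis. (h*pd c u x + u x*pd c V x) *\<^sub>R c)"
  have wc: "w \<bullet> c = h*pd c u x + u x*pd c V x" if "c \<in> Basis" for c
    using that by (simp add: w_def inner_sum_left inner_Basis if_distrib cong: if_cong)
  have "h*pd v u x + u x*pd v V x = (\<Sum>c\<in>Basis. (v \<bullet> c)*(w \<bullet> c))"
    unfolding pd_linear_expand[OF assms(1), of v] pd_linear_expand[OF assms(2), of v]
    by (simp add: sum_distrib_left sum.distrib[symmetric] algebra_simps wc)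
  also have "\<dots> = v \<bullet> w" by (simp add: euclidean_inner[of v w])
  finally have "\<bar>h*pd v u x + u x*pd v V x\<bar> <= norm v * norm w" by (simp add: Cauchy_Schwarz_ineq2)
  moreover have "norm w = sqrt (\<Sum>c\<in>Basis. (h*pd c u x + u x*pd c V x)^2)"
    unfolding norm_eq_sqrt_inner euclidean_inner[of w w] by (simp add: wc power2_eq_square)
  ultimately show ?thesis by simp
qed

lemma Qform_integrable:
  fixes u V :: "'a::euclidean_space => real"
  assumes V: "smooth_on UNIV V" and u: "Ck_on UNIV (Suc 0) u" "bsupp u"
  shows "integrable lborel (%x. \<Sum>b\<in>Basis. (h*pd b u x + u x*pd b V x)^2)"
proof (rule integrable_bsupp)
  have cV: "continuous_on UNIV (pd b V)" if "b \<in> Basis" for b using smooth_Ck[OF V, of "Suc 0"] that by simp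
  show "continuous_on UNIV (%x. \<Sum>b\<in>Basis. (h*pd b u x + u x*pd b V x)^2)"
    using Ck_continuous[OF u(1)] u(1) cV by (intro continuous_intros) auto
qed (intro bsupp_sum bsupp_power bsupp_add bsupp_mult_right[OF bsupp_pd] bsupp_mult_left u finite_Basis)

locale morse_chart = chart x0 U g W N L for x0 U g W N L +
  fixes V :: "'a => real" and t :: "'a => real" and \<nu> :: "'a => nat"
  assumes V: "smooth_on UNIV V"
    and V_form: "\<And>x. x \<in> N ==> V x = V x0 + (\<Sum>b\<in>Basis. t b*((g x - x0) \<bullet> b)^\<nu> b)"
    and t0: "\<And>b. b \<in> Basis ==> t b \<noteq> 0" and \<nu>2: "\<And>b. b \<in> Basis ==> \<nu> b >= 2"
begin

definition yc :: "'a => 'a => real" where "yc b x = (g x - x0) \<bullet> b"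

lemma V_differentiable: "V differentiable (at x)" using smooth_Ck[OF V, of "Suc 0"] by simp

lemma yc_has_derivative: "x \<in> N ==> (yc b has_derivative (%v. pd v g x \<bullet> b)) (at x)"
  unfolding yc_def[abs_def] using has_derivative_pd[OF dg] by (auto intro!: derivative_eq_intros)

lemma yc_differentiable: "x \<in> N ==> yc b differentiable (at x)"
  using yc_has_derivative by (auto simp: differentiable_def)

lemma pd_yc: "x \<in> N ==> pd v (yc b) x = pd v g x \<bullet> b"
  by (rule pd_eqI[OF yc_has_derivative])

lemma continuous_yc: "continuous_on N (yc b)"
  unfolding yc_def[abs_def] by (intro continuous_intros continuous_g)

lemma XV:
  assumes x: "x \<in> N" and b: "b \<in> Basis"
  shows "pd (X b x) V x = t b*real (\<nu> b)*yc b x^(\<nu> b - 1)"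
proof -
  have "((%x. V x0 + (\<Sum>c\<in>Basis. t c*(yc c x)^\<nu> c)) has_derivative
      (%v. \<Sum>c\<in>Basis. t c*(real (\<nu> c)*(pd v g x \<bullet> c)*yc c x^(\<nu> c - 1)))) (at x)"
    using yc_has_derivative[OF x] by (auto intro!: derivative_eq_intros)
  then have "(V has_derivative (%v. \<Sum>c\<in>Basis. t c*(real (\<nu> c)*(pd v g x \<bullet> c)*yc c x^(\<nu> c - 1)))) (at x)"
    by (rule has_derivative_transform_within_open[OF _ oN x]) (simp add: V_form yc_def)
  from pd_eqI[OF this, of "X b x"] show ?thesis
    using b by (simp add: pd_g_X[OF x] inner_Basis if_distrib if_distribR cong: if_cong)
qed

text \<open>The divergence of the field \<open>X b\<close>.\<close>

definition dv :: "'a => 'a => real" where "dv b x = (\<Sum>c\<in>Basis. pd c (X b) x \<bullet> c)"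

lemma continuous_dv: "b \<in> Basis ==> continuous_on N (dv b)"
  unfolding dv_def[abs_def] by (intro continuous_intros continuous_pd_X)

text \<open>The divergence of \<open>A (yc b)*u^2\<close> times \<open>X b\<close> integrates to
  zero. Because \<open>X b\<close> differentiates \<open>yc b\<close> to 1, this yields the term
  \<open>A'\<close>; the derivative of \<open>u\<close> is completed to
  \<open>h*X u + u*X V\<close>, which Young's inequality with weight \<open>\<eta>\<close> bounds by
  the form. A good choice of \<open>A\<close> makes the left-hand bracket positive.\<close>

lemma multiplier_inequality:
  assumes K: "compact K" "K \<subseteq> N" and b: "b \<in> Basis"
    and u: "Ck_on UNIV (Suc 0) u" and uK: "\<And>x. x \<notin> K ==> u x = 0"
    and A: "\<And>s. (A has_real_derivative A' s) (at s)" "continuous_on UNIV A'" "\<And>s. \<bar>A s\<bar> <= a"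
    and \<eta>: "\<eta> > 0"
  shows "integrable lborel (%x. (u x)^2*(2*A (yc b x)*pd (X b x) V x - h*A' (yc b x) - h*A (yc b x)*dv b x))"
    "(LBINT x. (u x)^2*(2*A (yc b x)*pd (X b x) V x - h*A' (yc b x) - h*A (yc b x)*dv b x))
      <= a*L*(\<eta>*(LBINT x. (u x)^2) + Qform V h u/\<eta>)"
proof -
  have clK: "closed K" using K by (simp add: compact_imp_closed)
  have a0: "a >= 0" using A(3)[of 0] by linarith
  have bs: "bsupp u"
  proof -
    obtain B where "\<forall>x\<in>K. norm x <= B" using compact_imp_bounded[OF K(1)] by (auto simp: bounded_iff)
    then show ?thesis unfolding bsupp_def by (intro exI[of _ B]) (force intro: uK)
  qed
  have du: "u differentiable (at x)" for x using u by simp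
  have cu: "continuous_on S u" "c \<in> Basis ==> continuous_on S (pd c u)" for S c
    using Ck_continuous[OF u] u continuous_on_subset by (auto intro: continuous_on_subset)
  have cA: "continuous_on UNIV A" using A(1) by (auto simp: continuous_on_eq_continuous_at intro: DERIV_isCont)
  have cAy: "continuous_on N (%x. A (yc b x))" "continuous_on N (%x. A' (yc b x))"
    using continuous_on_compose2[OF cA continuous_yc] continuous_on_compose2[OF A(2) continuous_yc] by auto
  define f where "f = (%c x. A (yc b x)*(u x*u x)*(X b x \<bullet> c))"
  have pAy: "pd c (%x. A (yc b x)) x = A' (yc b x)*(pd c g x \<bullet> b)" and dAy: "(%x. A (yc b x)) differentiable (at x)"
    if x: "x \<in> N" for c x
  proof -
    show "pd c (%x. A (yc b x)) x = A' (yc b x)*(pd c g x \<bullet> b)"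
      using pd_compose_real[OF yc_differentiable[OF x, of b] A(1), of c] pd_yc[OF x] by simp
    have "A differentiable (at (yc b x))" using A(1)[of "yc b x"] unfolding differentiable_def has_field_derivative_def by blast
    then show "(%x. A (yc b x)) differentiable (at x)"
      by (rule differentiable_compose[OF _ yc_differentiable[OF x]])
  qed
  have dX: "(%x. X b x \<bullet> c) differentiable (at x)" and pX: "pd e (%x. X b x \<bullet> c) x = pd e (X b) x \<bullet> c" if x: "x \<in> N" for c e x
  proof -
    show "(%x. X b x \<bullet> c) differentiable (at x)" using X_differentiable[OF x b] by (intro differentiable_inner differentiable_const)
    show "pd e (%x. X b x \<bullet> c) x = pd e (X b) x \<bullet> c"
      by (rule pd_bounded_linear[OF bounded_linear_inner_left X_differentiable[OF x b]])
  qed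
  have df: "f c differentiable (at x)" and pf: "pd e (f c) x = A (yc b x)*(u x*u x)*(pd e (X b) x \<bullet> c)
      + (A (yc b x)*(2*u x*pd e u x) + A' (yc b x)*(pd e g x \<bullet> b)*(u x*u x))*(X b x \<bullet> c)" if x: "x \<in> N" for c e x
  proof -
    have d1: "(%x. u x*u x) differentiable (at x)" by (intro differentiable_mult du)
    have d2: "(%x. A (yc b x)*(u x*u x)) differentiable (at x)" by (intro differentiable_mult d1 dAy[OF x])
    show "f c differentiable (at x)" unfolding f_def by (intro differentiable_mult d2 dX[OF x])
    show "pd e (f c) x = A (yc b x)*(u x*u x)*(pd e (X b) x \<bullet> c)
      + (A (yc b x)*(2*u x*pd e u x) + A' (yc b x)*(pd e g x \<bullet> b)*(u x*u x))*(X b x \<bullet> c)"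
      unfolding f_def pd_mult[OF d2 dX[OF x]] pd_mult[OF dAy[OF x] d1] pd_mult[OF du du] pAy[OF x] pX[OF x] by (simp add: algebra_simps)
  qed
  have cpf: "continuous_on N (pd e (f c))" if "e \<in> Basis" for c e
  proof -
    have "continuous_on N (%x. A (yc b x)*(u x*u x)*(pd e (X b) x \<bullet> c)
      + (A (yc b x)*(2*u x*pd e u x) + A' (yc b x)*(pd e g x \<bullet> b)*(u x*u x))*(X b x \<bullet> c))"
      using that b by (intro continuous_intros cAy cu continuous_pd_X continuous_pd_g continuous_X)
    then show ?thesis by (rule continuous_on_eq) (simp add: pf)
  qed
  have zf: "f c x = 0" if "x \<notin> K" for c x using uK[OF that] by (simp add: f_def)
  define Z where "Z = (%c x. if x \<in> N then f c x else 0)"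
  have CZ: "Ck_on UNIV (Suc 0) (Z c)" for c unfolding Z_def by (rule C1_extend_zero[OF oN clK K(2) df cpf zf])
  have pZ: "pd e (Z c) x = (if x \<in> N then pd e (f c) x else 0)" for c e x
    unfolding Z_def by (rule C1_extend_zero[OF oN clK K(2) df cpf zf])
  have bZ: "bsupp (Z c)" for c
  proof -
    have "Z c = (%x. u x*(if x \<in> N then A (yc b x)*u x*(X b x \<bullet> c) else 0))" by (auto simp: Z_def f_def)
    then show ?thesis using bsupp_mult_left[OF bs] by simp
  qed
  note div = integral_divergence_eq_0[of Z, OF CZ bZ]
  \<comment> \<open>Twice the pairing of \<open>A*u\<close> times \<open>X b\<close> with the
    density of the form; it is the part of the integrand that is not a divergence.\<close>
  define T where "T = (%x. 2*A (yc b x)*u x*(h*pd (X b x) u x + u x*pd (X b x) V x))"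
  define S where "S = (%x. (u x)^2*(2*A (yc b x)*pd (X b x) V x - h*A' (yc b x) - h*A (yc b x)*dv b x))"
  have sumZ: "(\<Sum>c\<in>Basis. pd c (Z c) x) = (u x)^2*A' (yc b x) + 2*A (yc b x)*u x*pd (X b x) u x + (u x)^2*A (yc b x)*dv b x" for x
  proof (cases "x \<in> N")
    case x: True
    \<comment> \<open>This is the derivative of \<open>yc b\<close> along
      \<open>X b\<close>.\<close>
    have 1: "(\<Sum>c\<in>Basis. (pd c g x \<bullet> b)*(X b x \<bullet> c)) = 1"
    proof -
      have "(\<Sum>c\<in>Basis. (X b x \<bullet> c) *\<^sub>R pd c g x) = b" using pd_linear_expand[OF dg[OF x], of "X b x"] pd_g_X[OF x] by simp
      from arg_cong[OF this, of "%w. w \<bullet> b"] show ?thesis using b by (simp add: inner_sum_left mult.commute)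
    qed
    have 2: "(\<Sum>c\<in>Basis. pd c u x*(X b x \<bullet> c)) = pd (X b x) u x"
      using pd_linear_expand[OF du, of "X b x" x] by (simp add: mult.commute)
    have "(\<Sum>c\<in>Basis. pd c (Z c) x) = (\<Sum>c\<in>Basis. A (yc b x)*(u x*u x)*(pd c (X b) x \<bullet> c)
       + 2*A (yc b x)*u x*(pd c u x*(X b x \<bullet> c)) + A' (yc b x)*(u x*u x)*((pd c g x \<bullet> b)*(X b x \<bullet> c)))"
      using x by (simp add: pZ pf algebra_simps)
    also have "\<dots> = A (yc b x)*(u x*u x)*dv b x + 2*A (yc b x)*u x*pd (X b x) u x + A' (yc b x)*(u x*u x)*1"
      unfolding sum.distrib sum_distrib_left[symmetric] 1 2 dv_def ..
    finally show ?thesis by (simp add: power2_eq_square algebra_simps)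
  next
    case False
    then have "x \<notin> K" using K by auto
    then show ?thesis using False uK by (simp add: pZ)
  qed
  have ST: "S x = T x - h*(\<Sum>c\<in>Basis. pd c (Z c) x)" for x
    unfolding S_def T_def sumZ by (simp add: power2_eq_square algebra_simps)
  have cT: "continuous_on UNIV T"
  proof -
    have V1: "continuous_on Y (pd c V)" if "c \<in> Basis" for c Y
      using smooth_Ck[OF V, of "Suc 0"] that by (auto intro: continuous_on_subset)
    have "continuous_on N (%x. 2*A (yc b x)*u x*(h*(\<Sum>c\<in>Basis. (X b x \<bullet> c)*pd c u x) + u x*(\<Sum>c\<in>Basis. (X b x \<bullet> c)*pd c V x)))"
      using b by (intro continuous_intros cAy cu continuous_X V1)
    then have "continuous_on N T"
      by (rule continuous_on_eq) (simp add: T_def pd_linear_expand[OF du, of "X b _"] pd_linear_expand[OF V_differentiable, of "X b _"])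
    then have "continuous_on UNIV (%x. if x \<in> N then T x else 0)"
      by (rule continuous_extend_zero[OF oN clK K(2)]) (simp add: T_def uK)
    moreover have "(%x. if x \<in> N then T x else 0) = T"
    proof
      fix x show "(if x \<in> N then T x else 0) = T x" using K uK[of x] by (cases "x \<in> N") (auto simp: T_def)
    qed
    ultimately show ?thesis by (simp only:)
  qed
  have bT: "bsupp T" unfolding T_def by (intro bsupp_mult_left[OF bsupp_mult_right[OF bs]])
  have iT: "integrable lborel T" by (rule integrable_bsupp[OF cT bT])
  have iS: "integrable lborel S" unfolding ST using iT div by auto
  then show "integrable lborel (%x. (u x)^2*(2*A (yc b x)*pd (X b x) V x - h*A' (yc b x) - h*A (yc b x)*dv b x))"
    by (simp add: S_def)
  define q where "q = (%x. \<Sum>c\<in>Basis. (h*pd c u x + u x*pd c V x)^2)"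
  have iq: "integrable lborel q" unfolding q_def by (rule Qform_integrable[OF V u bs])
  have iu: "integrable lborel (%x. (u x)^2)"
    by (intro integrable_bsupp continuous_intros cu bsupp_power bs)
  have "(LBINT x. S x) = (LBINT x. T x)" unfolding ST using iT div by simp
  also have "\<dots> <= (LBINT x. a*L*(\<eta>*(u x)^2 + q x/\<eta>))"
  proof (rule integral_mono[OF iT])
    show "integrable lborel (%x. a*L*(\<eta>*(u x)^2 + q x/\<eta>))" using iu iq by simp
    fix x
    show "T x <= a*L*(\<eta>*(u x)^2 + q x/\<eta>)"
    proof (cases "x \<in> N")
      case True
      have q0: "q x >= 0" by (auto simp: q_def intro: sum_nonneg)
      have "\<bar>h*pd (X b x) u x + u x*pd (X b x) V x\<bar> <= norm (X b x) * sqrt (q x)"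
        unfolding q_def by (rule directional_le[OF du V_differentiable])
      also have "\<dots> <= L * sqrt (q x)" using X_le[OF True b] q0 by (intro mult_right_mono) auto
      finally have 1: "\<bar>h*pd (X b x) u x + u x*pd (X b x) V x\<bar> <= L * sqrt (q x)" .
      have "T x <= \<bar>T x\<bar>" by simp
      also have "\<dots> = 2*\<bar>A (yc b x)\<bar>*\<bar>u x\<bar>*\<bar>h*pd (X b x) u x + u x*pd (X b x) V x\<bar>"
        by (simp add: T_def abs_mult)
      also have "\<dots> <= 2*a*\<bar>u x\<bar>*(L * sqrt (q x))"
        using 1 A(3) a0 by (intro mult_mono) auto
      also have "\<dots> = a*L*(2*(\<bar>u x\<bar> * sqrt (q x)))" by simp
      also have "\<dots> <= a*L*(\<eta>*(u x)^2 + q x/\<eta>)"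
      proof (rule mult_left_mono)
        \<comment> \<open>Young's inequality with weight \<open>\<eta>\<close>.\<close>
        have "0 <= (\<eta>*\<bar>u x\<bar> - sqrt (q x))^2/\<eta>" using \<eta> by simp
        also have "\<dots> = \<eta>*(u x)^2 + q x/\<eta> - 2*(\<bar>u x\<bar> * sqrt (q x))"
          using \<eta> q0 by (simp add: power2_diff add_divide_distrib diff_divide_distrib power_mult_distrib) (simp add: power2_eq_square)
        finally show "2*(\<bar>u x\<bar> * sqrt (q x)) <= \<eta>*(u x)^2 + q x/\<eta>" by simp
      qed (use a0 L0 in simp)
      finally show ?thesis .
    next
      case False
      then have "u x = 0" using K uK by auto
      moreover have "q x >= 0" by (auto simp: q_def intro: sum_nonneg)
      ultimately show ?thesis using a0 L0 \<eta> by (simp add: T_def)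
    qed
  qed
  also have "\<dots> = a*L*(\<eta>*(LBINT x. (u x)^2) + Qform V h u/\<eta>)"
    using iu iq by (simp add: Qform_def q_def)
  finally show "(LBINT x. (u x)^2*(2*A (yc b x)*pd (X b x) V x - h*A' (yc b x) - h*A (yc b x)*dv b x))
      <= a*L*(\<eta>*(LBINT x. (u x)^2) + Qform V h u/\<eta>)" by (simp add: S_def)
qed

end

section \<open>A Poincare inequality on chart images of boxes\<close>

context chart
begin

text \<open>Fundamental theorem of calculus along the image of a segment, then Jensen on
  \<open>{0..1}\<close>. Keeping each side length \<open>(q - p) \<bullet> b\<close> with its own
  derivative is what later allows sides shrinking at different rates.\<close>

lemma path_integral_square_bound:
  fixes v :: "'a => real" and p q :: 'a
  assumes P: "cbox p q \<subseteq> W" and v: "Ck_on UNIV (Suc 0) v"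
    and y: "y \<in> cbox p q" "y' \<in> cbox p q"
  shows "ennreal ((v (U y) - v (U y'))^2) <= (\<integral>\<^sup>+s. (\<Sum>b\<in>Basis. ennreal (real DIM('a)*((q - p) \<bullet> b)^2) *
      ennreal ((pd (X b (U (y' + s *\<^sub>R (y - y')))) v (U (y' + s *\<^sub>R (y - y'))))^2))*indicator {0..1} s \<partial>lborel)"
proof -
  have dv: "v differentiable (at x)" for x using v by simp
  define ys where "ys = (%s. y' + s *\<^sub>R (y - y'))"
  define D where "D = (%b x. pd (X b x) v x)"
  define \<phi>' where "\<phi>' = (%s. \<Sum>b\<in>Basis. ((y - y') \<bullet> b)*D b (U (ys s)))"
  have ysP: "ys s \<in> cbox p q" if "0 <= s" "s <= 1" for s
  proof -
    have "ys s = (1 - s) *\<^sub>R y' + s *\<^sub>R y" by (simp add: ys_def algebra_simps)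
    then show ?thesis using convexD_alt[OF convex_box(1), of y' p q y s] y that by simp
  qed
  have ysW: "ys s \<in> W" if "0 <= s" "s <= 1" for s using ysP[OF that] P by blast
  have der: "((%s. v (U (ys s))) has_real_derivative \<phi>' s) (at s)" if s: "0 <= s" "s <= 1" for s
  proof -
    have 1: "(ys has_derivative (%r. r *\<^sub>R (y - y'))) (at s)" unfolding ys_def by (auto intro!: derivative_eq_intros)
    have 2: "(U has_derivative (%w. pd w U (ys s))) (at (ys s))" by (rule has_derivative_pd[OF dU[OF ysW[OF s]]])
    have 3: "(v has_derivative (%w. pd w v (U (ys s)))) (at (U (ys s)))" by (rule has_derivative_pd[OF dv])
    have 4: "((%s. v (U (ys s))) has_derivative (%r. pd (pd (r *\<^sub>R (y - y')) U (ys s)) v (U (ys s)))) (at s)"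
      by (rule has_derivative_compose[OF has_derivative_compose[OF 1 2] 3])
    have linv: "linear (%w. pd w v (U (ys s)))" by (rule has_derivative_linear[OF 3])
    have "pd (y - y') U (ys s) = (\<Sum>b\<in>Basis. ((y - y') \<bullet> b) *\<^sub>R X b (U (ys s)))"
      using pd_linear_expand[OF dU[OF ysW[OF s]], of "y - y'"] by (simp add: X_def gU[OF ysW[OF s]])
    then have "pd (pd (y - y') U (ys s)) v (U (ys s)) = \<phi>' s"
      by (simp add: \<phi>'_def D_def linear_sum[OF linv] linear_scale[OF linv])
    then have "(%r. pd (pd (r *\<^sub>R (y - y')) U (ys s)) v (U (ys s))) = (*) (\<phi>' s)"
      by (auto simp: linear_scale[OF linear_pd_U[OF ysW[OF s]]] linear_scale[OF linv] mult.commute)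
    then show ?thesis using 4 by (simp add: has_field_derivative_def)
  qed
  have cD: "continuous_on N (D b)" if "b \<in> Basis" for b
  proof -
    have "continuous_on N (%x. \<Sum>c\<in>Basis. (X b x \<bullet> c)*pd c v x)"
      using that v by (intro continuous_intros continuous_X) (auto intro: continuous_on_subset)
    then show ?thesis by (rule continuous_on_eq) (simp add: D_def pd_linear_expand[OF dv, of "X b _"])
  qed
  have cont: "isCont \<phi>' s" if s: "0 <= s" "s <= 1" for s
  proof -
    have "isCont ys s" unfolding ys_def by (intro continuous_intros)
    moreover have "isCont U (ys s)" using dU[OF ysW[OF s]] by (rule differentiable_imp_continuous_within)
    ultimately have "isCont (%s. U (ys s)) s" by (rule isCont_o2)
    moreover have "isCont (D b) (U (ys s))" if "b \<in> Basis" for b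
      using cD[OF that] oN UN[OF ysW[OF s]] by (simp add: continuous_on_eq_continuous_at)
    ultimately have "isCont (%s. D b (U (ys s))) s" if "b \<in> Basis" for b using isCont_o2 that by blast
    then show ?thesis unfolding \<phi>'_def by (intro continuous_intros)
  qed
  define m where "m = v (U y) - v (U y')"
  have "has_bochner_integral lborel (%s. \<phi>' s*indicator {0..1} s) (v (U (ys 1)) - v (U (ys 0)))"
    using der cont by (intro has_bochner_integral_FTC_Icc_real) auto
  then have hb: "has_bochner_integral lborel (%s. \<phi>' s*indicator {0..1} s) m" by (simp add: ys_def m_def)
  have i2: "integrable lborel (%s. (\<phi>' s)^2*indicator {0..1} s)"
    using borel_integrable_atLeastAtMost[of 0 1 "%s. (\<phi>' s)^2"] cont by (auto simp: mult.commute intro!: continuous_intros)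
  have i1: "integrable lborel (%s::real. indicator {0..1} s :: real)" by (intro integrable_real_indicator) auto
  have ip: "integrable lborel (%s. \<phi>' s*indicator {0..1} s)" and Ip: "(LBINT s. \<phi>' s*indicator {0..1} s) = m"
    using hb by (auto simp: has_bochner_integral_iff)
  \<comment> \<open>Jensen again as a nonnegative variance: \<open>m\<close> is the mean of
    \<open>\<phi>'\<close>.\<close>
  have "0 <= (LBINT s. (\<phi>' s - m)^2*indicator {0..1} s)" by (intro integral_nonneg_AE) auto
  also have "(%s. (\<phi>' s - m)^2*indicator {0..1} s) = (%s. (\<phi>' s)^2*indicator {0..1} s - 2*m*(\<phi>' s*indicator {0..1} s) + m^2*indicator {0..1} s)"
    by (auto simp: power2_eq_square algebra_simps)
  also have "(LBINT s. (\<phi>' s)^2*indicator {0..1} s - 2*m*(\<phi>' s*indicator {0..1} s) + m^2*indicator {0..1} s)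
     = (LBINT s. (\<phi>' s)^2*indicator {0..1} s) - 2*m*m + m^2"
    using i1 i2 ip Ip by simp
  finally have "m^2 <= (LBINT s. (\<phi>' s)^2*indicator {0..1} s)" by (simp add: power2_eq_square)
  then have "ennreal (m^2) <= ennreal (LBINT s. (\<phi>' s)^2*indicator {0..1} s)" by (rule ennreal_leI)
  also have "\<dots> = (\<integral>\<^sup>+s. ennreal ((\<phi>' s)^2*indicator {0..1} s) \<partial>lborel)"
    using i2 by (intro nn_integral_eq_integral[symmetric]) auto
  also have "\<dots> <= (\<integral>\<^sup>+s. (\<Sum>b\<in>Basis. ennreal (real DIM('a)*((q - p) \<bullet> b)^2)*ennreal ((D b (U (ys s)))^2))*indicator {0..1} s \<partial>lborel)"
  proof (rule nn_integral_mono)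
    fix s :: real
    have "(\<phi>' s)^2 <= real DIM('a)*(\<Sum>b\<in>Basis. (((y - y') \<bullet> b)*D b (U (ys s)))^2)"
      unfolding \<phi>'_def by (subst mult.commute) (rule sum_squared_le_sum_of_squares)
    also have "\<dots> <= real DIM('a)*(\<Sum>b\<in>Basis. ((q - p) \<bullet> b)^2*(D b (U (ys s)))^2)"
    proof (intro mult_left_mono sum_mono)
      fix b :: 'a assume b: "b \<in> Basis"
      have "\<bar>(y - y') \<bullet> b\<bar> <= (q - p) \<bullet> b" using y b by (fastforce simp: mem_box inner_diff_left)
      from power_mono[OF this, of 2] show "(((y - y') \<bullet> b)*D b (U (ys s)))^2 <= ((q - p) \<bullet> b)^2*(D b (U (ys s)))^2"
        by (simp add: power_mult_distrib mult_right_mono)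
    qed simp
    finally have "ennreal ((\<phi>' s)^2) <= ennreal (\<Sum>b\<in>Basis. (real DIM('a)*((q - p) \<bullet> b)^2)*(D b (U (ys s)))^2)"
      by (intro ennreal_leI) (simp add: sum_distrib_left mult.assoc)
    also have "\<dots> = (\<Sum>b\<in>Basis. ennreal (real DIM('a)*((q - p) \<bullet> b)^2)*ennreal ((D b (U (ys s)))^2))"
      by (subst sum_ennreal[symmetric]) (auto simp: ennreal_mult)
    finally show "ennreal ((\<phi>' s)^2*indicator {0..1} s) <= (\<Sum>b\<in>Basis. ennreal (real DIM('a)*((q - p) \<bullet> b)^2)*ennreal ((D b (U (ys s)))^2))*indicator {0..1} s"
      by (auto simp: indicator_def)
  qed
  finally show ?thesis by (simp add: m_def D_def ys_def)
qed

text \<open>With \<open>z\<close> frozen and weight \<open>sg\<close> at least 1/2, the map sending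
  the free endpoint to the path point shrinks distances by at most \<open>2*L^2\<close>, so the
  one-sided substitution applies with a constant independent of \<open>sg\<close> and of the
  box.\<close>

lemma chart_path_substitution:
  fixes F :: "'a => ennreal"
  assumes P: "cbox p q \<subseteq> W" and Om: "Om = U ` cbox p q" and F: "F \<in> borel_measurable borel"
    and z: "z \<in> Om" and sg: "1/2 <= sg" "sg <= 1"
  shows "(\<integral>\<^sup>+w. F (U (g z + sg *\<^sub>R (g w - g z)))*indicator Om w \<partial>lborel)
     <= ennreal ((2*(2*L^2)*real DIM('a))^DIM('a))*(\<integral>\<^sup>+x. F x*indicator Om x \<partial>lborel)"
proof -
  have OmN: "Om \<subseteq> N" using P UN Om by auto
  have gOm: "g w \<in> cbox p q" if "w \<in> Om" for w using that P gU by (auto simp: Om)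
  have mid: "g z + sg *\<^sub>R (g w - g z) \<in> cbox p q" if "w \<in> Om" for w
  proof -
    have "g z + sg *\<^sub>R (g w - g z) = (1 - sg) *\<^sub>R g z + sg *\<^sub>R g w" by (simp add: algebra_simps)
    then show ?thesis using convexD_alt[OF convex_box(1) gOm[OF z] gOm[OF that], of sg] sg by simp
  qed
  have comp: "compact Om" unfolding Om
    by (intro compact_continuous_image continuous_on_subset[OF continuous_U P]) simp
  show ?thesis
  proof (rule nn_integral_substitution_le[where \<psi>="%w. U (g z + sg *\<^sub>R (g w - g z))"])
    fix x y assume xy: "x \<in> Om" "y \<in> Om"
    have xyN: "x \<in> N" "y \<in> N" using xy OmN by auto
    have "norm (x - y) <= L*norm (g x - g y)" using lipU[OF gW[OF xyN(1)] gW[OF xyN(2)]] Ug xyN by simp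
    also have "norm (g x - g y) <= 2*norm ((g z + sg *\<^sub>R (g x - g z)) - (g z + sg *\<^sub>R (g y - g z)))"
    proof -
      have "(g z + sg *\<^sub>R (g x - g z)) - (g z + sg *\<^sub>R (g y - g z)) = sg *\<^sub>R (g x - g y)" by (simp add: algebra_simps)
      moreover have "1*norm (g x - g y) <= (2 * sg)*norm (g x - g y)" using sg by (intro mult_right_mono) auto
      ultimately show ?thesis using sg by simp
    qed
    also have "norm ((g z + sg *\<^sub>R (g x - g z)) - (g z + sg *\<^sub>R (g y - g z)))
       <= L*norm (U (g z + sg *\<^sub>R (g x - g z)) - U (g z + sg *\<^sub>R (g y - g z)))"
      using mid xy P by (intro lipg) auto
    finally show "norm (x - y) <= (2*L^2)*norm (U (g z + sg *\<^sub>R (g x - g z)) - U (g z + sg *\<^sub>R (g y - g z)))"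
      using L0 by (simp add: power2_eq_square mult_ac)
  next
    show "2*L^2 > 0" using L0 by simp
    show "Om \<in> sets borel" "Om \<in> sets borel" "bounded Om" using comp by (auto simp: compact_imp_closed compact_imp_bounded)
    show "(%w. U (g z + sg *\<^sub>R (g w - g z))) ` Om \<subseteq> Om" using mid by (auto simp: Om)
    have "continuous_on Om (%w. g z + sg *\<^sub>R (g w - g z))" by (intro continuous_intros continuous_on_subset[OF continuous_g OmN])
    then show "continuous_on Om (%w. U (g z + sg *\<^sub>R (g w - g z)))"
      by (rule continuous_on_compose2[OF continuous_U]) (use mid P in auto)
  qed (rule F)
qed

text \<open>Double integration of \<open>(v x - v x')^2\<close> over \<open>Om\<close> gives twice
  the variance, in the unnormalised form \<open>2*m*I2 - 2*I1^2\<close>. The difference is bounded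
  by derivatives along the path joining \<open>x'\<close> to \<open>x\<close>, and these are turned
  back into integrals over \<open>Om\<close> by substitution.\<close>

lemma poincare:
  fixes v :: "'a => real" and p q :: 'a
  assumes P: "cbox p q \<subseteq> W" and v: "Ck_on UNIV (Suc 0) v" and Om: "Om = U ` cbox p q"
  shows "measure lborel Om*(LBINT x. indicator Om x*(v x)^2) \<le>
     (real DIM('a)*(2*(2*L^2)*real DIM('a))^DIM('a))*measure lborel Om *
       (\<Sum>b\<in>Basis. ((q - p) \<bullet> b)^2*(LBINT x. indicator Om x*(pd (X b x) v x)^2))
     + (LBINT x. indicator Om x * v x)^2"
proof -
  define C where "C = (2*(2*L^2)*real DIM('a))^DIM('a)"
  have C0: "C >= 0" by (simp add: C_def)
  define m where "m = measure lborel Om"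
  have dv: "v differentiable (at x)" for x using v by simp
  have OmN: "Om \<subseteq> N" using P UN Om by auto
  have gOm: "g w \<in> cbox p q" if "w \<in> Om" for w using that P gU by (auto simp: Om)
  have comp: "compact Om" unfolding Om
    by (intro compact_continuous_image continuous_on_subset[OF continuous_U P]) simp
  have Omm[measurable]: "Om \<in> sets borel" using comp by (simp add: compact_imp_closed)
  have em: "emeasure lborel Om = ennreal m"
    unfolding m_def using emeasure_bounded_finite[OF compact_imp_bounded[OF comp]] by (intro emeasure_eq_ennreal_measure) (simp add: less_top)
  define D where "D = (%b x. pd (X b x) v x)"
  have cD: "continuous_on N (D b)" if "b \<in> Basis" for b
  proof -
    have "continuous_on N (%x. \<Sum>c\<in>Basis. (X b x \<bullet> c)*pd c v x)"
      using that v by (intro continuous_intros continuous_X) (auto intro: continuous_on_subset)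
    then show ?thesis by (rule continuous_on_eq) (simp add: D_def pd_linear_expand[OF dv, of "X b _"])
  qed
  have cv: "continuous_on Om v" using Ck_continuous[OF v] by (rule continuous_on_subset) simp
  have ind_int: "integrable lborel (%x. indicator Om x*f x)" if "continuous_on Om f" for f :: "'a => real"
    using borel_integrable_compact[OF comp that] by (auto simp: indicator_def if_distrib[of "%z. z * _"] cong: if_cong)
  define J where "J = (%b. \<integral>x. indicator Om x*(D b x)^2 \<partial>lborel)"
  define F where "F = (%b x. ennreal (indicator Om x*(D b x)^2))"
  have cD2: "continuous_on Om (%x. (D b x)^2)" if "b \<in> Basis" for b
    by (intro continuous_intros continuous_on_subset[OF cD[OF that] OmN])
  have Fm: "F b \<in> borel_measurable borel" if "b \<in> Basis" for b
    unfolding F_def using borel_measurable_integrable[OF ind_int[OF cD2[OF that]]] by (intro measurable_compose[OF _ measurable_ennreal]) simp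
  have FJ: "(\<integral>\<^sup>+x. F b x*indicator Om x \<partial>lborel) = ennreal (J b)" if "b \<in> Basis" for b
  proof -
    have "F b x*indicator Om x = ennreal (indicator Om x*(D b x)^2)" for x by (auto simp: F_def indicator_def)
    then show ?thesis unfolding J_def using ind_int[OF cD2[OF that]] by (simp add: nn_integral_eq_integral)
  qed
  have J0: "J b >= 0" for b unfolding J_def by (intro integral_nonneg_AE) auto
  define \<psi> where "\<psi> = (%(x, x', s). U (g x' + s *\<^sub>R (g x - g x')))"
  define T where "T = Om \<times> Om \<times> {0..1::real}"
  have mid: "g x' + s *\<^sub>R (g x - g x') \<in> cbox p q" if "x \<in> Om" "x' \<in> Om" "0 <= s" "s <= 1" for x x' s
  proof -
    have "g x' + s *\<^sub>R (g x - g x') = (1 - s) *\<^sub>R g x' + s *\<^sub>R g x" by (simp add: algebra_simps)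
    then show ?thesis using convexD_alt[OF convex_box(1) gOm[OF that(2)] gOm[OF that(1)], of s] that by simp
  qed
  have \<psi>T: "\<psi> w \<in> Om" if "w \<in> T" for w using that mid by (auto simp: T_def \<psi>_def Om)
  have c\<psi>: "continuous_on T \<psi>"
  proof -
    have cg1: "continuous_on T (%w. g (fst w))" "continuous_on T (%w. g (fst (snd w)))"
      by (rule continuous_on_compose2[OF continuous_g]; use OmN in \<open>auto simp: T_def intro!: continuous_intros\<close>)+
    have "continuous_on T (%w. g (fst (snd w)) + snd (snd w) *\<^sub>R (g (fst w) - g (fst (snd w))))"
      by (intro continuous_intros cg1)
    then have "continuous_on T (%w. U (g (fst (snd w)) + snd (snd w) *\<^sub>R (g (fst w) - g (fst (snd w)))))"
      by (rule continuous_on_compose2[OF continuous_U]) (use mid P in \<open>auto simp: T_def\<close>)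
    then show ?thesis by (simp add: \<psi>_def case_prod_beta)
  qed
  have Tm: "T \<in> sets borel" unfolding T_def using comp by (intro borel_closed closed_Times) (auto simp: compact_imp_closed)
  \<comment> \<open>Cutting off with the indicator of the compact set \<open>T\<close> gives a
    function that is Borel on the whole product, although chart data are controlled only inside the
    chart.\<close>
  define H where "H = (%b w. ennreal (indicator T w *\<^sub>R (D b (\<psi> w))\<^sup>2))"
  have Hm: "H b \<in> borel_measurable borel" if "b \<in> Basis" for b
  proof -
    have "continuous_on T (%w. (D b (\<psi> w))^2)"
      by (intro continuous_intros continuous_on_compose2[OF cD[OF that] c\<psi>]) (use \<psi>T OmN in auto)
    then have "(%w. indicator T w *\<^sub>R (D b (\<psi> w))\<^sup>2) \<in> borel_measurable borel"
      by (rule borel_measurable_continuous_on_indicator[OF Tm])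
    then show ?thesis unfolding H_def by simp
  qed
  have Hm'[measurable]: "H b \<in> borel_measurable (borel \<Otimes>\<^sub>M (borel \<Otimes>\<^sub>M borel))" if "b \<in> Basis" for b
    using Hm[OF that] by (simp add: borel_prod)
  have HF: "H b (x, x', s) = F b (U (g x' + s *\<^sub>R (g x - g x')))*indicator Om x*indicator Om x'*indicator {0..1} s" for b x x' s
    using \<psi>T[of "(x, x', s)"] by (auto simp: H_def F_def T_def \<psi>_def indicator_def)
  have bound: "(\<integral>\<^sup>+x. \<integral>\<^sup>+x'. \<integral>\<^sup>+s. H b (x, x', s) \<partial>lborel \<partial>lborel \<partial>lborel) <= ennreal (C*m*J b)" if b: "b \<in> Basis" for b
  proof -
    note [measurable] = Hm'[OF b]
    have "(\<integral>\<^sup>+x. \<integral>\<^sup>+x'. \<integral>\<^sup>+s. H b (x, x', s) \<partial>lborel \<partial>lborel \<partial>lborel) = (\<integral>\<^sup>+x. \<integral>\<^sup>+s. \<integral>\<^sup>+x'. H b (x, x', s) \<partial>lborel \<partial>lborel \<partial>lborel)"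
      by (intro nn_integral_cong lborel_pair.Fubini') measurable
    also have "\<dots> = (\<integral>\<^sup>+s. \<integral>\<^sup>+x. \<integral>\<^sup>+x'. H b (x, x', s) \<partial>lborel \<partial>lborel \<partial>lborel)"
      by (intro lborel_pair.Fubini') measurable
    also have "\<dots> <= (\<integral>\<^sup>+s. ennreal (C*m*J b)*indicator {0..1::real} s \<partial>lborel)"
    proof (rule nn_integral_mono)
      fix s :: real
      have z: "(\<integral>\<^sup>+w. ennreal (C*J b)*indicator Om w \<partial>lborel) = ennreal (C*m*J b)"
      proof -
        have "(\<integral>\<^sup>+w. ennreal (C*J b)*indicator Om w \<partial>lborel) = ennreal (C*J b)*ennreal m"
          using nn_integral_cmult_indicator[of Om lborel "ennreal (C*J b)"] Omm by (simp add: em)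
        also have "\<dots> = ennreal (C*J b*m)" using C0 J0 by (intro ennreal_mult[symmetric]) (auto simp: m_def)
        finally show ?thesis by (simp add: mult_ac)
      qed
      \<comment> \<open>The path point follows \<open>x\<close> with weight \<open>s\<close> and
        \<open>x'\<close> with weight \<open>1 - s\<close>. The endpoint whose weight is at least
        1/2 is integrated first, the other one being frozen.\<close>
      consider "s < 0 \<or> s > 1" | "0 <= s" "s <= 1/2" | "1/2 <= s" "s <= 1" by linarith
      then show "(\<integral>\<^sup>+x. \<integral>\<^sup>+x'. H b (x, x', s) \<partial>lborel \<partial>lborel) <= ennreal (C*m*J b)*indicator {0..1} s"
      proof cases
        case 1
        then show ?thesis by (auto simp: HF)
      next
        case 2
        have "(\<integral>\<^sup>+x'. H b (x, x', s) \<partial>lborel) <= ennreal (C*J b)*indicator Om x" for x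
        proof (cases "x \<in> Om")
          case True
          have "(\<integral>\<^sup>+x'. H b (x, x', s) \<partial>lborel) = (\<integral>\<^sup>+w. F b (U (g x + (1 - s) *\<^sub>R (g w - g x)))*indicator Om w \<partial>lborel)"
          proof (rule nn_integral_cong)
            fix w
            have "g w + s *\<^sub>R (g x - g w) = g x + (1 - s) *\<^sub>R (g w - g x)" by (simp add: algebra_simps)
            then show "H b (x, w, s) = F b (U (g x + (1 - s) *\<^sub>R (g w - g x)))*indicator Om w" using True 2 by (simp add: HF)
          qed
          also have "\<dots> <= ennreal C*(\<integral>\<^sup>+x. F b x*indicator Om x \<partial>lborel)"
            unfolding C_def using 2 by (intro chart_path_substitution[OF P Om Fm[OF b] True]) auto
          finally show ?thesis using True C0 J0 by (simp add: FJ[OF b] ennreal_mult)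
        next
          case False
          then show ?thesis by (simp add: HF)
        qed
        then have "(\<integral>\<^sup>+x. \<integral>\<^sup>+x'. H b (x, x', s) \<partial>lborel \<partial>lborel) <= (\<integral>\<^sup>+x. ennreal (C*J b)*indicator Om x \<partial>lborel)" by (rule nn_integral_mono)
        then show ?thesis using 2 z by simp
      next
        case 3
        have "(\<integral>\<^sup>+x. H b (x, x', s) \<partial>lborel) <= ennreal (C*J b)*indicator Om x'" for x'
        proof (cases "x' \<in> Om")
          case True
          have "(\<integral>\<^sup>+x. H b (x, x', s) \<partial>lborel) = (\<integral>\<^sup>+w. F b (U (g x' + s *\<^sub>R (g w - g x')))*indicator Om w \<partial>lborel)"
            using True 3 by (intro nn_integral_cong) (simp add: HF)
          also have "\<dots> <= ennreal C*(\<integral>\<^sup>+x. F b x*indicator Om x \<partial>lborel)"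
            unfolding C_def using 3 by (intro chart_path_substitution[OF P Om Fm[OF b] True]) auto
          finally show ?thesis using True C0 J0 by (simp add: FJ[OF b] ennreal_mult)
        next
          case False
          then show ?thesis by (simp add: HF)
        qed
        then have "(\<integral>\<^sup>+x'. \<integral>\<^sup>+x. H b (x, x', s) \<partial>lborel \<partial>lborel) <= (\<integral>\<^sup>+x. ennreal (C*J b)*indicator Om x \<partial>lborel)" by (rule nn_integral_mono)
        moreover have "(\<integral>\<^sup>+x. \<integral>\<^sup>+x'. H b (x, x', s) \<partial>lborel \<partial>lborel) = (\<integral>\<^sup>+x'. \<integral>\<^sup>+x. H b (x, x', s) \<partial>lborel \<partial>lborel)"
          by (intro lborel_pair.Fubini') measurable
        ultimately show ?thesis using 3 z by simp
      qed
    qed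
    also have "\<dots> = ennreal (C*m*J b)" by (simp add: nn_integral_cmult)
    finally show ?thesis .
  qed
  define I1 I2 where "I1 = (LBINT x. indicator Om x * v x)" and "I2 = (LBINT x. indicator Om x*(v x)^2)"
  have iv: "integrable lborel (%x. indicator Om x * v x)" "integrable lborel (%x. indicator Om x*(v x)^2)"
     "integrable lborel (%x. indicator Om x*(1::real))" by (intro ind_int continuous_intros cv)+
  have i1: "integrable lborel (%x. indicator Om x :: real)" "(LBINT x. indicator Om x) = m" using iv(3) by (auto simp: m_def)
  \<comment> \<open>Expanding the square gives both diagonal terms and the product of the
    means.\<close>
  have dbl: "(\<integral>\<^sup>+x. \<integral>\<^sup>+x'. ennreal (indicator Om x*(indicator Om x'*(v x - v x')^2)) \<partial>lborel \<partial>lborel) = ennreal (2*m*I2 - 2*I1^2)"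
  proof -
    have inner: "(\<integral>\<^sup>+x'. ennreal (indicator Om x*(indicator Om x'*(v x - v x')^2)) \<partial>lborel) = ennreal (indicator Om x*((v x)^2*m - 2 * v x*I1 + I2))" for x
    proof -
      have e: "indicator Om x'*(v x - v x')^2 = (v x)^2*indicator Om x' - 2 * v x*(indicator Om x' * v x') + indicator Om x'*(v x')^2" for x'
        by (simp add: power2_eq_square algebra_simps)
      have i: "integrable lborel (%x'. indicator Om x'*(v x - v x')^2)" unfolding e using iv i1 by auto
      have "(\<integral>x'. indicator Om x*(indicator Om x'*(v x - v x')^2) \<partial>lborel) = indicator Om x*((v x)^2*m - 2 * v x*I1 + I2)"
        unfolding e using iv i1 by (simp add: I1_def I2_def)
      then show ?thesis using i by (subst nn_integral_eq_integral) auto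
    qed
    have e: "indicator Om x*((v x)^2*m - 2 * v x*I1 + I2) = m*(indicator Om x*(v x)^2) - 2*I1*(indicator Om x * v x) + I2*indicator Om x" for x
      by (simp add: algebra_simps)
    have i: "integrable lborel (%x. indicator Om x*((v x)^2*m - 2 * v x*I1 + I2))" unfolding e using iv i1 by auto
    have nn: "0 <= indicator Om x*((v x)^2*m - 2 * v x*I1 + I2)" for x
    proof -
      have e2: "indicator Om x'*(v x - v x')^2 = (v x)^2*indicator Om x' - 2 * v x*(indicator Om x' * v x') + indicator Om x'*(v x')^2" for x'
        by (simp add: power2_eq_square algebra_simps)
      have "0 <= (\<integral>x'. indicator Om x'*(v x - v x')^2 \<partial>lborel)" by (intro integral_nonneg_AE) auto
      also have "\<dots> = (v x)^2*m - 2 * v x*I1 + I2" unfolding e2 using iv i1 by (simp add: I1_def I2_def)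
      finally show ?thesis by simp
    qed
    have "(LBINT x. indicator Om x*((v x)^2*m - 2 * v x*I1 + I2)) = m*I2 - 2*I1*I1 + I2*m"
      unfolding e using iv i1 by (simp add: I1_def I2_def)
    also have "\<dots> = 2*m*I2 - 2*I1^2" by (simp add: power2_eq_square)
    finally show ?thesis unfolding inner using nn
      by (subst nn_integral_eq_integral[OF i]) (simp_all only: AE_I2)
  qed
  define k where "k = (%b. real DIM('a)*((q - p) \<bullet> b)^2)"
  have k0: "k b >= 0" for b by (simp add: k_def)
  have "ennreal (2*m*I2 - 2*I1^2) <= (\<integral>\<^sup>+x. \<integral>\<^sup>+x'. \<integral>\<^sup>+s. (\<Sum>b\<in>Basis. ennreal (k b)*H b (x, x', s)) \<partial>lborel \<partial>lborel \<partial>lborel)"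
    unfolding dbl[symmetric]
  proof (intro nn_integral_mono)
    fix x x' :: 'a
    show "ennreal (indicator Om x*(indicator Om x'*(v x - v x')^2)) <= (\<integral>\<^sup>+s. (\<Sum>b\<in>Basis. ennreal (k b)*H b (x, x', s)) \<partial>lborel)"
    proof (cases "x \<in> Om \<and> x' \<in> Om")
      case True
      then have UgO: "U (g x) = x" "U (g x') = x'" using Ug OmN by auto
      have "ennreal ((v (U (g x)) - v (U (g x')))^2) <= (\<integral>\<^sup>+s. (\<Sum>b\<in>Basis. ennreal (k b) *
        ennreal ((D b (U (g x' + s *\<^sub>R (g x - g x'))))^2))*indicator {0..1} s \<partial>lborel)"
        unfolding k_def D_def using True by (intro path_integral_square_bound[OF P v] gOm) auto
      also have "\<dots> = (\<integral>\<^sup>+s. (\<Sum>b\<in>Basis. ennreal (k b)*H b (x, x', s)) \<partial>lborel)"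
        using True by (intro nn_integral_cong) (auto simp: H_def T_def \<psi>_def indicator_def)
      finally show ?thesis using True UgO by simp
    qed auto
  qed
  also have "\<dots> = (\<Sum>b\<in>Basis. ennreal (k b)*(\<integral>\<^sup>+x. \<integral>\<^sup>+x'. \<integral>\<^sup>+s. H b (x, x', s) \<partial>lborel \<partial>lborel \<partial>lborel))"
  proof -
    have a1: "(\<integral>\<^sup>+s. (\<Sum>b\<in>Basis. ennreal (k b)*H b (x, x', s)) \<partial>lborel) = (\<Sum>b\<in>Basis. ennreal (k b)*(\<integral>\<^sup>+s. H b (x, x', s) \<partial>lborel))" for x x'
      by (subst nn_integral_sum) (auto intro!: sum.cong nn_integral_cmult measurable_compose[OF _ Hm'])
    have m1: "(%x'. \<integral>\<^sup>+s. H b (x, x', s) \<partial>lborel) \<in> borel_measurable borel" if b: "b \<in> Basis" for x b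
    proof -
      note [measurable] = Hm'[OF b]
      show ?thesis by measurable
    qed
    have a2: "(\<integral>\<^sup>+x'. (\<Sum>b\<in>Basis. ennreal (k b)*(\<integral>\<^sup>+s. H b (x, x', s) \<partial>lborel)) \<partial>lborel) = (\<Sum>b\<in>Basis. ennreal (k b)*(\<integral>\<^sup>+x'. \<integral>\<^sup>+s. H b (x, x', s) \<partial>lborel \<partial>lborel))" for x
      using m1 by (subst nn_integral_sum) (auto intro!: sum.cong nn_integral_cmult)
    have m2: "(%x. \<integral>\<^sup>+x'. \<integral>\<^sup>+s. H b (x, x', s) \<partial>lborel \<partial>lborel) \<in> borel_measurable borel" if b: "b \<in> Basis" for b
    proof -
      note [measurable] = Hm'[OF b]
      show ?thesis by measurable
    qed
    show ?thesis unfolding a1 a2 using m2 by (subst nn_integral_sum) (auto intro!: sum.cong nn_integral_cmult)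
  qed
  also have "\<dots> <= (\<Sum>b\<in>Basis. ennreal (k b)*ennreal (C*m*J b))" by (intro sum_mono mult_left_mono bound) auto
  also have "\<dots> = ennreal (\<Sum>b\<in>Basis. k b*(C*m*J b))"
    using k0 C0 J0 by (simp add: ennreal_mult[symmetric] sum_ennreal m_def)
  finally have "2*m*I2 - 2*I1^2 <= (\<Sum>b\<in>Basis. k b*(C*m*J b))"
    using k0 C0 J0 by (subst (asm) ennreal_le_iff) (auto intro!: sum_nonneg simp: m_def)
  also have "\<dots> = (real DIM('a)*C)*m*(\<Sum>b\<in>Basis. ((q - p) \<bullet> b)^2*J b)"
    by (simp add: k_def sum_distrib_left mult_ac)
  finally have "2*(m*I2) <= (real DIM('a)*C)*m*(\<Sum>b\<in>Basis. ((q - p) \<bullet> b)^2*J b) + 2*I1^2" by simp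
  moreover have "0 <= (real DIM('a)*C)*m*(\<Sum>b\<in>Basis. ((q - p) \<bullet> b)^2*J b)"
    using C0 J0 by (intro mult_nonneg_nonneg sum_nonneg) (auto simp: m_def)
  ultimately have "m*I2 <= (real DIM('a)*C)*m*(\<Sum>b\<in>Basis. ((q - p) \<bullet> b)^2*J b) + I1^2" by linarith
  then show ?thesis by (simp add: m_def I1_def I2_def C_def J_def D_def)
qed

end

section \<open>Scaling and the lower bound near a critical point that is not a minimum\<close>

lemma arctan_bounds: "\<bar>arctan s\<bar> <= 2"
  using arctan_ubound[of s] arctan_lbound[of s] pi_less_4 by (auto simp: abs_le_iff)

lemma odd_power_arctan:
  assumes k: "odd k"
  shows "s^k*arctan s >= 0" "\<bar>s\<bar> >= S ==> S >= 1 ==> s^k*arctan s >= S/2"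
proof -
  have pos: "r^k*arctan r >= 0" "r >= S ==> S >= 1 ==> r^k*arctan r >= S/2" if "r >= 0" for r
  proof -
    show "r^k*arctan r >= 0" using that by simp
    assume r: "r >= S" "S >= 1"
    have "k >= 1" using k by (cases k) auto
    then have "r^1 <= r^k" using r by (intro power_increasing) auto
    then have 1: "S <= r^k" using r by simp
    have "arctan 1 <= arctan r" using r by (intro arctan_monotone') auto
    then have 2: "1/2 <= arctan r" using pi_gt3 by (simp add: arctan_one)
    have "S*(1/2) <= r^k*arctan r" using 1 2 r by (intro mult_mono) auto
    then show "r^k*arctan r >= S/2" by simp
  qed
  have sym: "s^k*arctan s = (- s)^k*arctan (- s)" using k by (simp add: power_minus_odd arctan_minus)
  show "s^k*arctan s >= 0" using pos(1)[of s] pos(1)[of "- s"] sym by (cases "s >= 0") auto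
  assume "\<bar>s\<bar> >= S" "S >= 1"
  then show "s^k*arctan s >= S/2" using pos(2)[of s] pos(2)[of "- s"] sym by (cases "s >= 0") auto
qed

text \<open>The Riccati-type multiplier exists precisely because \<open>exp (- t s\<^sup>\<nu>)\<close> is not square integrable.\<close>

lemma nonmin_multiplier:
  fixes t :: real and \<nu> :: nat
  assumes t: "t \<noteq> 0" and \<nu>: "\<nu> >= 2" and bad: "\<not> (even \<nu> \<and> t > 0)"
  obtains \<alpha> \<alpha>' kp where "kp > 0" "\<And>s. (\<alpha> has_real_derivative \<alpha>' s) (at s)" "continuous_on UNIV \<alpha>'" "\<And>s::real. \<bar>\<alpha> s\<bar> <= 5"
    "\<And>s. 2*t*real \<nu> * s^(\<nu> - 1)*\<alpha> s - \<alpha>' s >= kp"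
proof -
  define kp where "kp = min (\<bar>t\<bar>*real \<nu>) (1/2)"
  have kp: "kp > 0" using t \<nu> by (auto simp: kp_def)
  \<comment> \<open>The multiplier is \<open>sg - arctan s\<close>. For even \<open>\<nu>\<close>
    the number \<open>t\<close> is negative and \<open>- arctan\<close> has the right sign; for odd
    \<open>\<nu>\<close> the power is nonnegative, and the shift by 3 beats the bound 2 on arctan,
    so the product with \<open>t\<close> is at least \<open>\<bar>t\<bar>\<close>. This is also the
    origin of the bound 5.\<close>
  define sg where "sg = (if even \<nu> then 0 else if t > 0 then 3 else (-3::real))"
  have key: "2*t*real \<nu> * s^(\<nu> - 1)*(sg - arctan s) - - inverse (1 + s^2) >= kp" for s
  proof -
    have nn: "2*t*real \<nu> * s^(\<nu> - 1)*(sg - arctan s) >= 0 \<and>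
      (\<bar>s\<bar> >= 1 --> 2*t*real \<nu> * s^(\<nu> - 1)*(sg - arctan s) >= \<bar>t\<bar>*real \<nu>)"
    proof (cases "even \<nu>")
      case True
      then have tn: "t < 0" using bad t by auto
      have o: "odd (\<nu> - 1)" using True \<nu> by simp
      have eq: "2*t*real \<nu> * s^(\<nu> - 1)*(sg - arctan s) = 2*\<bar>t\<bar>*real \<nu>*(s^(\<nu> - 1)*arctan s)"
        using True tn by (simp add: sg_def)
      have "2*\<bar>t\<bar>*real \<nu>*(s^(\<nu> - 1)*arctan s) >= 2*\<bar>t\<bar>*real \<nu>*(1/2)" if "\<bar>s\<bar> >= 1"
        using odd_power_arctan(2)[OF o that] by (intro mult_left_mono) auto
      moreover have "2*\<bar>t\<bar>*real \<nu>*(s^(\<nu> - 1)*arctan s) >= 0"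
        by (rule mult_nonneg_nonneg[OF _ odd_power_arctan(1)[OF o]]) simp
      ultimately show ?thesis unfolding eq by auto
    next
      case False
      have e: "even (\<nu> - 1)" using False by simp
      have ge: "\<bar>t\<bar> <= t*(sg - arctan s)"
      proof (cases "t > 0")
        case True
        have "t*1 <= t*(sg - arctan s)" using True False arctan_bounds[of s] by (intro mult_left_mono) (auto simp: sg_def)
        then show ?thesis using True by simp
      next
        case tn: False
        have "(- t)*1 <= (- t)*(arctan s - sg)" using tn False arctan_bounds[of s] by (intro mult_left_mono) (auto simp: sg_def)
        then show ?thesis using tn by (simp add: algebra_simps)
      qed
      have eq: "2*t*real \<nu> * s^(\<nu> - 1)*(sg - arctan s) = 2*real \<nu> * s^(\<nu> - 1)*(t*(sg - arctan s))" by simp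
      have p0: "s^(\<nu> - 1) >= 0" using e by (simp add: zero_le_even_power)
      have "2*real \<nu> * s^(\<nu> - 1)*(t*(sg - arctan s)) >= 0" using ge p0 by (intro mult_nonneg_nonneg[of "2*real \<nu> * s^(\<nu> - 1)"] order_trans[OF abs_ge_zero ge]) auto
      moreover have "\<bar>t\<bar>*real \<nu> <= 2*real \<nu> * s^(\<nu> - 1)*(t*(sg - arctan s))" if "\<bar>s\<bar> >= 1"
      proof -
        have "1 <= \<bar>s\<bar>^(\<nu> - 1)" using that by (rule one_le_power)
        then have s1: "1 <= s^(\<nu> - 1)" using e by (simp add: power_even_abs)
        have "real \<nu>*1*\<bar>t\<bar> <= (2*real \<nu>) * s^(\<nu> - 1)*(t*(sg - arctan s))"
          using s1 ge by (intro mult_mono) auto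
        then show ?thesis by (simp add: mult.commute)
      qed
      ultimately show ?thesis unfolding eq by auto
    qed
    \<comment> \<open>For \<open>\<bar>s\<bar> >= 1\<close> the potential term alone is large
      enough; for smaller \<open>s\<close> the derivative of arctan contributes at least
      1/2.\<close>
    show ?thesis
    proof (cases "\<bar>s\<bar> >= 1")
      case True
      have "inverse (1 + s^2) >= 0" by simp
      moreover have "kp <= \<bar>t\<bar>*real \<nu>" by (simp add: kp_def)
      ultimately show ?thesis using nn[THEN conjunct2, rule_format, OF True] by linarith
    next
      case False
      have "s^2 <= 1" using False by (simp add: abs_square_le_1)
      then have "inverse 2 <= inverse (1 + s^2)" by (intro le_imp_inverse_le) (auto simp: add_pos_nonneg)
      moreover have "kp <= inverse 2" by (simp add: kp_def)
      ultimately show ?thesis using nn[THEN conjunct1] by linarith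
    qed
  qed
  show ?thesis
  proof (rule that[OF kp _ _ _ key])
    show "((%s. sg - arctan s) has_real_derivative - inverse (1 + s^2)) (at s)" for s
      by (auto intro!: derivative_eq_intros)
    have "1 + s^2 \<noteq> 0" for s :: real using zero_le_power2[of s] by linarith
    then show "continuous_on UNIV (%s::real. - inverse (1 + s^2))" by (intro continuous_intros) auto
    show "\<bar>sg - arctan s\<bar> <= 5" for s using arctan_bounds[of s] by (auto simp: sg_def)
  qed
qed

text \<open>\<open>rh\<close> is the length at which \<open>y^n\<close> becomes comparable with
  \<open>h\<close>, and \<open>(h/rh)^2\<close> is the resulting size of the form.\<close>

lemma root_scale:
  fixes h :: real and n :: nat
  assumes h: "h > 0" and n: "n >= 2" and rh: "rh = h powr (1/real n)"
  shows "rh > 0" "rh^n = h" "rh^(n - 1) = h/rh" "(h/rh)^2 = h powr (2 - 2/real n)"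
proof -
  show r0: "rh > 0" using h rh by simp
  show rn: "rh^n = h" using h n by (simp add: rh powr_realpow[symmetric] powr_powr)
  have "rh^n = rh*rh^(n - 1)" using n by (simp add: power_eq_if)
  then show "rh^(n - 1) = h/rh" using rn r0 by (simp add: field_simps)
  have "rh^2 = h powr (2/real n)" using h by (simp add: rh powr_realpow[symmetric] powr_powr)
  moreover have "h^2 = h powr 2" using h by simp
  ultimately show "(h/rh)^2 = h powr (2 - 2/real n)" by (simp add: power_divide powr_diff)
qed

lemma root_scale_le:
  fixes h kp :: real
  assumes h: "0 < h" "h <= kp^m" and n: "n >= 2" "n <= m" and kp: "0 < kp" "kp <= 1"
  shows "h powr (1/real n) <= kp"
proof -
  have "kp^m <= kp^n" using kp n by (intro power_decreasing) auto
  then have "h powr (1/real n) <= (kp^n) powr (1/real n)" using h by (intro powr_mono2) auto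
  also have "\<dots> = kp" using kp n by (simp add: powr_realpow[symmetric] powr_powr)
  finally show ?thesis .
qed

lemma powr_exponent_mono:
  fixes h :: real
  assumes "0 < h" "h <= 1" "n >= 2" "n <= m"
  shows "h powr (2 - 2/real m) <= h powr (2 - 2/real n)"
proof -
  have "2/real m <= 2/real n" using assms by (intro divide_left_mono) auto
  then show ?thesis using assms by (intro powr_mono') auto
qed

context morse_chart
begin

text \<open>In the variable \<open>yc b x/rh\<close> the bracket of
  \<open>multiplier_inequality\<close> becomes \<open>h/rh\<close> times an expression free of
  \<open>h\<close>.\<close>

lemma scaled_multiplier_term:
  assumes x: "x \<in> N" and b: "b \<in> Basis" and h: "h > 0" and rh: "rh = h powr (1/real (\<nu> b))"
  shows "2*\<alpha> (yc b x/rh)*pd (X b x) V x - h*(\<alpha>' (yc b x/rh)/rh)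
     = (h/rh)*(2*t b*real (\<nu> b)*(yc b x/rh)^(\<nu> b - 1)*\<alpha> (yc b x/rh) - \<alpha>' (yc b x/rh))"
proof -
  note r = root_scale[OF h \<nu>2[OF b] rh]
  have "yc b x^(\<nu> b - 1) = rh^(\<nu> b - 1)*(yc b x/rh)^(\<nu> b - 1)"
    using r(1) by (simp add: power_divide)
  then have "pd (X b x) V x = (h/rh)*(t b*real (\<nu> b)*(yc b x/rh)^(\<nu> b - 1))"
    unfolding XV[OF x b] r(3) by simp
  then have e: "pd (X b x) V x = (h/rh)*(t b*real (\<nu> b)*(yc b x/rh)^(\<nu> b - 1))" .
  show ?thesis unfolding e right_diff_distrib by simp
qed

lemma nonmin_bound:
  assumes K: "compact K" "K \<subseteq> N" and b: "b \<in> Basis" and bad: "\<not> (even (\<nu> b) \<and> t b > 0)"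
  shows "\<exists>h0>0. \<exists>c>0. \<forall>h. 0 < h \<and> h <= h0 --> (\<forall>u. Ck_on UNIV (Suc 0) u --> (\<forall>x. x \<notin> K --> u x = 0) -->
     Qform V h u >= c*h powr (2 - 2/real (\<nu> b))*(LBINT x. (u x)^2))"
proof -
  obtain \<alpha> \<alpha>' kp where kp: "kp > 0" and \<alpha>: "\<And>s. (\<alpha> has_real_derivative \<alpha>' s) (at s)" "continuous_on UNIV \<alpha>'" "\<And>s::real. \<bar>\<alpha> s\<bar> <= 5"
    "\<And>s. 2*t b*real (\<nu> b) * s^(\<nu> b - 1)*\<alpha> s - \<alpha>' s >= kp"
  proof (rule nonmin_multiplier[OF t0[OF b] \<nu>2[OF b] bad], goal_cases)
    case (1 a a' k)
    show ?case by (rule that[OF 1(2-6)])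
  qed
  obtain D where D: "D > 0" "\<And>x. x \<in> K ==> \<bar>dv b x\<bar> <= D"
  proof -
    have "bounded (dv b ` K)"
      by (intro compact_imp_bounded compact_continuous_image continuous_on_subset[OF continuous_dv[OF b] K(2)] K(1))
    then obtain D where "D > 0" "\<forall>y\<in>dv b ` K. norm y <= D" by (meson bounded_pos)
    then show ?thesis by (intro that[of D]) auto
  qed
  \<comment> \<open>With \<open>h <= kp1^\<nu> b\<close> one has \<open>rh <= kp1\<close>, and then
    the divergence error \<open>5*h*D\<close> is at most a quarter of the main term
    \<open>e*kp\<close>; the 5 is the bound on the multiplier.\<close>
  define kp1 where "kp1 = min 1 (kp/(20*D))"
  have kp1: "0 < kp1" "kp1 <= 1" "20*D*kp1 <= kp" using kp D by (auto simp: kp1_def min_def field_simps)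
  define c where "c = kp^2/(200*L^2)"
  have c: "c > 0" using kp L0 by (simp add: c_def)
  have "Qform V h u >= c*h powr (2 - 2/real (\<nu> b))*(LBINT x. (u x)^2)"
    if h: "0 < h" "h <= kp1^\<nu> b" and u: "Ck_on UNIV (Suc 0) u" and uK: "\<And>x. x \<notin> K ==> u x = 0" for h u
  proof -
    define rh where "rh = h powr (1/real (\<nu> b))"
    note r = root_scale[OF h(1) \<nu>2[OF b] rh_def]
    have r1: "rh <= kp1" unfolding rh_def using h kp1 \<nu>2[OF b] by (intro root_scale_le) auto
    define e where "e = h/rh"
    have e: "e > 0" using h r by (simp add: e_def)
    \<comment> \<open>Makes the Young term \<open>5*L*\<eta>\<close> equal to \<open>e*kp/4\<close>.
      Together with the divergence error half of \<open>e*kp\<close> is lost; the other half times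
      \<open>\<eta>/(5*L)\<close> is \<open>c*e^2\<close>.\<close>
    define \<eta> where "\<eta> = e*kp/(20*L)"
    have \<eta>: "\<eta> > 0" using e kp L0 by (simp add: \<eta>_def)
    define A where "A = (%s. \<alpha> (s/rh))"
    define A' where "A' = (%s. \<alpha>' (s/rh)/rh)"
    have dA: "(A has_real_derivative A' s) (at s)" for s
    proof -
      have "((%s. s/rh) has_real_derivative 1/rh) (at s)" using r(1) by (auto intro!: derivative_eq_intros)
      from DERIV_chain2[OF \<alpha>(1) this] show ?thesis by (simp add: A_def A'_def)
    qed
    have cA': "continuous_on UNIV A'" unfolding A'_def
      using r(1) by (intro continuous_intros continuous_on_compose2[OF \<alpha>(2)]) auto
    have aA: "\<bar>A s\<bar> <= 5" for s using \<alpha>(3) by (simp add: A_def)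
    define I where "I = (LBINT x. (u x)^2)"
    have bs: "bsupp u"
    proof -
      obtain B where "\<forall>x\<in>K. norm x <= B" using compact_imp_bounded[OF K(1)] by (auto simp: bounded_iff)
      then show ?thesis unfolding bsupp_def by (intro exI[of _ B]) (force intro: uK)
    qed
    have iu: "integrable lborel (%x. (u x)^2)" by (intro integrable_bsupp continuous_intros Ck_continuous[OF u] bsupp_power bs)
    note M = multiplier_inequality[OF K b u uK dA cA' aA \<eta>, of h]
    have hD: "h*5*D <= e*kp/4"
    proof -
      have "h = e*rh" using r(1) by (simp add: e_def)
      then have "h*5*D = e*(5*D*rh)" by simp
      also have "\<dots> <= e*(5*D*kp1)" using r1 D e by (intro mult_left_mono) auto
      also have "\<dots> <= e*(kp/4)" using kp1 e by (intro mult_left_mono) auto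
      finally show ?thesis by simp
    qed
    have "(LBINT x. (3/4*e*kp)*(u x)^2) <= (LBINT x. (u x)^2*(2*A (yc b x)*pd (X b x) V x - h*A' (yc b x) - h*A (yc b x)*dv b x))"
    proof (rule integral_mono[OF _ M(1)])
      show "integrable lborel (%x. (3/4*e*kp)*(u x)^2)" using iu by simp
      fix x
      show "(3/4*e*kp)*(u x)^2 <= (u x)^2*(2*A (yc b x)*pd (X b x) V x - h*A' (yc b x) - h*A (yc b x)*dv b x)"
      proof (cases "x \<in> K")
        case True
        then have xN: "x \<in> N" using K by auto
        have "2*A (yc b x)*pd (X b x) V x - h*A' (yc b x) >= e*kp"
          unfolding A_def A'_def scaled_multiplier_term[OF xN b h(1) rh_def] e_def
          using \<alpha>(4) e by (intro mult_left_mono) (auto simp: e_def)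
        moreover have "\<bar>h*A (yc b x)*dv b x\<bar> <= h*5*D"
          unfolding abs_mult using aA D(2)[OF True] h by (intro mult_mono) auto
        ultimately have "3/4*e*kp <= 2*A (yc b x)*pd (X b x) V x - h*A' (yc b x) - h*A (yc b x)*dv b x"
          using hD by linarith
        then show ?thesis by (subst mult.commute) (intro mult_left_mono; simp)
      qed (simp add: uK)
    qed
    then have "3/4*e*kp*I <= 5*L*(\<eta>*I + Qform V h u/\<eta>)" using M(2) by (simp add: I_def)
    also have "\<dots> = e*kp/4*I + 5*L*(Qform V h u/\<eta>)" using L0 by (simp add: \<eta>_def algebra_simps)
    finally have "3/4*(e*kp*I) <= 1/4*(e*kp*I) + 5*L*(Qform V h u/\<eta>)" by (simp only: mult.assoc times_divide_eq_left times_divide_eq_right mult_1_left)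
    then have "1/2*(e*kp*I) <= 5*L*(Qform V h u/\<eta>)" by linarith
    then have "e*kp/2*I <= 5*L*(Qform V h u/\<eta>)" by simp
    then have "e*kp/2*I*(\<eta>/(5*L)) <= 5*L*(Qform V h u/\<eta>)*(\<eta>/(5*L))"
      using \<eta> L0 by (intro mult_right_mono) auto
    also have "\<dots> = Qform V h u" using \<eta> L0 by simp
    also have "e*kp/2*I*(\<eta>/(5*L)) = c*e^2*I" using L0 by (simp add: \<eta>_def c_def power2_eq_square)
    finally show ?thesis unfolding I_def e_def r(4) .
  qed
  then show ?thesis using c kp1(1) zero_less_power[OF kp1(1), of "\<nu> b"] by blast
qed

end

section \<open>The lower bound near a minimum\<close>

lemma Ck_exp: "Ck_on UNIV k (exp :: real => real)"
proof (induction k)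
  case (Suc k)
  have "pd 1 (exp::real=>real) = exp"
    by (rule ext) (rule pd_eqI[OF DERIV_exp[unfolded has_field_derivative_def], THEN trans], simp)
  moreover have "(exp::real=>real) differentiable (at x)" for x
    using DERIV_exp[of x] unfolding differentiable_def has_field_derivative_def by blast
  ultimately show ?case using Suc by simp
qed (auto intro: continuous_intros)

context morse_chart
begin

text \<open>Two scale relations make the constants uniform in \<open>h\<close>. On the box with half
  sides \<open>S*rh b\<close> the quotient \<open>(V x - V x0)/h\<close> stays below
  \<open>M0\<close>, so multiplication by its exponential is harmless. The squared side divided by
  \<open>h^2\<close> is at most \<open>4*S^2/E\<close>, so the Poincare inequality loses exactly the
  factor \<open>1/E\<close>. What remains is the mean value, the rank-one term.\<close>

lemma min_bound:
  assumes K: "compact K" "K \<subseteq> N" and good: "\<And>b. b \<in> Basis ==> even (\<nu> b) \<and> t b > 0"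
    and nb: "\<And>b. b \<in> Basis ==> \<nu> b <= nb"
  shows "\<exists>h0>0. \<exists>c>0. \<forall>h. 0 < h \<and> h <= h0 --> (\<exists>l C. B2 l \<and> C >= 0 \<and>
    (\<forall>u. Ck_on UNIV (Suc 0) u --> (\<forall>x. x \<notin> K --> u x = 0) -->
     Qform V h u >= c*h powr (2 - 2/real nb)*(LBINT x. (u x)^2) - C*(LBINT x. l x*u x)^2))"
proof -
  have clK: "closed K" using K by (simp add: compact_imp_closed)
  define d where "d = real DIM('a)"
  have d: "d >= 1" using DIM_positive[where 'a='a] unfolding d_def by linarith
  have "\<exists>D>0. \<forall>x\<in>K. \<bar>dv b x\<bar> <= D" if "b \<in> Basis" for b
  proof -
    have "bounded (dv b ` K)"
      by (intro compact_imp_bounded compact_continuous_image continuous_on_subset[OF continuous_dv[OF that] K(2)] K(1))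
    then obtain D where "D > 0" "\<forall>y\<in>dv b ` K. norm y <= D" by (meson bounded_pos)
    then show ?thesis by auto
  qed
  then obtain Db where Db: "\<And>b. b \<in> Basis ==> Db b > 0" "\<And>b x. b \<in> Basis ==> x \<in> K ==> \<bar>dv b x\<bar> <= Db b" by metis
  define D where "D = (\<Sum>b\<in>Basis. Db b)"
  have D: "D > 0" "\<And>b x. b \<in> Basis ==> x \<in> K ==> \<bar>dv b x\<bar> <= D"
  proof -
    show "D > 0" unfolding D_def using Db(1) by (intro sum_pos) auto
    fix b x :: 'a assume b: "b \<in> Basis" and x: "x \<in> K"
    have "Db b <= D" unfolding D_def using Db(1) b by (intro member_le_sum) (auto simp: less_imp_le)
    then show "\<bar>dv b x\<bar> <= D" using Db(2)[OF b x] by linarith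
  qed
  define \<tau> where "\<tau> = Min ((%b. t b*real (\<nu> b)) ` Basis)"
  have \<tau>: "\<tau> > 0" "\<And>b. b \<in> Basis ==> \<tau> <= t b*real (\<nu> b)"
  proof -
    have "0 < t b*real (\<nu> b)" if "b \<in> Basis" for b using good[OF that] \<nu>2[OF that] by simp
    then show "\<tau> > 0" unfolding \<tau>_def by (subst Min_gr_iff) auto
    show "\<tau> <= t b*real (\<nu> b)" if "b \<in> Basis" for b unfolding \<tau>_def using that by (intro Min_le) auto
  qed
  \<comment> \<open>Large enough that, in each of the \<open>d\<close> directions, the mass with
    \<open>\<bar>yc b x\<bar> >= S*rh b\<close> is at most \<open>I/(2*d)\<close> up to a multiple
    of \<open>Q/E\<close>; together these regions take at most half of \<open>I\<close>.\<close>
  define S where "S = max 1 (2*d*(1 + 2*D + 2*L)/\<tau>)"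
  have S1: "S >= 1" by (simp add: S_def)
  have S2: "\<tau>*S >= 2*d*(1 + 2*D + 2*L)"
  proof -
    have "2*d*(1 + 2*D + 2*L)/\<tau> <= S" by (simp add: S_def)
    then show ?thesis using \<tau> by (simp add: field_simps)
  qed
  obtain r where r: "r > 0" "ball x0 r \<subseteq> W" using oW x0W openE by blast
  \<comment> \<open>Since \<open>rh b <= kp\<close>, the box around \<open>x0\<close> has
    \<open>l1\<close>-radius at most \<open>d*(S*kp)\<close> and hence lies in the ball of radius
    \<open>r\<close> inside \<open>W\<close>.\<close>
  define kp where "kp = min 1 (r/(2*d*S))"
  have kp: "0 < kp" "kp <= 1" "d*(S*kp) < r"
  proof -
    show k0: "0 < kp" "kp <= 1" using r d S1 by (auto simp: kp_def)
    have "kp <= r/(2*d*S)" by (simp add: kp_def)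
    then have "2*(d*(S*kp)) <= r" using d S1 by (simp add: field_simps)
    then show "d*(S*kp) < r" using r by linarith
  qed
  define M0 where "M0 = (\<Sum>b\<in>Basis. t b*S^\<nu> b)"
  define CP where "CP = real DIM('a)*(2*(2*L^2)*real DIM('a))^DIM('a)"
  have CP0: "CP >= 0" by (simp add: CP_def)
  define C2 where "C2 = CP*(d*(4*S^2*((exp M0)^2*L^2)))"
  have C20: "C2 >= 0" using CP0 d by (simp add: C2_def)
  \<comment> \<open>The total coefficient of \<open>Q/E\<close>: \<open>d*(2*L/\<tau>)\<close> from
    outside the box and \<open>C2\<close> from the Poincare inequality inside.\<close>
  define C1 where "C1 = d*(2*L/\<tau>) + C2 + 1"
  have C1: "C1 > 0" using d L0 \<tau> C20 by (auto simp: C1_def intro!: add_nonneg_pos)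
  have "\<exists>l C. B2 l \<and> C >= 0 \<and>
    (\<forall>u. Ck_on UNIV (Suc 0) u --> (\<forall>x. x \<notin> K --> u x = 0) -->
     Qform V h u >= (1/(2*C1))*h powr (2 - 2/real nb)*(LBINT x. (u x)^2) - C*(LBINT x. l x*u x)^2)"
    if h: "0 < h" "h <= kp^nb" for h
  proof -
    have h1: "h <= 1" using h power_le_one[of kp nb] kp by linarith
    define E where "E = h powr (2 - 2/real nb)"
    have E: "E > 0" using h by (simp add: E_def)
    define rh where "rh = (%b. h powr (1/real (\<nu> b)))"
    note rs = root_scale[OF h(1) \<nu>2 rh_def[THEN fun_cong]]
    have rh0: "rh b > 0" and rhn: "rh b^\<nu> b = h" and rhE: "E <= (h/rh b)^2" and rhk: "rh b <= kp" if b: "b \<in> Basis" for b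
    proof -
      show "rh b > 0" "rh b^\<nu> b = h" using rs[OF b] by auto
      show "E <= (h/rh b)^2" unfolding rs(4)[OF b] E_def by (rule powr_exponent_mono[OF h(1) h1 \<nu>2[OF b] nb[OF b]])
      show "rh b <= kp" unfolding rh_def by (rule root_scale_le[OF h \<nu>2[OF b] nb[OF b] kp(1,2)])
    qed
    define w where "w = (\<Sum>b\<in>Basis. (S*rh b) *\<^sub>R b)"
    have wb: "w \<bullet> b = S*rh b" if "b \<in> Basis" for b
      using that by (simp add: w_def inner_sum_left inner_Basis if_distrib cong: if_cong)
    define p where "p = x0 - w"
    define q where "q = x0 + w"
    have inbox: "y \<in> cbox p q \<longleftrightarrow> (\<forall>b\<in>Basis. \<bar>(y - x0) \<bullet> b\<bar> <= S*rh b)" for y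
      unfolding mem_box p_def q_def by (intro ball_cong refl) (auto simp: wb inner_diff_left inner_add_left abs_le_iff)
    have P: "cbox p q \<subseteq> W"
    proof
      fix y assume "y \<in> cbox p q"
      then have y: "\<bar>(y - x0) \<bullet> b\<bar> <= S*rh b" if "b \<in> Basis" for b using inbox that by blast
      have "norm (y - x0) <= (\<Sum>b\<in>Basis. \<bar>(y - x0) \<bullet> b\<bar>)" by (rule norm_le_l1)
      also have "\<dots> <= (\<Sum>b\<in>(Basis::'a set). S*kp)"
        using y rhk S1 by (intro sum_mono) (meson mult_left_mono order_trans zero_le_one)
      also have "\<dots> = d*(S*kp)" by (simp add: d_def)
      finally show "y \<in> W" using kp(3) r(2) by (auto simp: dist_norm norm_minus_commute subset_eq)
    qed
    define Om where "Om = U ` cbox p q"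
    have OmN: "Om \<subseteq> N" using P UN by (auto simp: Om_def)
    have inOm: "x \<in> Om \<longleftrightarrow> (\<forall>b\<in>Basis. \<bar>yc b x\<bar> <= S*rh b)" if "x \<in> N" for x
    proof
      assume "x \<in> Om"
      then have "g x \<in> cbox p q" using P gU by (auto simp: Om_def)
      then show "\<forall>b\<in>Basis. \<bar>yc b x\<bar> <= S*rh b" using inbox by (simp add: yc_def)
    next
      assume "\<forall>b\<in>Basis. \<bar>yc b x\<bar> <= S*rh b"
      then have "g x \<in> cbox p q" using inbox by (simp add: yc_def)
      then show "x \<in> Om" using Ug[OF that] by (force simp: Om_def)
    qed
    have comp: "compact Om" unfolding Om_def
      by (intro compact_continuous_image continuous_on_subset[OF continuous_U P]) simp
    have Omm[measurable]: "Om \<in> sets borel" using comp by (simp add: compact_imp_closed)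
    define m where "m = measure lborel Om"
    \<comment> \<open>The final constant contains \<open>1/m\<close>, so the box image must have
      positive volume: it contains a ball around \<open>x0\<close>.\<close>
    have m0: "m > 0"
    proof -
      define S' where "S' = N \<inter> g -` box p q"
      have "open S'" unfolding S'_def using continuous_open_preimage[OF continuous_g oN open_box] .
      moreover have "x0 \<in> S'"
      proof -
        have "x0 \<in> box p q" unfolding mem_box p_def q_def using S1 rh0 by (auto simp: wb inner_diff_left inner_add_left)
        then show ?thesis using x0N gx0 by (simp add: S'_def)
      qed
      ultimately obtain \<delta> where \<delta>: "\<delta> > 0" "ball x0 \<delta> \<subseteq> S'" using openE by blast
      have "S' \<subseteq> Om"
      proof
        fix x assume "x \<in> S'"
        then have "g x \<in> cbox p q" "U (g x) = x" using box_subset_cbox Ug by (auto simp: S'_def)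
        then show "x \<in> Om" unfolding Om_def by (metis imageI)
      qed
      then have "ball x0 \<delta> \<subseteq> Om" using \<delta> by blast
      then have "measure lborel (ball x0 \<delta>) <= m" unfolding m_def
        using comp by (intro measure_mono_fmeasurable) (auto simp: fmeasurable_compact)
      then show ?thesis using content_ball_pos[OF \<delta>(1), of x0] by linarith
    qed
    define w0 where "w0 = (%x. exp ((V x - V x0)/h))"
    have Cw0: "Ck_on UNIV k w0" for k
    proof -
      have "Ck_on UNIV k (%x. (V x - V x0)*(1/h))"
        by (intro Ck_mult Ck_diff Ck_const smooth_Ck[OF V])
      from Ck_compose_real[OF Ck_exp this] show ?thesis by (simp add: w0_def)
    qed
    have w0b: "1 <= w0 x \<and> w0 x <= exp M0" if x: "x \<in> Om" for x
    proof -
      have xN: "x \<in> N" using x OmN by auto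
      have eq: "(V x - V x0)/h = (\<Sum>b\<in>Basis. t b*yc b x^\<nu> b/h)"
        using V_form[OF xN] by (simp add: yc_def sum_divide_distrib)
      have each: "0 <= t b*yc b x^\<nu> b/h" "t b*yc b x^\<nu> b/h <= t b*S^\<nu> b" if b: "b \<in> Basis" for b
      proof -
        have ev: "yc b x^\<nu> b = \<bar>yc b x\<bar>^\<nu> b" using good[OF b] by (simp add: power_even_abs)
        show "0 <= t b*yc b x^\<nu> b/h" unfolding ev using good[OF b] h by simp
        have "\<bar>yc b x\<bar>^\<nu> b <= (S*rh b)^\<nu> b" using inOm[OF xN] x b by (intro power_mono) auto
        also have "\<dots> = S^\<nu> b*h" by (simp add: power_mult_distrib rhn[OF b])
        finally have "\<bar>yc b x\<bar>^\<nu> b/h <= S^\<nu> b" using h by (simp add: field_simps)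
        then have "t b*(\<bar>yc b x\<bar>^\<nu> b/h) <= t b*S^\<nu> b" using good[OF b] by (intro mult_left_mono) auto
        then show "t b*yc b x^\<nu> b/h <= t b*S^\<nu> b" unfolding ev by simp
      qed
      have "0 <= (V x - V x0)/h" "(V x - V x0)/h <= M0"
        unfolding eq M0_def using each by (auto intro!: sum_nonneg sum_mono)
      then show ?thesis by (simp add: w0_def)
    qed
    \<comment> \<open>Pairing \<open>u\<close> with \<open>l\<close> is the integral of
      \<open>w0*u\<close> over the box image, the mean that the Poincare inequality cannot
      control.\<close>
    define l where "l = (%x. indicator Om x*w0 x)"
    have lm: "l \<in> borel_measurable borel" unfolding l_def
      using borel_measurable_continuous_onI[OF Ck_continuous[OF Cw0[of 0]]] by measurable
    have bsOm: "bsupp (%x. indicator Om x*f x :: real)" for f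
    proof -
      obtain B where "\<forall>x\<in>Om. norm x <= B" using compact_imp_bounded[OF comp] by (auto simp: bounded_iff)
      then show ?thesis unfolding bsupp_def by (intro exI[of _ B]) (force simp: indicator_def)
    qed
    have B2l: "B2 l" unfolding B2_def
    proof
      show "integrable lborel (%x. (l x)^2)"
      proof (rule integrable_bsupp_bounded)
        show "bsupp (%x. (l x)^2)" unfolding l_def by (intro bsupp_power bsOm)
        fix x show "\<bar>(l x)\<^sup>2\<bar> <= (exp M0)^2"
          using w0b[of x] power_mono[of "w0 x" "exp M0" 2] by (auto simp: l_def indicator_def)
      qed (use lm in measurable)
    qed (rule lm)
    have main: "Qform V h u >= (1/(2*C1))*E*(LBINT x. (u x)^2) - (E/(C1*m))*(LBINT x. l x*u x)^2"
      if u: "Ck_on UNIV (Suc 0) u" and uK: "\<And>x. x \<notin> K ==> u x = 0" for u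
    proof -
      define I where "I = (LBINT x. (u x)^2)"
      define Q where "Q = Qform V h u"
      have bs: "bsupp u"
      proof -
        obtain B where "\<forall>x\<in>K. norm x <= B" using compact_imp_bounded[OF K(1)] by (auto simp: bounded_iff)
        then show ?thesis unfolding bsupp_def by (intro exI[of _ B]) (force intro: uK)
      qed
      have cu: "continuous_on UNIV u" by (rule Ck_continuous[OF u])
      have um[measurable]: "u \<in> borel_measurable borel" by (rule borel_measurable_continuous_onI[OF cu])
      have iu: "integrable lborel (%x. (u x)^2)" by (intro integrable_bsupp continuous_intros cu bsupp_power bs)
      have I0: "I >= 0" unfolding I_def by (intro integral_nonneg_AE) auto
      define qq where "qq = (%x. \<Sum>c\<in>Basis. (h*pd c u x + u x*pd c V x)^2)"
      have qq0: "qq x >= 0" for x by (auto simp: qq_def intro: sum_nonneg)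
      have iq: "integrable lborel qq" unfolding qq_def by (rule Qform_integrable[OF V u bs])
      have Qq: "Q = (LBINT x. qq x)" by (simp add: Q_def Qform_def qq_def)
      have Q0: "Q >= 0" unfolding Qq using qq0 by (intro integral_nonneg_AE) auto
      \<comment> \<open>Together with \<open>Om\<close> these sets cover \<open>N\<close>.\<close>
      define out where "out = (%b. {x \<in> N. S*rh b <= \<bar>yc b x\<bar>})"
      have outm: "out b \<in> sets borel" for b
      proof -
        have "(%x. indicator N x *\<^sub>R \<bar>yc b x\<bar>) \<in> borel_measurable borel"
          using oN by (intro borel_measurable_continuous_on_indicator continuous_intros continuous_yc) auto
        then have "{x \<in> space borel. S*rh b <= indicator N x *\<^sub>R \<bar>yc b x\<bar>} \<in> sets borel" by measurable
        moreover have "N \<in> sets borel" using oN by simp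
        moreover have "out b = N \<inter> {x \<in> space borel. S*rh b <= indicator N x *\<^sub>R \<bar>yc b x\<bar>}" by (auto simp: out_def)
        ultimately show ?thesis by auto
      qed
      have iout: "integrable lborel (%x. indicator (out b) x*(u x)^2)" for b
        using integrable_real_mult_indicator[OF _ iu, of "out b"] outm by (simp add: mult.commute)
      have iOm: "integrable lborel (%x. indicator Om x*(u x)^2)"
        using integrable_real_mult_indicator[OF _ iu, of Om] by (simp add: mult.commute)
      \<comment> \<open>Multiplier \<open>arctan (yc b x/rh b)\<close>. Its main term is at least
        \<open>\<tau>*S\<close> on \<open>out b\<close> and nonnegative elsewhere; the derivative of
        arctan, the divergence and the Young term cost \<open>1 + 2*D + 2*L\<close>, all in units of
        \<open>e = h/rh b\<close>.\<close>
      have outb: "(LBINT x. indicator (out b) x*(u x)^2) <= I/(2*d) + (2*L/\<tau>)*(Q/E)" if b: "b \<in> Basis" for b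
      proof -
        define e where "e = h/rh b"
        have e: "e > 0" using h rh0[OF b] by (simp add: e_def)
        have he: "h <= e"
        proof -
          have "rh b <= 1" using rhk[OF b] kp by linarith
          then show ?thesis unfolding e_def using h rh0[OF b] by (simp add: pos_le_divide_eq mult_left_le)
        qed
        define A where "A = (%s. arctan (s/rh b))"
        define A' where "A' = (%s. inverse (1 + (s/rh b)^2)/rh b)"
        have dA: "(A has_real_derivative A' s) (at s)" for s
          unfolding A_def A'_def using rh0[OF b] by (auto intro!: derivative_eq_intros simp: field_simps)
        have nz: "1 + (s/rh b)^2 \<noteq> 0" for s using zero_le_power2[of "s/rh b"] by linarith
        have cA': "continuous_on UNIV A'" unfolding A'_def using rh0[OF b] nz by (intro continuous_intros) auto
        have aA: "\<bar>A s\<bar> <= 2" for s unfolding A_def by (rule arctan_bounds)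
        note M = multiplier_inequality[OF K b u uK dA cA' aA e, of h]
        have o: "odd (\<nu> b - 1)" using good[OF b] \<nu>2[OF b] by simp
        have "(LBINT x. e*(\<tau>*S*(indicator (out b) x*(u x)^2)) - e*(1 + 2*D)*(u x)^2)
          <= (LBINT x. (u x)^2*(2*A (yc b x)*pd (X b x) V x - h*A' (yc b x) - h*A (yc b x)*dv b x))"
        proof (rule integral_mono[OF _ M(1)])
          show "integrable lborel (%x. e*(\<tau>*S*(indicator (out b) x*(u x)^2)) - e*(1 + 2*D)*(u x)^2)"
            using iu iout by (intro Bochner_Integration.integrable_diff integrable_mult_right) auto
          fix x
          show "e*(\<tau>*S*(indicator (out b) x*(u x)^2)) - e*(1 + 2*D)*(u x)^2
            <= (u x)^2*(2*A (yc b x)*pd (X b x) V x - h*A' (yc b x) - h*A (yc b x)*dv b x)"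
          proof (cases "x \<in> K")
            case True
            then have xN: "x \<in> N" using K by auto
            define s where "s = yc b x/rh b"
            have eq: "2*A (yc b x)*pd (X b x) V x - h*A' (yc b x)
               = e*(2*t b*real (\<nu> b) * s^(\<nu> b - 1)*arctan s - inverse (1 + s^2))"
              unfolding A_def A'_def e_def s_def
              by (rule scaled_multiplier_term[OF xN b h(1) rh_def[THEN fun_cong], of arctan "%s. inverse (1 + s^2)"])
            have ts: "2*t b*real (\<nu> b) * s^(\<nu> b - 1)*arctan s >= \<tau>*S*indicator (out b) x"
            proof (cases "x \<in> out b")
              case xo: True
              then have "S*rh b <= \<bar>yc b x\<bar>" by (simp add: out_def)
              then have "S <= \<bar>s\<bar>" using rh0[OF b] by (simp add: s_def pos_le_divide_eq)
              from odd_power_arctan(2)[OF o this S1] have a: "S/2 <= s^(\<nu> b - 1)*arctan s" .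
              have "(2*\<tau>)*(S/2) <= (2*(t b*real (\<nu> b)))*(s^(\<nu> b - 1)*arctan s)"
                using a \<tau>(2)[OF b] \<tau>(1) S1 by (intro mult_mono) auto
              then show ?thesis using xo by (simp add: mult_ac)
            next
              case xo: False
              have "0 <= (2*(t b*real (\<nu> b)))*(s^(\<nu> b - 1)*arctan s)"
                by (rule mult_nonneg_nonneg[OF _ odd_power_arctan(1)[OF o]]) (use good[OF b] in auto)
              then show ?thesis using xo by (simp add: mult_ac)
            qed
            have "inverse (1 + s^2) <= 1" by (simp add: inverse_le_1_iff)
            then have "\<tau>*S*indicator (out b) x - 1 <= 2*t b*real (\<nu> b) * s^(\<nu> b - 1)*arctan s - inverse (1 + s^2)"
              using ts by linarith
            then have 1: "e*(\<tau>*S*indicator (out b) x - 1) <= 2*A (yc b x)*pd (X b x) V x - h*A' (yc b x)"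
              unfolding eq using e by (intro mult_left_mono) auto
            have "\<bar>h*A (yc b x)*dv b x\<bar> <= e*2*D"
              unfolding abs_mult using aA D(2)[OF b True] h he by (intro mult_mono) auto
            then have "e*(\<tau>*S*indicator (out b) x - 1) - e*2*D <= 2*A (yc b x)*pd (X b x) V x - h*A' (yc b x) - h*A (yc b x)*dv b x"
              using 1 by linarith
            then have "(u x)^2*(e*(\<tau>*S*indicator (out b) x - 1) - e*2*D) <= (u x)^2*(2*A (yc b x)*pd (X b x) V x - h*A' (yc b x) - h*A (yc b x)*dv b x)"
              by (intro mult_left_mono) auto
            moreover have "e*(\<tau>*S*(indicator (out b) x*(u x)^2)) - e*(1 + 2*D)*(u x)^2 = (u x)^2*(e*(\<tau>*S*indicator (out b) x - 1) - e*2*D)"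
              by (simp add: algebra_simps)
            ultimately show ?thesis by simp
          qed (simp add: uK)
        qed
        also have "\<dots> <= 2*L*(e*I + Q/e)" using M(2) by (simp add: I_def Q_def)
        also have "(LBINT x. e*(\<tau>*S*(indicator (out b) x*(u x)^2)) - e*(1 + 2*D)*(u x)^2)
          = e*(\<tau>*S*(LBINT x. indicator (out b) x*(u x)^2)) - e*(1 + 2*D)*I"
          using iu iout by (subst Bochner_Integration.integral_diff) (auto simp: I_def)
        finally have "e*(\<tau>*S*(LBINT x. indicator (out b) x*(u x)^2)) <= e*((1 + 2*D + 2*L)*I + 2*L*(Q/e^2))"
          using e by (simp add: algebra_simps power2_eq_square)
        then have 2: "\<tau>*S*(LBINT x. indicator (out b) x*(u x)^2) <= (1 + 2*D + 2*L)*I + 2*L*(Q/e^2)"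
          using e by simp
        have "Q/e^2 <= Q/E" using rhE[OF b] Q0 E e unfolding e_def[symmetric] by (intro divide_left_mono mult_pos_pos zero_less_power)
        then have "2*L*(Q/e^2) <= 2*L*(Q/E)" using L0 by (intro mult_left_mono) auto
        then have 3: "\<tau>*S*(LBINT x. indicator (out b) x*(u x)^2) <= (1 + 2*D + 2*L)*I + 2*L*(Q/E)"
          using 2 by linarith
        have TS: "\<tau>*S > 0" using \<tau> S1 by simp
        have 4: "(1 + 2*D + 2*L)*I <= (\<tau>*S)*(I/(2*d))"
        proof -
          have "(2*d*(1 + 2*D + 2*L))*(I/(2*d)) <= (\<tau>*S)*(I/(2*d))" using S2 I0 d by (intro mult_right_mono) auto
          then show ?thesis using d by simp
        qed
        have 5: "2*L*(Q/E) <= (\<tau>*S)*((2*L/\<tau>)*(Q/E))"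
        proof -
          have "1*(2*L*(Q/E)) <= S*(2*L*(Q/E))" using S1 L0 Q0 E by (intro mult_right_mono) auto
          then show ?thesis using \<tau> by simp
        qed
        have "(\<tau>*S)*(LBINT x. indicator (out b) x*(u x)^2) <= (\<tau>*S)*(I/(2*d) + (2*L/\<tau>)*(Q/E))"
          using 3 4 5 unfolding distrib_left by linarith
        then show ?thesis using TS by (simp only: mult_le_cancel_left_pos)
      qed
      have "I <= (LBINT x. indicator Om x*(u x)^2 + (\<Sum>b\<in>Basis. indicator (out b) x*(u x)^2))"
        unfolding I_def
      proof (rule integral_mono[OF iu])
        show "integrable lborel (%x. indicator Om x*(u x)^2 + (\<Sum>b\<in>Basis. indicator (out b) x*(u x)^2))"
          by (intro Bochner_Integration.integrable_add Bochner_Integration.integrable_sum iOm iout)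
        fix x
        have nn: "0 <= (\<Sum>b\<in>Basis. indicator (out b) x*(u x)^2)" by (intro sum_nonneg) auto
        show "(u x)^2 <= indicator Om x*(u x)^2 + (\<Sum>b\<in>Basis. indicator (out b) x*(u x)^2)"
        proof (cases "x \<in> N")
          case True
          show ?thesis
          proof (cases "x \<in> Om")
            case False
            then obtain b where b: "b \<in> Basis" "\<not> \<bar>yc b x\<bar> <= S*rh b" using inOm[OF True] by blast
            then have "x \<in> out b" using True by (auto simp: out_def)
            moreover have "indicator (out b) x*(u x)^2 <= (\<Sum>b\<in>Basis. indicator (out b) x*(u x)^2)"
              using b by (intro member_le_sum) auto
            ultimately have "(u x)^2 <= (\<Sum>b\<in>Basis. indicator (out b) x*(u x)^2)" by (simp only: indicator_simps mult_1_left)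
            then show ?thesis using False by (simp only: indicator_simps mult_zero_left add_0_left not_False_eq_True)
          next
            case True
            then show ?thesis using nn by (simp only: indicator_simps mult_1_left)
          qed
        next
          case False
          then have "u x = 0" using K uK by auto
          then show ?thesis by simp
        qed
      qed
      also have "\<dots> = (LBINT x. indicator Om x*(u x)^2) + (\<Sum>b\<in>Basis. \<integral>x. indicator (out b) x*(u x)^2 \<partial>lborel)"
        by (simp only: Bochner_Integration.integral_add[OF iOm Bochner_Integration.integrable_sum[OF iout]] Bochner_Integration.integral_sum[OF iout])
      also have "(\<Sum>b\<in>Basis. \<integral>x. indicator (out b) x*(u x)^2 \<partial>lborel) <= (\<Sum>b\<in>(Basis::'a set). I/(2*d) + (2*L/\<tau>)*(Q/E))"
        by (intro sum_mono outb)
      also have "\<dots> = I/2 + d*(2*L/\<tau>)*(Q/E)" using d by (simp add: d_def[symmetric] distrib_left)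
      finally have half: "I/2 <= (LBINT x. indicator Om x*(u x)^2) + d*(2*L/\<tau>)*(Q/E)" by simp
      define v where "v = (%x. w0 x*u x)"
      have Cv: "Ck_on UNIV (Suc 0) v" unfolding v_def by (intro Ck_mult Cw0 u)
      have lu: "(LBINT x. l x*u x) = (LBINT x. indicator Om x * v x)" by (simp add: l_def v_def mult.assoc)
      have Xv: "(pd (X b x) v x)^2 <= ((exp M0)^2*L^2/h^2)*qq x" if x: "x \<in> Om" and b: "b \<in> Basis" for x b
      proof -
        have xN: "x \<in> N" using x OmN by auto
        have dw0: "w0 differentiable (at x)" using Cw0[of "Suc 0"] by simp
        have du: "u differentiable (at x)" using u by simp
        have pw: "pd z w0 x = w0 x*pd z V x/h" for z
        proof -
          have "((%y. (V y - V x0)/h) has_derivative (%z. pd z V x/h)) (at x)"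
            using has_derivative_pd[OF V_differentiable[of x]] h by (auto intro!: derivative_eq_intros)
          from has_derivative_exp[OF this] have "(w0 has_derivative (%z. w0 x*(pd z V x/h))) (at x)"
            unfolding w0_def by (simp add: mult.commute)
          from pd_eqI[OF this] show ?thesis by simp
        qed
        \<comment> \<open>Conjugation by \<open>w0\<close> turns the twisted derivative of
          \<open>u\<close> into an ordinary derivative of \<open>v\<close>.\<close>
        have eq: "pd (X b x) v x = (w0 x/h)*(h*pd (X b x) u x + u x*pd (X b x) V x)"
          unfolding v_def pd_mult[OF dw0 du] pw using h by (simp add: field_simps)
        have "\<bar>h*pd (X b x) u x + u x*pd (X b x) V x\<bar> <= norm (X b x) * sqrt (qq x)"
          unfolding qq_def by (rule directional_le[OF du V_differentiable])
        also have "\<dots> <= L * sqrt (qq x)" using X_le[OF xN b] qq0 by (intro mult_right_mono) auto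
        finally have 1: "\<bar>h*pd (X b x) u x + u x*pd (X b x) V x\<bar> <= L * sqrt (qq x)" .
        have "\<bar>pd (X b x) v x\<bar> <= (exp M0/h)*(L * sqrt (qq x))"
          unfolding eq abs_mult using 1 w0b[OF x] h by (intro mult_mono) (auto simp: divide_right_mono)
        from power_mono[OF this, of 2] show ?thesis using qq0[of x] h by (simp add: power_mult_distrib power_divide)
      qed
      have iXv: "(LBINT x. indicator Om x*(pd (X b x) v x)^2) <= ((exp M0)^2*L^2/h^2)*Q" if b: "b \<in> Basis" for b
      proof -
        have "(LBINT x. indicator Om x*(pd (X b x) v x)^2) <= (LBINT x. ((exp M0)^2*L^2/h^2)*qq x)"
        proof (rule integral_mono')
          show "integrable lborel (%x. ((exp M0)^2*L^2/h^2)*qq x)" using iq by simp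
          fix x
          show "indicator Om x*(pd (X b x) v x)^2 <= ((exp M0)^2*L^2/h^2)*qq x"
            using Xv[OF _ b, of x] qq0[of x] by (cases "x \<in> Om") auto
          show "0 <= ((exp M0)^2*L^2/h^2)*qq x" using qq0[of x] by simp
        qed
        then show ?thesis by (simp add: Qq)
      qed
      define J where "J = (LBINT x. indicator Om x * v x)"
      have pc: "m*(LBINT x. indicator Om x*(v x)^2) <= CP*m*(\<Sum>b\<in>Basis. ((q - p) \<bullet> b)^2*(LBINT x. indicator Om x*(pd (X b x) v x)^2)) + J^2"
        unfolding m_def CP_def J_def by (rule poincare[OF P Cv Om_def])
      have "(\<Sum>b\<in>Basis. ((q - p) \<bullet> b)^2*(LBINT x. indicator Om x*(pd (X b x) v x)^2)) <= (\<Sum>b\<in>(Basis::'a set). 4*S^2*((exp M0)^2*L^2)*(Q/E))"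
      proof (rule sum_mono)
        fix b :: 'a assume b: "b \<in> Basis"
        have qp: "(q - p) \<bullet> b = 2*(S*rh b)" using wb[OF b] by (simp add: q_def p_def inner_diff_left inner_add_left)
        have "((q - p) \<bullet> b)^2*(LBINT x. indicator Om x*(pd (X b x) v x)^2) <= ((q - p) \<bullet> b)^2*(((exp M0)^2*L^2/h^2)*Q)"
          by (intro mult_left_mono iXv[OF b]) auto
        also have "\<dots> = 4*S^2*((exp M0)^2*L^2)*(Q/(h/rh b)^2)"
          unfolding qp using h rh0[OF b] by (simp add: power_mult_distrib power_divide)
        also have "\<dots> <= 4*S^2*((exp M0)^2*L^2)*(Q/E)"
          using rhE[OF b] Q0 E h rh0[OF b] by (intro mult_left_mono divide_left_mono mult_pos_pos zero_less_power divide_pos_pos) auto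
        finally show "((q - p) \<bullet> b)^2*(LBINT x. indicator Om x*(pd (X b x) v x)^2) <= 4*S^2*((exp M0)^2*L^2)*(Q/E)" .
      qed
      also have "(\<Sum>b\<in>(Basis::'a set). 4*S^2*((exp M0)^2*L^2)*(Q/E)) = d*(4*S^2*((exp M0)^2*L^2))*(Q/E)"
        by (simp add: d_def)
      finally have "CP*m*(\<Sum>b\<in>Basis. ((q - p) \<bullet> b)^2*(LBINT x. indicator Om x*(pd (X b x) v x)^2))
          <= CP*m*(d*(4*S^2*((exp M0)^2*L^2))*(Q/E))"
        using CP0 m0 by (intro mult_left_mono) auto
      then have "m*(LBINT x. indicator Om x*(v x)^2) <= CP*m*(d*(4*S^2*((exp M0)^2*L^2))*(Q/E)) + J^2"
        using pc by linarith
      also have "\<dots> = m*(C2*(Q/E) + J^2/m)" using m0 by (simp add: C2_def distrib_left mult_ac)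
      finally have pv: "(LBINT x. indicator Om x*(v x)^2) <= C2*(Q/E) + J^2/m" using m0 by (simp only: mult_le_cancel_left_pos)
      have "(LBINT x. indicator Om x*(u x)^2) <= (LBINT x. indicator Om x*(v x)^2)"
      proof (rule integral_mono[OF iOm])
        have "continuous_on Om (%x. (v x)^2)" by (intro continuous_intros continuous_on_subset[OF Ck_continuous[OF Cv]]) simp
        from borel_integrable_compact[OF comp this]
        show "integrable lborel (%x. indicator Om x*(v x)^2)" by (auto simp: indicator_def if_distrib[of "%z. z * _"] cong: if_cong)
        fix x
        show "indicator Om x*(u x)^2 <= indicator Om x*(v x)^2"
        proof (cases "x \<in> Om")
          case True
          have "1 <= (w0 x)^2" using w0b[OF True] by simp
          then have "1*(u x)^2 <= (w0 x)^2*(u x)^2" by (intro mult_right_mono) auto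
          then show ?thesis using True by (simp add: v_def power_mult_distrib)
        qed simp
      qed
      then have "I/2 <= C2*(Q/E) + J^2/m + d*(2*L/\<tau>)*(Q/E)" using half pv by linarith
      also have "\<dots> <= C1*(Q/E) + J^2/m" using divide_nonneg_pos[OF Q0 E] unfolding C1_def distrib_right by linarith
      \<comment> \<open>Multiplying by \<open>E/C1\<close> isolates \<open>Q\<close>, with
        \<open>1/(2*C1)\<close> as the uniform constant; the factor \<open>E/(C1*m)\<close> of the
        functional depends on \<open>h\<close>.\<close>
      finally have "E/C1*(I/2) <= E/C1*(C1*(Q/E) + J^2/m)" using E C1 by (intro mult_left_mono) auto
      also have "\<dots> = Q + E/(C1*m)*J^2" using E C1 m0 by (simp add: field_simps)
      finally have "1/(2*C1)*E*I - E/(C1*m)*J^2 <= Q" by simp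
      then show ?thesis unfolding lu by (simp add: I_def J_def Q_def)
    qed
    have "E/(C1*m) >= 0" using E C1 m0 by simp
    then show ?thesis using B2l main unfolding E_def by blast
  qed
  moreover have "kp^nb > 0" "1/(2*C1) > 0" using kp C1 by auto
  ultimately show ?thesis by blast
qed

end

section \<open>The effective potential away from critical points, and cutoffs in the form\<close>

definition Wpot :: "('a::euclidean_space => real) => real => 'a => real" where
  "Wpot V h x = (grad_norm V x)^2 - h*lap V x"

lemma continuous_grad_lap:
  fixes V :: "'a::euclidean_space => real"
  assumes V: "smooth_on UNIV V"
  shows "continuous_on S (%x. (grad_norm V x)^2)" "continuous_on S (lap V)" "continuous_on S (Wpot V h)"
    "b \<in> Basis ==> continuous_on S (pd b V)"
proof -
  have p: "continuous_on S (pd b V)" "continuous_on S (pd b (pd b V))" if "b \<in> Basis" for b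
  proof -
    have "continuous_on UNIV (pd b V)" "continuous_on UNIV (pd b (pd b V))"
      using smooth_Ck[OF V, of "Suc (Suc 0)"] smooth_Ck[OF V, of "Suc 0"] that by simp_all
    then show "continuous_on S (pd b V)" "continuous_on S (pd b (pd b V))" using continuous_on_subset subset_UNIV by blast+
  qed
  show 1: "continuous_on S (%x. (grad_norm V x)^2)" unfolding grad_norm_square using p by (intro continuous_intros)
  show 2: "continuous_on S (lap V)" unfolding lap_def[abs_def] using p by (intro continuous_intros)
  show "continuous_on S (Wpot V h)" unfolding Wpot_def[abs_def] by (intro continuous_intros 1 2)
  show "b \<in> Basis ==> continuous_on S (pd b V)" by (rule p)
qed

lemma crit_iff: "x \<in> crit V \<longleftrightarrow> grad_norm V x = 0"
  by (simp add: crit_def grad_norm_def sum_nonneg_eq_0_iff)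

text \<open>Outside the compact set of the confinement assumption \<open>h*lap V\<close> is absorbed
  by half of the squared gradient, which is bounded below; on the compact part outside
  \<open>S\<close> the gradient has a positive minimum. The global bound \<open>- s\<close> is
  independent of \<open>h\<close>, because only \<open>K\<close> contributes to it.\<close>

lemma potential_bounds:
  fixes V :: "'a::euclidean_space => real"
  assumes V: "smooth_on UNIV V" and conf: "confinement V" and S: "open S" "crit V \<subseteq> S"
  shows "\<exists>h0>0. \<exists>c>0. \<exists>s\<ge>0. \<forall>h. 0 < h \<and> h <= h0 --> (\<forall>x. x \<notin> S --> Wpot V h x >= c) \<and> (\<forall>x. Wpot V h x >= - s)"
proof -
  obtain C K where C: "C > 0" and K: "compact K" and out: "\<And>x. x \<notin> K ==> grad_norm V x >= 1/C \<and> \<bar>lap V x\<bar> <= C*(grad_norm V x)^2"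
    using conf unfolding confinement_def by blast
  have "bounded (lap V ` K)" by (intro compact_imp_bounded compact_continuous_image continuous_grad_lap V K)
  then obtain B where "B > 0" "\<forall>y\<in>lap V ` K. norm y <= B" by (meson bounded_pos)
  then have B: "B > 0" "\<And>x. x \<in> K ==> \<bar>lap V x\<bar> <= B" by auto
  have "\<exists>\<gamma>>0. \<forall>x\<in>K - S. \<gamma> <= (grad_norm V x)^2"
  proof (cases "K - S = {}")
    case False
    have "compact (K - S)" using K S by (simp add: compact_diff)
    then obtain z where z: "z \<in> K - S" "\<forall>x\<in>K - S. (grad_norm V z)^2 <= (grad_norm V x)^2"
      using continuous_attains_inf[OF _ False continuous_grad_lap(1)[OF V]] by blast
    have "grad_norm V z \<noteq> 0" using z S crit_iff[of z V] by auto
    then show ?thesis using z by (intro exI[of _ "(grad_norm V z)^2"]) auto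
  qed (auto intro: exI[of _ 1])
  then obtain \<gamma> where \<gamma>: "\<gamma> > 0" "\<And>x. x \<in> K - S ==> \<gamma> <= (grad_norm V x)^2" by auto
  \<comment> \<open>The second entry gives \<open>h*C <= 1/2\<close> for the absorption outside
    \<open>K\<close>, the third \<open>h*B <= \<gamma>/2\<close> on \<open>K - S\<close>.\<close>
  define h0 where "h0 = min 1 (min (1/(2*C)) (\<gamma>/(2*B)))"
  define c where "c = min (\<gamma>/2) (1/(2*C^2))"
  have h0: "h0 > 0" and c: "c > 0" using C B \<gamma> by (auto simp: h0_def c_def)
  have "(\<forall>x. x \<notin> S --> Wpot V h x >= c) \<and> (\<forall>x. Wpot V h x >= - B)" if h: "0 < h" "h <= h0" for h
  proof -
    have h1: "h <= 1" "h*C <= 1/2" "h*B <= \<gamma>/2"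
    proof -
      have "h <= 1/(2*C)" "h <= \<gamma>/(2*B)" "h <= 1" using h by (auto simp: h0_def)
      then show "h <= 1" "h*C <= 1/2" "h*B <= \<gamma>/2" using C B by (auto simp: field_simps)
    qed
    have outW: "Wpot V h x >= (grad_norm V x)^2/2 \<and> Wpot V h x >= 1/(2*C^2)" if x: "x \<notin> K" for x
    proof -
      have "h*lap V x <= h*(C*(grad_norm V x)^2)" using out[OF x] h by (intro mult_left_mono) auto
      also have "\<dots> = (h*C)*(grad_norm V x)^2" by simp
      also have "\<dots> <= 1/2*(grad_norm V x)^2" using h1 by (intro mult_right_mono) auto
      finally have 1: "Wpot V h x >= (grad_norm V x)^2/2" by (simp add: Wpot_def)
      have "(1/C)^2 <= (grad_norm V x)^2" using out[OF x] C by (intro power_mono) auto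
      then have "1/(2*C^2) <= (grad_norm V x)^2/2" by (simp add: power_divide)
      then show ?thesis using 1 by linarith
    qed
    have inK: "Wpot V h x >= (grad_norm V x)^2 - h*B" if "x \<in> K" for x
    proof -
      have "h*lap V x <= h*B" using B(2)[OF that] h by (intro mult_left_mono) auto
      then show ?thesis by (simp add: Wpot_def)
    qed
    show ?thesis
    proof (intro conjI allI impI)
      fix x
      show "Wpot V h x >= c" if "x \<notin> S"
        using outW[of x] inK[of x] \<gamma>(2)[of x] h1 that by (cases "x \<in> K") (auto simp: c_def min_def)
      have "h*B <= 1*B" using h1 B by (intro mult_right_mono) auto
      moreover have "(grad_norm V x)^2 >= 0" by simp
      ultimately show "Wpot V h x >= - B"
      proof (cases "x \<in> K")
        case True
        then show ?thesis using inK[OF True] \<open>h*B <= 1*B\<close> \<open>(grad_norm V x)\<^sup>2 >= 0\<close> by linarith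
      next
        case False
        then show ?thesis using outW[OF False] B(1) \<open>(grad_norm V x)\<^sup>2 >= 0\<close> by linarith
      qed
    qed
  qed
  then show ?thesis using h0 c less_imp_le[OF B(1)] by (intro exI[of _ h0] exI[of _ c] exI[of _ B] conjI) auto
qed

text \<open>The twisted gradient of \<open>\<eta>*u\<close> is \<open>\<eta>\<close> times that of
  \<open>u\<close> plus \<open>h*u\<close> times the gradient of \<open>\<eta>\<close>; the squares
  are separated with a factor 2, so no exact localisation formula is needed.\<close>

lemma Qform_cutoff:
  fixes V u \<eta> :: "'a::euclidean_space => real"
  assumes V: "smooth_on UNIV V" and u: "Ck_on UNIV (Suc 0) u" "bsupp u"
    and \<eta>: "Ck_on UNIV (Suc 0) \<eta>" "\<And>x. \<bar>\<eta> x\<bar> <= 1" "\<And>x. (\<Sum>b\<in>Basis. (pd b \<eta> x)^2) <= B"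
  shows "Qform V h (%x. \<eta> x*u x) <= 2*Qform V h u + 2*h^2*B*(LBINT x. (u x)^2)"
proof -
  have iu: "integrable lborel (%x. (u x)^2)" by (intro integrable_bsupp continuous_intros Ck_continuous[OF u(1)] bsupp_power u)
  note iq = Qform_integrable[OF V u, of h]
  have iq': "integrable lborel (%x. \<Sum>b\<in>Basis. (h*pd b (%x. \<eta> x*u x) x + \<eta> x*u x*pd b V x)^2)"
    by (rule Qform_integrable[OF V Ck_mult[OF \<eta>(1) u(1)] bsupp_mult_right[OF u(2)]])
  have "Qform V h (%x. \<eta> x*u x) <= (LBINT x. 2*(\<Sum>b\<in>Basis. (h*pd b u x + u x*pd b V x)^2) + 2*h^2*B*(u x)^2)"
    unfolding Qform_def
  proof (rule integral_mono[OF iq'])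
    show "integrable lborel (%x. 2*(\<Sum>b\<in>Basis. (h*pd b u x + u x*pd b V x)^2) + 2*h^2*B*(u x)^2)" using iu iq by simp
    fix x
    have d: "\<eta> differentiable (at x)" "u differentiable (at x)" using \<eta> u by auto
    have "(\<Sum>b\<in>Basis. (h*pd b (%x. \<eta> x*u x) x + \<eta> x*u x*pd b V x)^2)
      <= (\<Sum>b\<in>Basis. 2*(h*pd b u x + u x*pd b V x)^2 + 2*h^2*(u x)^2*(pd b \<eta> x)^2)"
    proof (rule sum_mono)
      fix b :: 'a
      define p q where "p = \<eta> x*(h*pd b u x + u x*pd b V x)" and "q = h*u x*pd b \<eta> x"
      have eq: "h*pd b (%x. \<eta> x*u x) x + \<eta> x*u x*pd b V x = p + q"
        unfolding pd_mult[OF d] p_def q_def by (simp add: algebra_simps)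
      have "0 <= (p - q)^2" by simp
      then have "(p + q)^2 <= 2*p^2 + 2*q^2" by (simp add: power2_eq_square algebra_simps)
      moreover have "p^2 <= 1*(h*pd b u x + u x*pd b V x)^2"
        unfolding p_def power_mult_distrib using \<eta>(2)[of x] by (intro mult_right_mono) (auto simp: abs_square_le_1)
      ultimately show "(h*pd b (%x. \<eta> x*u x) x + \<eta> x*u x*pd b V x)^2 <= 2*(h*pd b u x + u x*pd b V x)^2 + 2*h^2*(u x)^2*(pd b \<eta> x)^2"
        unfolding eq by (simp add: q_def power_mult_distrib)
    qed
    also have "\<dots> = 2*(\<Sum>b\<in>Basis. (h*pd b u x + u x*pd b V x)^2) + 2*h^2*(u x)^2*(\<Sum>b\<in>Basis. (pd b \<eta> x)^2)"
      by (simp add: sum.distrib sum_distrib_left)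
    also have "\<dots> <= 2*(\<Sum>b\<in>Basis. (h*pd b u x + u x*pd b V x)^2) + 2*h^2*(u x)^2*B"
      using \<eta>(3)[of x] by (intro add_left_mono mult_left_mono) auto
    finally show "(\<Sum>b\<in>Basis. (h*pd b (%x. \<eta> x*u x) x + \<eta> x*u x*pd b V x)^2)
      <= 2*(\<Sum>b\<in>Basis. (h*pd b u x + u x*pd b V x)^2) + 2*h^2*B*(u x)^2" by (simp add: mult_ac)
  qed
  also have "\<dots> = 2*Qform V h u + 2*h^2*B*(LBINT x. (u x)^2)" using iu iq by (simp add: Qform_def)
  finally show ?thesis .
qed

section \<open>Critical points and the bounds around each of them\<close>

locale witten_setup =
  fixes V :: "'a::euclidean_space => real" and t :: "'a => 'a => real" and \<nu> :: "'a => 'a => nat"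
  assumes V: "smooth_on UNIV V" and conf: "confinement V" and morse: "degenerate_morse V t \<nu>"
begin

lemma exists_chart:
  assumes x: "x \<in> crit V"
  shows "\<exists>U g W N L. morse_chart x U g W N L V (t x) (\<nu> x)"
proof -
  note m = morse[unfolded degenerate_morse_def, THEN bspec, OF x]
  have tn: "\<And>b. b \<in> Basis ==> t x b \<noteq> 0 \<and> \<nu> x b >= 2" using conjunct1[OF m] by (rule bspec)
  obtain W0 U where w: "open W0 \<and> x \<in> W0 \<and> smooth_on W0 U \<and> U x = x \<and> inj_on U W0 \<and> bij (frechet_derivative U (at x)) \<and>
       (\<forall>y\<in>W0. V (U y) - V x = (\<Sum>b\<in>Basis. t x b*((y - x) \<bullet> b)^\<nu> x b))"
    using conjunct2[OF m] by (elim exE) (rule that)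
  have W0: "open W0" using w by (elim conjE)
  have W1: "x \<in> W0" using w by (elim conjE)
  have W2: "smooth_on W0 U" using w by (elim conjE)
  have W3: "U x = x" using w by (elim conjE)
  have W4: "bij (frechet_derivative U (at x))" using w by (elim conjE)
  have Vf: "V (U y) - V x = (\<Sum>b\<in>Basis. t x b*((y - x) \<bullet> b)^\<nu> x b)" if "y \<in> W0" for y
    using w that by (elim conjE) (erule bspec)
  obtain W g N L where ch: "chart x U g W N L" "W \<subseteq> W0" using chart_exists[OF W0 W1 W2 W3 W4] by metis
  interpret chart x U g W N L by (rule ch)
  have "morse_chart x U g W N L V (t x) (\<nu> x)"
  proof
    fix z assume z: "z \<in> N"
    have "V (U (g z)) - V x = (\<Sum>b\<in>Basis. t x b*((g z - x) \<bullet> b)^\<nu> x b)" using gW[OF z] ch(2) by (intro Vf) auto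
    then show "V z = V x + (\<Sum>b\<in>Basis. t x b*((g z - x) \<bullet> b)^\<nu> x b)" using Ug[OF z] by simp
  qed (use V tn in auto)
  then show ?thesis by blast
qed

text \<open>Only the neighbourhood is fixed globally, since the radius of the balls refers to it;
  the remaining chart data are obtained anew from \<open>Nb_chart\<close>.\<close>

definition Nb :: "'a => 'a set" where
  "Nb x = (SOME N. \<exists>U g W L. morse_chart x U g W N L V (t x) (\<nu> x))"

lemma Nb_chart: "x \<in> crit V ==> \<exists>U g W L. morse_chart x U g W (Nb x) L V (t x) (\<nu> x)"
  unfolding Nb_def using exists_chart[of x] by (intro someI_ex[of "%N. \<exists>U g W L. morse_chart x U g W N L V (t x) (\<nu> x)"]) blast

text \<open>At a critical point the derivative along \<open>X b\<close> vanishes. It is a nonzero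
  multiple of a positive power of \<open>yc b\<close>, so all coordinates are zero.\<close>

lemma Nb_props:
  assumes x: "x \<in> crit V"
  shows "open (Nb x)" "x \<in> Nb x" "crit V \<inter> Nb x = {x}"
proof -
  obtain U g W L where "morse_chart x U g W (Nb x) L V (t x) (\<nu> x)" using Nb_chart[OF x] by blast
  then interpret morse_chart x U g W "Nb x" L V "t x" "\<nu> x" .
  show "open (Nb x)" "x \<in> Nb x" using oN x0N by auto
  have "z = x" if z: "z \<in> crit V" "z \<in> Nb x" for z
  proof -
    have y0: "yc b z = 0" if b: "b \<in> Basis" for b
    proof -
      have "pd (X b z) V z = (\<Sum>c\<in>Basis. (X b z \<bullet> c) *\<^sub>R pd c V z)" by (rule pd_linear_expand[OF V_differentiable])
      also have "\<dots> = 0" using z by (simp add: crit_def)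
      finally have "t x b*real (\<nu> x b)*yc b z^(\<nu> x b - 1) = 0" using XV[OF z(2) b] by simp
      then show ?thesis using t0[OF b] \<nu>2[OF b] by auto
    qed
    have "g z = x" by (rule euclidean_eqI) (use y0 in \<open>auto simp: yc_def inner_diff_left\<close>)
    then show ?thesis using Ug[OF z(2)] Ux0 by simp
  qed
  then show "crit V \<inter> Nb x = {x}" using x x0N by auto
qed

text \<open>Confinement puts the critical set into a compact set, and the neighbourhoods
  \<open>Nb x\<close> show its points to be isolated.\<close>

lemma finite_crit: "finite (crit V)"
proof -
  obtain C K where C: "C > 0" and K: "compact K" and out: "\<And>x. x \<notin> K ==> grad_norm V x >= 1/C"
    using conf unfolding confinement_def by blast
  have sub: "crit V \<subseteq> K"
  proof
    fix x assume "x \<in> crit V"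
    then have "grad_norm V x = 0" by (simp add: crit_iff)
    then show "x \<in> K" using out[of x] C by (cases "x \<in> K") auto
  qed
  have "crit V = (\<Inter>b\<in>Basis. {x. pd b V x = 0})" by (auto simp: crit_def)
  moreover have "closed {x. pd b V x = 0}" if "b \<in> Basis" for b
    by (intro closed_Collect_eq continuous_grad_lap(4)[OF V that] continuous_on_const)
  ultimately have "closed (crit V)" by (auto intro: closed_INT)
  then have "compact (crit V)" using compact_Int_closed[OF K] sub by (metis inf.absorb2)
  then obtain F where F: "F \<subseteq> crit V" "finite F" "crit V \<subseteq> (\<Union>x\<in>F. Nb x)"
  proof (rule compactE_image[of "crit V" "crit V" Nb])
    show "crit V \<subseteq> (\<Union>x\<in>crit V. Nb x)" using Nb_props(2) by blast
  qed (use Nb_props(1) in auto)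
  have "crit V \<subseteq> F"
  proof
    fix c assume c: "c \<in> crit V"
    then obtain x where x: "x \<in> F" "c \<in> Nb x" using F(3) by blast
    then have "x \<in> crit V" using F(1) by blast
    from Nb_props(3)[OF this] have "c = x" using c x(2) by blast
    then show "c \<in> F" using x by simp
  qed
  then show ?thesis using F(2) finite_subset by blast
qed

lemma radius_exists: "\<exists>r>0. \<forall>x\<in>crit V. cball x r \<subseteq> Nb x \<and> (\<forall>y\<in>crit V. y \<noteq> x --> cball x r \<inter> cball y r = {})"
proof (cases "crit V = {}")
  case False
  have "\<forall>x\<in>crit V. \<exists>r>0. cball x r \<subseteq> Nb x" using Nb_props(1,2) open_contains_cball by blast
  then obtain rr where rr: "\<And>x. x \<in> crit V ==> rr x > 0" "\<And>x. x \<in> crit V ==> cball x (rr x) \<subseteq> Nb x" by metis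
  \<comment> \<open>Other critical points are farther away than \<open>rr x >= 3*r\<close>, so a
    third makes the closed balls disjoint.\<close>
  define r where "r = Min (rr ` crit V)/3"
  have rle: "3*r <= rr x" if "x \<in> crit V" for x using finite_crit that by (simp add: r_def)
  have r: "r > 0" unfolding r_def using finite_crit False rr(1) by simp
  have "cball x r \<subseteq> Nb x \<and> (\<forall>y\<in>crit V. y \<noteq> x --> cball x r \<inter> cball y r = {})" if x: "x \<in> crit V" for x
  proof (intro conjI ballI impI)
    show "cball x r \<subseteq> Nb x" using order_trans[OF subset_cball rr(2)[OF x]] rle[OF x] r by simp
    fix y assume y: "y \<in> crit V" "y \<noteq> x"
    have "y \<notin> Nb x" using Nb_props(3)[OF x] y by auto
    then have "dist x y > rr x" using rr(2)[OF x] by force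
    then have d: "dist x y > 2*r" using rle[OF x] r by linarith
    show "cball x r \<inter> cball y r = {}"
    proof (rule ccontr)
      assume "cball x r \<inter> cball y r \<noteq> {}"
      then obtain z where "dist x z <= r" "dist y z <= r" by auto
      then show False using d dist_triangle[of x y z] by (simp add: dist_commute)
    qed
  qed
  then show ?thesis using r by blast
qed (auto intro: exI[of _ 1])

abbreviation "nb \<equiv> nu_bar V \<nu>"

lemma nu_le_nb: "x \<in> crit V ==> b \<in> Basis ==> \<nu> x b <= nb" "crit V \<noteq> {} ==> nb >= 2"
proof -
  have eq: "{\<nu> x b | x b. x \<in> crit V \<and> b \<in> Basis} = (%(x, b). \<nu> x b) ` (crit V \<times> Basis)" by auto
  have fin: "finite {\<nu> x b | x b. x \<in> crit V \<and> b \<in> Basis}" unfolding eq using finite_crit by simp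
  show le: "\<nu> x b <= nb" if "x \<in> crit V" "b \<in> Basis" for x b
    unfolding nu_bar_def using that by (intro Max_ge fin) blast
  assume "crit V \<noteq> {}"
  then obtain x where x: "x \<in> crit V" by blast
  obtain b :: 'a where b: "b \<in> Basis" using nonempty_Basis by blast
  have "\<nu> x b >= 2" using morse[unfolded degenerate_morse_def, THEN bspec, OF x, THEN conjunct1, THEN bspec, OF b] by simp
  then show "nb >= 2" using le[OF x b] by linarith
qed

definition EE :: "real => real" where "EE h = h powr (2 - 2/real nb)"

text \<open>Valid for every natural number \<open>nb\<close>, including the unspecified maximum of
  an empty set: division by zero gives exponent 2, and in all cases the exponent lies between 0 and
  2.\<close>

lemma EE_bounds: assumes "0 < h" "h <= 1" shows "EE h > 0" "EE h <= 1" "h^2 <= EE h"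
proof -
  have e: "0 <= 2 - 2/real nb" "2 - 2/real nb <= 2" by (cases "nb = 0"; simp add: field_simps)+
  show "EE h > 0" using assms by (simp add: EE_def)
  show "EE h <= 1" unfolding EE_def using assms e powr_mono'[of 0 "2 - 2/real nb" h] by simp
  have "h powr 2 <= EE h" unfolding EE_def using assms e by (intro powr_mono') auto
  then show "h^2 <= EE h" using assms by simp
qed

text \<open>\<open>C = 0\<close> off the minima ensures that only minima contribute functionals to
  the final count.\<close>

abbreviation (input) local_lower where
  "local_lower x r c h l C \<equiv> B2 l \<and> C >= 0 \<and> (x \<notin> local_minima V t \<nu> --> C = 0) \<and>
    (\<forall>u. Ck_on UNIV (Suc 0) u --> (\<forall>y. y \<notin> cball x r --> u y = 0) -->
     Qform V h u >= c*EE h*(LBINT x. (u x)^2) - C*(LBINT x. l x*u x)^2)"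

lemma local_bound:
  assumes x: "x \<in> crit V" and r: "cball x r \<subseteq> Nb x"
  shows "\<exists>h0>0. \<exists>c>0. \<forall>h. 0 < h \<and> h <= h0 --> (\<exists>l C. local_lower x r c h l C)"
proof -
  obtain U g W L where "morse_chart x U g W (Nb x) L V (t x) (\<nu> x)" using Nb_chart[OF x] by blast
  then interpret morse_chart x U g W "Nb x" L V "t x" "\<nu> x" .
  show ?thesis
  proof (cases "x \<in> local_minima V t \<nu>")
    case True
    have "\<exists>h0>0. \<exists>c>0. \<forall>h. 0 < h \<and> h <= h0 --> (\<exists>l C. B2 l \<and> C >= 0 \<and>
      (\<forall>u. Ck_on UNIV (Suc 0) u --> (\<forall>y. y \<notin> cball x r --> u y = 0) -->
       Qform V h u >= c*h powr (2 - 2/real nb)*(LBINT x. (u x)^2) - C*(LBINT x. l x*u x)^2))"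
      using True nu_le_nb(1)[OF x] by (intro min_bound compact_cball r) (auto simp: local_minima_def)
    then show ?thesis unfolding EE_def by (simp only: True not_True_eq_False simp_thms)
  next
    case False
    then obtain b where b: "b \<in> Basis" "\<not> (even (\<nu> x b) \<and> t x b > 0)" using x by (auto simp: local_minima_def)
    obtain h0 c where hc: "h0 > 0" "c > 0" and bd: "\<And>h u. 0 < h ==> h <= h0 ==> Ck_on UNIV (Suc 0) u ==> (\<forall>y. y \<notin> cball x r --> u y = 0) ==>
     Qform V h u >= c*h powr (2 - 2/real (\<nu> x b))*(LBINT x. (u x)^2)"
      using nonmin_bound[OF compact_cball r b] by blast
    have main: "Qform V h u >= c*EE h*(LBINT x. (u x)^2) - 0*(LBINT x. 0*u x)^2"
      if h: "0 < h" "h <= min 1 h0" and u: "Ck_on UNIV (Suc 0) u" "\<forall>y. y \<notin> cball x r --> u y = 0" for h u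
    proof -
      have "EE h <= h powr (2 - 2/real (\<nu> x b))" unfolding EE_def using h nu_le_nb(1)[OF x b(1)] \<nu>2[OF b(1)] by (intro powr_exponent_mono) auto
      then have "c*EE h*(LBINT x. (u x)^2) <= c*h powr (2 - 2/real (\<nu> x b))*(LBINT x. (u x)^2)"
        using hc by (intro mult_right_mono mult_left_mono integral_nonneg_AE) auto
      then show ?thesis using bd[OF h(1) _ u] h by simp
    qed
    have B20: "B2 (%x::'a. 0)" by (simp add: B2_def)
    show ?thesis
    proof (rule exI[of _ "min 1 h0"], rule conjI, use hc in simp, rule exI[of _ c], rule conjI, rule hc(2), intro allI impI)
      fix h assume h: "0 < h \<and> h <= min 1 h0"
      show "\<exists>l C. local_lower x r c h l C"
        by (rule exI[of _ "%x. 0"], rule exI[of _ "0::real"], intro conjI allI impI B20 order_refl refl, rule main) (use h in auto)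
    qed
  qed
qed

end

section \<open>Gluing the local bounds\<close>

text \<open>The constant value \<open>c\<close> at infinity is 0 for the cutoffs at critical points
  and 1 for the remainder of the partition.\<close>

lemma gradient_bounded:
  fixes f :: "'a::euclidean_space => real"
  assumes f: "Ck_on UNIV (Suc 0) f" and c: "\<And>x. norm x > R ==> f x = c"
  obtains B where "B > 0" "\<And>x. (\<Sum>b\<in>Basis. (pd b f x)^2) <= B"
proof -
  have "bsupp (pd b f)" for b
  proof -
    have "bsupp (%x. f x + (- c))" unfolding bsupp_def using c by (intro exI[of _ R]) auto
    then have "bsupp (pd b (%x. f x + (- c)))" by (rule bsupp_pd)
    moreover have "pd b (%x. f x + (- c)) = pd b f" by (rule ext, subst pd_add) (use f in auto)
    ultimately show ?thesis by simp
  qed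
  then have "bsupp (%x. \<Sum>b\<in>Basis. (pd b f x)^2)" by (intro bsupp_sum bsupp_power) auto
  moreover have "continuous_on UNIV (%x. \<Sum>b\<in>Basis. (pd b f x)^2)" using f by (intro continuous_intros) auto
  ultimately obtain B where "B > 0" "\<And>x. norm (\<Sum>b\<in>Basis. (pd b f x)^2) <= B" using bsupp_bounded_continuous by blast
  then show ?thesis by (intro that[of B]) (auto simp: abs_le_iff)
qed

text \<open>This is \<open>theta_le\<close> at \<open>h/kp\<close>.\<close>

lemma exp_minus_le_power:
  fixes kp h :: real
  assumes "kp > 0" "h > 0"
  shows "exp (- kp/h) <= fact (n + 1)*(h/kp)^(n + 1)"
proof -
  have s: "h/kp > 0" using assms by simp
  have "theta n (h/kp) = exp (- kp/h)/(h/kp)^n" using s assms by (simp add: theta_def)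
  then have "exp (- kp/h)/(h/kp)^n <= fact (n + 1)*(h/kp)" using theta_le[of n "h/kp"] s assms by (simp add: abs_of_pos del: fact_Suc)
  then have "exp (- kp/h) <= fact (n + 1)*(h/kp)*(h/kp)^n" using s by (simp only: pos_divide_le_eq[OF zero_less_power[OF s]])
  then show ?thesis by (simp add: mult_ac)
qed

context witten_setup
begin

text \<open>Without critical points the potential is bounded below everywhere, and
  \<open>EE h <= 1\<close> suffices because the exponent has no meaning here.\<close>

lemma global_lower_empty:
  assumes "crit V = {}"
  shows "\<exists>h0>0. \<exists>\<epsilon>>0. \<forall>h. 0 < h \<and> h <= h0 --> (\<forall>u. Ck_on UNIV (Suc 0) u --> bsupp u -->
     Qform V h u >= \<epsilon>*EE h*(LBINT x. (u x)^2))"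
proof -
  obtain h1 c where h1: "h1 > 0" "c > 0" and pot: "\<And>h x. 0 < h ==> h <= h1 ==> Wpot V h x >= c"
    using potential_bounds[OF V conf open_empty] assms by auto
  have "Qform V h u >= c*EE h*(LBINT x. (u x)^2)" if h: "0 < h" "h <= min 1 h1" and u: "Ck_on UNIV (Suc 0) u" "bsupp u" for h u
  proof -
    have cu: "continuous_on UNIV u" by (rule Ck_continuous[OF u(1)])
    have iu: "integrable lborel (%x. (u x)^2)" by (intro integrable_bsupp continuous_intros cu bsupp_power u)
    have E: "EE h <= 1" using EE_bounds h by auto
    have "c*EE h*(LBINT x. (u x)^2) <= c*1*(LBINT x. (u x)^2)"
      using E h1 by (intro mult_right_mono mult_left_mono integral_nonneg_AE) auto
    also have "\<dots> = (LBINT x. c*(u x)^2)" using iu by simp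
    also have "\<dots> <= (LBINT x. Wpot V h x*(u x)^2)"
    proof (rule integral_mono)
      show "integrable lborel (%x. c*(u x)^2)" using iu by simp
      show "integrable lborel (%x. Wpot V h x*(u x)^2)"
        by (intro integrable_bsupp continuous_intros cu continuous_grad_lap[OF V] bsupp_mult_right bsupp_power u)
    qed (use pot[of h] h in \<open>auto intro: mult_right_mono\<close>)
    also have "\<dots> <= Qform V h u" using Qform_ge_potential[OF V u, of h] by (simp add: Wpot_def)
    finally show ?thesis .
  qed
  then show ?thesis using h1 by (intro exI[of _ "min 1 h1"] exI[of _ c] conjI) auto
qed

text \<open>Partition \<open>1 = \<eta>\<^sub>0 + \<Sum>x\<in>G. \<eta> x\<close> by functions and
  not by their squares; this costs the factor \<open>n2\<close>, which \<open>\<epsilon>\<close>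
  absorbs. Each \<open>\<eta> x*u\<close> obeys a local bound, \<open>\<eta>\<^sub>0*u\<close> the
  potential bound.\<close>

lemma global_lower:
  shows "\<exists>h0>0. \<exists>\<epsilon>>0. \<forall>h. 0 < h \<and> h <= h0 --> (\<exists>l C. (\<forall>m. B2 (l m)) \<and> C >= 0 \<and> (\<forall>u. Ck_on UNIV (Suc 0) u --> bsupp u -->
     Qform V h u >= \<epsilon>*EE h*(LBINT x. (u x)^2) - C*(\<Sum>m\<in>local_minima V t \<nu>. (LBINT x. l m x*u x)^2)))"
proof (cases "crit V = {}")
  case True
  obtain h0 \<epsilon> where h0: "h0 > 0" "\<epsilon> > 0" and bd: "\<And>h u. 0 < h ==> h <= h0 ==> Ck_on UNIV (Suc 0) u ==> bsupp u ==>
     Qform V h u >= \<epsilon>*EE h*(LBINT x. (u x)^2)"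
    using global_lower_empty[OF True] by blast
  show ?thesis
  proof (rule exI[of _ h0], rule conjI[OF h0(1)], rule exI[of _ \<epsilon>], rule conjI[OF h0(2)], intro allI impI)
    fix h assume h: "0 < h \<and> h <= h0"
    show "\<exists>l C. (\<forall>m. B2 (l m)) \<and> C >= 0 \<and> (\<forall>u. Ck_on UNIV (Suc 0) u --> bsupp u -->
     Qform V h u >= \<epsilon>*EE h*(LBINT x. (u x)^2) - C*(\<Sum>m\<in>local_minima V t \<nu>. (LBINT x. l m x*u x)^2))"
      by (rule exI[of _ "%m x. 0"], rule exI[of _ "0::real"]) (use bd[of h] h in \<open>auto simp: B2_def\<close>)
  qed
next
  case ne: False
  define G where "G = crit V"
  have finG: "finite G" using finite_crit by (simp add: G_def)
  have nb2: "nb >= 2" using nu_le_nb(2)[OF ne] .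
  obtain r where r: "r > 0" and rN: "\<And>x. x \<in> G ==> cball x r \<subseteq> Nb x"
    and rD: "\<And>x y. x \<in> G ==> y \<in> G ==> y \<noteq> x ==> cball x r \<inter> cball y r = {}"
    using radius_exists unfolding G_def by blast
  define \<eta> where "\<eta> = (%x::'a. cutoff x r)"
  define \<eta>\<^sub>0 where "\<eta>\<^sub>0 = (%y. 1 - (\<Sum>x\<in>G. \<eta> x y))"
  have C\<eta>: "Ck_on UNIV k (\<eta> x)" for k x unfolding \<eta>_def by (rule Ck_cutoff)
  have C\<eta>0: "Ck_on UNIV k \<eta>\<^sub>0" for k unfolding \<eta>\<^sub>0_def by (intro Ck_diff Ck_const Ck_sum finG C\<eta>)
  obtain R where R: "\<And>x. x \<in> G ==> norm x <= R" using finite_imp_bounded[OF finG] by (auto simp: bounded_iff)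
  have \<eta>far: "\<eta> x y = 0" if "x \<in> G" "norm y > R + r" for x y
  proof -
    have "norm (y - x) >= r" using that R[OF that(1)] norm_triangle_ineq2[of y x] by linarith
    then show ?thesis unfolding \<eta>_def using r by (intro cutoff_outside)
  qed
  have "\<exists>B>0. \<forall>y. (\<Sum>b\<in>Basis. (pd b (\<eta> x) y)^2) <= B" if "x \<in> G" for x
    by (rule gradient_bounded[OF C\<eta>, of "R + r" x 0]) (use \<eta>far that in blast)+
  then obtain Bx where Bx: "\<And>x. x \<in> G ==> Bx x > 0" "\<And>x y. x \<in> G ==> (\<Sum>b\<in>Basis. (pd b (\<eta> x) y)^2) <= Bx x" by metis
  obtain B0 where B0: "B0 > 0" "\<And>y. (\<Sum>b\<in>Basis. (pd b \<eta>\<^sub>0 y)^2) <= B0"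
    by (rule gradient_bounded[OF C\<eta>0, of "R + r" 1]) (auto simp: \<eta>\<^sub>0_def \<eta>far)
  define B where "B = B0 + (\<Sum>x\<in>G. Bx x)"
  have B: "B > 0" "B0 <= B" "\<And>x. x \<in> G ==> Bx x <= B"
  proof -
    have s0: "(\<Sum>x\<in>G. Bx x) >= 0" using Bx(1) by (intro sum_nonneg) (auto simp: less_imp_le)
    then show "B > 0" "B0 <= B" using B0(1) by (auto simp: B_def)
    fix x assume x: "x \<in> G"
    have "Bx x <= (\<Sum>x\<in>G. Bx x)" using Bx(1) finG x by (intro member_le_sum) (auto simp: less_imp_le)
    then show "Bx x <= B" using B0(1) by (simp add: B_def)
  qed
  \<comment> \<open>On these half balls a cutoff equals 1 and the others vanish, so
    \<open>\<eta>\<^sub>0\<close> is zero there and the potential bound is needed only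
    outside.\<close>
  define S where "S = (\<Union>x\<in>G. ball x (r/2))"
  have S: "open S" "crit V \<subseteq> S" using r by (auto simp: S_def G_def)
  obtain h1 c1 where h1: "h1 > 0" "c1 > 0" and pot: "\<And>h x. 0 < h ==> h <= h1 ==> x \<notin> S ==> Wpot V h x >= c1"
    using potential_bounds[OF V conf S] by blast
  have "\<forall>x\<in>G. \<exists>h0>0. \<exists>c>0. \<forall>h. 0 < h \<and> h <= h0 --> (\<exists>l C. local_lower x r c h l C)"
    using local_bound rN unfolding G_def by blast
  from bchoice[OF this] obtain hx where "\<forall>x\<in>G. hx x > 0 \<and> (\<exists>c>0. \<forall>h. 0 < h \<and> h <= hx x --> (\<exists>l C. local_lower x r c h l C))" by (elim exE) (rule that)
  then have hx: "\<And>x. x \<in> G ==> hx x > 0" and hx2: "\<forall>x\<in>G. \<exists>c>0. \<forall>h. 0 < h \<and> h <= hx x --> (\<exists>l C. local_lower x r c h l C)" by simp_all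
  from bchoice[OF hx2] obtain cx where "\<forall>x\<in>G. cx x > 0 \<and> (\<forall>h. 0 < h \<and> h <= hx x --> (\<exists>l C. local_lower x r (cx x) h l C))" by (elim exE) (rule that)
  then have cx: "\<And>x. x \<in> G ==> cx x > 0" and loc: "\<And>x h. x \<in> G ==> 0 < h ==> h <= hx x ==> (\<exists>l C. local_lower x r (cx x) h l C)" by simp_all
  define c0 where "c0 = Min (insert c1 (cx ` G))"
  have c0: "c0 > 0" "c0 <= c1" "\<And>x. x \<in> G ==> c0 <= cx x" using finG h1 cx by (auto simp: c0_def)
  \<comment> \<open>From \<open>(a + s)^2 <= 2*a^2 + 2 * s^2\<close> and Cauchy-Schwarz for the sum
    over \<open>G\<close>.\<close>
  define n2 where "n2 = 2 + 2*real (card G)"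
  have n2: "n2 >= 2" by (simp add: n2_def)
  \<comment> \<open>\<open>card G + 1\<close> pieces each cost \<open>Z = 2*Q + 2*h^2*B*I\<close>,
    all multiplied by \<open>n2\<close>.\<close>
  define k where "k = n2*(real (card G) + 1)*2"
  have k: "k > 0" using n2 by (simp add: k_def add_nonneg_pos)
  \<comment> \<open>Chosen so that the localisation error \<open>k*B*h^2\<close>, which
    \<open>hE\<close> bounds by \<open>k*B*kp^2*EE h\<close>, is at most half of
    \<open>c0*EE h\<close>.\<close>
  define kp where "kp = min 1 (sqrt (c0/(2*k*B)))"
  have kp: "0 < kp" "kp <= 1" "k*B*kp^2 <= c0/2"
  proof -
    show "0 < kp" "kp <= 1" using c0 k B by (auto simp: kp_def)
    have "kp^2 <= (sqrt (c0/(2*k*B)))^2" using \<open>0 < kp\<close> by (intro power_mono) (auto simp: kp_def)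
    also have "\<dots> = c0/(2*k*B)" using c0 k B by simp
    finally have "k*B*kp^2 <= k*B*(c0/(2*k*B))" using k B by (intro mult_left_mono) auto
    also have "\<dots> = c0/2" using k B by simp
    finally show "k*B*kp^2 <= c0/2" .
  qed
  define h0 where "h0 = Min (insert h1 (insert (kp^nb) (insert 1 (hx ` G))))"
  have h0: "h0 > 0" "h0 <= h1" "h0 <= kp^nb" "h0 <= 1" "\<And>x. x \<in> G ==> h0 <= hx x"
  proof -
    show "h0 > 0" unfolding h0_def by (subst Min_gr_iff) (use finG h1 kp hx in auto)
  qed (unfold h0_def, (rule Min_le; use finG in simp)+)
  have "\<exists>l C. (\<forall>m. B2 (l m)) \<and> C >= 0 \<and> (\<forall>u. Ck_on UNIV (Suc 0) u --> bsupp u -->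
     Qform V h u >= (c0/(2*k))*EE h*(LBINT x. (u x)^2) - C*(\<Sum>m\<in>local_minima V t \<nu>. (LBINT x. l m x*u x)^2))"
    if h: "0 < h" "h <= h0" for h
  proof -
    have E: "EE h > 0" using EE_bounds h h0 by auto
    have E1: "EE h <= 1" using EE_bounds h h0 by auto
    \<comment> \<open>\<open>h^2\<close> is \<open>rh^2*EE h\<close> with
      \<open>rh = h powr (1/real nb)\<close>, and \<open>rh <= kp\<close> for small
      \<open>h\<close>.\<close>
    have hE: "h^2 <= kp^2*EE h"
    proof -
      define rh where "rh = h powr (1/real nb)"
      note rs = root_scale[OF h(1) nb2 rh_def]
      have rk: "rh <= kp" unfolding rh_def by (rule root_scale_le[OF h(1) _ nb2 order_refl kp(1,2)]) (use h h0 in linarith)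
      have "h^2 = rh^2*EE h" unfolding EE_def rs(4)[symmetric] using rs(1) by (simp add: power_divide)
      also have "\<dots> <= kp^2*EE h" using rk rs(1) E by (intro mult_right_mono power_mono) auto
      finally show ?thesis .
    qed
    have "\<forall>x\<in>G. \<exists>p. B2 (fst p) \<and> snd p >= 0 \<and> (x \<notin> local_minima V t \<nu> --> snd p = 0) \<and>
      (\<forall>u. Ck_on UNIV (Suc 0) u --> (\<forall>y. y \<notin> cball x r --> u y = 0) -->
       Qform V h u >= cx x*EE h*(LBINT x. (u x)^2) - snd p*(LBINT x. fst p x*u x)^2)"
    proof
      fix x assume x: "x \<in> G"
      have "h <= hx x" using h h0(5)[OF x] by linarith
      from loc[OF x h(1) this] obtain l C where lC: "local_lower x r (cx x) h l C" by (elim exE) (rule that)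
      show "\<exists>p. B2 (fst p) \<and> snd p >= 0 \<and> (x \<notin> local_minima V t \<nu> --> snd p = 0) \<and>
      (\<forall>u. Ck_on UNIV (Suc 0) u --> (\<forall>y. y \<notin> cball x r --> u y = 0) -->
       Qform V h u >= cx x*EE h*(LBINT x. (u x)^2) - snd p*(LBINT x. fst p x*u x)^2)"
        by (rule exI[of _ "(l, C)"], unfold fst_conv snd_conv, rule lC)
    qed
    from bchoice[OF this] obtain pp where pp: "\<forall>x\<in>G. B2 (fst (pp x)) \<and> snd (pp x) >= 0 \<and> (x \<notin> local_minima V t \<nu> --> snd (pp x) = 0) \<and>
      (\<forall>u. Ck_on UNIV (Suc 0) u --> (\<forall>y. y \<notin> cball x r --> u y = 0) -->
       Qform V h u >= cx x*EE h*(LBINT x. (u x)^2) - snd (pp x)*(LBINT y. fst (pp x) y*u y)^2)" by (elim exE) (rule that)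
    \<comment> \<open>The local functional applied to \<open>\<eta> x*u\<close> is moved onto
      \<open>u\<close>.\<close>
    define l where "l = (%x y. if x \<in> G then \<eta> x y*fst (pp x) y else 0)"
    define Cx where "Cx = (%x. snd (pp x))"
    have Cx: "Cx x >= 0" "x \<notin> local_minima V t \<nu> ==> Cx x = 0" if "x \<in> G" for x using pp that by (auto simp: Cx_def)
    have \<eta>m: "\<eta> x \<in> borel_measurable borel" for x by (rule borel_measurable_continuous_onI[OF Ck_continuous[OF C\<eta>[of 0]]])
    have \<eta>1: "\<bar>\<eta> x y\<bar> <= 1" for x y unfolding \<eta>_def using cutoff_bounds[of x r y] by simp
    have B2l: "B2 (l x)" for x
    proof (cases "x \<in> G")
      case True
      have "B2 (fst (pp x))" using pp True by blast
      from B2_bounded_mult(1)[OF this \<eta>m \<eta>1] show ?thesis using True by (simp add: l_def)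
    qed (simp add: l_def B2_def)
    define C where "C = n2*(\<Sum>x\<in>G. Cx x)/k"
    have C0: "C >= 0" unfolding C_def using n2 k Cx by (intro divide_nonneg_pos mult_nonneg_nonneg sum_nonneg) auto
    have \<eta>01: "\<bar>\<eta>\<^sub>0 y\<bar> <= 1 \<and> (y \<in> S --> \<eta>\<^sub>0 y = 0)" for y
    proof -
      have nn: "0 <= \<eta> x y" for x by (simp add: \<eta>_def cutoff_bounds)
      have le1: "(\<Sum>x\<in>G. \<eta> x y) <= 1 \<and> (y \<in> S --> (\<Sum>x\<in>G. \<eta> x y) = 1)"
      proof (cases "\<exists>x\<in>G. y \<in> cball x r")
        case True
        then obtain x where x: "x \<in> G" "y \<in> cball x r" by blast
        have z: "\<eta> x' y = 0" if "x' \<in> G - {x}" for x'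
        proof -
          have "y \<notin> cball x' r" using rD[OF x(1), of x'] that x(2) by blast
          then show ?thesis unfolding \<eta>_def using r by (intro cutoff_outside) (auto simp: dist_norm norm_minus_commute)
        qed
        have "(\<Sum>x\<in>G. \<eta> x y) = \<eta> x y + (\<Sum>x'\<in>G - {x}. \<eta> x' y)" using finG x by (simp add: sum.remove)
        then have e: "(\<Sum>x\<in>G. \<eta> x y) = \<eta> x y" using z by simp
        moreover have "\<eta> x y = 1" if yS: "y \<in> S"
        proof -
          obtain x' where x': "x' \<in> G" "y \<in> ball x' (r/2)" using yS by (auto simp: S_def)
          have one: "\<eta> x' y = 1" unfolding \<eta>_def using x' r by (intro cutoff_inside) (auto simp: dist_norm norm_minus_commute)
          then have "x' = x" using z[of x'] x' by (cases "x' = x") auto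
          then show ?thesis using one by simp
        qed
        ultimately show ?thesis using \<eta>1[of x y] by simp
      next
        case False
        have z: "\<eta> x y = 0" if "x \<in> G" for x
          unfolding \<eta>_def using r False that by (intro cutoff_outside) (auto simp: dist_norm norm_minus_commute not_le less_imp_le)
        moreover have "y \<notin> S"
        proof
          assume "y \<in> S"
          then obtain x where "x \<in> G" "dist x y < r/2" by (auto simp: S_def)
          then have "x \<in> G" "y \<in> cball x r" using r by auto
          then show False using False by blast
        qed
        ultimately show ?thesis by simp
      qed
      moreover have "0 <= (\<Sum>x\<in>G. \<eta> x y)" using nn by (intro sum_nonneg) auto
      ultimately show ?thesis by (auto simp: \<eta>\<^sub>0_def)
    qed
    have main: "Qform V h u >= (c0/(2*k))*EE h*(LBINT x. (u x)^2) - C*(\<Sum>m\<in>local_minima V t \<nu>. (LBINT x. l m x*u x)^2)"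
      if u: "Ck_on UNIV (Suc 0) u" "bsupp u" for u
    proof -
      define I where "I = (LBINT x. (u x)^2)"
      define Q where "Q = Qform V h u"
      define J where "J = (%x. \<integral>y. l x y*u y \<partial>lborel)"
      have I0: "I >= 0" unfolding I_def by (intro integral_nonneg_AE) auto
      have cu: "continuous_on UNIV u" by (rule Ck_continuous[OF u(1)])
      have i2: "integrable lborel (%y. (f y*u y)^2)" if "continuous_on UNIV f" for f
        by (intro integrable_bsupp continuous_intros that cu bsupp_power bsupp_mult_right u)
      have c\<eta>: "continuous_on UNIV (\<eta> x)" for x by (rule Ck_continuous[OF C\<eta>[of 0]])
      have c\<eta>0: "continuous_on UNIV \<eta>\<^sub>0" by (rule Ck_continuous[OF C\<eta>0[of 0]])
      define T where "T = (%x. \<integral>y. (\<eta> x y*u y)^2 \<partial>lborel)"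
      define T0 where "T0 = (LBINT y. (\<eta>\<^sub>0 y*u y)^2)"
      have split: "I <= n2*(T0 + (\<Sum>x\<in>G. T x))"
      proof -
        have "I <= (LBINT y. n2*((\<eta>\<^sub>0 y*u y)^2 + (\<Sum>x\<in>G. (\<eta> x y*u y)^2)))"
          unfolding I_def
        proof (rule integral_mono)
          show "integrable lborel (%x. (u x)^2)" by (intro integrable_bsupp continuous_intros cu bsupp_power u)
          show "integrable lborel (%y. n2*((\<eta>\<^sub>0 y*u y)^2 + (\<Sum>x\<in>G. (\<eta> x y*u y)^2)))"
            by (intro integrable_mult_right Bochner_Integration.integrable_add Bochner_Integration.integrable_sum i2 c\<eta> c\<eta>0)
          fix y
          define a s where "a = \<eta>\<^sub>0 y*u y" and "s = (\<Sum>x\<in>G. \<eta> x y*u y)"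
          have "u y = a + s" unfolding a_def s_def \<eta>\<^sub>0_def by (simp add: sum_distrib_right[symmetric] left_diff_distrib)
          then have "(u y)^2 = (a + s)^2" by simp
          also have "\<dots> <= 2*a^2 + 2 * s^2"
          proof -
            have "0 <= (a - s)^2" by simp
            then show ?thesis by (simp add: power2_eq_square algebra_simps)
          qed
          also have "s^2 <= (\<Sum>x\<in>G. (\<eta> x y*u y)^2)*real (card G)" unfolding s_def by (rule sum_squared_le_sum_of_squares)
          finally have "(u y)^2 <= 2*a^2 + 2*real (card G)*(\<Sum>x\<in>G. (\<eta> x y*u y)^2)" by (simp add: mult_ac)
          also have "\<dots> <= n2*a^2 + n2*(\<Sum>x\<in>G. (\<eta> x y*u y)^2)"
            by (intro add_mono mult_right_mono sum_nonneg) (auto simp: n2_def)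
          finally show "(u y)^2 <= n2*((\<eta>\<^sub>0 y*u y)^2 + (\<Sum>x\<in>G. (\<eta> x y*u y)^2))" by (simp add: a_def distrib_left)
        qed
        also have "\<dots> = n2*(T0 + (\<Sum>x\<in>G. T x))"
          unfolding T0_def T_def
          by (simp only: integral_mult_right_zero Bochner_Integration.integral_add[OF i2[OF c\<eta>0] Bochner_Integration.integrable_sum[OF i2[OF c\<eta>]]] Bochner_Integration.integral_sum[OF i2[OF c\<eta>]])
        finally show ?thesis .
      qed
      define Z where "Z = 2*Q + 2*h^2*B*I"
      have Tx: "c0*EE h*T x <= Z + Cx x*(J x)^2" if x: "x \<in> G" for x
      proof -
        have Ceu: "Ck_on UNIV (Suc 0) (%y. \<eta> x y*u y)" by (intro Ck_mult C\<eta> u)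
        have sup: "\<forall>y. y \<notin> cball x r --> \<eta> x y*u y = 0"
          unfolding \<eta>_def using r by (auto simp: dist_norm norm_minus_commute intro!: cutoff_outside)
        have "cx x*EE h*T x - Cx x*(LBINT y. fst (pp x) y*(\<eta> x y*u y))^2 <= Qform V h (%y. \<eta> x y*u y)"
          unfolding T_def Cx_def using pp[THEN bspec, OF x, THEN conjunct2, THEN conjunct2, THEN conjunct2, THEN spec, THEN mp, THEN mp, OF Ceu sup] .
        moreover have "Qform V h (%y. \<eta> x y*u y) <= Z"
          unfolding Z_def Q_def I_def using \<eta>1 Bx(2)[OF x] B(3)[OF x] by (intro Qform_cutoff V u C\<eta>) (auto intro: order_trans)
        moreover have "(LBINT y. fst (pp x) y*(\<eta> x y*u y)) = J x" unfolding J_def l_def using x by (simp add: mult_ac)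
        moreover have "c0*EE h*T x <= cx x*EE h*T x"
          using c0(3)[OF x] E by (intro mult_right_mono) (auto simp: T_def intro!: integral_nonneg_AE)
        ultimately show ?thesis by simp
      qed
      have T0b: "c0*EE h*T0 <= Z"
      proof -
        have Ceu: "Ck_on UNIV (Suc 0) (%y. \<eta>\<^sub>0 y*u y)" by (intro Ck_mult C\<eta>0 u)
        have beu: "bsupp (%y. \<eta>\<^sub>0 y*u y)" by (rule bsupp_mult_right[OF u(2)])
        have T00: "T0 >= 0" unfolding T0_def by (intro integral_nonneg_AE) auto
        have "c0*EE h <= c1*1" using c0 E E1 h1 by (intro mult_mono) auto
        then have "c0*EE h*T0 <= c1*T0" using T00 by (intro mult_right_mono) auto
        also have "\<dots> = (LBINT y. c1*(\<eta>\<^sub>0 y*u y)^2)" by (simp add: T0_def)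
        also have "\<dots> <= (LBINT y. Wpot V h y*(\<eta>\<^sub>0 y*u y)^2)"
        proof (rule integral_mono)
          show "integrable lborel (%y. c1*(\<eta>\<^sub>0 y*u y)^2)" using i2[OF c\<eta>0] by simp
          show "integrable lborel (%y. Wpot V h y*(\<eta>\<^sub>0 y*u y)^2)"
            by (intro integrable_bsupp continuous_intros cu c\<eta>0 continuous_grad_lap[OF V] bsupp_mult_right[OF bsupp_power] bsupp_mult_right u)
          fix y
          show "c1*(\<eta>\<^sub>0 y*u y)^2 <= Wpot V h y*(\<eta>\<^sub>0 y*u y)^2"
          proof (cases "y \<in> S")
            case True
            then show ?thesis using \<eta>01[of y] by simp
          next
            case False
            then have "c1 <= Wpot V h y" using h h0 by (intro pot) auto
            then show ?thesis by (intro mult_right_mono) auto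
          qed
        qed
        also have "\<dots> <= Qform V h (%y. \<eta>\<^sub>0 y*u y)" using Qform_ge_potential[OF V Ceu beu, of h] by (simp add: Wpot_def)
        also have "\<dots> <= Z" unfolding Z_def Q_def I_def
          using \<eta>01 B0(2) B(2) by (intro Qform_cutoff V u C\<eta>0) (auto intro: order_trans)
        finally show ?thesis .
      qed
      have "c0*EE h*I <= c0*EE h*(n2*(T0 + (\<Sum>x\<in>G. T x)))" using split c0 E by (intro mult_left_mono) auto
      also have "\<dots> = n2*(c0*EE h*T0 + (\<Sum>x\<in>G. c0*EE h*T x))" by (simp add: sum_distrib_left distrib_left mult_ac)
      also have "\<dots> <= n2*(Z + (\<Sum>x\<in>G. Z + Cx x*(J x)^2))" using n2 by (intro mult_left_mono add_mono T0b sum_mono Tx) auto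
      also have "\<dots> = (n2*(real (card G) + 1))*Z + n2*(\<Sum>x\<in>G. Cx x*(J x)^2)" by (simp add: sum.distrib algebra_simps)
      also have "(n2*(real (card G) + 1))*Z = k*Q + k*B*h^2*I" by (simp add: Z_def k_def algebra_simps)
      finally have 1: "c0*EE h*I <= k*Q + k*B*h^2*I + n2*(\<Sum>x\<in>G. Cx x*(J x)^2)" .
      have "k*B*h^2 <= k*B*(kp^2*EE h)" using k B hE by (intro mult_left_mono) auto
      also have "\<dots> = (k*B*kp^2)*EE h" by simp
      also have "\<dots> <= (c0/2)*EE h" using kp(3) E by (intro mult_right_mono) auto
      finally have "k*B*h^2*I <= (c0/2)*EE h*I" using I0 by (intro mult_right_mono) auto
      then have 2: "(c0/2)*EE h*I <= k*Q + n2*(\<Sum>x\<in>G. Cx x*(J x)^2)"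
      proof -
        have "c0*EE h*I = (c0/2)*EE h*I + (c0/2)*EE h*I" by simp
        then show ?thesis using 1 \<open>k*B*h^2*I <= (c0/2)*EE h*I\<close> by linarith
      qed
      have minG: "local_minima V t \<nu> \<subseteq> G" by (auto simp: local_minima_def G_def)
      \<comment> \<open>Terms at critical points that are not minima drop out since
        \<open>Cx\<close> vanishes there.\<close>
      have "(\<Sum>x\<in>G. Cx x*(J x)^2) = (\<Sum>x\<in>local_minima V t \<nu>. Cx x*(J x)^2)"
        using minG finG Cx by (intro sum.mono_neutral_right) auto
      also have "\<dots> <= (\<Sum>x\<in>local_minima V t \<nu>. (\<Sum>x\<in>G. Cx x)*(J x)^2)"
        using minG finG Cx by (intro sum_mono mult_right_mono member_le_sum) auto
      also have "\<dots> = (\<Sum>x\<in>G. Cx x)*(\<Sum>x\<in>local_minima V t \<nu>. (J x)^2)" by (simp add: sum_distrib_left)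
      finally have "n2*(\<Sum>x\<in>G. Cx x*(J x)^2) <= n2*((\<Sum>x\<in>G. Cx x)*(\<Sum>x\<in>local_minima V t \<nu>. (J x)^2))"
        using n2 by (intro mult_left_mono) auto
      also have "\<dots> = k*(C*(\<Sum>x\<in>local_minima V t \<nu>. (J x)^2))" using k by (simp add: C_def)
      finally have "(c0/2)*EE h*I <= k*(Q + C*(\<Sum>x\<in>local_minima V t \<nu>. (J x)^2))" using 2 by (simp add: distrib_left)
      then have "(c0/2)*EE h*I/k <= Q + C*(\<Sum>x\<in>local_minima V t \<nu>. (J x)^2)" using k by (simp add: divide_le_eq mult.commute)
      then show ?thesis by (simp add: I_def Q_def J_def)
    qed
    show ?thesis by (rule exI[of _ l], rule exI[of _ C]) (use B2l C0 main in blast)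
  qed
  moreover have "c0/(2*k) > 0" using c0 k by simp
  ultimately show ?thesis using h0(1) by (intro exI[of _ h0] conjI exI[of _ "c0/(2*k)"]) auto
qed

end

section \<open>Quasimodes with exponentially small energy\<close>

context witten_setup
begin

definition quasimode :: "real => real => 'a => 'a => real" where
  "quasimode r h m = (%x. cutoff m r x*exp ((V x - V m)*(- 1/h)))"

lemma quasimode_rtest: "r > 0 ==> rtest (quasimode r h m)"
proof -
  assume r: "r > 0"
  have "Ck_on UNIV k (%x. (V x - V m)*(- 1/h))" for k by (intro Ck_mult Ck_diff Ck_const smooth_Ck[OF V])
  from Ck_compose_real[OF Ck_exp this] have e: "Ck_on UNIV k (%x. exp ((V x - V m)*(- 1/h)))" for k .
  have "Ck_on UNIV k (quasimode r h m)" for k unfolding quasimode_def by (intro Ck_mult Ck_cutoff e)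
  moreover have "bsupp (quasimode r h m)"
    unfolding bsupp_def
  proof (intro exI[of _ "norm m + r"] allI impI)
    fix x :: 'a assume "norm m + r < norm x"
    then have "norm (x - m) >= r" using norm_triangle_ineq2[of x m] by linarith
    then show "quasimode r h m x = 0" using r by (simp add: quasimode_def cutoff_outside)
  qed
  ultimately show ?thesis by (simp add: rtest_def smooth_on_def)
qed

lemma quasimode_outside:
  assumes r: "r > 0" and x: "x \<notin> cball m r"
  shows "quasimode r h m x = 0" "pd b (quasimode r h m) x = 0"
proof -
  have z: "quasimode r h m y = 0" if "y \<in> - cball m r" for y
    using that r by (simp add: quasimode_def cutoff_outside dist_norm norm_minus_commute)
  then show "quasimode r h m x = 0" using x by simp
  have "eventually (%y. y \<in> - cball m r) (nhds x)" using x by (intro eventually_nhds_in_open) auto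
  then have "eventually (%y. quasimode r h m y = 0) (nhds x)" by (rule eventually_mono) (rule z)
  from pd_cong_eventually[OF this] show "pd b (quasimode r h m) x = 0" by simp
qed

lemma quasimode_orthogonal:
  assumes r: "r > 0" and d: "cball m r \<inter> cball m' r = {}"
  shows "(LBINT x. quasimode r h m x*quasimode r h m' x) = 0"
    "(LBINT x. rwitten V h (quasimode r h m) x*quasimode r h m' x) = 0"
proof -
  have z: "x \<notin> cball m r \<or> x \<notin> cball m' r" for x using d by blast
  have "(%x. quasimode r h m x*quasimode r h m' x) = (%x. 0)"
    by (rule ext) (metis z quasimode_outside(1)[OF r] mult_zero_left mult_zero_right)
  then show "(LBINT x. quasimode r h m x*quasimode r h m' x) = 0" by (simp only:) simp
  have "(h*pd b (quasimode r h m) x + quasimode r h m x*pd b V x)*(h*pd b (quasimode r h m') x + quasimode r h m' x*pd b V x) = 0" for b x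
    using z[of x] quasimode_outside[OF r, of x m] quasimode_outside[OF r, of x m'] by auto
  then have "(%x. \<Sum>b\<in>Basis. (h*pd b (quasimode r h m) x + quasimode r h m x*pd b V x)*(h*pd b (quasimode r h m') x + quasimode r h m' x*pd b V x)) = (%x. 0)"
    by (intro ext sum.neutral) blast
  then show "(LBINT x. rwitten V h (quasimode r h m) x*quasimode r h m' x) = 0"
    unfolding rwitten_form[OF V quasimode_rtest[OF r] quasimode_rtest[OF r]] by (simp only:) simp
qed

abbreviation (input) small_energy where
  "small_energy r c h m \<equiv> (LBINT x. (quasimode r h m x)^2) > 0 \<and>
    (LBINT x. rwitten V h (quasimode r h m) x*quasimode r h m x) <= exp (- c/h)*(LBINT x. (quasimode r h m x)^2)"

text \<open>The twisted gradient annihilates the Gibbs factor, so only the gradient of the cutoff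
  survives, on an annulus where \<open>V - V m >= kp\<close>; the energy carries
  \<open>exp (- kp/h)\<close> squared. The norm is at least of order \<open>h^d\<close>. One
  exponential pays for this power and for all constants, the other one is the claim.\<close>

lemma quasimode_energy:
  assumes m: "m \<in> local_minima V t \<nu>" and r: "r > 0" "cball m r \<subseteq> Nb m"
  shows "\<exists>h0>0. \<exists>c>0. \<forall>h. 0 < h \<and> h <= h0 --> small_energy r c h m"
proof -
  have mc: "m \<in> crit V" using m by (simp add: local_minima_def)
  obtain U g W L where "morse_chart m U g W (Nb m) L V (t m) (\<nu> m)" using Nb_chart[OF mc] by blast
  then interpret morse_chart m U g W "Nb m" L V "t m" "\<nu> m" .
  have good: "even (\<nu> m b) \<and> t m b > 0" if "b \<in> Basis" for b using m that by (simp add: local_minima_def)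
  have Vpos: "V x > V m" if x: "x \<in> Nb m" "x \<noteq> m" for x
  proof -
    have nn: "0 <= t m b*((g x - m) \<bullet> b)^\<nu> m b" if "b \<in> Basis" for b
      using good[OF that] by (intro mult_nonneg_nonneg) (auto simp: zero_le_even_power)
    have "g x \<noteq> m" using Ug[OF x(1)] Ux0 x(2) by auto
    then obtain b where b: "b \<in> Basis" "(g x - m) \<bullet> b \<noteq> 0" using euclidean_eq_iff[of "g x" m] by (auto simp: inner_diff_left)
    have "0 < t m b*((g x - m) \<bullet> b)^\<nu> m b"
      using good[OF b(1)] b(2) by (intro mult_pos_pos) (auto simp: zero_less_power_eq)
    then have "0 < (\<Sum>b\<in>Basis. t m b*((g x - m) \<bullet> b)^\<nu> m b)" using b nn by (intro sum_pos2[of _ b]) auto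
    then show ?thesis using V_form[OF x(1)] by simp
  qed
  \<comment> \<open>The annulus contains the support of the gradient of the cutoff. It avoids
    \<open>m\<close>, so by compactness \<open>V - V m\<close> has a positive minimum on it.\<close>
  define An where "An = cball m r - ball m (r/2)"
  have cV: "continuous_on S V" for S using Ck_continuous[OF smooth_Ck[OF V, of 0]] continuous_on_subset by blast
  have "\<exists>kp>0. \<forall>x\<in>An. kp <= V x - V m"
  proof (cases "An = {}")
    case False
    have "compact An" unfolding An_def by (intro compact_diff) auto
    moreover have "continuous_on An (%x. V x - V m)" by (intro continuous_intros cV)
    ultimately obtain z where z: "z \<in> An" "\<forall>x\<in>An. V z - V m <= V x - V m"
      using continuous_attains_inf[OF _ False, of "%x. V x - V m"] by blast
    have "z \<noteq> m" "z \<in> Nb m" using z r by (auto simp: An_def)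
    then have "V z - V m > 0" using Vpos by simp
    then show ?thesis using z by blast
  qed (auto intro: exI[of _ 1])
  then obtain kp where kp: "kp > 0" "\<And>x. x \<in> An ==> kp <= V x - V m" by auto
  define \<eta> where "\<eta> = cutoff m r"
  have C\<eta>: "Ck_on UNIV k \<eta>" for k unfolding \<eta>_def by (rule Ck_cutoff)
  have c\<eta>p: "continuous_on S (pd b \<eta>)" if "b \<in> Basis" for b S using C\<eta>[of "Suc 0"] that by (auto intro: continuous_on_subset)
  have "bounded ((%x. \<Sum>b\<in>Basis. (pd b \<eta> x)^2) ` cball m r)"
    by (intro compact_imp_bounded compact_continuous_image continuous_intros c\<eta>p compact_cball)
  then obtain B where "B > 0" "\<forall>y\<in>(%x. \<Sum>b\<in>Basis. (pd b \<eta> x)^2) ` cball m r. norm y <= B" by (meson bounded_pos)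
  then have B: "B > 0" "\<And>x. x \<in> cball m r ==> (\<Sum>b\<in>Basis. (pd b \<eta> x)^2) <= B" by (auto simp: abs_le_iff)
  have "bounded ((%x. \<Sum>b\<in>Basis. \<bar>pd b V x\<bar>) ` cball m r)"
    by (intro compact_imp_bounded compact_continuous_image continuous_intros continuous_grad_lap(4)[OF V] compact_cball)
  then obtain \<Lambda> where "\<Lambda> > 0" "\<forall>y\<in>(%x. \<Sum>b\<in>Basis. \<bar>pd b V x\<bar>) ` cball m r. norm y <= \<Lambda>" by (meson bounded_pos)
  then have \<Lambda>: "\<Lambda> > 0" "\<And>x. x \<in> cball m r ==> (\<Sum>b\<in>Basis. \<bar>pd b V x\<bar>) <= \<Lambda>" by (auto simp: abs_le_iff)
  have Vlip: "V x - V m <= \<Lambda>*norm (x - m)" if x: "x \<in> cball m r" for x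
  proof -
    have "norm (V x - V m) <= \<Lambda>*norm (x - m)"
    proof (rule differentiable_bound[OF convex_cball[of m r], of V "%x v. pd v V x"])
      show "(V has_derivative (%v. pd v V y)) (at y within cball m r)" for y
        by (rule has_derivative_at_withinI[OF has_derivative_pd[OF V_differentiable]])
      show "onorm (%v. pd v V y) <= \<Lambda>" if y: "y \<in> cball m r" for y
      proof (rule onorm_le)
        fix v :: 'a
        have "norm (pd v V y) <= (\<Sum>b\<in>Basis. \<bar>(v \<bullet> b) *\<^sub>R pd b V y\<bar>)"
          unfolding pd_linear_expand[OF V_differentiable, of v] by (simp add: sum_abs)
        also have "\<dots> <= (\<Sum>b\<in>Basis. norm v * \<bar>pd b V y\<bar>)"
          by (intro sum_mono) (auto simp: abs_mult intro!: mult_right_mono Basis_le_norm)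
        also have "\<dots> = norm v * (\<Sum>b\<in>Basis. \<bar>pd b V y\<bar>)" by (simp add: sum_distrib_left)
        also have "\<dots> <= norm v * \<Lambda>" using \<Lambda>(2)[OF y] by (intro mult_left_mono) auto
        finally show "norm (pd v V y) <= \<Lambda>*norm v" by (simp add: mult.commute)
      qed
    qed (use x r in auto)
    then show ?thesis by simp
  qed
  define d where "d = DIM('a)"
  define vr where "vr = measure lborel (cball m r)"
  define ub where "ub = unit_ball_vol (real d)*(r/2)^d"
  have ub: "ub > 0" unfolding ub_def using r by simp
  have vr: "vr >= 0" by (simp add: vr_def)
  \<comment> \<open>\<open>(B * vr + 1)/K1\<close> is \<open>exp (- (\<Lambda>*r))*ub\<close>, the
    constant in the lower bound for the norm, so \<open>exp (- kp/h) <= h^d/K1\<close> is what has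
    to be arranged.\<close>
  define K1 where "K1 = (B * vr + 1)*exp (\<Lambda>*r)/ub"
  have K1: "K1 > 0" unfolding K1_def using B vr ub by (intro divide_pos_pos mult_pos_pos add_nonneg_pos) auto
  \<comment> \<open>By \<open>exp_minus_le_power\<close> with exponent \<open>d + 1\<close>, one
    power of \<open>h\<close> is left over; this choice makes it beat the factorial and
    \<open>1/K1\<close>.\<close>
  define h0 where "h0 = min 1 (kp^(d + 1)/(K1*fact (d + 1)))"
  have h0: "h0 > 0" unfolding h0_def using kp K1 by (simp del: fact_Suc)
  have "small_energy r kp h m"
    if h: "0 < h" "h <= h0" for h
  proof -
    define f where "f = quasimode r h m"
    have h1: "h <= 1" using h by (simp add: h0_def)
    have tf: "rtest f" unfolding f_def by (rule quasimode_rtest[OF r(1)])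
    have if2: "integrable lborel (%x. (f x)^2)" using rtest_B2[OF tf] by (simp add: B2_def)
    define w where "w = (%x. exp ((V x - V m)*(- 1/h)))"
    have fw: "f = (%x. \<eta> x*w x)" by (simp add: f_def quasimode_def \<eta>_def w_def)
    \<comment> \<open>On the ball of radius \<open>h*r/2\<close> the Lipschitz bound keeps
      \<open>2*(V x - V m)/h\<close> below \<open>\<Lambda>*r\<close>, so the quasimode is bounded
      below there independently of \<open>h\<close>.\<close>
    have lower: "exp (- (\<Lambda>*r))*(ub*h^d) <= (LBINT x. (f x)^2)"
    proof -
      have bsub: "norm (x - m) < h*r/2" if "x \<in> ball m (h*r/2)" for x using that by (simp add: dist_norm norm_minus_commute)
      have hr: "h*r <= r" using h1 r by (simp add: mult_left_le_one_le h less_imp_le)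
      have "(LBINT x. exp (- (\<Lambda>*r))*indicator (ball m (h*r/2)) x) <= (LBINT x. (f x)^2)"
      proof (rule integral_mono[OF _ if2])
        show "integrable lborel (%x. exp (- (\<Lambda>*r))*indicator (ball m (h*r/2)) x)"
          using emeasure_bounded_finite[of "ball m (h*r/2)"] by (intro integrable_mult_right integrable_real_indicator) auto
        fix x
        show "exp (- (\<Lambda>*r))*indicator (ball m (h*r/2)) x <= (f x)^2"
        proof (cases "x \<in> ball m (h*r/2)")
          case True
          have n: "norm (x - m) <= h*r/2" using bsub[OF True] by simp
          have n2: "norm (x - m) <= r/2" using n hr by linarith
          have e1: "\<eta> x = 1" unfolding \<eta>_def by (rule cutoff_inside[OF r(1) n2])
          have "x \<in> cball m r" using n2 r by (simp add: dist_norm norm_minus_commute)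
          from Vlip[OF this] have "V x - V m <= \<Lambda>*(h*r/2)" using n \<Lambda>(1) by (meson mult_left_mono order_trans less_imp_le)
          then have "2*(V x - V m)/h <= \<Lambda>*r" using h by (simp add: field_simps)
          then have "exp (- (\<Lambda>*r)) <= exp (- (2*(V x - V m)/h))" by simp
          also have "\<dots> = (w x)^2" using h by (simp add: w_def power2_eq_square exp_add[symmetric] field_simps)
          finally show ?thesis using True e1 by (simp add: fw)
        qed simp
      qed
      moreover have "measure lborel (ball m (h*r/2)) = ub*h^d"
        using h r by (subst content_ball) (auto simp: ub_def d_def power_mult_distrib power_divide)
      ultimately show ?thesis by simp
    qed
    have pos: "0 < exp (- (\<Lambda>*r))*(ub*h^d)" using ub h by simp
    have upper: "(LBINT x. rwitten V h f x*f x) <= B * vr*(exp (- kp/h))^2"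
    proof -
      have "(LBINT x. rwitten V h f x*f x) = (LBINT x. (\<Sum>b\<in>Basis. (h*pd b f x + f x*pd b V x)*(h*pd b f x + f x*pd b V x)))"
        by (rule rwitten_form[OF V tf tf])
      also have "\<dots> <= (LBINT x. B*(exp (- kp/h))^2*indicator (cball m r) x)"
      proof (rule integral_mono')
        show "integrable lborel (%x. B*(exp (- kp/h))^2*indicator (cball m r) x)"
          using emeasure_bounded_finite[of "cball m r"] by (intro integrable_mult_right integrable_real_indicator) auto
        fix x
        show "0 <= B*(exp (- kp/h))^2*indicator (cball m r) x" using B by simp
        have dw: "w differentiable (at x)" and pw: "pd b w x = w x*(pd b V x*(- 1/h))" for b
        proof -
          have "((%y. (V y - V m)*(- 1/h)) has_derivative (%z. pd z V x*(- 1/h))) (at x)"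
            using has_derivative_pd[OF V_differentiable[of x]] h by (auto intro!: derivative_eq_intros)
          from has_derivative_exp[OF this] have "(w has_derivative (%z. w x*(pd z V x*(- 1/h)))) (at x)"
            unfolding w_def by (simp add: mult.commute)
          then show "w differentiable (at x)" "pd b w x = w x*(pd b V x*(- 1/h))" by (auto simp: differentiable_def intro: pd_eqI)
        qed
        have de: "\<eta> differentiable (at x)" using C\<eta>[of "Suc 0"] by simp
        have eq: "h*pd b f x + f x*pd b V x = h*pd b \<eta> x*w x" for b
          unfolding fw pd_mult[OF de dw] pw using h by (simp add: field_simps)
        consider "x \<notin> cball m r" | "x \<in> ball m (r/2)" | "x \<in> An" by (auto simp: An_def)
        then show "(\<Sum>b\<in>Basis. (h*pd b f x + f x*pd b V x)*(h*pd b f x + f x*pd b V x)) <= B*(exp (- kp/h))^2*indicator (cball m r) x"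
        proof cases
          case 1
          then show ?thesis using quasimode_outside[OF r(1) 1] by (simp add: f_def)
        next
          case 2
          have "eventually (%y. y \<in> ball m (r/2)) (nhds x)" using 2 by (intro eventually_nhds_in_open) auto
          then have "eventually (%y. \<eta> y = 1) (nhds x)" unfolding \<eta>_def
            by (rule eventually_mono) (use r in \<open>auto intro!: cutoff_inside simp: dist_norm norm_minus_commute\<close>)
          from pd_cong_eventually[OF this] have "pd b \<eta> x = 0" for b by simp
          then show ?thesis unfolding eq using B by simp
        next
          case 3
          have xc: "x \<in> cball m r" using 3 by (simp add: An_def)
          have "kp/h <= (V x - V m)/h" using kp(2)[OF 3] h by (intro divide_right_mono) auto
          then have wle: "w x <= exp (- kp/h)" by (simp add: w_def)
          have w0: "w x >= 0" by (simp add: w_def)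
          have "(\<Sum>b\<in>Basis. (h*pd b \<eta> x*w x)*(h*pd b \<eta> x*w x)) = h^2*(\<Sum>b\<in>Basis. (pd b \<eta> x)^2)*(w x)^2"
            by (simp add: sum_distrib_left sum_distrib_right power2_eq_square mult_ac)
          also have "\<dots> <= 1*B*(exp (- kp/h))^2"
            using B(2)[OF xc] B(1) h h1 wle w0 by (intro mult_mono power_mono) (auto simp: power_le_one intro: sum_nonneg)
          finally show ?thesis unfolding eq using xc by simp
        qed
      qed
      also have "\<dots> = B * vr*(exp (- kp/h))^2" by (simp add: vr_def)
      finally show ?thesis .
    qed
    have "B * vr*(exp (- kp/h))^2 <= exp (- kp/h)*(exp (- (\<Lambda>*r))*(ub*h^d))"
    proof -
      have "exp (- kp/h) <= fact (d + 1)*(h/kp)^(d + 1)"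
        using exp_minus_le_power[of kp h d] h kp(1) by (simp del: fact_Suc power_Suc)
      also have "\<dots> = (h*(fact (d + 1)/kp^(d + 1)))*h^d" by (simp add: power_divide del: fact_Suc)
      also have "\<dots> <= (1/K1)*h^d"
      proof (rule mult_right_mono)
        have "h <= kp^(d + 1)/(K1*fact (d + 1))" using h by (simp add: h0_def)
        then have "h*(fact (d + 1)/kp^(d + 1)) <= kp^(d + 1)/(K1*fact (d + 1))*(fact (d + 1)/kp^(d + 1))"
          using kp by (intro mult_right_mono) auto
        also have "\<dots> = 1/K1" using kp K1 by (simp del: fact_Suc power_Suc add: fact_nonzero)
        finally show "h*(fact (d + 1)/kp^(d + 1)) <= 1/K1" .
      qed (use h in simp)
      finally have "B * vr*exp (- kp/h) <= B * vr*((1/K1)*h^d)" using B vr by (intro mult_left_mono) auto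
      also have "\<dots> <= (B * vr + 1)*((1/K1)*h^d)" using K1 h by (intro mult_right_mono) auto
      also have "\<dots> = exp (- (\<Lambda>*r))*(ub*h^d)"
      proof -
        obtain q where q: "B * vr + 1 = q" by simp
        have "q > 0" using B vr q by (auto intro: add_nonneg_pos)
        moreover have "q*((1/(q*X/ub))*y) = inverse X*(ub*y)" if "q > 0" "X > 0" for X y :: real
          using that ub by (simp add: divide_inverse)
        ultimately show ?thesis unfolding K1_def q exp_minus by simp
      qed
      finally have "exp (- kp/h)*(B * vr*exp (- kp/h)) <= exp (- kp/h)*(exp (- (\<Lambda>*r))*(ub*h^d))" by (intro mult_left_mono) auto
      then show ?thesis by (simp add: power2_eq_square mult_ac)
    qed
    also have "\<dots> <= exp (- kp/h)*(LBINT x. (f x)^2)" using lower by (intro mult_left_mono) auto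
    finally show ?thesis using upper lower pos unfolding f_def[symmetric] by linarith
  qed
  then show ?thesis by (intro exI[of _ h0] conjI[OF h0] exI[of _ kp] conjI[OF kp(1)] allI impI) (elim conjE)
qed

end

section \<open>The real graph on test functions and density of its shifted range\<close>

lemma lap_rtest_linear:
  assumes u: "rtest u" and v: "rtest v"
  shows "lap (%x. u x + v x) x = lap u x + lap v x" "lap (%x. c*u x) x = c*lap u x"
proof -
  have "pd b (pd b (%x. u x + v x)) x = pd b (pd b u) x + pd b (pd b v) x" if b: "b \<in> Basis" for b
  proof -
    have "pd b (%x. u x + v x) = (%x. pd b u x + pd b v x)"
      by (intro ext pd_add rtest_differentiable u v)
    then show ?thesis using pd_add[OF rtest_differentiable rtest_differentiable, OF rtest_pd[OF u b] rtest_pd[OF v b]] by simp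
  qed
  then show "lap (%x. u x + v x) x = lap u x + lap v x" by (simp add: lap_def sum.distrib)
  have "pd b (pd b (%x. c*u x)) x = c*pd b (pd b u) x" if b: "b \<in> Basis" for b
  proof -
    have "pd b (%x. c*u x) = (%x. c*pd b u x)"
      by (intro ext pd_bounded_linear[OF bounded_linear_mult_right] rtest_differentiable u)
    then show ?thesis
      using pd_bounded_linear[OF bounded_linear_mult_right rtest_differentiable[OF rtest_pd[OF u b]]] by simp
  qed
  then show "lap (%x. c*u x) x = c*lap u x" by (simp add: lap_def sum_distrib_left)
qed

lemma rtest_add: "rtest u ==> rtest v ==> rtest (%x. u x + v x)"
  by (simp add: rtest_def smooth_on_def Ck_add bsupp_add)

lemma rtest_scale: "rtest u ==> rtest (%x. c*u x)"
  by (simp add: rtest_def smooth_on_def Ck_mult Ck_const bsupp_mult_right)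

lemma rwitten_B2:
  assumes V: "smooth_on UNIV V" and u: "rtest u"
  shows "B2 (rwitten V h u)"
proof -
  have "continuous_on UNIV (pd b (pd b u))" "bsupp (pd b (pd b u))" if "b \<in> Basis" for b
    using rtest_pd[OF rtest_pd[OF u that] that] by (auto simp: rtest_continuous rtest_def)
  then have "continuous_on UNIV (lap u)" "bsupp (lap u)"
    unfolding lap_def[abs_def] by (auto intro!: continuous_intros bsupp_sum)
  then show ?thesis unfolding rwitten_def[abs_def] using u
    by (intro B2_continuous continuous_intros continuous_grad_lap[OF V] bsupp_add bsupp_mult_right)
      (auto simp: rtest_continuous rtest_def)
qed

definition rgraph :: "('a::euclidean_space => real) => real => ('a rl2 \<times> 'a rl2) set" where
  "rgraph V h = (%\<phi>. (abs_rl2 \<phi>, abs_rl2 (rwitten V h \<phi>))) ` Collect rtest"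

lemma rgraphI: "rtest \<phi> ==> (abs_rl2 \<phi>, abs_rl2 (rwitten V h \<phi>)) \<in> rgraph V h"
  by (simp add: rgraph_def)

lemma rgraphE:
  assumes "(u, f) \<in> rgraph V h"
  obtains \<phi> where "rtest \<phi>" "u = abs_rl2 \<phi>" "f = abs_rl2 (rwitten V h \<phi>)"
  using assms by (auto simp: rgraph_def)

text \<open>Orthogonality to the range says that \<open>w\<close> is a weak solution with potential
  \<open>Wpot V h + s >= 1\<close>, and such a solution vanishes.\<close>

lemma dense_range_rgraph:
  fixes V :: "'a::euclidean_space => real"
  assumes V: "smooth_on UNIV V" and s: "s > 0" "\<And>x. Wpot V h x + s >= 1"
  shows "dense_range_graph (rgraph V h) s"
proof (rule dense_range_graph.intro)
  show "subspace (rgraph V h)"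
  proof (rule subspaceI)
    have z: "rtest (%x::'a. 0)" by (simp add: rtest_def smooth_on_def Ck_const bsupp_def)
    have r0: "rwitten V h (%x. 0) = (%x. 0)"
    proof
      fix x
      show "rwitten V h (%x. 0) x = 0" using lap_rtest_linear(2)[OF z z, of 0] by (simp add: rwitten_def)
    qed
    show "0 \<in> rgraph V h" using rgraphI[OF z, of V h] by (simp add: r0 zero_prod_def zero_rl2.abs_eq)
  next
    fix p q assume p: "p \<in> rgraph V h" and q: "q \<in> rgraph V h"
    obtain \<phi> where u: "rtest \<phi>" "p = (abs_rl2 \<phi>, abs_rl2 (rwitten V h \<phi>))" using p by (auto simp: rgraph_def)
    obtain \<psi> where v: "rtest \<psi>" "q = (abs_rl2 \<psi>, abs_rl2 (rwitten V h \<psi>))" using q by (auto simp: rgraph_def)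
    have "rwitten V h (%x. \<phi> x + \<psi> x) = (%x. rwitten V h \<phi> x + rwitten V h \<psi> x)"
      using lap_rtest_linear(1)[OF u(1) v(1)] by (auto simp: rwitten_def algebra_simps)
    then show "p + q \<in> rgraph V h"
      using rgraphI[OF rtest_add[OF u(1) v(1)], of V h] u v
      by (simp add: abs_rl2_add B2_L2fun rtest_B2 rwitten_B2[OF V])
  next
    fix c p assume p: "p \<in> rgraph V h"
    obtain \<phi> where u: "rtest \<phi>" "p = (abs_rl2 \<phi>, abs_rl2 (rwitten V h \<phi>))" using p by (auto simp: rgraph_def)
    have "rwitten V h (%x. c*\<phi> x) = (%x. c*rwitten V h \<phi> x)"
      using lap_rtest_linear(2)[OF u(1) u(1)] by (auto simp: rwitten_def algebra_simps)
    then show "c *\<^sub>R p \<in> rgraph V h"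
      using rgraphI[OF rtest_scale[OF u(1)], of c V h] u
      by (simp add: abs_rl2_scale B2_L2fun rtest_B2 rwitten_B2[OF V])
  qed
  show "inner f w = inner u g" if uf: "(u, f) \<in> rgraph V h" and wg: "(w, g) \<in> rgraph V h" for u f w g
  proof -
    obtain \<phi> where p: "rtest \<phi>" "u = abs_rl2 \<phi>" "f = abs_rl2 (rwitten V h \<phi>)" using uf by (rule rgraphE)
    obtain \<psi> where q: "rtest \<psi>" "w = abs_rl2 \<psi>" "g = abs_rl2 (rwitten V h \<psi>)" using wg by (rule rgraphE)
    have "inner f w = (LBINT x. rwitten V h \<phi> x*\<psi> x)" "inner g u = (LBINT x. rwitten V h \<psi> x*\<phi> x)"
      using p q by (simp_all add: B2_inner rwitten_B2[OF V] rtest_B2)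
    then show ?thesis unfolding rwitten_form[OF V p(1) q(1)] rwitten_form[OF V q(1) p(1)] inner_commute[of u g]
      by (simp add: mult.commute)
  qed
  show "inner f u >= 0" if uf: "(u, f) \<in> rgraph V h" for u f
  proof -
    obtain \<phi> where p: "rtest \<phi>" "u = abs_rl2 \<phi>" "f = abs_rl2 (rwitten V h \<phi>)" using uf by (rule rgraphE)
    have "inner f u = (LBINT x. rwitten V h \<phi> x*\<phi> x)"
      using p by (simp add: B2_inner rwitten_B2[OF V] rtest_B2)
    then show ?thesis unfolding rwitten_form[OF V p(1) p(1)]
      by (auto intro!: integral_nonneg_AE sum_nonneg)
  qed
  show "w = 0" if orth: "\<And>u f. (u, f) \<in> rgraph V h ==> inner w (f + s *\<^sub>R u) = 0" for w
  proof -
    obtain f where f: "L2fun f" "w = abs_rl2 f" by (rule rl2_cases)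
    then have "f \<in> borel_measurable (completion lborel)" by (simp add: L2fun_def)
    \<comment> \<open>Passage to a Borel representative, on which mollification operates.\<close>
    from completion_ex_borel_measurable_real[OF this] obtain g where g: "g \<in> borel_measurable lborel" "AE x in lborel. f x = g x" by blast
    have ae: "AE x in lebesgue. f x = g x" using g(2) by (rule AE_completion)
    have gm: "g \<in> borel_measurable lebesgue" using g(1) by (simp add: measurable_completion)
    have "integrable lebesgue (%x. (g x)^2)"
      using f(1) gm ae by (subst integrable_cong_AE[where g="%x. (f x)^2"]) (auto simp: L2fun_def)
    then have B: "B2 g" unfolding B2_def using g(1) by (simp add: integrable_completion)
    have wg: "w = abs_rl2 g" using f ae abs_rl2_eq_iff[OF f(1) B2_L2fun[OF B]] by simp
    have "AE x in lborel. g x = 0"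
    proof (rule weak_solution_zero[OF B, of "%x. Wpot V h x + s" h])
      show "continuous_on UNIV (%x. Wpot V h x + s)" by (intro continuous_intros continuous_grad_lap[OF V])
      fix \<phi> :: "'a => real" assume p: "rtest \<phi>"
      have "abs_rl2 (rwitten V h \<phi>) + s *\<^sub>R abs_rl2 \<phi> = abs_rl2 (%x. rwitten V h \<phi> x + s*\<phi> x)"
        using p by (simp add: abs_rl2_add abs_rl2_scale L2fun_scale B2_L2fun rtest_B2 rwitten_B2[OF V])
      then have "inner w (abs_rl2 (%x. rwitten V h \<phi> x + s*\<phi> x)) = 0" using orth[OF rgraphI[OF p]] by simp
      then have "(LBINT x. g x*(rwitten V h \<phi> x + s*\<phi> x)) = 0"
        using B2_inner[OF B B2_add[OF rwitten_B2[OF V p, of h] B2_scale[OF rtest_B2[OF p], of s]]] by (simp add: wg)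
      moreover have "rwitten V h \<phi> x + s*\<phi> x = - h\<^sup>2*lap \<phi> x + (Wpot V h x + s)*\<phi> x" for x
        by (simp add: rwitten_def Wpot_def algebra_simps)
      ultimately show "(LBINT x. g x*(- h\<^sup>2*lap \<phi> x + (Wpot V h x + s)*\<phi> x)) = 0" by simp
    qed (rule s(2))
    then have "AE x in lebesgue. g x = 0" by (rule AE_completion)
    then have "abs_rl2 g = abs_rl2 (%x. 0)" using abs_rl2_eq_iff[OF B2_L2fun[OF B] L2fun_0] by simp
    then show ?thesis by (simp add: wg zero_rl2.abs_eq)
  qed
qed (rule s(1))

section \<open>Translation between complex functions and pairs of real classes\<close>

lemma L2_iff: "L2 u \<longleftrightarrow> L2fun (%x. Re (u x)) \<and> L2fun (%x. Im (u x))"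
proof
  assume "L2 u"
  then have m[measurable]: "u \<in> borel_measurable lebesgue" and i: "integrable lebesgue (%x. (cmod (u x))^2)" by (auto simp: L2_def)
  have "integrable lebesgue (%x. (Re (u x))^2)" "integrable lebesgue (%x. (Im (u x))^2)"
    by (rule Bochner_Integration.integrable_bound[OF i]; simp add: cmod_power2)+
  then show "L2fun (%x. Re (u x)) \<and> L2fun (%x. Im (u x))" by (simp add: L2fun_def)
next
  assume "L2fun (%x. Re (u x)) \<and> L2fun (%x. Im (u x))"
  then show "L2 u" by (auto simp: L2_def L2fun_def cmod_power2 borel_measurable_complex_iff)
qed

definition re_part :: "('a::euclidean_space => complex) => 'a rl2" where "re_part u = abs_rl2 (%x. Re (u x))"
definition im_part :: "('a::euclidean_space => complex) => 'a rl2" where "im_part u = abs_rl2 (%x. Im (u x))"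

lemma L2norm_parts: "L2 u ==> L2norm u = sqrt ((norm (re_part u))^2 + (norm (im_part u))^2)"
proof -
  assume "L2 u"
  then have l: "L2fun (%x. Re (u x))" "L2fun (%x. Im (u x))" by (auto simp: L2_iff)
  then have "(\<integral>x. (cmod (u x))^2 \<partial>lebesgue) = (\<integral>x. (Re (u x))^2 \<partial>lebesgue) + (\<integral>x. (Im (u x))^2 \<partial>lebesgue)"
    unfolding cmod_power2 by (intro Bochner_Integration.integral_add) (auto simp: L2fun_def)
  then show ?thesis using l by (simp add: L2norm_def re_part_def im_part_def norm_abs_rl2)
qed

lemma L2_combine:
  assumes u: "L2 u" and v: "L2 v"
  shows "L2 (%x. v x - z*u x)"
    "re_part (%x. v x - z*u x) = re_part v - (Re z *\<^sub>R re_part u - Im z *\<^sub>R im_part u)"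
    "im_part (%x. v x - z*u x) = im_part v - (Re z *\<^sub>R im_part u + Im z *\<^sub>R re_part u)"
  using u v unfolding L2_iff re_part_def im_part_def
  by (simp_all add: L2fun_diff L2fun_add L2fun_scale abs_rl2_diff abs_rl2_add abs_rl2_scale)

lemma L2_diff_parts:
  assumes "L2 u" "L2 v"
  shows "L2 (%x. v x - u x)" "re_part (%x. v x - u x) = re_part v - re_part u" "im_part (%x. v x - u x) = im_part v - im_part u"
  using L2_combine[OF assms, of 1] by simp_all

lemma parts_eq_iff: "L2 u ==> L2 v ==> re_part u = re_part v \<and> im_part u = im_part v \<longleftrightarrow> (AE x in lebesgue. u x = v x)"
  unfolding L2_iff re_part_def im_part_def by (auto simp: abs_rl2_eq_iff complex_eq_iff)

lemma parts_cases:
  obtains u where "L2 u" "re_part u = a" "im_part u = b"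
proof -
  obtain f where f: "L2fun f" "a = abs_rl2 f" by (rule rl2_cases)
  obtain g where g: "L2fun g" "b = abs_rl2 g" by (rule rl2_cases)
  show ?thesis by (rule that[of "%x. Complex (f x) (g x)"]) (simp_all add: L2_iff re_part_def im_part_def f g)
qed

lemma test_fun_iff: "test_fun u \<longleftrightarrow> rtest (%x. Re (u x)) \<and> rtest (%x. Im (u x))"
proof
  assume u: "test_fun u"
  then have "bounded {x. u x \<noteq> 0}" by (simp add: test_fun_def compact_closure)
  then obtain R where "\<And>x. u x \<noteq> 0 ==> norm x <= R" by (auto simp: bounded_iff)
  then have "bsupp u" unfolding bsupp_def by (intro exI[of _ R]) (auto simp: not_le[symmetric])
  then have "bsupp (%x. Re (u x))" "bsupp (%x. Im (u x))" by (fastforce simp: bsupp_def)+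
  moreover have "Ck_on UNIV k u" for k using u by (simp add: test_fun_def smooth_on_def)
  ultimately show "rtest (%x. Re (u x)) \<and> rtest (%x. Im (u x))"
    by (simp add: rtest_def smooth_on_def Ck_bounded_linear[OF bounded_linear_Re] Ck_bounded_linear[OF bounded_linear_Im])
next
  assume r: "rtest (%x. Re (u x)) \<and> rtest (%x. Im (u x))"
  have "Ck_on UNIV k u" for k
  proof -
    have "Ck_on UNIV k (%x. complex_of_real (Re (u x)) + \<i>*complex_of_real (Im (u x)))" using r
      by (intro Ck_add Ck_bounded_linear[OF bounded_linear_of_real] Ck_bounded_linear[OF bounded_linear_const_mult[OF bounded_linear_of_real]])
        (auto simp: rtest_def smooth_on_def)
    then show ?thesis by (simp add: complex_eq[symmetric])
  qed
  moreover have "bsupp (%x. (Re (u x))^2 + (Im (u x))^2)" using r by (intro bsupp_add bsupp_power) (auto simp: rtest_def)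
  then obtain R where "\<forall>x. norm x > R --> (Re (u x))^2 + (Im (u x))^2 = 0" unfolding bsupp_def by blast
  then have "norm x > R ==> u x = 0" for x by (simp add: complex_eq_iff sum_power2_eq_zero_iff)
  then have "bounded {x. u x \<noteq> 0}" unfolding bounded_iff by (intro exI[of _ R]) (auto simp: not_less[symmetric])
  ultimately show "test_fun u" by (simp add: test_fun_def smooth_on_def compact_closure)
qed

lemma witten_parts:
  assumes u: "test_fun u"
  shows "Re (witten V h u x) = rwitten V h (%x. Re (u x)) x" "Im (witten V h u x) = rwitten V h (%x. Im (u x)) x"
proof -
  have "Ck_on UNIV (Suc (Suc 0)) u" using u by (simp only: test_fun_def smooth_on_def)
  then have d: "u differentiable (at x)" "b \<in> Basis ==> pd b u differentiable (at x)" for x b by simp_all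
  have l: "lap (%x. L (u x)) x = L (lap u x)" if L: "bounded_linear L" for L :: "complex => real"
  proof -
    have "pd b (pd b (%x. L (u x))) x = L (pd b (pd b u) x)" if b: "b \<in> Basis" for b
    proof -
      have "pd b (%x. L (u x)) = (%x. L (pd b u x))" by (intro ext pd_bounded_linear L d)
      then show ?thesis using pd_bounded_linear[OF L d(2)[OF b]] by simp
    qed
    then show ?thesis by (simp add: lap_def linear_sum[OF bounded_linear.linear[OF L]])
  qed
  show "Re (witten V h u x) = rwitten V h (%x. Re (u x)) x" "Im (witten V h u x) = rwitten V h (%x. Im (u x)) x"
    using l[OF bounded_linear_Re] l[OF bounded_linear_Im] by (simp_all add: witten_def rwitten_def)
qed

lemma test_fun_graph:
  assumes V: "smooth_on UNIV V" and u: "test_fun u"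
  shows "L2 u" "L2 (witten V h u)" "(re_part u, re_part (witten V h u)) \<in> rgraph V h" "(im_part u, im_part (witten V h u)) \<in> rgraph V h"
  using u rgraphI rwitten_B2[OF V] unfolding L2_iff re_part_def im_part_def witten_parts[OF u]
  by (auto simp: test_fun_iff B2_L2fun rtest_B2)

lemma tendsto_L2norm_iff:
  assumes "\<And>k. L2 (\<phi> k)" "L2 u"
  shows "(%k. L2norm (%x. \<phi> k x - u x)) \<longlonglongrightarrow> 0 \<longleftrightarrow> (%k. re_part (\<phi> k)) \<longlonglongrightarrow> re_part u \<and> (%k. im_part (\<phi> k)) \<longlonglongrightarrow> im_part u"
proof -
  have e: "L2norm (%x. \<phi> k x - u x) = sqrt ((norm (re_part (\<phi> k) - re_part u))^2 + (norm (im_part (\<phi> k) - im_part u))^2)" for k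
    using L2_diff_parts[OF assms(2) assms(1)] by (simp add: L2norm_parts)
  have "L2norm (%x. \<phi> k x - u x) = dist (re_part (\<phi> k), im_part (\<phi> k)) (re_part u, im_part u)" for k
    unfolding e by (simp add: dist_prod_def dist_norm)
  then have "(%k. L2norm (%x. \<phi> k x - u x)) \<longlonglongrightarrow> 0 \<longleftrightarrow> (%k. (re_part (\<phi> k), im_part (\<phi> k))) \<longlonglongrightarrow> (re_part u, im_part u)"
    by (simp add: tendsto_dist_iff[symmetric])
  also have "\<dots> \<longleftrightarrow> (%k. re_part (\<phi> k)) \<longlonglongrightarrow> re_part u \<and> (%k. im_part (\<phi> k)) \<longlonglongrightarrow> im_part u"
    using tendsto_fst[of "%k. (re_part (\<phi> k), im_part (\<phi> k))"] tendsto_snd[of "%k. (re_part (\<phi> k), im_part (\<phi> k))"] by (fastforce intro: tendsto_Pair)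
  finally show ?thesis .
qed

text \<open>The operator has real coefficients, so the complex closure splits into two copies of the
  real one; approximating sequences for the two parts combine into one complex sequence.\<close>

lemma witten_graph_iff:
  assumes V: "smooth_on UNIV V"
  shows "(u, f) \<in> witten_graph V h \<longleftrightarrow> L2 u \<and> L2 f \<and>
    (re_part u, re_part f) \<in> closure (rgraph V h) \<and> (im_part u, im_part f) \<in> closure (rgraph V h)"
proof
  assume "(u, f) \<in> witten_graph V h"
  then obtain \<phi> where l: "L2 u" "L2 f" and p: "\<And>k. test_fun (\<phi> k)"
    and c: "(%k. L2norm (%x. \<phi> k x - u x)) \<longlonglongrightarrow> 0" "(%k. L2norm (%x. witten V h (\<phi> k) x - f x)) \<longlonglongrightarrow> 0"
    by (auto simp: witten_graph_def)
  note g = test_fun_graph(1)[OF V p] test_fun_graph(2-4)[OF V p, where h=h]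
  note t = c[unfolded tendsto_L2norm_iff[OF g(1) l(1)] tendsto_L2norm_iff[OF g(2) l(2)]]
  show "L2 u \<and> L2 f \<and> (re_part u, re_part f) \<in> closure (rgraph V h) \<and> (im_part u, im_part f) \<in> closure (rgraph V h)"
  proof (intro conjI l)
    show "(re_part u, re_part f) \<in> closure (rgraph V h)"
      unfolding closure_sequential using t g(3)
      by (intro exI[of _ "%k. (re_part (\<phi> k), re_part (witten V h (\<phi> k)))"]) (auto intro: tendsto_Pair)
    show "(im_part u, im_part f) \<in> closure (rgraph V h)"
      unfolding closure_sequential using t g(4)
      by (intro exI[of _ "%k. (im_part (\<phi> k), im_part (witten V h (\<phi> k)))"]) (auto intro: tendsto_Pair)
  qed
next
  assume a: "L2 u \<and> L2 f \<and> (re_part u, re_part f) \<in> closure (rgraph V h) \<and> (im_part u, im_part f) \<in> closure (rgraph V h)"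
  then have l: "L2 u" "L2 f" by auto
  have ex: "\<exists>\<phi>. (\<forall>k. rtest (\<phi> k)) \<and> (%k. abs_rl2 (\<phi> k)) \<longlonglongrightarrow> v \<and> (%k. abs_rl2 (rwitten V h (\<phi> k))) \<longlonglongrightarrow> g"
    if vg: "(v, g) \<in> closure (rgraph V h)" for v g
  proof -
    obtain p where p: "\<And>k. p k \<in> rgraph V h" "p \<longlonglongrightarrow> (v, g)" using vg unfolding closure_sequential by blast
    have "\<forall>k. \<exists>\<phi>. rtest \<phi> \<and> p k = (abs_rl2 \<phi>, abs_rl2 (rwitten V h \<phi>))" using p(1) by (auto simp: rgraph_def image_iff)
    from choice[OF this] obtain \<phi> where \<phi>: "\<And>k. rtest (\<phi> k)" "\<And>k. p k = (abs_rl2 (\<phi> k), abs_rl2 (rwitten V h (\<phi> k)))" by blast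
    then show ?thesis using tendsto_fst[OF p(2)] tendsto_snd[OF p(2)] by auto
  qed
  obtain \<phi> where \<phi>: "\<And>k. rtest (\<phi> k)" "(%k. abs_rl2 (\<phi> k)) \<longlonglongrightarrow> re_part u" "(%k. abs_rl2 (rwitten V h (\<phi> k))) \<longlonglongrightarrow> re_part f"
    using ex[of "re_part u" "re_part f"] a by blast
  obtain \<psi> where \<psi>: "\<And>k. rtest (\<psi> k)" "(%k. abs_rl2 (\<psi> k)) \<longlonglongrightarrow> im_part u" "(%k. abs_rl2 (rwitten V h (\<psi> k))) \<longlonglongrightarrow> im_part f"
    using ex[of "im_part u" "im_part f"] a by blast
  define \<xi> where "\<xi> = (%k x. Complex (\<phi> k x) (\<psi> k x))"
  have t: "test_fun (\<xi> k)" for k using \<phi>(1)[of k] \<psi>(1)[of k] by (simp add: test_fun_iff \<xi>_def)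
  note g = test_fun_graph(1)[OF V t] test_fun_graph(2-4)[OF V t, where h=h]
  have "re_part (\<xi> k) = abs_rl2 (\<phi> k)" "im_part (\<xi> k) = abs_rl2 (\<psi> k)"
    "re_part (witten V h (\<xi> k)) = abs_rl2 (rwitten V h (\<phi> k))" "im_part (witten V h (\<xi> k)) = abs_rl2 (rwitten V h (\<psi> k))" for k
    unfolding re_part_def im_part_def witten_parts[OF t] by (simp_all add: \<xi>_def)
  then have "(%k. L2norm (%x. \<xi> k x - u x)) \<longlonglongrightarrow> 0" "(%k. L2norm (%x. witten V h (\<xi> k) x - f x)) \<longlonglongrightarrow> 0"
    unfolding tendsto_L2norm_iff[OF g(1) l(1)] tendsto_L2norm_iff[OF g(2) l(2)] using \<phi> \<psi> by simp_all
  then show "(u, f) \<in> witten_graph V h" using l t by (auto simp: witten_graph_def)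
qed

section \<open>Consequences of an eigenbasis with a gap\<close>

context dense_range_graph
begin

text \<open>Subtracting the eigencomponents from \<open>u\<close> and their images from
  \<open>g\<close> stays in the graph, and pairings with vectors orthogonal to all
  \<open>e i\<close> do not notice it.\<close>

lemma split_eigenvectors:
  fixes n :: nat
  assumes orth: "\<forall>i<n. \<forall>j<n. inner (e i) (e j) = (if i = j then 1 else 0)"
    and eig: "\<forall>i<n. (e i, lam i *\<^sub>R e i) \<in> G"
    and ug: "(u, g) \<in> G"
  shows "\<exists>u' g'. (u', g') \<in> G \<and> (\<forall>i<n. inner (e i) u' = 0) \<and> u = u' + (\<Sum>i<n. inner (e i) u *\<^sub>R e i) \<and>
    (\<forall>v. (\<forall>i<n. inner (e i) v = 0) --> inner u v = inner u' v \<and> inner g v = inner g' v) \<and>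
    (norm u)^2 = (norm u')^2 + (\<Sum>i<n. (inner (e i) u)^2)"
proof -
  define p q where "p = (\<Sum>i<n. inner (e i) u *\<^sub>R e i)" and "q = (\<Sum>i<n. inner (e i) u *\<^sub>R lam i *\<^sub>R e i)"
  have pq: "(p, q) \<in> G" unfolding p_def q_def using eig by (intro G_sum G_scale) auto
  have ep: "inner (e j) p = inner (e j) u" if j: "j < n" for j
  proof -
    have "inner (e j) p = (\<Sum>i<n. if j = i then inner (e i) u else 0)"
      unfolding p_def inner_sum_right using orth j by (intro sum.cong) auto
    then show ?thesis using j by simp
  qed
  have pv: "inner p v = (\<Sum>i<n. inner (e i) u*inner (e i) v)" for v by (simp add: p_def inner_sum_left)
  have z: "inner p v = 0 \<and> inner q v = 0" if "\<forall>i<n. inner (e i) v = 0" for v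
    using that by (simp add: p_def q_def inner_sum_left)
  have o: "\<forall>i<n. inner (e i) (u - p) = 0" using ep by (simp add: inner_diff_right)
  have "inner p p = (\<Sum>i<n. (inner (e i) u)^2)" unfolding pv using ep by (intro sum.cong) (auto simp: power2_eq_square)
  moreover have "inner p (u - p) = 0" using z[OF o] by simp
  moreover have "(norm ((u - p) + p))^2 = (norm (u - p))^2 + inner p p + 2*inner p (u - p)"
    unfolding power2_norm_eq_inner inner_add_left inner_add_right by (simp add: inner_commute)
  ultimately have "(norm u)^2 = (norm (u - p))^2 + (\<Sum>i<n. (inner (e i) u)^2)" by simp
  then show ?thesis using z
    by (intro exI[of _ "u - p"] exI[of _ "g - q"] conjI G_diff[OF ug pq] o) (auto simp: p_def[symmetric] inner_diff_left)
qed

text \<open>The part of \<open>u\<close> orthogonal to all \<open>e i\<close> has form value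
  \<open>a\<close> times its squared norm, which the gap \<open>E > a\<close> excludes unless it is
  zero; symmetry removes components with another eigenvalue.\<close>

lemma eigenvector_span:
  fixes n :: nat
  assumes orth: "\<forall>i<n. \<forall>j<n. inner (e i) (e j) = (if i = j then 1 else 0)"
    and eig: "\<forall>i<n. (e i, lam i *\<^sub>R e i) \<in> G"
    and gap: "\<And>u f. (u, f) \<in> G ==> (\<forall>i<n. inner (e i) u = 0) ==> inner f u >= E*(norm u)^2"
    and u: "(u, a *\<^sub>R u) \<in> G" and a: "a < E"
  shows "u = (\<Sum>i\<in>{i. i < n \<and> lam i = a}. inner (e i) u *\<^sub>R e i)"
proof -
  obtain u' g' where s: "(u', g') \<in> G" "\<forall>i<n. inner (e i) u' = 0" "u = u' + (\<Sum>i<n. inner (e i) u *\<^sub>R e i)"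
    "\<forall>v. (\<forall>i<n. inner (e i) v = 0) --> inner u v = inner u' v \<and> inner (a *\<^sub>R u) v = inner g' v"
    using split_eigenvectors[OF orth eig u] by (elim exE conjE) (rule that)
  have "inner g' u' = a*(norm u')^2"
    using s(4)[THEN spec, THEN mp, OF s(2)] unfolding power2_norm_eq_inner by (metis inner_scaleR_left)
  then have "(E - a)*(norm u')^2 <= 0" using gap[OF s(1,2)] by (simp add: left_diff_distrib)
  then have "u' = 0" using a by (simp add: mult_le_0_iff)
  moreover have "inner (e i) u = 0" if "i < n" "lam i \<noteq> a" for i
    using G_sym[OF eig[rule_format, OF that(1)] u] that by simp
  then have "(\<Sum>i<n. inner (e i) u *\<^sub>R e i) = (\<Sum>i\<in>{i. i < n \<and> lam i = a}. inner (e i) u *\<^sub>R e i)"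
    by (intro sum.mono_neutral_right) auto
  ultimately show ?thesis using s(3) by simp
qed

text \<open>Along \<open>e i\<close> the system is a 2 by 2 matrix which is
  \<open>sqrt (d i)\<close> times an isometry. On the complement, pairing the two equations with the
  two unknowns cancels the \<open>b\<close>-terms and leaves coercivity
  \<open>E - a\<close>.\<close>

lemma resolvent_bound:
  fixes n :: nat
  assumes orth: "\<forall>i<n. \<forall>j<n. inner (e i) (e j) = (if i = j then 1 else 0)"
    and eig: "\<forall>i<n. (e i, lam i *\<^sub>R e i) \<in> G"
    and gap: "\<And>u f. (u, f) \<in> G ==> (\<forall>i<n. inner (e i) u = 0) ==> inner f u >= E*(norm u)^2"
    and a: "a < E" and nl: "\<forall>i<n. a \<noteq> lam i \<or> b \<noteq> 0"
  obtains C where "C >= 0" "\<And>u1 g1 u2 g2. (u1, g1) \<in> G ==> (u2, g2) \<in> G ==>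
    (norm u1)^2 + (norm u2)^2 <= C*((norm (g1 - (a *\<^sub>R u1 - b *\<^sub>R u2)))^2 + (norm (g2 - (a *\<^sub>R u2 + b *\<^sub>R u1)))^2)"
proof -
  define d where "d i = (lam i - a)^2 + b^2" for i
  have d: "d i > 0" if "i < n" for i using nl that by (auto simp: d_def sum_power2_gt_zero_iff)
  show ?thesis
  proof (rule that[of "1/(E - a)^2 + (\<Sum>i<n. 1/d i)"])
    show "1/(E - a)^2 + (\<Sum>i<n. 1/d i) >= 0" using d by (intro add_nonneg_nonneg sum_nonneg) (auto simp: less_imp_le)
    fix u1 g1 u2 g2 assume G1: "(u1, g1) \<in> G" and G2: "(u2, g2) \<in> G"
    define F1 F2 where "F1 = g1 - (a *\<^sub>R u1 - b *\<^sub>R u2)" and "F2 = g2 - (a *\<^sub>R u2 + b *\<^sub>R u1)"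
    define N where "N = (norm F1)^2 + (norm F2)^2"
    obtain v1 k1 where v1: "(v1, k1) \<in> G" "\<forall>i<n. inner (e i) v1 = 0"
      "\<forall>v. (\<forall>i<n. inner (e i) v = 0) --> inner u1 v = inner v1 v \<and> inner g1 v = inner k1 v"
      "(norm u1)^2 = (norm v1)^2 + (\<Sum>i<n. (inner (e i) u1)^2)" using split_eigenvectors[OF orth eig G1] by (elim exE conjE) (rule that)
    obtain v2 k2 where v2: "(v2, k2) \<in> G" "\<forall>i<n. inner (e i) v2 = 0"
      "\<forall>v. (\<forall>i<n. inner (e i) v = 0) --> inner u2 v = inner v2 v \<and> inner g2 v = inner k2 v"
      "(norm u2)^2 = (norm v2)^2 + (\<Sum>i<n. (inner (e i) u2)^2)" using split_eigenvectors[OF orth eig G2] by (elim exE conjE) (rule that)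
    have "(inner (e i) u1)^2 + (inner (e i) u2)^2 <= (1/d i)*N" if i: "i < n" for i
    proof -
      define x y where "x = inner (e i) u1" and "y = inner (e i) u2"
      have ge: "inner (e i) g1 = lam i*x" "inner (e i) g2 = lam i*y"
        using G_sym[OF eig[rule_format, OF i] G1] G_sym[OF eig[rule_format, OF i] G2] by (simp_all add: x_def y_def)
      have p: "inner (e i) F1 = (lam i - a)*x + b*y" "inner (e i) F2 = (lam i - a)*y - b*x"
        unfolding F1_def F2_def inner_diff_right inner_add_right inner_scaleR_right ge x_def[symmetric] y_def[symmetric] by (simp_all add: algebra_simps)
      have n1: "norm (e i) = 1" using orth[rule_format, OF i i] by (simp add: norm_eq_sqrt_inner)
      have "d i*(x^2 + y^2) = (inner (e i) F1)^2 + (inner (e i) F2)^2"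
        unfolding p d_def by (simp add: power2_eq_square algebra_simps)
      also have "\<dots> <= N" unfolding N_def
        using Cauchy_Schwarz_ineq[of "e i" F1] Cauchy_Schwarz_ineq[of "e i" F2] n1
        by (simp add: power2_norm_eq_inner[symmetric])
      finally show ?thesis unfolding x_def[symmetric] y_def[symmetric] using d[OF i] by (simp add: field_simps)
    qed
    then have "(\<Sum>i<n. (inner (e i) u1)^2 + (inner (e i) u2)^2) <= (\<Sum>i<n. (1/d i)*N)" by (intro sum_mono) auto
    then have S: "(\<Sum>i<n. (inner (e i) u1)^2) + (\<Sum>i<n. (inner (e i) u2)^2) <= (\<Sum>i<n. 1/d i)*N"
      by (simp only: sum.distrib sum_distrib_right)
    define M where "M = (norm v1)^2 + (norm v2)^2"
    have "M <= (1/(E - a)^2)*N"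
    proof -
      have "inner F1 v1 + inner F2 v2 = inner k1 v1 + inner k2 v2 - a*M"
        unfolding F1_def F2_def M_def power2_norm_eq_inner inner_diff_left inner_add_left inner_scaleR_left
          v1(3)[THEN spec, THEN mp, OF v1(2), THEN conjunct1] v1(3)[THEN spec, THEN mp, OF v1(2), THEN conjunct2] v1(3)[THEN spec, THEN mp, OF v2(2), THEN conjunct1]
          v2(3)[THEN spec, THEN mp, OF v2(2), THEN conjunct1] v2(3)[THEN spec, THEN mp, OF v2(2), THEN conjunct2] v2(3)[THEN spec, THEN mp, OF v1(2), THEN conjunct1]
        by (simp add: algebra_simps inner_commute)
      then have 1: "(E - a)*M <= inner F1 v1 + inner F2 v2"
        using gap[OF v1(1,2)] gap[OF v2(1,2)] by (simp add: M_def algebra_simps)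
      \<comment> \<open>Expanding the squared norm of \<open>F - (E - a) *\<^sub>R v\<close>;
        Young's inequality with the weight that absorbs half of the left-hand side.\<close>
      have yg: "2*(E - a)*inner F v <= (norm F)^2 + (E - a)^2*(norm v)^2" for F v
      proof -
        have "0 <= inner (F - (E - a) *\<^sub>R v) (F - (E - a) *\<^sub>R v)" by simp
        also have "\<dots> = inner F F - 2*(E - a)*inner F v + (E - a)^2*inner v v"
          unfolding inner_diff_left inner_diff_right inner_scaleR_left inner_scaleR_right inner_commute[of v F]
          by (simp add: power2_eq_square algebra_simps)
        finally show ?thesis by (simp add: power2_norm_eq_inner)
      qed
      have "2*(E - a)*((E - a)*M) <= 2*(E - a)*(inner F1 v1 + inner F2 v2)" using 1 a by (intro mult_left_mono) auto
      moreover have "\<dots> <= N + (E - a)^2*M" using yg[of F1 v1] yg[of F2 v2] by (simp add: N_def M_def distrib_left)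
      moreover have "2*(E - a)*((E - a)*M) = (E - a)^2*M + (E - a)^2*M" by (simp add: power2_eq_square algebra_simps)
      ultimately have "(E - a)^2*M <= N" by linarith
      then show ?thesis using a by (simp add: field_simps)
    qed
    then show "(norm u1)^2 + (norm u2)^2 <= (1/(E - a)^2 + (\<Sum>i<n. 1/d i))*((norm (g1 - (a *\<^sub>R u1 - b *\<^sub>R u2)))^2 + (norm (g2 - (a *\<^sub>R u2 + b *\<^sub>R u1)))^2)"
      using S v1(4) v2(4) unfolding F1_def[symmetric] F2_def[symmetric] N_def[symmetric] M_def by (simp add: distrib_right)
  qed
qed

end

section \<open>Spectrum and multiplicities of the complex graph, and the conclusion\<close>

text \<open>Off the \<open>lam i\<close>, solvability and the norm bound are transferred through
  real and imaginary parts; at \<open>lam i\<close> the vector \<open>e i\<close> has zero image, so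
  no norm bound can hold. Coinciding values cause no trouble: the eigenspace of \<open>a\<close> is
  spanned by exactly the \<open>e i\<close> with \<open>lam i = a\<close>, and
  \<open>\<beta>\<close> transports this count to \<open>M\<close>.\<close>

lemma witten_graph_spectrum:
  fixes V :: "'a::euclidean_space => real" and M :: "'a set" and n :: nat
  assumes V: "smooth_on UNIV V" and drg: "dense_range_graph (rgraph V h) s"
    and M: "finite M" "card M = n"
    and orth: "\<forall>i<n. \<forall>j<n. inner (e i) (e j) = (if i = j then 1 else 0)"
    and eig: "\<forall>i<n. (e i, lam i *\<^sub>R e i) \<in> closure (rgraph V h)"
    and gap: "\<And>u f. (u, f) \<in> closure (rgraph V h) ==> (\<forall>i<n. inner (e i) u = 0) ==> inner f u >= E*(norm u)^2"
    and surj: "\<And>a b f1 f2. a < E ==> (\<forall>i<n. a \<noteq> lam i \<or> b \<noteq> 0) ==>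
       \<exists>u1 g1 u2 g2. (u1, g1) \<in> closure (rgraph V h) \<and> (u2, g2) \<in> closure (rgraph V h) \<and>
         g1 - (a *\<^sub>R u1 - b *\<^sub>R u2) = f1 \<and> g2 - (a *\<^sub>R u2 + b *\<^sub>R u1) = f2"
    and lam\<delta>: "\<forall>i<n. lam i <= \<delta>" and \<delta>: "\<delta> < E"
  shows "\<exists>lam' :: 'a => real.
     op_spectrum (witten_graph V h) \<inter> {z. Re z < E} = (%m. complex_of_real (lam' m)) ` M \<and>
     (\<forall>\<mu>\<in>(%m. complex_of_real (lam' m)) ` M.
        has_multiplicity (witten_graph V h) \<mu> (card {m\<in>M. complex_of_real (lam' m) = \<mu>})) \<and>
     (\<forall>m\<in>M. lam' m <= \<delta>)"
proof -
  have lamE: "\<forall>i<n. lam i < E" using lam\<delta> \<delta> by fastforce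
  interpret dense_range_graph "rgraph V h" s by (rule drg)
  note graph_iff = witten_graph_iff[OF V, where h=h]
  obtain \<beta> where \<beta>: "bij_betw \<beta> M {..<n}" using ex_bij_betw_finite_nat[OF M(1)] M(2) by (auto simp: atLeast0LessThan)
  define lam' where "lam' m = lam (\<beta> m)" for m
  have lamM: "\<exists>i<n. lam' m = lam i" if "m \<in> M" for m using bij_betwE[OF \<beta>] that by (auto simp: lam'_def)
  have zero_part: "re_part (%x::'a. 0) = 0" "im_part (%x::'a. 0) = 0" "L2 (%x::'a. 0)"
    by (simp_all add: re_part_def im_part_def zero_rl2.abs_eq L2_iff L2fun_0)
  have "z \<in> resolvent_set (witten_graph V h)" if z: "Re z < E" and zn: "\<forall>i<n. z \<noteq> complex_of_real (lam i)" for z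
  proof -
    have nl: "\<forall>i<n. Re z \<noteq> lam i \<or> Im z \<noteq> 0" using zn by (auto simp: complex_eq_iff)
    have "\<exists>(u, g)\<in>witten_graph V h. AE x in lebesgue. g x - z*u x = f x" if f: "L2 f" for f
    proof -
      obtain u1 g1 u2 g2 where G: "(u1, g1) \<in> G" "(u2, g2) \<in> G"
        and eq: "g1 - (Re z *\<^sub>R u1 - Im z *\<^sub>R u2) = re_part f" "g2 - (Re z *\<^sub>R u2 + Im z *\<^sub>R u1) = im_part f"
        using surj[OF z nl] by metis
      obtain u where u: "L2 u" "re_part u = u1" "im_part u = u2" by (rule parts_cases)
      obtain g where g: "L2 g" "re_part g = g1" "im_part g = g2" by (rule parts_cases)
      have "(u, g) \<in> witten_graph V h" unfolding graph_iff using u g G by simp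
      moreover have "AE x in lebesgue. g x - z*u x = f x"
        using parts_eq_iff[OF L2_combine(1)[OF u(1) g(1)] f, of z] L2_combine(2,3)[OF u(1) g(1), of z] eq u g by simp
      ultimately show ?thesis by blast
    qed
    moreover obtain C where C: "C >= 0" "\<And>u1 g1 u2 g2. (u1, g1) \<in> G ==> (u2, g2) \<in> G ==>
      (norm u1)^2 + (norm u2)^2 <= C*((norm (g1 - (Re z *\<^sub>R u1 - Im z *\<^sub>R u2)))^2 + (norm (g2 - (Re z *\<^sub>R u2 + Im z *\<^sub>R u1)))^2)"
      using resolvent_bound[OF orth eig gap z nl] by metis
    have "L2norm u <= sqrt C*L2norm (%x. g x - z*u x)" if "(u, g) \<in> witten_graph V h" for u g
    proof -
      have l: "L2 u" "L2 g" and G: "(re_part u, re_part g) \<in> G" "(im_part u, im_part g) \<in> G"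
        using that by (simp_all add: graph_iff)
      show ?thesis unfolding L2norm_parts[OF l(1)] L2norm_parts[OF L2_combine(1)[OF l]] L2_combine(2,3)[OF l] real_sqrt_mult[symmetric]
        by (intro real_sqrt_le_mono C(2) G)
    qed
    then have "\<exists>C. \<forall>(u, g)\<in>witten_graph V h. L2norm u <= C*L2norm (%x. g x - z*u x)" by blast
    ultimately show ?thesis by (simp add: resolvent_set_def)
  qed
  moreover have "complex_of_real (lam i) \<notin> resolvent_set (witten_graph V h)" if i: "i < n" for i
  proof
    assume "complex_of_real (lam i) \<in> resolvent_set (witten_graph V h)"
    then obtain C where C: "\<forall>(u, g)\<in>witten_graph V h. L2norm u <= C*L2norm (%x. g x - complex_of_real (lam i)*u x)"
      unfolding resolvent_set_def by blast
    obtain u where u: "L2 u" "re_part u = e i" "im_part u = 0" by (rule parts_cases)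
    obtain g where g: "L2 g" "re_part g = lam i *\<^sub>R e i" "im_part g = 0" by (rule parts_cases)
    have "(0, 0) \<in> G" using subspace_0[OF G_subspace] by (simp add: zero_prod_def)
    then have "(u, g) \<in> witten_graph V h" unfolding graph_iff using u g eig i by simp
    with C have "L2norm u <= C*L2norm (%x. g x - complex_of_real (lam i)*u x)" by blast
    moreover have "L2norm u = 1" using orth i by (simp add: L2norm_parts u power2_norm_eq_inner)
    moreover have "L2norm (%x. g x - complex_of_real (lam i)*u x) = 0"
      unfolding L2norm_parts[OF L2_combine(1)[OF u(1) g(1)]] L2_combine(2,3)[OF u(1) g(1)] by (simp add: u g)
    ultimately show False by simp
  qed
  ultimately have "op_spectrum (witten_graph V h) \<inter> {z. Re z < E} = (%i. complex_of_real (lam i)) ` {..<n}"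
    using lamE by (auto simp: op_spectrum_def)
  also have "\<dots> = (%m. complex_of_real (lam' m)) ` M"
    unfolding lam'_def bij_betw_imp_surj_on[OF \<beta>, symmetric] by (simp add: image_image)
  finally have spec: "op_spectrum (witten_graph V h) \<inter> {z. Re z < E} = (%m. complex_of_real (lam' m)) ` M" .
  have "has_multiplicity (witten_graph V h) (complex_of_real a) (card {m\<in>M. complex_of_real (lam' m) = complex_of_real a})"
    if a: "a < E" for a
  proof -
    define I where "I = {i. i < n \<and> lam i = a}"
    define k where "k = card I"
    have "I = {i\<in>\<beta> ` M. lam i = a}" using bij_betw_imp_surj_on[OF \<beta>] by (auto simp: I_def)
    also have "\<dots> = \<beta> ` {m\<in>M. lam' m = a}" by (auto simp: lam'_def)
    finally have "bij_betw \<beta> {m\<in>M. lam' m = a} I"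
      using inj_on_subset[OF bij_betw_imp_inj_on[OF \<beta>]] by (intro bij_betw_imageI) auto
    then have kc: "card {m\<in>M. complex_of_real (lam' m) = complex_of_real a} = k" by (simp add: k_def bij_betw_same_card)
    have "finite I" by (simp add: I_def)
    then obtain sg where sg: "bij_betw sg {..<k} I" using ex_bij_betw_nat_finite[of I] by (auto simp: k_def atLeast0LessThan)
    have sgI: "sg j < n" "lam (sg j) = a" if "j < k" for j using bij_betwE[OF sg] that by (auto simp: I_def)
    have "\<forall>i. \<exists>f. L2fun f \<and> e i = abs_rl2 f" using rl2_cases by metis
    from choice[OF this] obtain fe where fe: "\<And>i. L2fun (fe i)" "\<And>i. abs_rl2 (fe i) = e i" by metis
    define e' where "e' j x = complex_of_real (fe (sg j) x)" for j x
    have comb: "L2 (%x. \<Sum>j<k. c j*e' j x)"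
      "re_part (%x. \<Sum>j<k. c j*e' j x) = (\<Sum>j<k. Re (c j) *\<^sub>R e (sg j))"
      "im_part (%x. \<Sum>j<k. c j*e' j x) = (\<Sum>j<k. Im (c j) *\<^sub>R e (sg j))" for c
      using abs_rl2_sum[of "{..<k}" "%j x. Re (c j)*fe (sg j) x"] abs_rl2_sum[of "{..<k}" "%j x. Im (c j)*fe (sg j) x"]
      by (simp_all add: L2_iff re_part_def im_part_def e'_def fe abs_rl2_scale[symmetric] L2fun_scale)
    have "e' j \<in> eigenspace_of (witten_graph V h) (complex_of_real a)" if j: "j < k" for j
    proof -
      have p: "L2 (e' j)" "re_part (e' j) = e (sg j)" "im_part (e' j) = 0"
        by (simp_all add: L2_iff re_part_def im_part_def e'_def[abs_def] fe zero_rl2.abs_eq L2fun_0)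
      have q: "L2 (%x. complex_of_real a*e' j x)" "re_part (%x. complex_of_real a*e' j x) = a *\<^sub>R e (sg j)" "im_part (%x. complex_of_real a*e' j x) = 0"
        by (simp_all add: L2_iff re_part_def im_part_def e'_def[abs_def] fe zero_rl2.abs_eq L2fun_0 L2fun_scale abs_rl2_scale[symmetric])
      have "(0, 0) \<in> G" using subspace_0[OF G_subspace] by (simp add: zero_prod_def)
      moreover have "(e (sg j), a *\<^sub>R e (sg j)) \<in> G" using eig sgI[OF j] by metis
      ultimately have "(e' j, %x. complex_of_real a*e' j x) \<in> witten_graph V h" unfolding graph_iff by (simp add: p q)
      then show ?thesis unfolding eigenspace_of_def by (intro CollectI exI[of _ "%x. complex_of_real a*e' j x"]) simp
    qed
    moreover have "\<exists>c. AE x in lebesgue. u x = (\<Sum>j<k. c j*e' j x)" if "u \<in> eigenspace_of (witten_graph V h) (complex_of_real a)" for u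
    proof -
      obtain g where ug: "(u, g) \<in> witten_graph V h" and ae: "AE x in lebesgue. g x = complex_of_real a*u x"
        using \<open>u \<in> _\<close> by (auto simp: eigenspace_of_def)
      then have l: "L2 u" "L2 g" and G: "(re_part u, re_part g) \<in> G" "(im_part u, im_part g) \<in> G" by (simp_all add: graph_iff)
      have "AE x in lebesgue. g x - complex_of_real a*u x = 0" using ae by simp
      then have "re_part (%x. g x - complex_of_real a*u x) = 0 \<and> im_part (%x. g x - complex_of_real a*u x) = 0"
        using parts_eq_iff[OF L2_combine(1)[OF l] zero_part(3), of "complex_of_real a"] zero_part by simp
      then have "re_part g = a *\<^sub>R re_part u" "im_part g = a *\<^sub>R im_part u" unfolding L2_combine(2,3)[OF l] by simp_all
      then have G': "(re_part u, a *\<^sub>R re_part u) \<in> G" "(im_part u, a *\<^sub>R im_part u) \<in> G" using G by simp_all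
      have sp: "v = (\<Sum>j<k. inner (e (sg j)) v *\<^sub>R e (sg j))" if "(v, a *\<^sub>R v) \<in> G" for v
        using eigenvector_span[OF orth eig gap that a] sum.reindex_bij_betw[OF sg, of "%i. inner (e i) v *\<^sub>R e i"]
        unfolding I_def[symmetric] by simp
      define c where "c j = Complex (inner (e (sg j)) (re_part u)) (inner (e (sg j)) (im_part u))" for j
      have "re_part u = re_part (%x. \<Sum>j<k. c j*e' j x) \<and> im_part u = im_part (%x. \<Sum>j<k. c j*e' j x)"
        unfolding comb(2,3) using sp[OF G'(1)] sp[OF G'(2)] by (simp add: c_def)
      then have "AE x in lebesgue. u x = (\<Sum>j<k. c j*e' j x)" using parts_eq_iff[OF l(1) comb(1)] by blast
      then show ?thesis by (intro exI[of _ c])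
    qed
    moreover have "\<forall>j<k. c j = 0" if "AE x in lebesgue. (\<Sum>j<k. c j*e' j x) = 0" for c
    proof (intro allI impI)
      fix j assume j: "j < k"
      have z: "re_part (%x. \<Sum>j<k. c j*e' j x) = 0 \<and> im_part (%x. \<Sum>j<k. c j*e' j x) = 0"
        using parts_eq_iff[OF comb(1) zero_part(3), of c] that zero_part by simp
      have "inner (e (sg j)) (\<Sum>l<k. d l *\<^sub>R e (sg l)) = d j" for d :: "nat => real"
      proof -
        have "inner (e (sg j)) (\<Sum>l<k. d l *\<^sub>R e (sg l)) = (\<Sum>l<k. if j = l then d l else 0)"
          unfolding inner_sum_right using orth sgI j bij_betw_imp_inj_on[OF sg] by (intro sum.cong) (auto simp: inj_on_eq_iff)
        then show ?thesis using j by simp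
      qed
      from this[of "%l. Re (c l)"] this[of "%l. Im (c l)"] show "c j = 0" using z[unfolded comb] by (simp add: complex_eq_iff)
    qed
    ultimately show ?thesis unfolding kc has_multiplicity_def by (intro exI[of _ e'] conjI allI impI ballI) blast+
  qed
  then have "\<forall>\<mu>\<in>(%m. complex_of_real (lam' m)) ` M. has_multiplicity (witten_graph V h) \<mu> (card {m\<in>M. complex_of_real (lam' m) = \<mu>})"
    using lamM lamE by fastforce
  moreover have "\<forall>m\<in>M. lam' m <= \<delta>" using lamM lam\<delta> by fastforce
  ultimately show ?thesis using spec by (intro exI[of _ lam'] conjI)
qed

theorem theorem1:
  fixes V :: "'a::euclidean_space \<Rightarrow> real"
    and t :: "'a \<Rightarrow> 'a \<Rightarrow> real" and \<nu> :: "'a \<Rightarrow> 'a \<Rightarrow> nat"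
  assumes "smooth_on UNIV V"
    and "confinement V"
    and "degenerate_morse V t \<nu>"
  shows "\<exists>h0>0. \<exists>\<epsilon>>0. \<exists>c>0. \<forall>h. 0 < h \<and> h \<le> h0 \<longrightarrow>
     (\<exists>lam :: 'a \<Rightarrow> real.
        op_spectrum (witten_graph V h) \<inter> {z. Re z < \<epsilon> * h powr (2 - 2 / real (nu_bar V \<nu>))}
          = (\<lambda>m. complex_of_real (lam m)) ` local_minima V t \<nu> \<and>
        (\<forall>\<mu>\<in>(\<lambda>m. complex_of_real (lam m)) ` local_minima V t \<nu>.
           has_multiplicity (witten_graph V h) \<mu>
             (card {m\<in>local_minima V t \<nu>. complex_of_real (lam m) = \<mu>})) \<and>
        (\<forall>m\<in>local_minima V t \<nu>. lam m \<le> exp (- c / h)))"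
proof -
  interpret witten_setup V t \<nu> by unfold_locales (fact assms)+
  define M where "M = local_minima V t \<nu>"
  have Mc: "M \<subseteq> crit V" by (auto simp: M_def local_minima_def)
  have finM: "finite M" by (rule finite_subset[OF Mc finite_crit])
  obtain r where r: "r > 0" and rN: "\<And>x. x \<in> crit V ==> cball x r \<subseteq> Nb x"
    and rD: "\<And>x y. x \<in> crit V ==> y \<in> crit V ==> y \<noteq> x ==> cball x r \<inter> cball y r = {}"
    using radius_exists by blast
  obtain h1 \<epsilon> where h1: "h1 > 0" "\<epsilon> > 0" and low: "\<And>h. 0 < h ==> h <= h1 ==> (\<exists>l C. (\<forall>m. B2 (l m)) \<and> C >= 0 \<and> (\<forall>u. Ck_on UNIV (Suc 0) u --> bsupp u -->
     Qform V h u >= \<epsilon>*EE h*(LBINT x. (u x)^2) - C*(\<Sum>m\<in>M. (LBINT x. l m x*u x)^2)))"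
    using global_lower unfolding M_def by blast
  \<comment> \<open>With the whole space as exceptional set only the global lower bound of the
    potential remains.\<close>
  obtain h2 s where h2: "h2 > 0" "s >= 0" and pot: "\<And>h x. 0 < h ==> h <= h2 ==> Wpot V h x >= - s"
    using potential_bounds[OF V conf open_UNIV subset_UNIV] by (elim exE conjE) (erule that, assumption, blast)
  have "\<forall>m\<in>M. \<exists>h0>0. \<exists>c>0. \<forall>h. 0 < h \<and> h <= h0 --> small_energy r c h m"
    using quasimode_energy[OF _ r rN] Mc unfolding M_def by blast
  from bchoice[OF this] obtain hq where "\<forall>m\<in>M. hq m > 0 \<and> (\<exists>c>0. \<forall>h. 0 < h \<and> h <= hq m --> small_energy r c h m)" by (elim exE) (rule that)
  then have hq: "\<And>m. m \<in> M ==> hq m > 0" and ex: "\<forall>m\<in>M. \<exists>c>0. \<forall>h. 0 < h \<and> h <= hq m --> small_energy r c h m" by simp_all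
  from bchoice[OF ex] obtain cq where "\<forall>m\<in>M. cq m > 0 \<and> (\<forall>h. 0 < h \<and> h <= hq m --> small_energy r (cq m) h m)" by (elim exE) (rule that)
  then have cq: "\<And>m. m \<in> M ==> cq m > 0" and qm: "\<And>m h. m \<in> M ==> 0 < h ==> h <= hq m ==> small_energy r (cq m) h m" by simp_all
  \<comment> \<open>A common rate for all minima; the extra entry 1 covers the case without
    minima.\<close>
  define c where "c = Min (insert 1 (cq ` M))"
  have c: "c > 0" "\<And>m. m \<in> M ==> c <= cq m" using finM cq by (auto simp: c_def)
  \<comment> \<open>The entry \<open>\<epsilon>*c^3/7\<close> serves \<open>\<delta>E\<close> below:
    \<open>exp (- c/h) <= 6*(h/c)^3\<close>, where 6 is the factorial of 3, and the third power of
    \<open>h\<close> leaves one factor beyond \<open>h^2 <= EE h\<close>. Taking 7 instead of 6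
    makes the inequality strict.\<close>
  define S where "S = {1, h1, h2, \<epsilon>*c^3/7} \<union> hq ` M"
  define h0 where "h0 = Min S"
  have S: "finite S" "S \<noteq> {}" "\<forall>x\<in>S. 0 < x" using finM hq h1 h2 c by (auto simp: S_def)
  have le: "h0 <= x" if "x \<in> S" for x unfolding h0_def by (rule Min_le[OF S(1) that])
  have "h0 > 0" using Min_gr_iff[OF S(1,2), of 0] S(3) unfolding h0_def by blast
  moreover have "h0 <= 1" "h0 <= h1" "h0 <= h2" "h0 <= \<epsilon>*c^3/7" "\<And>m. m \<in> M ==> h0 <= hq m"
    by (rule le, simp add: S_def)+
  ultimately have h0: "h0 > 0" "h0 <= 1" "h0 <= h1" "h0 <= h2" "h0 <= \<epsilon>*c^3/7" "\<And>m. m \<in> M ==> h0 <= hq m" by blast+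
  have main: "\<exists>lam :: 'a => real.
        op_spectrum (witten_graph V h) \<inter> {z. Re z < \<epsilon>*EE h} = (%m. complex_of_real (lam m)) ` M \<and>
        (\<forall>\<mu>\<in>(%m. complex_of_real (lam m)) ` M.
           has_multiplicity (witten_graph V h) \<mu> (card {m\<in>M. complex_of_real (lam m) = \<mu>})) \<and>
        (\<forall>m\<in>M. lam m <= exp (- c/h))" if h: "0 < h" "h <= h0" for h
  proof -
    define \<delta> where "\<delta> = exp (- c/h)"
    define n where "n = card M"
    have hh: "h <= 1" "h <= h1" "h <= h2" using h h0 by auto
    have \<delta>E: "\<delta> < \<epsilon>*EE h"
    proof -
      have "7*h <= \<epsilon>*c^3" using h(2) h0(5) by simp
      moreover have "6*h < 7*h" using h by simp
      ultimately have 1: "6*h < \<epsilon>*c^3" by linarith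
      have "\<delta> <= 6*(h/c)^3"
        using exp_minus_le_power[OF c(1) h(1), of 2] by (simp add: \<delta>_def fact_numeral)
      also have "\<dots> = (6*h)*(h^2/c^3)" by (simp add: power_divide power3_eq_cube power2_eq_square)
      also have "\<dots> < (\<epsilon>*c^3)*(h^2/c^3)" using 1 h c by (intro mult_strict_right_mono) auto
      also have "\<dots> = \<epsilon>*h^2" using c by simp
      also have "\<dots> <= \<epsilon>*EE h" using EE_bounds(3)[OF h(1) hh(1)] h1 by (intro mult_left_mono) auto
      finally show ?thesis .
    qed
    have "1 <= Wpot V h x + (s + 1)" for x using pot[OF h(1) hh(3), of x] by linarith
    \<comment> \<open>Shifting by \<open>s + 1\<close> makes the potential at least 1, and keeps the
      shift positive even when \<open>s\<close> is 0.\<close>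
    then have drg: "dense_range_graph (rgraph V h) (s + 1)" using h2 by (intro dense_range_rgraph V) auto
    obtain l C where l: "\<And>m. B2 (l m)" and C: "C >= 0" and lo: "\<And>u. Ck_on UNIV (Suc 0) u ==> bsupp u ==>
       Qform V h u >= \<epsilon>*EE h*(LBINT x. (u x)^2) - C*(\<Sum>m\<in>M. (LBINT x. l m x*u x)^2)"
      using low[OF h(1) hh(2)] by blast
    obtain \<gamma> where \<gamma>: "bij_betw \<gamma> {..<n} M" using ex_bij_betw_nat_finite[OF finM] by (auto simp: n_def atLeast0LessThan)
    have \<gamma>M: "\<gamma> i \<in> M" if "i < n" for i using bij_betwE[OF \<gamma>] that by auto
    define q where "q i = quasimode r h (\<gamma> i)" for i
    have qt: "rtest (q i)" for i unfolding q_def by (rule quasimode_rtest[OF r])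
    have qin: "inner (abs_rl2 (rwitten V h (q i))) (abs_rl2 (q j)) = (LBINT x. rwitten V h (q i) x*q j x)"
      "inner (abs_rl2 (q i)) (abs_rl2 (q j)) = (LBINT x. q i x*q j x)"
      "(norm (abs_rl2 (q i)))^2 = (LBINT x. (q i x)^2)" for i j
      using qt by (simp_all add: B2_inner B2_norm rwitten_B2[OF V] rtest_B2)
    have qs: "0 < (LBINT x. (q i x)^2)" "(LBINT x. rwitten V h (q i) x*q i x) <= \<delta>*(LBINT x. (q i x)^2)" if i: "i < n" for i
    proof -
      have hi: "h <= hq (\<gamma> i)" using h(2) h0(6)[OF \<gamma>M[OF i]] by linarith
      note b = qm[OF \<gamma>M[OF i] h(1) hi, folded q_def]
      then show p: "0 < (LBINT x. (q i x)^2)" by blast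
      have "c/h <= cq (\<gamma> i)/h" using c(2)[OF \<gamma>M[OF i]] h by (intro divide_right_mono) auto
      then have "exp (- cq (\<gamma> i)/h) <= \<delta>" by (simp add: \<delta>_def)
      then have "exp (- cq (\<gamma> i)/h)*(LBINT x. (q i x)^2) <= \<delta>*(LBINT x. (q i x)^2)"
        using p by (intro mult_right_mono) auto
      then show "(LBINT x. rwitten V h (q i) x*q i x) <= \<delta>*(LBINT x. (q i x)^2)" using b by linarith
    qed
    define L where "L = (%m. abs_rl2 (l m)) ` M"
    show ?thesis
    \<comment> \<open>Different minima might give the same functional, so \<open>L\<close> is a set
      of at most \<open>n\<close> elements. Each of the \<open>n\<close> squares is bounded by the
      sum over \<open>L\<close>, whence the factor \<open>C*n\<close>.\<close>
    proof (rule dense_range_graph.finite_spectrum_below[OF drg, of L n "C*n" \<delta> "\<epsilon>*EE h" "%i. abs_rl2 (q i)" "%i. abs_rl2 (rwitten V h (q i))"])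
      show "finite L" "card L <= n" using finM by (auto simp: L_def n_def card_image_le)
      show "0 <= C*n" "0 <= \<delta>" using C by (auto simp: \<delta>_def)
      show "\<delta> < \<epsilon>*EE h" by (rule \<delta>E)
      fix u f assume "(u, f) \<in> rgraph V h"
      then obtain \<phi> where p: "rtest \<phi>" "u = abs_rl2 \<phi>" "f = abs_rl2 (rwitten V h \<phi>)" by (rule rgraphE)
      have "(\<Sum>m\<in>M. (LBINT x. l m x*\<phi> x)^2) <= (\<Sum>m\<in>M. (\<Sum>x\<in>L. (inner x u)^2))"
      proof (rule sum_mono)
        fix m assume m: "m \<in> M"
        have "(LBINT x. l m x*\<phi> x) = inner (abs_rl2 (l m)) u" using p l by (simp add: B2_inner rtest_B2)
        moreover have "(inner (abs_rl2 (l m)) u)^2 <= (\<Sum>x\<in>L. (inner x u)^2)"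
          using finM m by (intro member_le_sum) (auto simp: L_def)
        ultimately show "(LBINT x. l m x*\<phi> x)^2 <= (\<Sum>x\<in>L. (inner x u)^2)" by simp
      qed
      then have "C*(\<Sum>m\<in>M. (LBINT x. l m x*\<phi> x)^2) <= C*(real n*(\<Sum>x\<in>L. (inner x u)^2))"
        using C by (intro mult_left_mono) (auto simp: n_def)
      moreover have "inner f u = Qform V h \<phi>"
        using p rwitten_form[OF V p(1) p(1), of h] by (simp add: B2_inner rwitten_B2[OF V] rtest_B2 Qform_def power2_eq_square)
      moreover have "(norm u)^2 = (LBINT x. (\<phi> x)^2)" using p by (simp add: B2_norm rtest_B2)
      moreover have "Ck_on UNIV (Suc 0) \<phi>" "bsupp \<phi>" using p(1) smooth_Ck by (auto simp only: rtest_def)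
      note lo[OF this]
      ultimately show "inner f u >= \<epsilon>*EE h*(norm u)^2 - C*n*(\<Sum>l\<in>L. (inner l u)^2)"
        by (simp only: mult.assoc)
    next
      show "(abs_rl2 (q i), abs_rl2 (rwitten V h (q i))) \<in> rgraph V h" for i by (rule rgraphI[OF qt])
      show "abs_rl2 (q i) \<noteq> 0" if "i < n" for i using qs(1)[OF that] qin(3)[of i] by auto
      show "inner (abs_rl2 (rwitten V h (q i))) (abs_rl2 (q i)) <= \<delta>*(norm (abs_rl2 (q i)))^2" if "i < n" for i
        unfolding qin by (rule qs(2)[OF that])
      show "inner (abs_rl2 (q i)) (abs_rl2 (q j)) = 0 \<and> inner (abs_rl2 (rwitten V h (q i))) (abs_rl2 (q j)) = 0"
        if ij: "i < n" "j < n" "i \<noteq> j" for i j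
      proof -
        have "\<gamma> j \<noteq> \<gamma> i" using ij bij_betw_imp_inj_on[OF \<gamma>] by (auto simp: inj_on_def)
        then have "cball (\<gamma> i) r \<inter> cball (\<gamma> j) r = {}" using ij \<gamma>M Mc by (intro rD) auto
        from quasimode_orthogonal[OF r this, of h] show ?thesis unfolding qin unfolding q_def by simp
      qed
    next
      fix e lam
      assume e: "\<And>i j. i < n ==> j < n ==> inner (e i) (e j) = (if i = j then 1 else 0)"
        "\<And>i. i < n ==> (e i, lam i *\<^sub>R e i) \<in> closure (rgraph V h)" "\<And>i. i < n ==> 0 <= lam i" "\<And>i. i < n ==> lam i <= \<delta>"
      assume gap: "\<And>u f. (u, f) \<in> closure (rgraph V h) ==> \<forall>i<n. inner (e i) u = 0 ==> inner f u >= \<epsilon>*EE h*(norm u)^2"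
        and surj: "\<And>a b f1 f2. a < \<epsilon>*EE h ==> \<forall>i<n. a \<noteq> lam i \<or> b \<noteq> 0 ==>
          \<exists>u1 g1 u2 g2. (u1, g1) \<in> closure (rgraph V h) \<and> (u2, g2) \<in> closure (rgraph V h) \<and>
            g1 - (a *\<^sub>R u1 - b *\<^sub>R u2) = f1 \<and> g2 - (a *\<^sub>R u2 + b *\<^sub>R u1) = f2"
      have e1: "\<forall>i<n. \<forall>j<n. inner (e i) (e j) = (if i = j then 1 else 0)" using e(1) by blast
      have e2: "\<forall>i<n. (e i, lam i *\<^sub>R e i) \<in> closure (rgraph V h)" using e(2) by blast
      have e4: "\<forall>i<n. lam i <= \<delta>" using e(4) by blast
      show ?thesis unfolding \<delta>_def[symmetric]
        by (rule witten_graph_spectrum[OF V drg finM n_def[symmetric] e1 e2 gap surj e4 \<delta>E])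
    qed
  qed
  show ?thesis
    by (rule exI[of _ h0], rule conjI[OF h0(1)], rule exI[of _ \<epsilon>], rule conjI[OF h1(2)], rule exI[of _ c], rule conjI[OF c(1)], intro allI impI)
      (use main in \<open>simp add: M_def EE_def\<close>)
qed

end
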